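(* (a) Let $G$ be a countable discrete subgroup of $\mathbb{R}$ with positive cone $\Sigma = G\cap[0,\infty)$. Let $\alpha$ be a free partial action of $G$ on a separable abelian $C^*$-algebra $A$. Then there is a locally compact $r$-discrete principal groupoid $\mathcal{G}$ with second countable unit space and a locally constant real valued cocycle $c$ on $\mathcal{G}$ such that the partial crossed product $A\times_\alpha G$ is $*$-isomorphic to the groupoid $C^*$-algebra $C^*(\mathcal{G})$, and such that this isomorphism carries the analytic subalgebra $A\times_\alpha\Sigma$ of $A\times_\alpha G$ onto the analytic subalgebra of $C^*(\mathcal{G})$ determined by the cocycle $c$. (b) Conversely, given a locally compact $r$-discrete principal groupoid $\mathcal{G}$ with second countable unit space and a locally constant real valued cocycle $c$ on $\mathcal{G}$, there is a countable discrete subgroup $G$ of $\mathbb{R}$ and a partial action $\alpha$ of $G$ on a locally compact second countable Hausdorff space $X$ such that $C^*(\mathcal{G})$ is isomorphic to $C_0(X)\times_\alpha G$, and such that this isomorphism carries the analytic subalgebra of $C^*(\mathcal{G})$ determined by the cocycle $c$ onto the analytic subalgebra $C_0(X)\times_\alpha (G\cap[0,\infty))$ of $C_0(X)\times_\alpha G$ determined by the positive cone $G\cap[0,\infty)$.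
   Context: **Discrete subgroup.** A "discrete subgroup of $\mathbb{R}$" is a subgroup of $(\mathbb{R},+)$ regarded as a group with the discrete topology (it may be dense in $\mathbb{R}$). **Partial actions.** Let $A$ be a $C^*$-algebra, $(G,+)$ a discrete abelian group and $\Sigma\subseteq G$ with $\Sigma+\Sigma\subseteq\Sigma$ (the case $\Sigma=G$ is allowed). A partial action of $\Sigma$ on $A$ is a family of $*$-isomorphisms $\alpha=\{\alpha_t\colon D_{-t}\to D_t \mid t\in\Sigma\}$ between closed two-sided ideals of $A$ such that: (1a) $\alpha_s(D_{-s}\cap D_t)=D_s\cap D_{s+t}$ for $s,t\in\Sigma$; (1b) $\alpha_t(D_{-t}\cap D_{-s-t})=D_t\cap D_{-s}$ for $s,t\in\Sigma$; (2) $\alpha_{s+t}(x)=\alpha_s\circ\alpha_t(x)$ for $x\in D_{-t}\cap D_{-s-t}$; (3) $D_0=A$ and $\alpha_0=\mathrm{Id}_A$. A partial action on a locally compact Hausdorff space $X$ is defined in the same way, with open subsets $X_t$ of $X$ in place of the ideals $D_t$ and homeomorphisms $X_{-t}\to X_t$ in place of the $*$-isomorphisms. A partial action $\beta$ on $X$, with $\beta_t\colon X_{-t}\to X_t$, corresponds to the partial action $\alpha$ on $C_0(X)$ with $D_t=C_0(X_t)$ (functions in $C_0(X)$ vanishing off $X_t$) and $\alpha_t(f)=f\circ\beta_t^{-1}$; every partial action on $C_0(X)$ arises this way, and one passes freely between the two, writing $C_0(X)\times_\alpha G$ or $C_0(X)\times_\beta G$ for the crossed product. A partial action (on $X$, or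 the corresponding one on $C_0(X)$) is free if, on $X$, $\alpha_t(x)=x$ for some $x\in X_{-t}$ implies $t=0$. **Partial crossed product.** For a partial action $\alpha$ of $G$ on $A$, let $\mathcal{P}$ be the $*$-algebra of formal polynomials $\sum f_nU^n$ (finite sums, $n\in G$, $f_n\in D_n$) with $fU^n\,gU^m=\alpha_n(\alpha_{-n}(f)g)U^{n+m}$ and $(fU^n)^*=\alpha_{-n}(f^* )U^{-n}$. Put $\|\sum f_nU^n\|_L=\sum\|f_n\|$. The $C^*$-norm on $\mathcal{P}$ is $\|x\|=\sup_\pi\|\pi(x)\|$ over all ($*$-)representations $\pi$ of $\mathcal{P}$ that are continuous in the $L$-norm. $A\times_\alpha G$ is the completion of $\mathcal{P}$ in this norm. For a cone $\Sigma\subseteq G$, the analytic subalgebra (analytic crossed product) $A\times_\alpha\Sigma$ is the closure in $A\times_\alpha G$ of the polynomials $\sum f_nU^n$ all of whose indices $n$ lie in $\Sigma$. **Groupoids.** A principal groupoid is an equivalence relation $\mathcal{G}$ on a set $X$, with $(x,y)(y,z)=(x,z)$ and $(x,y)^{-1}=(y,x)$; its unit space is the diagonal, identified with $X$; range and domain maps are $r(x,y)=x$, $d(x,y)=y$. Groupoids carry a locally compact topology for which the groupoid operations are continuous. $\mathcal{G}$ is $r$-discrete if the unit space is open in $\mathcal{G}$. A $\mathcal{G}$-set is a subset of $\mathcal{G}$ on which $r$ and $d$ are both one-to-one; in the groupoids considered the open $\mathcal{G}$-sets form a base for the topology. A cocycle on $\mathcal{G}$ is a continuous map $c\colon\mathcal{G}\to\mathbb{R}$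 with $c(x,z)=c(x,y)+c(y,z)$ for all composable pairs $(x,y),(y,z)$; it is locally constant if every point of $\mathcal{G}$ has a neighbourhood on which $c$ is constant. **Groupoid $C^*$-algebra.** $C_c(\mathcal{G})$, the continuous compactly supported functions on $\mathcal{G}$, is a $*$-algebra with $f^*(x,y)=\overline{f(y,x)}$ and $(f\cdot g)(x,z)=\sum_y f(x,y)g(y,z)$ (sum over $y$ in the equivalence class of $x$). Put $\|f\|_I=\max\{\sup_x\sum_y|f(x,y)|,\ \sup_y\sum_x|f(x,y)|\}$. $C^*(\mathcal{G})$ is the completion of $C_c(\mathcal{G})$ in the norm $\|f\|=\sup_\pi\|\pi(f)\|$, with $\pi$ ranging over the $*$-representations of $C_c(\mathcal{G})$ that are norm decreasing for $\|\cdot\|_I$. The analytic subalgebra of $C^*(\mathcal{G})$ determined by a cocycle $c$ is the closure of the set of functions in $C_c(\mathcal{G})$ supported on $\{(x,y)\in\mathcal{G}\mid c(x,y)\ge 0\}$.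
   Formalization: In (b) two hypotheses are added, since (b) is false without either: the cocycle c vanishes only on the unit space, and the groupoid itself, not only its unit space, is second countable. Both are forced by the conclusion of (b). *)

theory Defs
  imports "HOL-Analysis.Analysis" "HOL-Algebra.AbelCoset" "HOL-Algebra.Module"
begin

section \<open>Normed *-algebras and C*-algebras\<close>

definition class_ring :: "'a::comm_ring_1 ring" where
  "class_ring = \<lparr>carrier = UNIV, mult = (*), one = 1, zero = 0, add = (+)\<rparr>"

text \<open>
  The algebras are not assumed to have a unit: the field \<^const>\<open>one\<close> inherited from rings
  is never referred to by the definitions below.
\<close>

record 'a star_algebra = "(complex, 'a) module" +
  star :: "'a \<Rightarrow> 'a"
  nrm :: "'a \<Rightarrow> real"

locale star_algebra =
  fixes A (structure)
  assumes vector_space: "module (class_ring :: complex ring) A"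
    and mult_closed: "\<lbrakk>x \<in> carrier A; y \<in> carrier A\<rbrakk> \<Longrightarrow> x \<otimes> y \<in> carrier A"
    and mult_assoc: "\<lbrakk>x \<in> carrier A; y \<in> carrier A; z \<in> carrier A\<rbrakk>
        \<Longrightarrow> (x \<otimes> y) \<otimes> z = x \<otimes> (y \<otimes> z)"
    and distrib_left: "\<lbrakk>x \<in> carrier A; y \<in> carrier A; z \<in> carrier A\<rbrakk>
        \<Longrightarrow> x \<otimes> (y \<oplus> z) = x \<otimes> y \<oplus> x \<otimes> z"
    and distrib_right: "\<lbrakk>x \<in> carrier A; y \<in> carrier A; z \<in> carrier A\<rbrakk>
        \<Longrightarrow> (x \<oplus> y) \<otimes> z = x \<otimes> z \<oplus> y \<otimes> z"
    and smult_mult_left: "\<lbrakk>x \<in> carrier A; y \<in> carrier A\<rbrakk>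
        \<Longrightarrow> (a \<odot>\<^bsub>A\<^esub> x) \<otimes> y = a \<odot>\<^bsub>A\<^esub> (x \<otimes> y)"
    and smult_mult_right: "\<lbrakk>x \<in> carrier A; y \<in> carrier A\<rbrakk>
        \<Longrightarrow> x \<otimes> (a \<odot>\<^bsub>A\<^esub> y) = a \<odot>\<^bsub>A\<^esub> (x \<otimes> y)"
    and star_closed: "x \<in> carrier A \<Longrightarrow> star A x \<in> carrier A"
    and star_star: "x \<in> carrier A \<Longrightarrow> star A (star A x) = x"
    and star_add: "\<lbrakk>x \<in> carrier A; y \<in> carrier A\<rbrakk> \<Longrightarrow> star A (x \<oplus> y) = star A x \<oplus> star A y"
    and star_smult: "x \<in> carrier A \<Longrightarrow> star A (a \<odot>\<^bsub>A\<^esub> x) = cnj a \<odot>\<^bsub>A\<^esub> star A x"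
    and star_mult: "\<lbrakk>x \<in> carrier A; y \<in> carrier A\<rbrakk> \<Longrightarrow> star A (x \<otimes> y) = star A y \<otimes> star A x"

text \<open>
  The distance is cut off outside the carrier because \<^locale>\<open>Metric_space\<close> asks for symmetry
  and nonnegativity on the whole type.
\<close>

definition nrm_dist :: "('a, 'm) star_algebra_scheme \<Rightarrow> 'a \<Rightarrow> 'a \<Rightarrow> real" where
  "nrm_dist A x y = (if x \<in> carrier A \<and> y \<in> carrier A then nrm A (x \<ominus>\<^bsub>A\<^esub> y) else 0)"

definition nrm_topology :: "('a, 'm) star_algebra_scheme \<Rightarrow> 'a topology" where
  "nrm_topology A = Metric_space.mtopology (carrier A) (nrm_dist A)"

locale cstar_algebra = star_algebra +
  assumes nrm_nonneg: "x \<in> carrier A \<Longrightarrow> 0 \<le> nrm A x"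
    and nrm_eq_0: "x \<in> carrier A \<Longrightarrow> nrm A x = 0 \<longleftrightarrow> x = \<zero>"
    and nrm_triangle: "\<lbrakk>x \<in> carrier A; y \<in> carrier A\<rbrakk> \<Longrightarrow> nrm A (x \<oplus> y) \<le> nrm A x + nrm A y"
    and nrm_smult: "x \<in> carrier A \<Longrightarrow> nrm A (a \<odot>\<^bsub>A\<^esub> x) = cmod a * nrm A x"
    and nrm_mult: "\<lbrakk>x \<in> carrier A; y \<in> carrier A\<rbrakk> \<Longrightarrow> nrm A (x \<otimes> y) \<le> nrm A x * nrm A y"
    and cstar_identity: "x \<in> carrier A \<Longrightarrow> nrm A (star A x \<otimes> x) = (nrm A x)\<^sup>2"
    and complete: "Metric_space.mcomplete (carrier A) (nrm_dist A)"

definition abelian_star_algebra :: "('a, 'm) star_algebra_scheme \<Rightarrow> bool" where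
  "abelian_star_algebra A \<longleftrightarrow> (\<forall>x\<in>carrier A. \<forall>y\<in>carrier A. x \<otimes>\<^bsub>A\<^esub> y = y \<otimes>\<^bsub>A\<^esub> x)"

definition closed_ideal :: "'a set \<Rightarrow> ('a, 'm) star_algebra_scheme \<Rightarrow> bool" where
  "closed_ideal I A \<longleftrightarrow>
     additive_subgroup I A \<and>
     (\<forall>a. \<forall>x\<in>I. a \<odot>\<^bsub>A\<^esub> x \<in> I) \<and>
     (\<forall>a\<in>carrier A. \<forall>x\<in>I. a \<otimes>\<^bsub>A\<^esub> x \<in> I \<and> x \<otimes>\<^bsub>A\<^esub> a \<in> I) \<and>
     closedin (nrm_topology A) I"

definition star_iso ::
  "('a, 'm) star_algebra_scheme \<Rightarrow> ('b, 'n) star_algebra_scheme \<Rightarrow> ('a \<Rightarrow> 'b) \<Rightarrow> bool" where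
  "star_iso A B \<phi> \<longleftrightarrow>
     bij_betw \<phi> (carrier A) (carrier B) \<and>
     (\<forall>x\<in>carrier A. \<forall>y\<in>carrier A. \<phi> (x \<oplus>\<^bsub>A\<^esub> y) = \<phi> x \<oplus>\<^bsub>B\<^esub> \<phi> y) \<and>
     (\<forall>a. \<forall>x\<in>carrier A. \<phi> (a \<odot>\<^bsub>A\<^esub> x) = a \<odot>\<^bsub>B\<^esub> \<phi> x) \<and>
     (\<forall>x\<in>carrier A. \<forall>y\<in>carrier A. \<phi> (x \<otimes>\<^bsub>A\<^esub> y) = \<phi> x \<otimes>\<^bsub>B\<^esub> \<phi> y) \<and>
     (\<forall>x\<in>carrier A. \<phi> (star A x) = star B (\<phi> x))"

section \<open>Completion of a *-algebra in a seminorm\<close>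

definition cauchy_seqs :: "('p, 'm) star_algebra_scheme \<Rightarrow> (nat \<Rightarrow> 'p) set" where
  "cauchy_seqs P = {s. (\<forall>n. s n \<in> carrier P) \<and>
     (\<forall>e>0. \<exists>N. \<forall>m\<ge>N. \<forall>n\<ge>N. nrm P (s m \<ominus>\<^bsub>P\<^esub> s n) < e)}"

definition null_rel :: "('p, 'm) star_algebra_scheme \<Rightarrow> ((nat \<Rightarrow> 'p) \<times> (nat \<Rightarrow> 'p)) set" where
  "null_rel P = {(s, t). s \<in> cauchy_seqs P \<and> t \<in> cauchy_seqs P \<and>
     (\<lambda>n. nrm P (s n \<ominus>\<^bsub>P\<^esub> t n)) \<longlonglongrightarrow> 0}"

definition completion :: "('p, 'm) star_algebra_scheme \<Rightarrow> (nat \<Rightarrow> 'p) set star_algebra" where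
  "completion P = \<lparr>
     carrier = cauchy_seqs P // null_rel P,
     mult = (\<lambda>S T. \<Union>s\<in>S. \<Union>t\<in>T. null_rel P `` {\<lambda>n. s n \<otimes>\<^bsub>P\<^esub> t n}),
     one = undefined,
     zero = null_rel P `` {\<lambda>n. \<zero>\<^bsub>P\<^esub>},
     add = (\<lambda>S T. \<Union>s\<in>S. \<Union>t\<in>T. null_rel P `` {\<lambda>n. s n \<oplus>\<^bsub>P\<^esub> t n}),
     smult = (\<lambda>a S. \<Union>s\<in>S. null_rel P `` {\<lambda>n. a \<odot>\<^bsub>P\<^esub> s n}),
     star = (\<lambda>S. \<Union>s\<in>S. null_rel P `` {\<lambda>n. star P (s n)}),
     nrm = (\<lambda>S. lim (\<lambda>n. nrm P ((SOME s. s \<in> S) n)))\<rparr>"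

definition completion_embed :: "('p, 'm) star_algebra_scheme \<Rightarrow> 'p \<Rightarrow> (nat \<Rightarrow> 'p) set" where
  "completion_embed P x = null_rel P `` {\<lambda>n. x}"

definition closure_in_completion :: "('p, 'm) star_algebra_scheme \<Rightarrow> 'p set \<Rightarrow> (nat \<Rightarrow> 'p) set set" where
  "closure_in_completion P S = nrm_topology (completion P) closure_of (completion_embed P ` S)"

section \<open>Hilbert spaces and representations\<close>

text \<open>
  Only the vector space part of the module record is used, together with an inner product that
  is linear in its first argument.
\<close>

record 'h inner_product_space = "(complex, 'h) module" +
  inner_prod :: "'h \<Rightarrow> 'h \<Rightarrow> complex"

definition vec_norm :: "('h, 'm) inner_product_space_scheme \<Rightarrow> 'h \<Rightarrow> real" where
  "vec_norm H v = sqrt (Re (inner_prod H v v))"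

definition vec_dist :: "('h, 'm) inner_product_space_scheme \<Rightarrow> 'h \<Rightarrow> 'h \<Rightarrow> real" where
  "vec_dist H v w = (if v \<in> carrier H \<and> w \<in> carrier H then vec_norm H (v \<ominus>\<^bsub>H\<^esub> w) else 0)"

locale hilbert_space =
  fixes H (structure)
  assumes vector_space: "module (class_ring :: complex ring) H"
    and inner_add: "\<lbrakk>u \<in> carrier H; v \<in> carrier H; w \<in> carrier H\<rbrakk>
        \<Longrightarrow> inner_prod H (u \<oplus> v) w = inner_prod H u w + inner_prod H v w"
    and inner_smult: "\<lbrakk>v \<in> carrier H; w \<in> carrier H\<rbrakk>
        \<Longrightarrow> inner_prod H (a \<odot>\<^bsub>H\<^esub> v) w = a * inner_prod H v w"
    and inner_commute: "\<lbrakk>v \<in> carrier H; w \<in> carrier H\<rbrakk>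
        \<Longrightarrow> inner_prod H w v = cnj (inner_prod H v w)"
    and inner_nonneg: "v \<in> carrier H \<Longrightarrow> 0 \<le> Re (inner_prod H v v)"
    and inner_eq_0: "v \<in> carrier H \<Longrightarrow> inner_prod H v v = 0 \<longleftrightarrow> v = \<zero>"
    and complete: "Metric_space.mcomplete (carrier H) (vec_dist H)"

definition bounded_operator :: "('h, 'm) inner_product_space_scheme \<Rightarrow> ('h \<Rightarrow> 'h) \<Rightarrow> bool" where
  "bounded_operator H T \<longleftrightarrow>
     T \<in> carrier H \<rightarrow> carrier H \<and>
     (\<forall>v\<in>carrier H. \<forall>w\<in>carrier H. T (v \<oplus>\<^bsub>H\<^esub> w) = T v \<oplus>\<^bsub>H\<^esub> T w) \<and>
     (\<forall>a. \<forall>v\<in>carrier H. T (a \<odot>\<^bsub>H\<^esub> v) = a \<odot>\<^bsub>H\<^esub> T v) \<and>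
     (\<exists>C. \<forall>v\<in>carrier H. vec_norm H (T v) \<le> C * vec_norm H v)"

definition op_norm :: "('h, 'm) inner_product_space_scheme \<Rightarrow> ('h \<Rightarrow> 'h) \<Rightarrow> real" where
  "op_norm H T = (SUP v\<in>{v \<in> carrier H. vec_norm H v \<le> 1}. vec_norm H (T v))"

definition representation ::
  "('p, 'm) star_algebra_scheme \<Rightarrow> ('h, 'n) inner_product_space_scheme \<Rightarrow> ('p \<Rightarrow> 'h \<Rightarrow> 'h) \<Rightarrow> bool" where
  "representation P H \<pi> \<longleftrightarrow>
     hilbert_space H \<and>
     (\<forall>x\<in>carrier P. bounded_operator H (\<pi> x)) \<and>
     (\<forall>x\<in>carrier P. \<forall>y\<in>carrier P. \<forall>v\<in>carrier H. \<pi> (x \<oplus>\<^bsub>P\<^esub> y) v = \<pi> x v \<oplus>\<^bsub>H\<^esub> \<pi> y v) \<and>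
     (\<forall>a. \<forall>x\<in>carrier P. \<forall>v\<in>carrier H. \<pi> (a \<odot>\<^bsub>P\<^esub> x) v = a \<odot>\<^bsub>H\<^esub> \<pi> x v) \<and>
     (\<forall>x\<in>carrier P. \<forall>y\<in>carrier P. \<forall>v\<in>carrier H. \<pi> (x \<otimes>\<^bsub>P\<^esub> y) v = \<pi> x (\<pi> y v)) \<and>
     (\<forall>x\<in>carrier P. \<forall>v\<in>carrier H. \<forall>w\<in>carrier H.
        inner_prod H (\<pi> (star P x) v) w = inner_prod H v (\<pi> x w))"

definition continuous_representation ::
  "('p, 'm) star_algebra_scheme \<Rightarrow> ('h, 'n) inner_product_space_scheme \<Rightarrow> ('p \<Rightarrow> 'h \<Rightarrow> 'h) \<Rightarrow> bool" where
  "continuous_representation P H \<pi> \<longleftrightarrow> representation P H \<pi> \<and>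
     (\<forall>x\<in>carrier P. \<forall>e>0. \<exists>d>0. \<forall>y\<in>carrier P.
        nrm P (y \<ominus>\<^bsub>P\<^esub> x) < d \<longrightarrow> op_norm H (\<lambda>v. \<pi> y v \<ominus>\<^bsub>H\<^esub> \<pi> x v) < e)"

definition norm_decreasing_representation ::
  "('p, 'm) star_algebra_scheme \<Rightarrow> ('h, 'n) inner_product_space_scheme \<Rightarrow> ('p \<Rightarrow> 'h \<Rightarrow> 'h) \<Rightarrow> bool" where
  "norm_decreasing_representation P H \<pi> \<longleftrightarrow> representation P H \<pi> \<and>
     (\<forall>x\<in>carrier P. op_norm H (\<pi> x) \<le> nrm P x)"

text \<open>
  The supremum over all representations in a class \<open>R\<close> of representations. The Hilbert spaces
  are those with vectors in the type \<open>nat \<Rightarrow> 'p\<close>, which imposes no restriction: the norm of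
  \<open>\<pi> x\<close> is the supremum of its norms on cyclic subrepresentations, and in a cyclic
  representation every vector is the limit of a sequence \<open>\<pi> (p n) v\<close> (with \<open>v\<close> cyclic and
  \<open>p n\<close> in \<open>P\<close>), so that choosing such sequences injects the space into \<open>nat \<Rightarrow> 'p\<close>.
\<close>

definition universal_norm ::
  "('p, 'm) star_algebra_scheme \<Rightarrow>
   ((nat \<Rightarrow> 'p) inner_product_space \<Rightarrow> ('p \<Rightarrow> (nat \<Rightarrow> 'p) \<Rightarrow> (nat \<Rightarrow> 'p)) \<Rightarrow> bool) \<Rightarrow> 'p \<Rightarrow> real" where
  "universal_norm P R x = Sup {op_norm H (\<pi> x) | H \<pi>. R H \<pi>}"

section \<open>The algebra \<open>C\<^sub>0(X)\<close>\<close>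

definition lch_space :: "'x topology \<Rightarrow> bool" where
  "lch_space X \<longleftrightarrow> locally_compact_space X \<and> Hausdorff_space X"

text \<open>
  Functions are extended by 0 outside the space; in particular a supremum over the whole type is
  the supremum over the space, and it is also meaningful for the empty space.
\<close>

definition C0 :: "'x topology \<Rightarrow> ('x \<Rightarrow> complex) star_algebra" where
  "C0 X = \<lparr>
     carrier = {f. continuous_map X euclidean f \<and> (\<forall>x. x \<notin> topspace X \<longrightarrow> f x = 0) \<and>
                   (\<forall>e>0. compactin X {x \<in> topspace X. e \<le> cmod (f x)})},
     mult = (\<lambda>f g x. f x * g x),
     one = undefined,
     zero = (\<lambda>x. 0),
     add = (\<lambda>f g x. f x + g x),
     smult = (\<lambda>a f x. a * f x),
     star = (\<lambda>f x. cnj (f x)),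
     nrm = (\<lambda>f. SUP x. cmod (f x))\<rparr>"

section \<open>Partial actions\<close>

locale partial_action =
  fixes \<Sigma> :: "'g::ab_group_add set"
    and A :: "('a, 'm) star_algebra_scheme"
    and D :: "'g \<Rightarrow> 'a set"
    and \<alpha> :: "'g \<Rightarrow> 'a \<Rightarrow> 'a"
  assumes add_closed: "\<lbrakk>s \<in> \<Sigma>; t \<in> \<Sigma>\<rbrakk> \<Longrightarrow> s + t \<in> \<Sigma>"
    and ideal: "t \<in> \<Sigma> \<Longrightarrow> closed_ideal (D t) A \<and> closed_ideal (D (- t)) A"
    and iso: "t \<in> \<Sigma> \<Longrightarrow> star_iso (A\<lparr>carrier := D (- t)\<rparr>) (A\<lparr>carrier := D t\<rparr>) (\<alpha> t)"
    and image_1a: "\<lbrakk>s \<in> \<Sigma>; t \<in> \<Sigma>\<rbrakk> \<Longrightarrow> \<alpha> s ` (D (- s) \<inter> D t) = D s \<inter> D (s + t)"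
    and image_1b: "\<lbrakk>s \<in> \<Sigma>; t \<in> \<Sigma>\<rbrakk> \<Longrightarrow> \<alpha> t ` (D (- t) \<inter> D (- s - t)) = D t \<inter> D (- s)"
    and comp: "\<lbrakk>s \<in> \<Sigma>; t \<in> \<Sigma>; x \<in> D (- t) \<inter> D (- s - t)\<rbrakk> \<Longrightarrow> \<alpha> (s + t) x = \<alpha> s (\<alpha> t x)"
    and domain_0: "D 0 = carrier A"
    and action_0: "x \<in> carrier A \<Longrightarrow> \<alpha> 0 x = x"

locale space_partial_action =
  fixes \<Sigma> :: "'g::ab_group_add set"
    and X :: "'x topology"
    and Xs :: "'g \<Rightarrow> 'x set"
    and \<beta> :: "'g \<Rightarrow> 'x \<Rightarrow> 'x"
  assumes space: "lch_space X"
    and add_closed: "\<lbrakk>s \<in> \<Sigma>; t \<in> \<Sigma>\<rbrakk> \<Longrightarrow> s + t \<in> \<Sigma>"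
    and open_domain: "t \<in> \<Sigma> \<Longrightarrow> openin X (Xs t) \<and> openin X (Xs (- t))"
    and homeo: "t \<in> \<Sigma> \<Longrightarrow> homeomorphic_map (subtopology X (Xs (- t))) (subtopology X (Xs t)) (\<beta> t)"
    and image_1a: "\<lbrakk>s \<in> \<Sigma>; t \<in> \<Sigma>\<rbrakk> \<Longrightarrow> \<beta> s ` (Xs (- s) \<inter> Xs t) = Xs s \<inter> Xs (s + t)"
    and image_1b: "\<lbrakk>s \<in> \<Sigma>; t \<in> \<Sigma>\<rbrakk> \<Longrightarrow> \<beta> t ` (Xs (- t) \<inter> Xs (- s - t)) = Xs t \<inter> Xs (- s)"
    and comp: "\<lbrakk>s \<in> \<Sigma>; t \<in> \<Sigma>; x \<in> Xs (- t) \<inter> Xs (- s - t)\<rbrakk> \<Longrightarrow> \<beta> (s + t) x = \<beta> s (\<beta> t x)"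
    and domain_0: "Xs 0 = topspace X"
    and action_0: "x \<in> topspace X \<Longrightarrow> \<beta> 0 x = x"

definition free_on_space :: "'g::ab_group_add set \<Rightarrow> ('g \<Rightarrow> 'x set) \<Rightarrow> ('g \<Rightarrow> 'x \<Rightarrow> 'x) \<Rightarrow> bool" where
  "free_on_space \<Sigma> Xs \<beta> \<longleftrightarrow> (\<forall>t\<in>\<Sigma>. \<forall>x\<in>Xs (- t). \<beta> t x = x \<longrightarrow> t = 0)"

text \<open>The partial action on \<^term>\<open>C0 X\<close> corresponding to a partial action on \<open>X\<close>.\<close>

definition C0_domain :: "'x topology \<Rightarrow> ('g \<Rightarrow> 'x set) \<Rightarrow> 'g \<Rightarrow> ('x \<Rightarrow> complex) set" where
  "C0_domain X Xs t = {f \<in> carrier (C0 X). \<forall>x. x \<notin> Xs t \<longrightarrow> f x = 0}"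

definition C0_action ::
  "('g::ab_group_add \<Rightarrow> 'x set) \<Rightarrow> ('g \<Rightarrow> 'x \<Rightarrow> 'x) \<Rightarrow> 'g \<Rightarrow> ('x \<Rightarrow> complex) \<Rightarrow> ('x \<Rightarrow> complex)" where
  "C0_action Xs \<beta> t f = (\<lambda>x. if x \<in> Xs t then f (inv_into (Xs (- t)) (\<beta> t) x) else 0)"

text \<open>
  A partial action on an abelian C*-algebra \<open>A\<close> is free if the partial action on \<open>X\<close> to which it
  corresponds under an identification of \<open>A\<close> with \<open>C\<^sub>0(X)\<close> is free; \<open>X\<close> is unique up to
  homeomorphism. Points of \<open>X\<close> are taken in the type \<open>'a \<Rightarrow> complex\<close>, which contains the
  Gelfand spectrum of \<open>A\<close>, hence a copy of every such \<open>X\<close>.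
\<close>

definition free_partial_action ::
  "'g::ab_group_add set \<Rightarrow> ('a, 'm) star_algebra_scheme \<Rightarrow> ('g \<Rightarrow> 'a set) \<Rightarrow> ('g \<Rightarrow> 'a \<Rightarrow> 'a) \<Rightarrow> bool" where
  "free_partial_action \<Sigma> A D \<alpha> \<longleftrightarrow>
     partial_action \<Sigma> A D \<alpha> \<and>
     (\<exists>(X :: ('a \<Rightarrow> complex) topology) Xs \<beta> \<phi>.
        space_partial_action \<Sigma> X Xs \<beta> \<and>
        star_iso A (C0 X) \<phi> \<and>
        (\<forall>t\<in>\<Sigma>. \<phi> ` D t = C0_domain X Xs t \<and> \<phi> ` D (- t) = C0_domain X Xs (- t)) \<and>
        (\<forall>t\<in>\<Sigma>. \<forall>f\<in>D (- t). \<phi> (\<alpha> t f) = C0_action Xs \<beta> t (\<phi> f)) \<and>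
        free_on_space \<Sigma> Xs \<beta>)"

section \<open>Partial crossed products\<close>

text \<open>
  A polynomial \<open>\<Sum> f\<^sub>n U\<^sup>n\<close> is the finitely supported family of its coefficients. The norm
  recorded here is the \<open>L\<close>-norm.
\<close>

definition polynomial_algebra ::
  "'g::ab_group_add set \<Rightarrow> ('a, 'm) star_algebra_scheme \<Rightarrow> ('g \<Rightarrow> 'a set) \<Rightarrow> ('g \<Rightarrow> 'a \<Rightarrow> 'a) \<Rightarrow>
   ('g \<Rightarrow> 'a) star_algebra" where
  "polynomial_algebra G A D \<alpha> = \<lparr>
     carrier = {p. (\<forall>n\<in>G. p n \<in> D n) \<and> (\<forall>n. n \<notin> G \<longrightarrow> p n = \<zero>\<^bsub>A\<^esub>) \<and> finite {n. p n \<noteq> \<zero>\<^bsub>A\<^esub>}},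
     mult = (\<lambda>p q k. \<Oplus>\<^bsub>A\<^esub>n\<in>{n. p n \<noteq> \<zero>\<^bsub>A\<^esub>}. \<alpha> n (\<alpha> (- n) (p n) \<otimes>\<^bsub>A\<^esub> q (k - n))),
     one = undefined,
     zero = (\<lambda>n. \<zero>\<^bsub>A\<^esub>),
     add = (\<lambda>p q n. p n \<oplus>\<^bsub>A\<^esub> q n),
     smult = (\<lambda>a p n. a \<odot>\<^bsub>A\<^esub> p n),
     star = (\<lambda>p n. if n \<in> G then \<alpha> n (star A (p (- n))) else \<zero>\<^bsub>A\<^esub>),
     nrm = (\<lambda>p. \<Sum>n | p n \<noteq> \<zero>\<^bsub>A\<^esub>. nrm A (p n))\<rparr>"

definition normed_polynomial_algebra ::
  "'g::ab_group_add set \<Rightarrow> ('a, 'm) star_algebra_scheme \<Rightarrow> ('g \<Rightarrow> 'a set) \<Rightarrow> ('g \<Rightarrow> 'a \<Rightarrow> 'a) \<Rightarrow>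
   ('g \<Rightarrow> 'a) star_algebra" where
  "normed_polynomial_algebra G A D \<alpha> =
     (let P = polynomial_algebra G A D \<alpha>
      in P\<lparr>nrm := universal_norm P (continuous_representation P)\<rparr>)"

definition crossed_product ::
  "'g::ab_group_add set \<Rightarrow> ('a, 'm) star_algebra_scheme \<Rightarrow> ('g \<Rightarrow> 'a set) \<Rightarrow> ('g \<Rightarrow> 'a \<Rightarrow> 'a) \<Rightarrow>
   (nat \<Rightarrow> 'g \<Rightarrow> 'a) set star_algebra" where
  "crossed_product G A D \<alpha> = completion (normed_polynomial_algebra G A D \<alpha>)"

definition analytic_crossed_product ::
  "'g::ab_group_add set \<Rightarrow> ('a, 'm) star_algebra_scheme \<Rightarrow> ('g \<Rightarrow> 'a set) \<Rightarrow> ('g \<Rightarrow> 'a \<Rightarrow> 'a) \<Rightarrow>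
   'g set \<Rightarrow> (nat \<Rightarrow> 'g \<Rightarrow> 'a) set set" where
  "analytic_crossed_product G A D \<alpha> \<Sigma> =
     closure_in_completion (normed_polynomial_algebra G A D \<alpha>)
       {p \<in> carrier (polynomial_algebra G A D \<alpha>). \<forall>n. p n \<noteq> \<zero>\<^bsub>A\<^esub> \<longrightarrow> n \<in> \<Sigma>}"

section \<open>Principal groupoids\<close>

text \<open>
  A principal groupoid is given by the topology of the groupoid, whose underlying set is the
  equivalence relation. The unit space is the diagonal with the relative topology, transported
  to the base set along \<open>x \<mapsto> (x, x)\<close>.
\<close>

definition unit_space :: "('x \<times> 'x) topology \<Rightarrow> 'x topology" where
  "unit_space \<G> = pullback_topology UNIV (\<lambda>x. (x, x)) \<G>"

definition groupoid_set :: "('x \<times> 'x) topology \<Rightarrow> ('x \<times> 'x) set \<Rightarrow> bool" where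
  "groupoid_set \<G> S \<longleftrightarrow> S \<subseteq> topspace \<G> \<and> inj_on fst S \<and> inj_on snd S"

text \<open>
  The range map is required to be open onto the unit space. Given a base of open \<open>\<G>\<close>-sets,
  this holds exactly when the continuous compactly supported functions are closed under
  convolution (for \<open>f\<close> supported in an open \<open>\<G>\<close>-set \<open>S\<close>, \<open>f \<cdot> f\<^sup>*\<close> restricted to the units is
  \<open>\<bar>f\<bar>\<^sup>2\<close> transported to \<open>r(S)\<close> and extended by 0).
\<close>

locale lc_r_discrete_principal_groupoid =
  fixes \<G> :: "('x \<times> 'x) topology"
  assumes equivalence: "equiv (topspace (unit_space \<G>)) (topspace \<G>)"
    and continuous_mult:
      "continuous_map (subtopology (prod_topology \<G> \<G>) {(p, q). snd p = fst q}) \<G>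
         (\<lambda>(p, q). (fst p, snd q))"
    and continuous_inverse: "continuous_map \<G> \<G> (\<lambda>(x, y). (y, x))"
    and locally_compact: "locally_compact_space \<G>"
    and hausdorff: "Hausdorff_space \<G>"
    and r_discrete: "openin \<G> {p \<in> topspace \<G>. fst p = snd p}"
    and base_groupoid_sets: "\<lbrakk>openin \<G> U; p \<in> U\<rbrakk>
        \<Longrightarrow> \<exists>S. openin \<G> S \<and> groupoid_set \<G> S \<and> p \<in> S \<and> S \<subseteq> U"
    and open_range: "open_map \<G> (unit_space \<G>) fst"

definition cocycle :: "('x \<times> 'x) topology \<Rightarrow> ('x \<times> 'x \<Rightarrow> real) \<Rightarrow> bool" where
  "cocycle \<G> c \<longleftrightarrow>
     continuous_map \<G> euclideanreal c \<and>
     (\<forall>x y z. (x, y) \<in> topspace \<G> \<and> (y, z) \<in> topspace \<G> \<longrightarrow> c (x, z) = c (x, y) + c (y, z))"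

definition locally_constant :: "'p topology \<Rightarrow> ('p \<Rightarrow> 'b) \<Rightarrow> bool" where
  "locally_constant T c \<longleftrightarrow> (\<forall>p\<in>topspace T. \<exists>U. openin T U \<and> p \<in> U \<and> (\<forall>q\<in>U. c q = c p))"

section \<open>Groupoid C*-algebras\<close>

text \<open>
  Elements of \<open>C\<^sub>c(\<G>)\<close> are extended by 0 outside \<open>\<G>\<close>, so that sums over an equivalence class
  may be written as sums over the whole type; they have finitely many nonzero terms. The norm
  recorded here is the \<open>I\<close>-norm.
\<close>

definition Cc_algebra :: "('x \<times> 'x) topology \<Rightarrow> ('x \<times> 'x \<Rightarrow> complex) star_algebra" where
  "Cc_algebra \<G> = \<lparr>
     carrier = {f. continuous_map \<G> euclidean f \<and> (\<forall>p. p \<notin> topspace \<G> \<longrightarrow> f p = 0) \<and>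
                   compactin \<G> (\<G> closure_of {p \<in> topspace \<G>. f p \<noteq> 0})},
     mult = (\<lambda>f g (x, z). \<Sum>\<^sub>\<infinity>y. f (x, y) * g (y, z)),
     one = undefined,
     zero = (\<lambda>p. 0),
     add = (\<lambda>f g p. f p + g p),
     smult = (\<lambda>a f p. a * f p),
     star = (\<lambda>f (x, y). cnj (f (y, x))),
     nrm = (\<lambda>f. max (SUP x. \<Sum>\<^sub>\<infinity>y. cmod (f (x, y))) (SUP y. \<Sum>\<^sub>\<infinity>x. cmod (f (x, y))))\<rparr>"

definition normed_Cc_algebra :: "('x \<times> 'x) topology \<Rightarrow> ('x \<times> 'x \<Rightarrow> complex) star_algebra" where
  "normed_Cc_algebra \<G> =
     (Cc_algebra \<G>)\<lparr>nrm := universal_norm (Cc_algebra \<G>)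
        (norm_decreasing_representation (Cc_algebra \<G>))\<rparr>"

definition groupoid_algebra ::
  "('x \<times> 'x) topology \<Rightarrow> (nat \<Rightarrow> 'x \<times> 'x \<Rightarrow> complex) set star_algebra" where
  "groupoid_algebra \<G> = completion (normed_Cc_algebra \<G>)"

definition analytic_groupoid_algebra ::
  "('x \<times> 'x) topology \<Rightarrow> ('x \<times> 'x \<Rightarrow> real) \<Rightarrow> (nat \<Rightarrow> 'x \<times> 'x \<Rightarrow> complex) set set" where
  "analytic_groupoid_algebra \<G> c =
     closure_in_completion (normed_Cc_algebra \<G>)
       {f \<in> carrier (Cc_algebra \<G>). \<forall>p\<in>topspace \<G>. f p \<noteq> 0 \<longrightarrow> 0 \<le> c p}"

end

theory Submission
  imports Defs
begin

text \<open>
  The cocycle cuts the groupoid into slices \<open>c\<^sup>-\<^sup>1(n)\<close>, which are graphs of partial homeomorphisms of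
  the unit space, and the monomials \<open>f U\<^sup>n\<close> of the crossed product are the functions on
  \<open>c\<^sup>-\<^sup>1(n)\<close> vanishing at infinity; for a free action the groupoid is the orbit relation. Thus the
  polynomials become an algebra of functions under convolution that contains the functions with
  compact support. Soft thresholding shows that the latter are dense, and a Schur test shows that
  every \<open>*\<close>-representation of either algebra is bounded by the norm
  \<open>\<parallel>\<cdot>\<parallel>\<^sub>I\<close>. Hence representations restrict and extend, both algebras carry the same universal
  norm, and their completions agree. The sets of polynomials and of compactly supported functions
  carried by nonnegative degrees have the same closure, which gives the statement on the analytic
  subalgebras.
\<close>

section \<open>Complex vector spaces and *-algebras given by records\<close>

text \<open>The two universal norms are suprema over Hilbert spaces whose vectors have different
  types, \<open>nat \<Rightarrow> real \<Rightarrow> 'a\<close> and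
  \<open>nat \<Rightarrow> 'x \<times> 'x \<Rightarrow> complex\<close>. Comparing them therefore
  takes more than restricting or extending a representation: the cyclic subspace of a vector has to
  be recoded in the other type, which works because its points are limits of sequences drawn from a
  dense part of the algebra. As the algebras may lack a unit, the vector itself may lie outside its
  cyclic subspace, and the estimates pass to the adjoint.

  Uniform approximation would not control operator norms if the number of slices could grow. With
  the degrees confined to a fixed finite set, every row and column has boundedly many entries, and
  the Schur test turns uniform errors into norm errors. The test uses only square roots of entries
  and functions on the units, so it holds alike for both algebras.\<close>

lemma cring_class_ring: "cring (class_ring :: 'a::comm_ring_1 ring)"
proof -
  have "\<exists>y. x + y = 0 \<and> y + x = 0" for x :: 'a
    by (rule exI[of _ "- x"]) simp
  then show ?thesis
    unfolding class_ring_def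
    by unfold_locales (auto simp: algebra_simps Units_def)
qed

text \<open>The module laws over \<open>class_ring\<close> speak of record operations on scalars;
  this locale restates them in ordinary complex arithmetic, for algebras and Hilbert spaces
  alike.\<close>

locale complex_module =
  fixes V :: "(complex, 'v, 'm) module_scheme" (structure)
  assumes module_V: "module (class_ring :: complex ring) V"
begin

sublocale abelian_group V
  using module_V by (rule module.axioms)

lemma smult_closed [simp, intro]: "v \<in> carrier V \<Longrightarrow> a \<odot> v \<in> carrier V"
  using module.smult_closed[OF module_V] by (auto simp: class_ring_def)

lemma smult_add_left: "v \<in> carrier V \<Longrightarrow> (a + b) \<odot> v = a \<odot> v \<oplus> b \<odot> v"
  using module.smult_l_distr[OF module_V, of a b v] by (auto simp: class_ring_def)

lemma smult_add_right:
  "\<lbrakk>v \<in> carrier V; w \<in> carrier V\<rbrakk> \<Longrightarrow> a \<odot> (v \<oplus> w) = a \<odot> v \<oplus> a \<odot> w"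
  using module.smult_r_distr[OF module_V, of a v w] by (auto simp: class_ring_def)

lemma smult_smult: "v \<in> carrier V \<Longrightarrow> a \<odot> (b \<odot> v) = (a * b) \<odot> v"
  using module.smult_assoc1[OF module_V, of a b v] by (auto simp: class_ring_def)

lemma smult_1 [simp]: "v \<in> carrier V \<Longrightarrow> 1 \<odot> v = v"
  using module.smult_one[OF module_V, of v] by (auto simp: class_ring_def)

lemma smult_0 [simp]: "v \<in> carrier V \<Longrightarrow> 0 \<odot> v = \<zero>"
  using smult_add_left[of v 0 0] by (metis add.l_cancel_one' add_0 smult_closed)

lemma minus_eq_smult: "v \<in> carrier V \<Longrightarrow> \<ominus> v = (- 1) \<odot> v"
  by (metis smult_1 smult_0 smult_add_left smult_closed minus_equality ab_left_minus)

lemma diff_eq_smult: "w \<in> carrier V \<Longrightarrow> v \<ominus> w = v \<oplus> (- 1) \<odot> w"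
  by (simp add: a_minus_def minus_eq_smult)

lemma smult_zero [simp]: "a \<odot> \<zero> = \<zero>"
  using smult_smult[of \<zero> a 0] by simp

lemma diff_add_diff:
  "\<lbrakk>u \<in> carrier V; v \<in> carrier V; w \<in> carrier V; z \<in> carrier V\<rbrakk> \<Longrightarrow>
    (u \<oplus> v) \<ominus> (w \<oplus> z) = (u \<ominus> w) \<oplus> (v \<ominus> z)"
  by (simp add: diff_eq_smult smult_add_right a_ac)

lemma diff_smult:
  "\<lbrakk>u \<in> carrier V; v \<in> carrier V\<rbrakk> \<Longrightarrow> (a \<odot> u) \<ominus> (a \<odot> v) = a \<odot> (u \<ominus> v)"
  by (simp add: diff_eq_smult smult_add_right smult_smult)

lemma diff_swap: "\<lbrakk>u \<in> carrier V; v \<in> carrier V\<rbrakk> \<Longrightarrow> u \<ominus> v = (- 1) \<odot> (v \<ominus> u)"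
  by (simp add: diff_eq_smult smult_add_right smult_smult a_ac)

lemma diff_split:
  "\<lbrakk>u \<in> carrier V; v \<in> carrier V; w \<in> carrier V\<rbrakk> \<Longrightarrow> u \<ominus> w = (u \<ominus> v) \<oplus> (v \<ominus> w)"
proof -
  assume *: "u \<in> carrier V" "v \<in> carrier V" "w \<in> carrier V"
  have "(u \<ominus> v) \<oplus> (v \<ominus> w) = u \<oplus> (((- 1) \<odot> v \<oplus> v) \<oplus> (- 1) \<odot> w)"
    using * by (simp add: diff_eq_smult a_assoc)
  also have "(- 1) \<odot> v \<oplus> v = \<zero>"
    using * by (metis l_neg minus_eq_smult)
  finally show ?thesis using * by (simp add: diff_eq_smult)
qed

lemma diff_eq_zero_iff: "\<lbrakk>u \<in> carrier V; v \<in> carrier V\<rbrakk> \<Longrightarrow> u \<ominus> v = \<zero> \<longleftrightarrow> u = v"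
  by (metis a_minus_def a_inv_closed minus_equality minus_minus r_neg)

lemma diff_add_cancel: "\<lbrakk>u \<in> carrier V; v \<in> carrier V\<rbrakk> \<Longrightarrow> (u \<ominus> v) \<oplus> v = u"
  by (simp add: a_minus_def a_assoc l_neg)

end

text \<open>Additive inverses come from the scalars: distributivity turns
  \<open>(- 1) \<odot> v \<oplus> 1 \<odot> v\<close> into \<open>0 \<odot> v\<close>.\<close>

lemma complex_moduleI:
  fixes V (structure)
  assumes add_closed: "\<And>u v. \<lbrakk>u \<in> carrier V; v \<in> carrier V\<rbrakk> \<Longrightarrow> u \<oplus> v \<in> carrier V"
    and zero_closed: "\<zero> \<in> carrier V"
    and smult_closed: "\<And>a v. v \<in> carrier V \<Longrightarrow> a \<odot>\<^bsub>V\<^esub> v \<in> carrier V"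
    and add_assoc: "\<And>u v w. \<lbrakk>u \<in> carrier V; v \<in> carrier V; w \<in> carrier V\<rbrakk>
        \<Longrightarrow> (u \<oplus> v) \<oplus> w = u \<oplus> (v \<oplus> w)"
    and add_commute: "\<And>u v. \<lbrakk>u \<in> carrier V; v \<in> carrier V\<rbrakk> \<Longrightarrow> u \<oplus> v = v \<oplus> u"
    and zero_add: "\<And>v. v \<in> carrier V \<Longrightarrow> \<zero> \<oplus> v = v"
    and smult_add_left: "\<And>a b v. v \<in> carrier V \<Longrightarrow> (a + b) \<odot>\<^bsub>V\<^esub> v = a \<odot>\<^bsub>V\<^esub> v \<oplus> b \<odot>\<^bsub>V\<^esub> v"
    and smult_add_right: "\<And>a v w. \<lbrakk>v \<in> carrier V; w \<in> carrier V\<rbrakk>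
        \<Longrightarrow> a \<odot>\<^bsub>V\<^esub> (v \<oplus> w) = a \<odot>\<^bsub>V\<^esub> v \<oplus> a \<odot>\<^bsub>V\<^esub> w"
    and smult_smult: "\<And>a b v. v \<in> carrier V \<Longrightarrow> (a * b) \<odot>\<^bsub>V\<^esub> v = a \<odot>\<^bsub>V\<^esub> (b \<odot>\<^bsub>V\<^esub> v)"
    and smult_1: "\<And>v. v \<in> carrier V \<Longrightarrow> 1 \<odot>\<^bsub>V\<^esub> v = v"
    and smult_0: "\<And>v. v \<in> carrier V \<Longrightarrow> 0 \<odot>\<^bsub>V\<^esub> v = \<zero>"
  shows "module (class_ring :: complex ring) V"
proof (rule moduleI[OF cring_class_ring])
  show "abelian_group V"
  proof (rule abelian_groupI)
    fix v assume v: "v \<in> carrier V"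
    have "(- 1) \<odot>\<^bsub>V\<^esub> v \<oplus> 1 \<odot>\<^bsub>V\<^esub> v = \<zero>"
      using smult_add_left[OF v, of "- 1" 1] smult_0[OF v] by simp
    then show "\<exists>y\<in>carrier V. y \<oplus> v = \<zero>"
      using v smult_1 smult_closed by auto
  qed (use assms in auto)
qed (use assms in \<open>auto simp: class_ring_def\<close>)

lemma module_pullback:
  fixes V W
  assumes W: "module (class_ring :: complex ring) W"
    and h: "inj_on h (carrier V)" "\<And>v. v \<in> carrier V \<Longrightarrow> h v \<in> carrier W"
    and add: "\<And>u v. \<lbrakk>u \<in> carrier V; v \<in> carrier V\<rbrakk>
        \<Longrightarrow> u \<oplus>\<^bsub>V\<^esub> v \<in> carrier V \<and> h (u \<oplus>\<^bsub>V\<^esub> v) = h u \<oplus>\<^bsub>W\<^esub> h v"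
    and zero: "\<zero>\<^bsub>V\<^esub> \<in> carrier V" "h \<zero>\<^bsub>V\<^esub> = \<zero>\<^bsub>W\<^esub>"
    and smult: "\<And>a v. v \<in> carrier V \<Longrightarrow> a \<odot>\<^bsub>V\<^esub> v \<in> carrier V \<and> h (a \<odot>\<^bsub>V\<^esub> v) = a \<odot>\<^bsub>W\<^esub> h v"
  shows "module (class_ring :: complex ring) V"
proof -
  interpret W: complex_module W by (rule complex_module.intro[OF W])
  have hI: "h u = h v \<Longrightarrow> u \<in> carrier V \<Longrightarrow> v \<in> carrier V \<Longrightarrow> u = v" for u v
    using h(1) by (auto dest: inj_onD)
  show ?thesis
    by (rule complex_moduleI; (rule hI)?)
       (auto simp: add zero smult h(2) W.a_ac W.smult_add_left W.smult_add_right W.smult_smult)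
qed

sublocale star_algebra \<subseteq> complex_module A
  by (rule complex_module.intro[OF vector_space])

text \<open>Each law is an equation, so it may be checked after applying the injection
  \<open>h\<close>. With \<open>h = id\<close> this covers subalgebras and changes of norm; with
  \<open>h = \<Psi>\<close> it later yields the laws of the polynomial algebra.\<close>

lemma star_algebra_pullback:
  fixes V W
  assumes W: "star_algebra W"
    and h: "inj_on h (carrier V)" "\<And>v. v \<in> carrier V \<Longrightarrow> h v \<in> carrier W"
    and add: "\<And>u v. \<lbrakk>u \<in> carrier V; v \<in> carrier V\<rbrakk>
        \<Longrightarrow> u \<oplus>\<^bsub>V\<^esub> v \<in> carrier V \<and> h (u \<oplus>\<^bsub>V\<^esub> v) = h u \<oplus>\<^bsub>W\<^esub> h v"
    and zero: "\<zero>\<^bsub>V\<^esub> \<in> carrier V" "h \<zero>\<^bsub>V\<^esub> = \<zero>\<^bsub>W\<^esub>"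
    and smult: "\<And>a v. v \<in> carrier V \<Longrightarrow> a \<odot>\<^bsub>V\<^esub> v \<in> carrier V \<and> h (a \<odot>\<^bsub>V\<^esub> v) = a \<odot>\<^bsub>W\<^esub> h v"
    and mult: "\<And>u v. \<lbrakk>u \<in> carrier V; v \<in> carrier V\<rbrakk>
        \<Longrightarrow> u \<otimes>\<^bsub>V\<^esub> v \<in> carrier V \<and> h (u \<otimes>\<^bsub>V\<^esub> v) = h u \<otimes>\<^bsub>W\<^esub> h v"
    and star: "\<And>v. v \<in> carrier V \<Longrightarrow> star V v \<in> carrier V \<and> h (star V v) = star W (h v)"
  shows "star_algebra V"
proof -
  interpret W: star_algebra W by (rule W)
  have hI: "h u = h v \<Longrightarrow> u \<in> carrier V \<Longrightarrow> v \<in> carrier V \<Longrightarrow> u = v" for u v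
    using h(1) by (auto dest: inj_onD)
  have "module class_ring V"
    by (rule module_pullback[OF W.vector_space h add zero smult])
  show ?thesis
    by (rule star_algebra.intro[OF \<open>module class_ring V\<close>]; (rule hI)?)
       (auto simp: add zero smult mult star h(2) W.mult_assoc W.distrib_left W.distrib_right
         W.smult_mult_left W.smult_mult_right W.star_star W.star_add W.star_smult W.star_mult)
qed

lemma star_iso_inv:
  assumes "star_iso A B \<phi>"
    and "\<And>x y. \<lbrakk>x \<in> carrier A; y \<in> carrier A\<rbrakk> \<Longrightarrow> x \<oplus>\<^bsub>A\<^esub> y \<in> carrier A"
    and "\<And>x y. \<lbrakk>x \<in> carrier A; y \<in> carrier A\<rbrakk> \<Longrightarrow> x \<otimes>\<^bsub>A\<^esub> y \<in> carrier A"
    and "\<And>a x. x \<in> carrier A \<Longrightarrow> a \<odot>\<^bsub>A\<^esub> x \<in> carrier A"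
    and "\<And>x. x \<in> carrier A \<Longrightarrow> star A x \<in> carrier A"
  shows "star_iso B A (inv_into (carrier A) \<phi>)"
proof -
  let ?i = "inv_into (carrier A) \<phi>"
  have bij: "bij_betw \<phi> (carrier A) (carrier B)" using assms(1) by (simp add: star_iso_def)
  have i: "y \<in> carrier B \<Longrightarrow> ?i y \<in> carrier A \<and> \<phi> (?i y) = y" for y
    by (metis bij bij_betw_def f_inv_into_f inv_into_into)
  have j: "x \<in> carrier A \<Longrightarrow> ?i (\<phi> x) = x" for x
    using bij by (simp add: bij_betw_def)
  have k: "\<phi> x = y \<Longrightarrow> x \<in> carrier A \<Longrightarrow> ?i y = x" for x y using j by blast
  show ?thesis
    unfolding star_iso_def
    by (intro conjI bij_betw_inv_into[OF bij] ballI allI; rule k)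
       (use assms i in \<open>auto simp: star_iso_def\<close>)
qed

section \<open>Completions\<close>

text \<open>Definiteness is left out because \<open>null_rel\<close> identifies elements at distance
  zero. Invariance under the star is what makes the star well defined on classes of Cauchy
  sequences.\<close>

locale seminormed_star_algebra = star_algebra P for P (structure) +
  assumes nrm_nonneg: "x \<in> carrier P \<Longrightarrow> 0 \<le> nrm P x"
    and nrm_triangle: "\<lbrakk>x \<in> carrier P; y \<in> carrier P\<rbrakk> \<Longrightarrow> nrm P (x \<oplus> y) \<le> nrm P x + nrm P y"
    and nrm_smult: "x \<in> carrier P \<Longrightarrow> nrm P (a \<odot>\<^bsub>P\<^esub> x) = cmod a * nrm P x"
    and nrm_mult: "\<lbrakk>x \<in> carrier P; y \<in> carrier P\<rbrakk> \<Longrightarrow> nrm P (x \<otimes> y) \<le> nrm P x * nrm P y"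
    and nrm_star: "x \<in> carrier P \<Longrightarrow> nrm P (star P x) = nrm P x"
begin

lemma nrm_zero [simp]: "nrm P \<zero> = 0"
  using nrm_smult[of \<zero> 0] by simp

lemma nrm_diff_commute:
  "\<lbrakk>x \<in> carrier P; y \<in> carrier P\<rbrakk> \<Longrightarrow> nrm P (x \<ominus> y) = nrm P (y \<ominus> x)"
  by (subst diff_swap) (simp_all add: nrm_smult)

lemma nrm_diff_triangle:
  "\<lbrakk>x \<in> carrier P; y \<in> carrier P; z \<in> carrier P\<rbrakk> \<Longrightarrow>
    nrm P (x \<ominus> z) \<le> nrm P (x \<ominus> y) + nrm P (y \<ominus> z)"
  by (subst diff_split[of x y z]) (auto intro: nrm_triangle)

lemma abs_nrm_diff:
  assumes "x \<in> carrier P" "y \<in> carrier P"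
  shows "\<bar>nrm P x - nrm P y\<bar> \<le> nrm P (x \<ominus> y)"
proof -
  have "nrm P x \<le> nrm P (x \<ominus> y) + nrm P y"
    using nrm_triangle[of "x \<ominus> y" y] assms by (simp add: diff_add_cancel)
  moreover have "nrm P y \<le> nrm P (y \<ominus> x) + nrm P x"
    using nrm_triangle[of "y \<ominus> x" x] assms by (simp add: diff_add_cancel)
  ultimately show ?thesis using nrm_diff_commute[OF assms] by linarith
qed

lemma nrm_add_diff:
  "\<lbrakk>x \<in> carrier P; y \<in> carrier P; x' \<in> carrier P; y' \<in> carrier P\<rbrakk> \<Longrightarrow>
    nrm P ((x \<oplus> y) \<ominus> (x' \<oplus> y')) \<le> nrm P (x \<ominus> x') + nrm P (y \<ominus> y')"
  by (simp add: diff_add_diff nrm_triangle)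

lemma nrm_mult_diff:
  assumes "x \<in> carrier P" "y \<in> carrier P" "x' \<in> carrier P" "y' \<in> carrier P"
  shows "nrm P ((x \<otimes> y) \<ominus> (x' \<otimes> y')) \<le> nrm P (x \<ominus> x') * nrm P y + nrm P x' * nrm P (y \<ominus> y')"
proof -
  have "(x \<otimes> y) \<ominus> (x' \<otimes> y') = ((x \<otimes> y) \<ominus> (x' \<otimes> y)) \<oplus> ((x' \<otimes> y) \<ominus> (x' \<otimes> y'))"
    using assms by (intro diff_split) (auto simp: mult_closed)
  also have "(x \<otimes> y) \<ominus> (x' \<otimes> y) = (x \<ominus> x') \<otimes> y"
    using assms by (simp add: diff_eq_smult distrib_right smult_mult_left mult_closed)
  also have "(x' \<otimes> y) \<ominus> (x' \<otimes> y') = x' \<otimes> (y \<ominus> y')"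
    using assms by (simp add: diff_eq_smult distrib_left smult_mult_right mult_closed)
  finally have "nrm P ((x \<otimes> y) \<ominus> (x' \<otimes> y')) \<le> nrm P ((x \<ominus> x') \<otimes> y) + nrm P (x' \<otimes> (y \<ominus> y'))"
    using assms by (simp add: nrm_triangle mult_closed)
  also have "\<dots> \<le> nrm P (x \<ominus> x') * nrm P y + nrm P x' * nrm P (y \<ominus> y')"
    using assms by (intro add_mono nrm_mult) auto
  finally show ?thesis .
qed

lemma nrm_star_diff:
  assumes "x \<in> carrier P" "y \<in> carrier P"
  shows "nrm P (star P x \<ominus> star P y) = nrm P (x \<ominus> y)"
proof -
  have "star P x \<ominus> star P y = star P (x \<ominus> y)"
    using assms by (simp add: diff_eq_smult star_add star_smult star_closed)
  then show ?thesis using assms by (simp add: nrm_star)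
qed

lemma cauchy_seqs_closed: "s \<in> cauchy_seqs P \<Longrightarrow> s n \<in> carrier P"
  by (simp add: cauchy_seqs_def)

text \<open>Every operation is Lipschitz in its arguments, multiplication on bounded sets, so one
  criterion serves them all; unary operations use it with \<open>t = s\<close>.
  \<open>null_relI\<close> is the matching criterion for independence of representatives.\<close>

lemma cauchy_seqsI:
  assumes s: "s \<in> cauchy_seqs P" and t: "t \<in> cauchy_seqs P"
    and u: "\<And>n. u n \<in> carrier P"
    and bound: "\<And>m n. nrm P (u m \<ominus> u n) \<le> K * (nrm P (s m \<ominus> s n) + nrm P (t m \<ominus> t n))"
  shows "u \<in> cauchy_seqs P"
proof -
  have "\<exists>N. \<forall>m\<ge>N. \<forall>n\<ge>N. nrm P (u m \<ominus> u n) < e" if "e > 0" for e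
  proof -
    \<comment> \<open>Replacing \<open>K\<close> by \<open>\<bar>K\<bar> + 1\<close> gives a
      positive divisor even when \<open>K \<le> 0\<close>; the 2 shares the tolerance between
      \<open>s\<close> and \<open>t\<close>.\<close>
    define d where "d = e / (2 * (\<bar>K\<bar> + 1))"
    have d: "d > 0" using that by (simp add: d_def)
    obtain N where N: "\<forall>m\<ge>N. \<forall>n\<ge>N. nrm P (s m \<ominus> s n) < d"
      using s d by (auto simp: cauchy_seqs_def)
    obtain N' where N': "\<forall>m\<ge>N'. \<forall>n\<ge>N'. nrm P (t m \<ominus> t n) < d"
      using t d by (auto simp: cauchy_seqs_def)
    have "nrm P (u m \<ominus> u n) < e" if "m \<ge> max N N'" "n \<ge> max N N'" for m n
    proof -
      have a: "0 \<le> nrm P (s m \<ominus> s n) + nrm P (t m \<ominus> t n)"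
        using s t by (simp add: cauchy_seqs_closed nrm_nonneg)
      have "nrm P (u m \<ominus> u n) \<le> K * (nrm P (s m \<ominus> s n) + nrm P (t m \<ominus> t n))" by (rule bound)
      also have "\<dots> \<le> (\<bar>K\<bar> + 1) * (nrm P (s m \<ominus> s n) + nrm P (t m \<ominus> t n))"
        using a by (intro mult_right_mono) auto
      also have "\<dots> < (\<bar>K\<bar> + 1) * (2 * d)"
        using N N' that by (intro mult_strict_left_mono) force+
      also have "\<dots> = e" by (simp add: d_def field_simps add_pos_nonneg pos_add_strict)
      finally show ?thesis .
    qed
    then show ?thesis by blast
  qed
  then show ?thesis using u by (simp add: cauchy_seqs_def)
qed

lemma const_cauchy: "x \<in> carrier P \<Longrightarrow> (\<lambda>n. x) \<in> cauchy_seqs P"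
  using diff_eq_zero_iff[of x x] by (simp add: cauchy_seqs_def)

lemma convergent_nrm:
  assumes s: "s \<in> cauchy_seqs P"
  shows "convergent (\<lambda>n. nrm P (s n))"
proof -
  have "Cauchy (\<lambda>n. nrm P (s n))"
  proof (rule metric_CauchyI)
    fix e :: real assume "e > 0"
    then obtain N where N: "\<forall>m\<ge>N. \<forall>n\<ge>N. nrm P (s m \<ominus> s n) < e"
      using s by (auto simp: cauchy_seqs_def)
    then have "\<forall>m\<ge>N. \<forall>n\<ge>N. dist (nrm P (s m)) (nrm P (s n)) < e"
      using s by (auto simp: dist_real_def cauchy_seqs_closed intro: le_less_trans[OF abs_nrm_diff])
    then show "\<exists>M. \<forall>m\<ge>M. \<forall>n\<ge>M. dist (nrm P (s m)) (nrm P (s n)) < e" by blast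
  qed
  then show ?thesis by (simp add: Cauchy_convergent_iff)
qed

lemma cauchy_bounded:
  assumes s: "s \<in> cauchy_seqs P"
  obtains M where "M > 0" "\<And>n. nrm P (s n) \<le> M"
proof -
  have "Bseq (\<lambda>n. nrm P (s n))" using convergent_nrm[OF s] by (rule convergent_imp_Bseq)
  then obtain M where "M > 0" "\<forall>n. norm (nrm P (s n)) \<le> M" by (auto elim: BseqE)
  then have "nrm P (s n) \<le> M" for n by (auto dest: spec[of _ n])
  with \<open>M > 0\<close> show thesis by (rule that)
qed

lemma add_cauchy:
  "\<lbrakk>s \<in> cauchy_seqs P; t \<in> cauchy_seqs P\<rbrakk> \<Longrightarrow> (\<lambda>n. s n \<oplus> t n) \<in> cauchy_seqs P"
  by (rule cauchy_seqsI[of s t _ 1]) (auto simp: cauchy_seqs_closed intro: nrm_add_diff)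

lemma smult_cauchy: "s \<in> cauchy_seqs P \<Longrightarrow> (\<lambda>n. a \<odot>\<^bsub>P\<^esub> s n) \<in> cauchy_seqs P"
  by (rule cauchy_seqsI[of s s _ "cmod a"])
     (auto simp: cauchy_seqs_closed diff_smult nrm_smult nrm_nonneg intro!: mult_left_mono)

lemma star_cauchy: "s \<in> cauchy_seqs P \<Longrightarrow> (\<lambda>n. star P (s n)) \<in> cauchy_seqs P"
  by (rule cauchy_seqsI[of s s _ 1])
     (auto simp: cauchy_seqs_closed star_closed nrm_star_diff nrm_nonneg)

lemma diff_cauchy:
  "\<lbrakk>s \<in> cauchy_seqs P; t \<in> cauchy_seqs P\<rbrakk> \<Longrightarrow> (\<lambda>n. s n \<ominus> t n) \<in> cauchy_seqs P"
  using add_cauchy[of s "\<lambda>n. (- 1) \<odot>\<^bsub>P\<^esub> t n"] by (simp add: smult_cauchy diff_eq_smult cauchy_seqs_closed)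

text \<open>The asymmetric estimate of \<open>nrm_mult_diff\<close> is weakened to the symmetric
  form that \<open>cauchy_seqsI\<close> and \<open>null_relI\<close> accept.\<close>

lemma nrm_mult_diff_bound:
  assumes "x \<in> carrier P" "y \<in> carrier P" "x' \<in> carrier P" "y' \<in> carrier P"
    and "nrm P y \<le> M" "nrm P x' \<le> L" "0 \<le> M" "0 \<le> L"
  shows "nrm P ((x \<otimes> y) \<ominus> (x' \<otimes> y')) \<le> (M + L) * (nrm P (x \<ominus> x') + nrm P (y \<ominus> y'))"
proof -
  have "nrm P ((x \<otimes> y) \<ominus> (x' \<otimes> y')) \<le> nrm P (x \<ominus> x') * nrm P y + nrm P x' * nrm P (y \<ominus> y')"
    using assms by (intro nrm_mult_diff)
  also have "\<dots> \<le> nrm P (x \<ominus> x') * (M + L) + (M + L) * nrm P (y \<ominus> y')"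
    using assms by (intro add_mono mult_left_mono mult_right_mono nrm_nonneg) auto
  finally show ?thesis by (simp add: algebra_simps)
qed

lemma mult_cauchy:
  assumes s: "s \<in> cauchy_seqs P" and t: "t \<in> cauchy_seqs P"
  shows "(\<lambda>n. s n \<otimes> t n) \<in> cauchy_seqs P"
proof -
  obtain M where M: "M > 0" "\<And>n. nrm P (t n) \<le> M" by (rule cauchy_bounded[OF t]) blast
  obtain L where L: "L > 0" "\<And>n. nrm P (s n) \<le> L" by (rule cauchy_bounded[OF s]) blast
  show ?thesis
    by (rule cauchy_seqsI[OF s t, of _ "M + L"])
       (use s t M L in \<open>auto simp: cauchy_seqs_closed mult_closed less_imp_le intro!: nrm_mult_diff_bound\<close>)
qed

lemma null_relI:
  assumes s: "(s, s') \<in> null_rel P" and t: "(t, t') \<in> null_rel P"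
    and u: "u \<in> cauchy_seqs P" "u' \<in> cauchy_seqs P"
    and bound: "\<And>n. nrm P (u n \<ominus> u' n) \<le> K * (nrm P (s n \<ominus> s' n) + nrm P (t n \<ominus> t' n))"
  shows "(u, u') \<in> null_rel P"
proof -
  have "(\<lambda>n. K * (nrm P (s n \<ominus> s' n) + nrm P (t n \<ominus> t' n))) \<longlonglongrightarrow> K * (0 + 0)"
    using s t by (intro tendsto_intros) (auto simp: null_rel_def)
  then have lim: "(\<lambda>n. K * (nrm P (s n \<ominus> s' n) + nrm P (t n \<ominus> t' n))) \<longlonglongrightarrow> 0"
    by simp
  have "(\<lambda>n. nrm P (u n \<ominus> u' n)) \<longlonglongrightarrow> 0"
    by (rule Lim_null_comparison[OF _ lim])
       (use u bound in \<open>simp add: cauchy_seqs_closed nrm_nonneg\<close>)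
  then show ?thesis using u by (simp add: null_rel_def)
qed

lemma null_relD:
  assumes "(s, t) \<in> null_rel P"
  shows "s \<in> cauchy_seqs P" "t \<in> cauchy_seqs P" "(\<lambda>n. nrm P (s n \<ominus> t n)) \<longlonglongrightarrow> 0"
  using assms by (auto simp: null_rel_def)

lemma null_rel_refl: "s \<in> cauchy_seqs P \<Longrightarrow> (s, s) \<in> null_rel P"
  using diff_eq_zero_iff[of "s n" "s n" for n] by (simp add: null_rel_def cauchy_seqs_closed)

lemma equiv_null_rel: "equiv (cauchy_seqs P) (null_rel P)"
proof (rule equivI)
  show "null_rel P \<subseteq> cauchy_seqs P \<times> cauchy_seqs P" by (auto simp: null_rel_def)
  show "refl_on (cauchy_seqs P) (null_rel P)"
    using null_rel_refl by (auto simp: refl_on_def)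
  show "sym (null_rel P)"
  proof (rule symI)
    fix s t assume st: "(s, t) \<in> null_rel P"
    show "(t, s) \<in> null_rel P"
      by (rule null_relI[OF st st, of _ _ 1])
         (use null_relD[OF st] in \<open>auto simp: cauchy_seqs_closed nrm_diff_commute nrm_nonneg\<close>)
  qed
  show "trans (null_rel P)"
  proof (rule transI)
    fix s t u assume st: "(s, t) \<in> null_rel P" and tu: "(t, u) \<in> null_rel P"
    show "(s, u) \<in> null_rel P"
      by (rule null_relI[OF st tu, of _ _ 1])
         (use null_relD[OF st] null_relD[OF tu] in \<open>auto simp: cauchy_seqs_closed intro: nrm_diff_triangle\<close>)
  qed
qed

definition cls :: "(nat \<Rightarrow> 'a) \<Rightarrow> (nat \<Rightarrow> 'a) set" where
  "cls s = null_rel P `` {s}"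

lemma cls_eq_iff:
  "\<lbrakk>s \<in> cauchy_seqs P; t \<in> cauchy_seqs P\<rbrakk> \<Longrightarrow> cls s = cls t \<longleftrightarrow> (s, t) \<in> null_rel P"
  using eq_equiv_class_iff[OF equiv_null_rel] by (simp add: cls_def)

lemma cls_eqI: "(s, t) \<in> null_rel P \<Longrightarrow> cls s = cls t"
  using cls_eq_iff null_relD by blast

lemma cls_self: "s \<in> cauchy_seqs P \<Longrightarrow> s \<in> cls s"
  by (simp add: cls_def null_rel_refl)

lemma mem_cls: "t \<in> cls s \<longleftrightarrow> (s, t) \<in> null_rel P"
  by (simp add: cls_def)

lemma carrier_completion: "carrier (completion P) = cls ` cauchy_seqs P"
  by (auto simp: completion_def quotient_def cls_def)

lemma cls_closed [simp]: "s \<in> cauchy_seqs P \<Longrightarrow> cls s \<in> carrier (completion P)"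
  by (simp add: carrier_completion)

text \<open>Operations of \<open>completion\<close> are unions over all representatives. The members
  of such a union are classes that do not depend on the representative, so it collapses to one of
  them.\<close>

lemma UN_cls: 
  assumes "s \<in> cauchy_seqs P" "\<And>s'. (s, s') \<in> null_rel P \<Longrightarrow> f s' = f s"
  shows "(\<Union>s'\<in>cls s. f s') = f s"
proof -
  have "(\<Union>s'\<in>cls s. f s') = (\<Union>s'\<in>cls s. f s)"
    by (rule SUP_cong) (simp_all add: assms(2) mem_cls)
  also have "\<dots> = f s" using cls_self[OF assms(1)] by (simp only: UN_constant) auto
  finally show ?thesis .
qed

lemma UN_cls2:
  assumes s: "s \<in> cauchy_seqs P" and t: "t \<in> cauchy_seqs P"
    and f: "\<And>s' t'. \<lbrakk>(s, s') \<in> null_rel P; (t, t') \<in> null_rel P\<rbrakk> \<Longrightarrow> f s' t' = f s t"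
  shows "(\<Union>s'\<in>cls s. \<Union>t'\<in>cls t. f s' t') = f s t"
proof -
  have "(\<Union>t'\<in>cls t. f s' t') = f s' t" if "(s, s') \<in> null_rel P" for s'
    by (rule UN_cls[OF t]) (simp add: f that null_rel_refl t)
  then have "(\<Union>s'\<in>cls s. \<Union>t'\<in>cls t. f s' t') = (\<Union>s'\<in>cls s. f s' t)"
    by (intro SUP_cong) (simp_all add: mem_cls)
  also have "\<dots> = f s t"
    by (rule UN_cls[OF s]) (simp add: f null_rel_refl t)
  finally show ?thesis .
qed

lemma add_cls:
  assumes s: "s \<in> cauchy_seqs P" and t: "t \<in> cauchy_seqs P"
  shows "cls s \<oplus>\<^bsub>completion P\<^esub> cls t = cls (\<lambda>n. s n \<oplus> t n)"
proof -
  have "cls (\<lambda>n. s' n \<oplus> t' n) = cls (\<lambda>n. s n \<oplus> t n)"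
    if "(s, s') \<in> null_rel P" "(t, t') \<in> null_rel P" for s' t'
    using null_relD[OF that(1)] null_relD[OF that(2)]
    by (intro cls_eqI[symmetric] null_relI[OF that, of _ _ 1])
       (auto simp: add_cauchy cauchy_seqs_closed intro: nrm_add_diff)
  then have "(\<Union>s'\<in>cls s. \<Union>t'\<in>cls t. cls (\<lambda>n. s' n \<oplus> t' n)) = cls (\<lambda>n. s n \<oplus> t n)"
    by (rule UN_cls2[OF s t])
  then show ?thesis by (simp add: completion_def cls_def)
qed

lemma mult_cls:
  assumes s: "s \<in> cauchy_seqs P" and t: "t \<in> cauchy_seqs P"
  shows "cls s \<otimes>\<^bsub>completion P\<^esub> cls t = cls (\<lambda>n. s n \<otimes> t n)"
proof -
  have "cls (\<lambda>n. s' n \<otimes> t' n) = cls (\<lambda>n. s n \<otimes> t n)"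
    if ss: "(s, s') \<in> null_rel P" and tt: "(t, t') \<in> null_rel P" for s' t'
  proof -
    have s': "s' \<in> cauchy_seqs P" and t': "t' \<in> cauchy_seqs P"
      using null_relD ss tt by blast+
    obtain M where M: "M > 0" "\<And>n. nrm P (t n) \<le> M" by (rule cauchy_bounded[OF t]) blast
    obtain L where L: "L > 0" "\<And>n. nrm P (s' n) \<le> L" by (rule cauchy_bounded[OF s']) blast
    show ?thesis
      by (rule cls_eqI[symmetric], rule null_relI[OF ss tt, of _ _ "M + L"])
         (use s t s' t' M L in \<open>auto simp: cauchy_seqs_closed mult_cauchy less_imp_le intro!: nrm_mult_diff_bound\<close>)
  qed
  then have "(\<Union>s'\<in>cls s. \<Union>t'\<in>cls t. cls (\<lambda>n. s' n \<otimes> t' n)) = cls (\<lambda>n. s n \<otimes> t n)"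
    by (rule UN_cls2[OF s t])
  then show ?thesis by (simp add: completion_def cls_def)
qed

lemma smult_cls:
  assumes s: "s \<in> cauchy_seqs P"
  shows "a \<odot>\<^bsub>completion P\<^esub> cls s = cls (\<lambda>n. a \<odot>\<^bsub>P\<^esub> s n)"
proof -
  have "cls (\<lambda>n. a \<odot>\<^bsub>P\<^esub> s' n) = cls (\<lambda>n. a \<odot>\<^bsub>P\<^esub> s n)"
    if ss: "(s, s') \<in> null_rel P" for s'
    using null_relD[OF ss]
    by (intro cls_eqI[symmetric] null_relI[OF ss ss, of _ _ "cmod a"])
       (auto simp: smult_cauchy cauchy_seqs_closed diff_smult nrm_smult nrm_nonneg intro!: mult_left_mono)
  then have "(\<Union>s'\<in>cls s. cls (\<lambda>n. a \<odot>\<^bsub>P\<^esub> s' n)) = cls (\<lambda>n. a \<odot>\<^bsub>P\<^esub> s n)"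
    by (rule UN_cls[OF s])
  then show ?thesis by (simp add: completion_def cls_def)
qed

lemma star_cls:
  assumes s: "s \<in> cauchy_seqs P"
  shows "star (completion P) (cls s) = cls (\<lambda>n. star P (s n))"
proof -
  have "cls (\<lambda>n. star P (s' n)) = cls (\<lambda>n. star P (s n))"
    if ss: "(s, s') \<in> null_rel P" for s'
    using null_relD[OF ss]
    by (intro cls_eqI[symmetric] null_relI[OF ss ss, of _ _ 1])
       (auto simp: star_cauchy cauchy_seqs_closed nrm_star_diff nrm_nonneg)
  then have "(\<Union>s'\<in>cls s. cls (\<lambda>n. star P (s' n))) = cls (\<lambda>n. star P (s n))"
    by (rule UN_cls[OF s])
  then show ?thesis by (simp add: completion_def cls_def)
qed

lemma zero_cls: "\<zero>\<^bsub>completion P\<^esub> = cls (\<lambda>n. \<zero>)"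
  by (simp add: completion_def cls_def)

lemma nrm_cls:
  assumes s: "s \<in> cauchy_seqs P"
  shows "nrm (completion P) (cls s) = lim (\<lambda>n. nrm P (s n))"
proof -
  \<comment> \<open>This is the representative at which the completion evaluates its norm by
    definition; it differs from \<open>s\<close> by a null sequence.\<close>
  define t where "t = (SOME t. t \<in> cls s)"
  have "t \<in> cls s" unfolding t_def by (rule someI[of "\<lambda>t. t \<in> cls s", OF cls_self[OF s]])
  then have st: "(s, t) \<in> null_rel P" by (simp add: mem_cls)
  have "(\<lambda>n. nrm P (t n) - nrm P (s n)) \<longlonglongrightarrow> 0"
    by (rule Lim_null_comparison[OF _ null_relD(3)[OF st]])
       (use null_relD[OF st] abs_nrm_diff in \<open>simp add: cauchy_seqs_closed abs_minus_commute\<close>)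
  moreover have "(\<lambda>n. nrm P (s n)) \<longlonglongrightarrow> lim (\<lambda>n. nrm P (s n))"
    using convergent_nrm[OF s] by (simp add: convergent_LIMSEQ_iff)
  ultimately have "(\<lambda>n. nrm P (t n)) \<longlonglongrightarrow> lim (\<lambda>n. nrm P (s n))"
    using tendsto_add by fastforce
  then show ?thesis by (simp add: completion_def limI flip: t_def)
qed

lemma module_completion: "module (class_ring :: complex ring) (completion P)"
proof (rule complex_moduleI)
  have z: "(\<lambda>n. \<zero>) \<in> cauchy_seqs P" by (simp add: const_cauchy)
  show "\<zero>\<^bsub>completion P\<^esub> \<in> carrier (completion P)" by (simp add: zero_cls z)
qed (auto simp: carrier_completion add_cls smult_cls zero_cls add_cauchy smult_cauchy const_cauchy
       cauchy_seqs_closed a_ac smult_add_left smult_add_right smult_smult cong: image_cong)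

interpretation C: complex_module "completion P"
  by (rule complex_module.intro[OF module_completion])

lemma nrm_dist_cls:
  assumes s: "s \<in> cauchy_seqs P" and t: "t \<in> cauchy_seqs P"
  shows "nrm_dist (completion P) (cls s) (cls t) = lim (\<lambda>n. nrm P (s n \<ominus> t n))"
proof -
  have "cls s \<ominus>\<^bsub>completion P\<^esub> cls t = cls (\<lambda>n. s n \<ominus> t n)"
    using assms by (simp add: C.diff_eq_smult smult_cls add_cls smult_cauchy diff_eq_smult cauchy_seqs_closed)
  then show ?thesis using assms by (simp add: nrm_dist_def nrm_cls diff_cauchy)
qed

lemma nrm_dist_lim:
  assumes s: "s \<in> cauchy_seqs P" and t: "t \<in> cauchy_seqs P"
  shows "(\<lambda>n. nrm P (s n \<ominus> t n)) \<longlonglongrightarrow> nrm_dist (completion P) (cls s) (cls t)"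
  using convergent_nrm[OF diff_cauchy[OF s t]] by (simp add: nrm_dist_cls s t convergent_LIMSEQ_iff)

lemma Metric_space_completion:
  "Metric_space (carrier (completion P)) (nrm_dist (completion P))"
proof (rule Metric_space.intro)
  fix x y
  show "0 \<le> nrm_dist (completion P) x y"
  proof (cases "x \<in> carrier (completion P) \<and> y \<in> carrier (completion P)")
    case True
    then obtain s t where st: "s \<in> cauchy_seqs P" "t \<in> cauchy_seqs P" "x = cls s" "y = cls t"
      by (auto simp: carrier_completion)
    then show ?thesis
      by (auto intro!: LIMSEQ_le_const[OF nrm_dist_lim] simp: cauchy_seqs_closed nrm_nonneg)
  qed (auto simp: nrm_dist_def)
  show "nrm_dist (completion P) x y = nrm_dist (completion P) y x"
  proof (cases "x \<in> carrier (completion P) \<and> y \<in> carrier (completion P)")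
    case True
    then obtain s t where st: "s \<in> cauchy_seqs P" "t \<in> cauchy_seqs P" "x = cls s" "y = cls t"
      by (auto simp: carrier_completion)
    then show ?thesis
      by (simp add: nrm_dist_cls nrm_diff_commute cauchy_seqs_closed)
  qed (auto simp: nrm_dist_def)
  assume x: "x \<in> carrier (completion P)" and y: "y \<in> carrier (completion P)"
  then obtain s t where st: "s \<in> cauchy_seqs P" "t \<in> cauchy_seqs P" "x = cls s" "y = cls t"
    by (auto simp: carrier_completion)
  show "nrm_dist (completion P) x y = 0 \<longleftrightarrow> x = y"
  proof
    assume "nrm_dist (completion P) x y = 0"
    then show "x = y" using nrm_dist_lim[OF st(1,2)] st by (auto intro!: cls_eqI simp: null_rel_def)
  next
    assume "x = y"
    then have "(s, t) \<in> null_rel P" using cls_eq_iff st by blast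
    then show "nrm_dist (completion P) x y = 0"
      using nrm_dist_lim[OF st(1,2)] null_relD(3) LIMSEQ_unique st by blast
  qed
  fix z assume "z \<in> carrier (completion P)"
  then obtain u where u: "u \<in> cauchy_seqs P" "z = cls u" by (auto simp: carrier_completion)
  show "nrm_dist (completion P) x z \<le> nrm_dist (completion P) x y + nrm_dist (completion P) y z"
    unfolding st u
    by (rule LIMSEQ_le[OF nrm_dist_lim tendsto_add[OF nrm_dist_lim nrm_dist_lim]])
       (use st u in \<open>auto simp: cauchy_seqs_closed intro!: nrm_diff_triangle\<close>)
qed

lemma completion_embed_eq: "completion_embed P x = cls (\<lambda>n. x)"
  by (simp add: completion_embed_def cls_def)

lemma embed_closed: "x \<in> carrier P \<Longrightarrow> completion_embed P x \<in> carrier (completion P)"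
  by (simp add: completion_embed_eq const_cauchy)

lemma nrm_dist_embed:
  assumes "x \<in> carrier P" "y \<in> carrier P"
  shows "nrm_dist (completion P) (completion_embed P x) (completion_embed P y) = nrm P (x \<ominus> y)"
  using assms by (simp add: completion_embed_eq nrm_dist_cls const_cauchy)

lemma closure_in_completion_eq:
  assumes "T \<subseteq> carrier P"
  shows "closure_in_completion P T =
    {x \<in> carrier (completion P). \<forall>e>0. \<exists>p\<in>T. nrm_dist (completion P) x (completion_embed P p) < e}"
proof -
  interpret M: Metric_space "carrier (completion P)" "nrm_dist (completion P)"
    by (rule Metric_space_completion)
  have "completion_embed P p \<in> carrier (completion P)" if "p \<in> T" for p
    using assms embed_closed that by blast
  then show ?thesis
    unfolding closure_in_completion_def nrm_topology_def M.metric_closure_of bex_simps M.in_mball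
    by (intro Collect_cong) fast
qed

end

text \<open>An isometric homomorphism is applied termwise to Cauchy sequences; density of its range
  makes the result surjective. The second conclusion is relative: subsets correspond under closure
  as soon as the image of \<open>S\<close> is dense in \<open>T\<close>. It serves for the elements
  of nonnegative degree.\<close>

theorem star_iso_completion:
  fixes P Q
  assumes P: "seminormed_star_algebra P" and Q: "seminormed_star_algebra Q"
    and j: "\<And>x. x \<in> carrier Q \<Longrightarrow> j x \<in> carrier P"
    and j_add: "\<And>x y. \<lbrakk>x \<in> carrier Q; y \<in> carrier Q\<rbrakk> \<Longrightarrow> j (x \<oplus>\<^bsub>Q\<^esub> y) = j x \<oplus>\<^bsub>P\<^esub> j y"
    and j_smult: "\<And>a x. x \<in> carrier Q \<Longrightarrow> j (a \<odot>\<^bsub>Q\<^esub> x) = a \<odot>\<^bsub>P\<^esub> j x"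
    and j_mult: "\<And>x y. \<lbrakk>x \<in> carrier Q; y \<in> carrier Q\<rbrakk> \<Longrightarrow> j (x \<otimes>\<^bsub>Q\<^esub> y) = j x \<otimes>\<^bsub>P\<^esub> j y"
    and j_star: "\<And>x. x \<in> carrier Q \<Longrightarrow> j (star Q x) = star P (j x)"
    and j_nrm: "\<And>x. x \<in> carrier Q \<Longrightarrow> nrm P (j x) = nrm Q x"
    and dense: "\<And>p e. \<lbrakk>p \<in> carrier P; 0 < e\<rbrakk> \<Longrightarrow> \<exists>q\<in>carrier Q. nrm P (p \<ominus>\<^bsub>P\<^esub> j q) < e"
  obtains \<Phi> where "star_iso (completion Q) (completion P) \<Phi>"
    and "\<And>S T. \<lbrakk>S \<subseteq> carrier Q; T \<subseteq> carrier P; j ` S \<subseteq> T;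
            \<And>p e. \<lbrakk>p \<in> T; 0 < e\<rbrakk> \<Longrightarrow> \<exists>q\<in>S. nrm P (p \<ominus>\<^bsub>P\<^esub> j q) < e\<rbrakk>
          \<Longrightarrow> \<Phi> ` closure_in_completion Q S = closure_in_completion P T"
proof -
  interpret P: seminormed_star_algebra P by (rule P)
  interpret Q: seminormed_star_algebra Q by (rule Q)
  have j_diff: "j (x \<ominus>\<^bsub>Q\<^esub> y) = j x \<ominus>\<^bsub>P\<^esub> j y" if "x \<in> carrier Q" "y \<in> carrier Q" for x y
    using that by (simp add: Q.diff_eq_smult P.diff_eq_smult j j_add j_smult)
  have nrm_diff: "nrm P (j x \<ominus>\<^bsub>P\<^esub> j y) = nrm Q (x \<ominus>\<^bsub>Q\<^esub> y)" if "x \<in> carrier Q" "y \<in> carrier Q" for x y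
    using that by (simp add: j_nrm flip: j_diff)
  have jc: "(\<lambda>n. j (s n)) \<in> cauchy_seqs P" if "s \<in> cauchy_seqs Q" for s
    using that by (auto simp: cauchy_seqs_def j nrm_diff)
  have jn: "((\<lambda>n. j (s n)), (\<lambda>n. j (t n))) \<in> null_rel P \<longleftrightarrow> (s, t) \<in> null_rel Q"
    if "s \<in> cauchy_seqs Q" "t \<in> cauchy_seqs Q" for s t
    using that by (simp add: null_rel_def jc nrm_diff Q.cauchy_seqs_closed)
  define \<Phi> where "\<Phi> C = (\<Union>s\<in>C. P.cls (\<lambda>n. j (s n)))" for C
  have \<Phi>: "\<Phi> (Q.cls s) = P.cls (\<lambda>n. j (s n))" if s: "s \<in> cauchy_seqs Q" for s
  proof -
    have "P.cls (\<lambda>n. j (s' n)) = P.cls (\<lambda>n. j (s n))" if "(s, s') \<in> null_rel Q" for s'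
      using that s Q.null_relD[OF that] by (intro P.cls_eqI[symmetric]) (simp add: jn)
    then show ?thesis using Q.UN_cls[OF s, of "\<lambda>s. P.cls (\<lambda>n. j (s n))"] by (simp add: \<Phi>_def)
  qed
  have surj: "\<exists>q\<in>cauchy_seqs Q. \<Phi> (Q.cls q) = P.cls p" if p: "p \<in> cauchy_seqs P" for p
  proof -
    have "\<exists>q\<in>carrier Q. nrm P (p n \<ominus>\<^bsub>P\<^esub> j q) < 1 / Suc n" for n
      using p by (intro dense) (auto simp: P.cauchy_seqs_closed)
    then obtain q where q: "\<And>n. q n \<in> carrier Q" "\<And>n. nrm P (p n \<ominus>\<^bsub>P\<^esub> j (q n)) < 1 / Suc n"
      by metis
    have lim: "(\<lambda>n. nrm P (p n \<ominus>\<^bsub>P\<^esub> j (q n))) \<longlonglongrightarrow> 0"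
    proof (rule Lim_null_comparison[of _ "\<lambda>n. 1 / Suc n"])
      show "(\<lambda>n. 1 / real (Suc n)) \<longlonglongrightarrow> 0"
        using LIMSEQ_inverse_real_of_nat by (simp add: inverse_eq_divide)
      have "norm (nrm P (p n \<ominus>\<^bsub>P\<^esub> j (q n))) \<le> 1 / Suc n" for n
        using p q[of n] P.nrm_nonneg[of "p n \<ominus>\<^bsub>P\<^esub> j (q n)"] j P.cauchy_seqs_closed
        by (simp add: less_imp_le)
      then show "\<forall>\<^sub>F n in sequentially. norm (nrm P (p n \<ominus>\<^bsub>P\<^esub> j (q n))) \<le> 1 / Suc n" by simp
    qed
    \<comment> \<open>The images form a Cauchy sequence because they stay asymptotically close to
      \<open>p\<close>; isometry of \<open>j\<close> then carries this back to
      \<open>q\<close>.\<close>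
    have jq: "(\<lambda>n. j (q n)) \<in> cauchy_seqs P"
    proof -
      have "\<exists>N. \<forall>m\<ge>N. \<forall>n\<ge>N. nrm P (j (q m) \<ominus>\<^bsub>P\<^esub> j (q n)) < e" if "e > 0" for e
      proof -
        have "e / 3 > 0" using that by simp
        obtain N where N: "\<forall>m\<ge>N. \<forall>n\<ge>N. nrm P (p m \<ominus>\<^bsub>P\<^esub> p n) < e / 3"
          using p \<open>e / 3 > 0\<close> unfolding cauchy_seqs_def mem_Collect_eq by blast
        obtain N' where N': "\<forall>n\<ge>N'. nrm P (p n \<ominus>\<^bsub>P\<^esub> j (q n)) < e / 3"
          using order_tendstoD(2)[OF lim \<open>e / 3 > 0\<close>] unfolding eventually_sequentially by blast
        have "nrm P (j (q m) \<ominus>\<^bsub>P\<^esub> j (q n)) < e" if "m \<ge> max N N'" "n \<ge> max N N'" for m n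
        proof -
          have c: "p m \<in> carrier P" "p n \<in> carrier P" "j (q m) \<in> carrier P" "j (q n) \<in> carrier P"
            using p q j by (auto simp: P.cauchy_seqs_closed)
          have "nrm P (p m \<ominus>\<^bsub>P\<^esub> j (q m)) < e / 3" "nrm P (p n \<ominus>\<^bsub>P\<^esub> j (q n)) < e / 3"
            "nrm P (p m \<ominus>\<^bsub>P\<^esub> p n) < e / 3" using N N' that by auto
          then show ?thesis
            using P.nrm_diff_triangle[of "j (q m)" "p m" "j (q n)"] c
              P.nrm_diff_triangle[of "p m" "p n" "j (q n)"] P.nrm_diff_commute[of "j (q m)" "p m"]
            by linarith
        qed
        then show ?thesis by blast
      qed
      then show ?thesis using q j by (simp add: cauchy_seqs_def)
    qed
    then have qc: "q \<in> cauchy_seqs Q" using q by (simp add: cauchy_seqs_def nrm_diff)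
    have "(p, (\<lambda>n. j (q n))) \<in> null_rel P" using p jq lim by (simp add: null_rel_def)
    then show ?thesis using \<Phi>[OF qc] P.cls_eqI qc by metis
  qed
  have inj: "inj_on \<Phi> (carrier (completion Q))"
    by (auto simp: inj_on_def Q.carrier_completion \<Phi> jc P.cls_eq_iff Q.cls_eq_iff jn)
  have bij: "bij_betw \<Phi> (carrier (completion Q)) (carrier (completion P))"
    unfolding bij_betw_def
  proof
    show "\<Phi> ` carrier (completion Q) = carrier (completion P)"
      using surj by (auto simp: Q.carrier_completion P.carrier_completion \<Phi> jc image_iff) metis
  qed (rule inj)
  have iso: "star_iso (completion Q) (completion P) \<Phi>"
    unfolding star_iso_def
    using bij
    by (auto simp: Q.carrier_completion Q.add_cls Q.mult_cls Q.smult_cls Q.star_cls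
        P.add_cls P.mult_cls P.smult_cls P.star_cls \<Phi> jc Q.add_cauchy Q.mult_cauchy Q.smult_cauchy
        Q.star_cauchy j_add j_mult j_smult j_star Q.cauchy_seqs_closed)
  have dist: "nrm_dist (completion P) (\<Phi> x) (\<Phi> y) = nrm_dist (completion Q) x y"
    if "x \<in> carrier (completion Q)" "y \<in> carrier (completion Q)" for x y
    using that by (auto simp: Q.carrier_completion \<Phi> P.nrm_dist_cls Q.nrm_dist_cls jc nrm_diff
        Q.cauchy_seqs_closed)
  have embed: "\<Phi> (completion_embed Q q) = completion_embed P (j q)" if "q \<in> carrier Q" for q
    using that by (simp add: Q.completion_embed_eq P.completion_embed_eq \<Phi> Q.const_cauchy)
  interpret M: Metric_space "carrier (completion P)" "nrm_dist (completion P)"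
    by (rule P.Metric_space_completion)
  show thesis
  proof (rule that[OF iso])
    fix S T assume S: "S \<subseteq> carrier Q" and T: "T \<subseteq> carrier P" and jS: "j ` S \<subseteq> T"
      and dense': "\<And>p e. \<lbrakk>p \<in> T; 0 < e\<rbrakk> \<Longrightarrow> \<exists>q\<in>S. nrm P (p \<ominus>\<^bsub>P\<^esub> j q) < e"
    show "\<Phi> ` closure_in_completion Q S = closure_in_completion P T"
    proof (intro equalityI subsetI)
      fix y assume "y \<in> \<Phi> ` closure_in_completion Q S"
      then obtain x where x: "x \<in> carrier (completion Q)" "y = \<Phi> x"
        and c: "\<And>e. e > 0 \<Longrightarrow> \<exists>q\<in>S. nrm_dist (completion Q) x (completion_embed Q q) < e"
        using Q.closure_in_completion_eq[OF S] by auto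
      have "\<exists>p\<in>T. nrm_dist (completion P) y (completion_embed P p) < e" if e: "e > 0" for e
      proof -
        obtain q where q: "q \<in> S" "nrm_dist (completion Q) x (completion_embed Q q) < e"
          using c[OF e] by blast
        then have "nrm_dist (completion P) y (completion_embed P (j q)) < e"
          using S x dist[OF x(1) Q.embed_closed, of q] embed[of q] by auto
        then show ?thesis using q jS by blast
      qed
      moreover have "y \<in> carrier (completion P)" using bij x by (auto simp: bij_betw_def)
      ultimately show "y \<in> closure_in_completion P T"
        using P.closure_in_completion_eq[OF T] by auto
    next
      fix y assume "y \<in> closure_in_completion P T"
      then have y: "y \<in> carrier (completion P)"
        and c: "\<And>e. e > 0 \<Longrightarrow> \<exists>p\<in>T. nrm_dist (completion P) y (completion_embed P p) < e"
        using P.closure_in_completion_eq[OF T] by auto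
      have "y \<in> \<Phi> ` carrier (completion Q)" using bij y by (simp add: bij_betw_def)
      then obtain x where x: "x \<in> carrier (completion Q)" "y = \<Phi> x" by blast
      have "\<exists>q\<in>S. nrm_dist (completion Q) x (completion_embed Q q) < e" if e: "e > 0" for e
      proof -
        obtain p where p: "p \<in> T" "nrm_dist (completion P) y (completion_embed P p) < e / 2"
          using c[of "e / 2"] e by auto
        obtain q where q: "q \<in> S" "nrm P (p \<ominus>\<^bsub>P\<^esub> j q) < e / 2"
          using dense'[OF p(1), of "e / 2"] e by auto
        have cl: "p \<in> carrier P" "q \<in> carrier Q" using p q S T by auto
        have "nrm_dist (completion Q) x (completion_embed Q q) =
            nrm_dist (completion P) y (completion_embed P (j q))"
          using dist[OF x(1) Q.embed_closed[OF cl(2)]] embed[OF cl(2)] x by simp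
        also have "\<dots> \<le> nrm_dist (completion P) y (completion_embed P p) +
            nrm_dist (completion P) (completion_embed P p) (completion_embed P (j q))"
          using y cl j P.embed_closed by (intro M.triangle) auto
        also have "\<dots> < e" using p(2) q(2) cl j by (simp add: P.nrm_dist_embed)
        finally show ?thesis using q by blast
      qed
      then show "y \<in> \<Phi> ` closure_in_completion Q S"
        using x Q.closure_in_completion_eq[OF S] by auto
    qed
  qed
qed

section \<open>Hilbert spaces\<close>

text \<open>Completeness in \<open>hilbert_space\<close> refers to a distance that is known to be a
  metric only after Cauchy-Schwarz. Splitting it off lets new Hilbert spaces be built in two
  stages.\<close>

locale pre_hilbert_space =
  fixes H (structure)
  assumes vector_space: "module (class_ring :: complex ring) H"
    and inner_add: "\<lbrakk>u \<in> carrier H; v \<in> carrier H; w \<in> carrier H\<rbrakk>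
        \<Longrightarrow> inner_prod H (u \<oplus> v) w = inner_prod H u w + inner_prod H v w"
    and inner_smult: "\<lbrakk>v \<in> carrier H; w \<in> carrier H\<rbrakk>
        \<Longrightarrow> inner_prod H (a \<odot>\<^bsub>H\<^esub> v) w = a * inner_prod H v w"
    and inner_commute: "\<lbrakk>v \<in> carrier H; w \<in> carrier H\<rbrakk>
        \<Longrightarrow> inner_prod H w v = cnj (inner_prod H v w)"
    and inner_nonneg: "v \<in> carrier H \<Longrightarrow> 0 \<le> Re (inner_prod H v v)"
    and inner_eq_0: "v \<in> carrier H \<Longrightarrow> inner_prod H v v = 0 \<longleftrightarrow> v = \<zero>"
begin

sublocale complex_module H
  by (rule complex_module.intro[OF vector_space])

lemma inner_add_right: "\<lbrakk>u \<in> carrier H; v \<in> carrier H; w \<in> carrier H\<rbrakk>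
    \<Longrightarrow> inner_prod H u (v \<oplus> w) = inner_prod H u v + inner_prod H u w"
  by (metis inner_add inner_commute a_closed complex_cnj_add)

lemma inner_smult_right: "\<lbrakk>v \<in> carrier H; w \<in> carrier H\<rbrakk>
    \<Longrightarrow> inner_prod H v (a \<odot>\<^bsub>H\<^esub> w) = cnj a * inner_prod H v w"
  by (metis inner_smult inner_commute smult_closed complex_cnj_mult)

lemma vec_norm_nonneg [simp]: "v \<in> carrier H \<Longrightarrow> 0 \<le> vec_norm H v"
  by (simp add: vec_norm_def inner_nonneg)

lemma inner_self: "v \<in> carrier H \<Longrightarrow> inner_prod H v v = of_real ((vec_norm H v)\<^sup>2)"
  using inner_commute[of v v] inner_nonneg[of v]
  by (auto simp: vec_norm_def complex_eq_iff)

lemma vec_norm_sq: "v \<in> carrier H \<Longrightarrow> (vec_norm H v)\<^sup>2 = Re (inner_prod H v v)"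
  by (simp add: inner_self)

lemma vec_norm_eq_0: "v \<in> carrier H \<Longrightarrow> vec_norm H v = 0 \<longleftrightarrow> v = \<zero>"
  using inner_eq_0 inner_self by simp

lemma vec_norm_zero [simp]: "vec_norm H \<zero> = 0"
  by (simp add: vec_norm_eq_0)

lemma vec_norm_smult: "v \<in> carrier H \<Longrightarrow> vec_norm H (a \<odot>\<^bsub>H\<^esub> v) = cmod a * vec_norm H v"
proof (rule power2_eq_imp_eq)
  assume v: "v \<in> carrier H"
  have "inner_prod H (a \<odot>\<^bsub>H\<^esub> v) (a \<odot>\<^bsub>H\<^esub> v) = a * cnj a * of_real ((vec_norm H v)\<^sup>2)"
    using v by (simp add: inner_smult inner_smult_right inner_self[OF v])
  also have "a * cnj a = of_real ((cmod a)\<^sup>2)" by (rule complex_norm_square[symmetric])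
  finally have "inner_prod H (a \<odot>\<^bsub>H\<^esub> v) (a \<odot>\<^bsub>H\<^esub> v) = of_real ((cmod a * vec_norm H v)\<^sup>2)"
    by (simp add: power_mult_distrib)
  then show "(vec_norm H (a \<odot>\<^bsub>H\<^esub> v))\<^sup>2 = (cmod a * vec_norm H v)\<^sup>2"
    using v by (simp only: vec_norm_sq smult_closed Re_complex_of_real)
qed auto

lemma vec_norm_add_sq:
  assumes v: "v \<in> carrier H" and w: "w \<in> carrier H"
  shows "(vec_norm H (v \<oplus> w))\<^sup>2 = (vec_norm H v)\<^sup>2 + 2 * Re (inner_prod H v w) + (vec_norm H w)\<^sup>2"
  using v w inner_commute[OF v w] by (simp add: vec_norm_sq inner_add inner_add_right)

lemma Cauchy_Schwarz:
  assumes v: "v \<in> carrier H" and w: "w \<in> carrier H"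
  shows "cmod (inner_prod H v w) \<le> vec_norm H v * vec_norm H w"
proof (cases "w = \<zero>")
  case True
  then show ?thesis using inner_smult_right[OF v zero_closed, of 0] by simp
next
  case False
  define c where "c = cmod (inner_prod H v w)"
  define W where "W = (vec_norm H w)\<^sup>2"
  \<comment> \<open>With this coefficient \<open>v \<oplus> t \<odot> w\<close> is the component of
    \<open>v\<close> orthogonal to \<open>w\<close>; its squared norm being nonnegative is the
    inequality.\<close>
  define t where "t = - of_real (1 / W) * inner_prod H v w"
  have W: "W > 0" using False w vec_norm_eq_0[of w] by (simp add: W_def)
  have "inner_prod H v (t \<odot>\<^bsub>H\<^esub> w) = - of_real (1 / W) * (inner_prod H v w * cnj (inner_prod H v w))"
    using v w by (simp add: inner_smult_right t_def)
  also have "inner_prod H v w * cnj (inner_prod H v w) = of_real (c\<^sup>2)"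
    unfolding c_def by (rule complex_norm_square[symmetric])
  finally have e: "Re (inner_prod H v (t \<odot>\<^bsub>H\<^esub> w)) = - (c\<^sup>2 / W)" by simp
  have n: "(vec_norm H (t \<odot>\<^bsub>H\<^esub> w))\<^sup>2 = c\<^sup>2 / W"
    using W w by (simp add: vec_norm_smult t_def norm_mult norm_divide power_mult_distrib power_divide c_def
        flip: W_def) (simp add: power2_eq_square field_simps)
  have "0 \<le> (vec_norm H (v \<oplus> t \<odot>\<^bsub>H\<^esub> w))\<^sup>2" by simp
  also have "\<dots> = (vec_norm H v)\<^sup>2 - c\<^sup>2 / W"
    using v w by (simp add: vec_norm_add_sq e n)
  finally have "c\<^sup>2 \<le> (vec_norm H v * vec_norm H w)\<^sup>2"
    using W by (simp add: field_simps W_def power_mult_distrib)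
  then show ?thesis
    unfolding c_def by (rule power2_le_imp_le) (simp add: v w)
qed

lemma vec_norm_triangle:
  assumes v: "v \<in> carrier H" and w: "w \<in> carrier H"
  shows "vec_norm H (v \<oplus> w) \<le> vec_norm H v + vec_norm H w"
proof (rule power2_le_imp_le)
  have "Re (inner_prod H v w) \<le> vec_norm H v * vec_norm H w"
    using Cauchy_Schwarz[OF v w] complex_Re_le_cmod order_trans by blast
  then show "(vec_norm H (v \<oplus> w))\<^sup>2 \<le> (vec_norm H v + vec_norm H w)\<^sup>2"
    using v w by (simp add: vec_norm_add_sq power2_sum)
qed (use v w in simp)

lemma vec_norm_diff_commute:
  "\<lbrakk>v \<in> carrier H; w \<in> carrier H\<rbrakk> \<Longrightarrow> vec_norm H (v \<ominus> w) = vec_norm H (w \<ominus> v)"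
  by (subst diff_swap) (simp_all add: vec_norm_smult)

lemma vec_norm_diff_triangle:
  "\<lbrakk>u \<in> carrier H; v \<in> carrier H; w \<in> carrier H\<rbrakk> \<Longrightarrow>
    vec_norm H (u \<ominus> w) \<le> vec_norm H (u \<ominus> v) + vec_norm H (v \<ominus> w)"
  by (subst diff_split[of u v w]) (auto intro: vec_norm_triangle)

lemma abs_vec_norm_diff:
  assumes "v \<in> carrier H" "w \<in> carrier H"
  shows "\<bar>vec_norm H v - vec_norm H w\<bar> \<le> vec_norm H (v \<ominus> w)"
proof -
  have "vec_norm H v \<le> vec_norm H (v \<ominus> w) + vec_norm H w"
    using vec_norm_triangle[of "v \<ominus> w" w] assms by (simp add: diff_add_cancel)
  moreover have "vec_norm H w \<le> vec_norm H (w \<ominus> v) + vec_norm H v"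
    using vec_norm_triangle[of "w \<ominus> v" v] assms by (simp add: diff_add_cancel)
  ultimately show ?thesis using vec_norm_diff_commute[OF assms] by linarith
qed

lemma Metric_space_vec_dist: "Metric_space (carrier H) (vec_dist H)"
proof (rule Metric_space.intro)
  fix x y
  show "0 \<le> vec_dist H x y" by (simp add: vec_dist_def)
  show "vec_dist H x y = vec_dist H y x" by (simp add: vec_dist_def vec_norm_diff_commute)
  assume x: "x \<in> carrier H" and y: "y \<in> carrier H"
  then show "vec_dist H x y = 0 \<longleftrightarrow> x = y"
    by (simp add: vec_dist_def vec_norm_eq_0 diff_eq_zero_iff)
  fix z assume "z \<in> carrier H"
  with x y show "vec_dist H x z \<le> vec_dist H x y + vec_dist H y z"
    by (simp add: vec_dist_def vec_norm_diff_triangle)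
qed

end

section \<open>Limits of sequences of vectors and completeness\<close>

definition vlim :: "('h, 'm) inner_product_space_scheme \<Rightarrow> (nat \<Rightarrow> 'h) \<Rightarrow> 'h \<Rightarrow> bool" where
  "vlim H s v \<longleftrightarrow> (\<forall>n. s n \<in> carrier H) \<and> v \<in> carrier H \<and>
     (\<lambda>n. vec_norm H (s n \<ominus>\<^bsub>H\<^esub> v)) \<longlonglongrightarrow> 0"

definition vcauchy :: "('h, 'm) inner_product_space_scheme \<Rightarrow> (nat \<Rightarrow> 'h) \<Rightarrow> bool" where
  "vcauchy H s \<longleftrightarrow> (\<forall>n. s n \<in> carrier H) \<and>
     (\<forall>e>0. \<exists>N. \<forall>m\<ge>N. \<forall>n\<ge>N. vec_norm H (s m \<ominus>\<^bsub>H\<^esub> s n) < e)"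

lemma (in pre_hilbert_space) mcomplete_iff:
  "Metric_space.mcomplete (carrier H) (vec_dist H) \<longleftrightarrow> (\<forall>s. vcauchy H s \<longrightarrow> (\<exists>v. vlim H s v))"
proof -
  interpret M: Metric_space "carrier H" "vec_dist H" by (rule Metric_space_vec_dist)
  have c: "M.MCauchy s \<longleftrightarrow> vcauchy H s" for s
  proof (cases "\<forall>n. s n \<in> carrier H")
    case True
    then show ?thesis
      by (simp add: M.MCauchy_def vcauchy_def vec_dist_def image_subset_iff)
  next
    case False
    then show ?thesis by (auto simp: M.MCauchy_def vcauchy_def)
  qed
  have l: "limitin M.mtopology s v sequentially \<longleftrightarrow> vlim H s v" if "vcauchy H s" for s v
  proof -
    have s: "\<forall>n. s n \<in> carrier H" using that by (simp add: vcauchy_def)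
    show ?thesis
    proof (cases "v \<in> carrier H")
      case True
      then show ?thesis using s
        by (simp add: M.limit_metric_sequentially vlim_def LIMSEQ_iff vec_dist_def)
    next
      case False
      then show ?thesis by (simp add: M.limit_metric_sequentially vlim_def)
    qed
  qed
  show ?thesis unfolding M.mcomplete_def c using l by blast
qed

sublocale hilbert_space \<subseteq> pre_hilbert_space
  using hilbert_space_axioms unfolding hilbert_space_def pre_hilbert_space_def
    by - (elim conjE, intro conjI; assumption)

lemma hilbert_spaceI:
  assumes "pre_hilbert_space H" "\<And>s. vcauchy H s \<Longrightarrow> \<exists>v. vlim H s v"
  shows "hilbert_space H"
proof -
  interpret pre_hilbert_space H by fact
  have "Metric_space.mcomplete (carrier H) (vec_dist H)"
    using assms(2) by (simp add: mcomplete_iff)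
  then show ?thesis
    using pre_hilbert_space_axioms unfolding hilbert_space_def pre_hilbert_space_def
    by - (elim conjE, intro conjI; assumption)
qed

lemma (in hilbert_space) vcauchy_vlim: "vcauchy H s \<Longrightarrow> \<exists>v. vlim H s v"
  using complete by (simp add: mcomplete_iff)

context pre_hilbert_space
begin

lemma vlim_closed: "vlim H s v \<Longrightarrow> v \<in> carrier H"
  by (simp add: vlim_def)

lemma vlimI:
  assumes "\<And>n. s n \<in> carrier H" "v \<in> carrier H" "\<And>n. vec_norm H (s n \<ominus> v) \<le> f n" "f \<longlonglongrightarrow> 0"
  shows "vlim H s v"
proof -
  have "(\<lambda>n. vec_norm H (s n \<ominus> v)) \<longlonglongrightarrow> 0"
    by (rule Lim_null_comparison[OF _ assms(4)]) (simp add: assms)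
  then show ?thesis using assms by (simp add: vlim_def)
qed

lemma vlim_const: "v \<in> carrier H \<Longrightarrow> vlim H (\<lambda>n. v) v"
  by (simp add: vlim_def r_neg a_minus_def)

lemma vlim_unique:
  assumes "vlim H s v" "vlim H s w"
  shows "v = w"
proof -
  have c: "\<And>n. s n \<in> carrier H" "v \<in> carrier H" "w \<in> carrier H" using assms by (auto simp: vlim_def)
  have "(\<lambda>n. vec_norm H (s n \<ominus> v) + vec_norm H (s n \<ominus> w)) \<longlonglongrightarrow> 0 + 0"
    using assms by (intro tendsto_add) (auto simp: vlim_def)
  moreover have "vec_norm H (v \<ominus> w) \<le> vec_norm H (s n \<ominus> v) + vec_norm H (s n \<ominus> w)" for n
    using vec_norm_diff_triangle[of v "s n" w] vec_norm_diff_commute[of v "s n"] c by simp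
  ultimately have "vec_norm H (v \<ominus> w) \<le> 0 + 0"
    using LIMSEQ_le_const by blast
  then have "vec_norm H (v \<ominus> w) = 0" using c vec_norm_nonneg[of "v \<ominus> w"] by (intro antisym) auto
  then show ?thesis using c by (simp add: vec_norm_eq_0 diff_eq_zero_iff)
qed

lemma vlim_add:
  assumes "vlim H s v" "vlim H t w"
  shows "vlim H (\<lambda>n. s n \<oplus> t n) (v \<oplus> w)"
proof (rule vlimI)
  have c: "\<And>n. s n \<in> carrier H" "v \<in> carrier H" "\<And>n. t n \<in> carrier H" "w \<in> carrier H"
    using assms by (auto simp: vlim_def)
  show "vec_norm H ((s n \<oplus> t n) \<ominus> (v \<oplus> w)) \<le> vec_norm H (s n \<ominus> v) + vec_norm H (t n \<ominus> w)" for n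
    using c by (simp add: diff_add_diff vec_norm_triangle)
  show "(\<lambda>n. vec_norm H (s n \<ominus> v) + vec_norm H (t n \<ominus> w)) \<longlonglongrightarrow> 0"
    using tendsto_add[of _ 0 _ _ 0] assms by (fastforce simp: vlim_def)
qed (use assms in \<open>auto simp: vlim_def\<close>)

lemma vlim_smult:
  assumes "vlim H s v"
  shows "vlim H (\<lambda>n. a \<odot>\<^bsub>H\<^esub> s n) (a \<odot>\<^bsub>H\<^esub> v)"
proof (rule vlimI)
  show "vec_norm H (a \<odot>\<^bsub>H\<^esub> s n \<ominus> a \<odot>\<^bsub>H\<^esub> v) \<le> cmod a * vec_norm H (s n \<ominus> v)" for n
    using assms by (simp add: vlim_def diff_smult vec_norm_smult)
  show "(\<lambda>n. cmod a * vec_norm H (s n \<ominus> v)) \<longlonglongrightarrow> 0"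
    using assms by (auto simp: vlim_def intro: tendsto_mult_right_zero)
qed (use assms in \<open>auto simp: vlim_def\<close>)

lemma vlim_norm:
  assumes "vlim H s v"
  shows "(\<lambda>n. vec_norm H (s n)) \<longlonglongrightarrow> vec_norm H v"
proof -
  have "(\<lambda>n. vec_norm H (s n) - vec_norm H v) \<longlonglongrightarrow> 0"
    by (rule Lim_null_comparison[of _ "\<lambda>n. vec_norm H (s n \<ominus> v)"])
       (use assms abs_vec_norm_diff in \<open>auto simp: vlim_def\<close>)
  then show ?thesis by (simp add: LIM_zero_iff)
qed

lemma inner_zero_right [simp]: "v \<in> carrier H \<Longrightarrow> inner_prod H v \<zero> = 0"
  using inner_smult_right[of v \<zero> 0] by simp

lemma inner_zero_left [simp]: "v \<in> carrier H \<Longrightarrow> inner_prod H \<zero> v = 0"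
  using inner_smult[of \<zero> v 0] by simp

lemma inner_diff: "\<lbrakk>u \<in> carrier H; v \<in> carrier H; w \<in> carrier H\<rbrakk>
    \<Longrightarrow> inner_prod H (u \<ominus> v) w = inner_prod H u w - inner_prod H v w"
  by (simp add: diff_eq_smult inner_add inner_smult)

lemma vlim_inner:
  assumes s: "vlim H s v" and w: "w \<in> carrier H"
  shows "(\<lambda>n. inner_prod H (s n) w) \<longlonglongrightarrow> inner_prod H v w"
proof -
  have "(\<lambda>n. inner_prod H (s n) w - inner_prod H v w) \<longlonglongrightarrow> 0"
  proof (rule Lim_null_comparison)
    show "(\<lambda>n. vec_norm H (s n \<ominus> v) * vec_norm H w) \<longlonglongrightarrow> 0"
      using s by (auto simp: vlim_def intro: tendsto_mult_left_zero)
    show "\<forall>\<^sub>F n in sequentially. norm (inner_prod H (s n) w - inner_prod H v w) \<le>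
        vec_norm H (s n \<ominus> v) * vec_norm H w"
      using s w Cauchy_Schwarz by (simp add: vlim_def flip: inner_diff)
  qed
  then show ?thesis by (simp add: LIM_zero_iff)
qed

lemma vlim_inner_right:
  assumes s: "vlim H s v" and w: "w \<in> carrier H"
  shows "(\<lambda>n. inner_prod H w (s n)) \<longlonglongrightarrow> inner_prod H w v"
proof -
  have "(\<lambda>n. cnj (inner_prod H (s n) w)) \<longlonglongrightarrow> cnj (inner_prod H v w)"
    by (intro tendsto_cnj vlim_inner assms)
  moreover have "cnj (inner_prod H (s n) w) = inner_prod H w (s n)" for n
    by (rule inner_commute[symmetric]) (use s w in \<open>auto simp: vlim_def\<close>)
  moreover have "cnj (inner_prod H v w) = inner_prod H w v"
    by (rule inner_commute[symmetric]) (use s w in \<open>auto simp: vlim_def\<close>)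
  ultimately show ?thesis by simp
qed

subsection \<open>Bounded operators\<close>

lemma bounded_operatorD:
  assumes "bounded_operator H T"
  shows "v \<in> carrier H \<Longrightarrow> T v \<in> carrier H"
    and "\<lbrakk>v \<in> carrier H; w \<in> carrier H\<rbrakk> \<Longrightarrow> T (v \<oplus> w) = T v \<oplus> T w"
    and "v \<in> carrier H \<Longrightarrow> T (a \<odot>\<^bsub>H\<^esub> v) = a \<odot>\<^bsub>H\<^esub> T v"
  using assms by (auto simp: bounded_operator_def)

lemma op_norm_le:
  assumes "\<And>v. v \<in> carrier H \<Longrightarrow> vec_norm H (T v) \<le> K * vec_norm H v" "0 \<le> K"
  shows "op_norm H T \<le> K"
  unfolding op_norm_def
proof (rule cSUP_least)
  show "{v \<in> carrier H. vec_norm H v \<le> 1} \<noteq> {}"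
    using zero_closed vec_norm_zero by fastforce
  fix v assume v: "v \<in> {v \<in> carrier H. vec_norm H v \<le> 1}"
  then have "vec_norm H (T v) \<le> K * vec_norm H v" using assms by auto
  also have "\<dots> \<le> K * 1" using v assms by (intro mult_left_mono) auto
  finally show "vec_norm H (T v) \<le> K" by simp
qed

lemma bdd_above_op_norm:
  assumes T: "bounded_operator H T"
  shows "bdd_above ((\<lambda>v. vec_norm H (T v)) ` {v \<in> carrier H. vec_norm H v \<le> 1})"
proof -
  obtain C where C: "\<And>v. v \<in> carrier H \<Longrightarrow> vec_norm H (T v) \<le> C * vec_norm H v"
    using T unfolding bounded_operator_def by blast
  have "vec_norm H (T v) \<le> \<bar>C\<bar>" if v: "v \<in> carrier H" "vec_norm H v \<le> 1" for v
  proof -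
    have "C * vec_norm H v \<le> \<bar>C\<bar> * 1" using v by (intro mult_mono) auto
    then show ?thesis using C[OF v(1)] by simp
  qed
  then show ?thesis by (intro bdd_aboveI2[of _ _ "\<bar>C\<bar>"]) simp
qed

lemma op_norm_nonneg:
  assumes T: "bounded_operator H T"
  shows "0 \<le> op_norm H T"
proof -
  have "vec_norm H (T \<zero>) \<le> op_norm H T"
    unfolding op_norm_def by (rule cSUP_upper[OF _ bdd_above_op_norm[OF T]]) simp
  then show ?thesis
    using order_trans[OF vec_norm_nonneg[OF bounded_operatorD(1)[OF T zero_closed]]] by blast
qed

lemma op_norm_bound:
  assumes T: "bounded_operator H T" and v: "v \<in> carrier H"
  shows "vec_norm H (T v) \<le> op_norm H T * vec_norm H v"
proof (cases "vec_norm H v = 0")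
  case True
  then have "v = \<zero>" using v vec_norm_eq_0 by simp
  then have "T v = \<zero>" using bounded_operatorD(3)[OF T v, of 0] bounded_operatorD(1)[OF T v] by simp
  then show ?thesis using True by simp
next
  case False
  define a where "a = complex_of_real (1 / vec_norm H v)"
  have n: "vec_norm H v > 0" using False v vec_norm_nonneg[OF v] by linarith
  have "vec_norm H (T (a \<odot>\<^bsub>H\<^esub> v)) \<le> op_norm H T"
    unfolding op_norm_def
    by (rule cSUP_upper[OF _ bdd_above_op_norm[OF T]])
       (use n v in \<open>simp add: vec_norm_smult a_def norm_divide\<close>)
  moreover have "vec_norm H (T (a \<odot>\<^bsub>H\<^esub> v)) = vec_norm H (T v) / vec_norm H v"
    using n v bounded_operatorD(1,3)[OF T v] by (simp add: vec_norm_smult a_def norm_divide)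
  ultimately show ?thesis using n by (simp add: field_simps)
qed

lemma bounded_operator_diff:
  "\<lbrakk>bounded_operator H T; v \<in> carrier H; w \<in> carrier H\<rbrakk> \<Longrightarrow> T (v \<ominus> w) = T v \<ominus> T w"
  by (simp add: diff_eq_smult bounded_operatorD)

end

section \<open>Representations\<close>

lemma representationD:
  assumes "representation P H \<pi>"
  shows "hilbert_space H"
    and "x \<in> carrier P \<Longrightarrow> bounded_operator H (\<pi> x)"
    and "\<lbrakk>x \<in> carrier P; y \<in> carrier P; v \<in> carrier H\<rbrakk> \<Longrightarrow> \<pi> (x \<oplus>\<^bsub>P\<^esub> y) v = \<pi> x v \<oplus>\<^bsub>H\<^esub> \<pi> y v"
    and "\<lbrakk>x \<in> carrier P; v \<in> carrier H\<rbrakk> \<Longrightarrow> \<pi> (a \<odot>\<^bsub>P\<^esub> x) v = a \<odot>\<^bsub>H\<^esub> \<pi> x v"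
    and "\<lbrakk>x \<in> carrier P; y \<in> carrier P; v \<in> carrier H\<rbrakk> \<Longrightarrow> \<pi> (x \<otimes>\<^bsub>P\<^esub> y) v = \<pi> x (\<pi> y v)"
    and "\<lbrakk>x \<in> carrier P; v \<in> carrier H; w \<in> carrier H\<rbrakk> \<Longrightarrow>
      inner_prod H (\<pi> (star P x) v) w = inner_prod H v (\<pi> x w)"
  using assms unfolding representation_def by auto

locale star_representation = P: star_algebra P + H: hilbert_space H
  for P :: "('p, 'm) star_algebra_scheme" (structure)
    and H :: "('h, 'n) inner_product_space_scheme" and \<pi> +
  assumes rep: "representation P H \<pi>"
begin

lemmas rep_bounded = representationD(2)[OF rep]
lemmas rep_add = representationD(3)[OF rep]
lemmas rep_smult = representationD(4)[OF rep]
lemmas rep_mult = representationD(5)[OF rep]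
lemmas rep_adjoint = representationD(6)[OF rep]

lemma rep_closed [simp, intro]: "\<lbrakk>x \<in> carrier P; v \<in> carrier H\<rbrakk> \<Longrightarrow> \<pi> x v \<in> carrier H"
  using H.bounded_operatorD(1)[OF rep_bounded] .

lemma rep_zero: "v \<in> carrier H \<Longrightarrow> \<pi> \<zero> v = \<zero>\<^bsub>H\<^esub>"
  using rep_smult[of \<zero> v 0] by simp

lemma rep_diff: "\<lbrakk>x \<in> carrier P; y \<in> carrier P; v \<in> carrier H\<rbrakk> \<Longrightarrow> \<pi> (x \<ominus> y) v = \<pi> x v \<ominus>\<^bsub>H\<^esub> \<pi> y v"
  by (simp add: P.diff_eq_smult H.diff_eq_smult rep_add rep_smult)

lemma rep_norm_sq:
  assumes "x \<in> carrier P" "v \<in> carrier H"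
  shows "(vec_norm H (\<pi> x v))\<^sup>2 = Re (inner_prod H (\<pi> (star P x \<otimes> x) v) v)"
  using assms by (simp add: H.vec_norm_sq rep_mult rep_adjoint P.star_closed)

lemma rep_bound: "\<lbrakk>x \<in> carrier P; v \<in> carrier H\<rbrakk> \<Longrightarrow> vec_norm H (\<pi> x v) \<le> op_norm H (\<pi> x) * vec_norm H v"
  by (rule H.op_norm_bound[OF rep_bounded])

lemma rep_norm_nonneg: "x \<in> carrier P \<Longrightarrow> 0 \<le> op_norm H (\<pi> x)"
  by (rule H.op_norm_nonneg[OF rep_bounded])

lemma rep_norm_add:
  assumes x: "x \<in> carrier P" and y: "y \<in> carrier P"
  shows "op_norm H (\<pi> (x \<oplus> y)) \<le> op_norm H (\<pi> x) + op_norm H (\<pi> y)"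
proof (rule H.op_norm_le)
  fix v assume v: "v \<in> carrier H"
  have "vec_norm H (\<pi> (x \<oplus> y) v) \<le> vec_norm H (\<pi> x v) + vec_norm H (\<pi> y v)"
    using x y v by (simp add: rep_add H.vec_norm_triangle)
  also have "\<dots> \<le> (op_norm H (\<pi> x) + op_norm H (\<pi> y)) * vec_norm H v"
    using rep_bound[OF x v] rep_bound[OF y v] by (simp add: distrib_right)
  finally show "vec_norm H (\<pi> (x \<oplus> y) v) \<le> (op_norm H (\<pi> x) + op_norm H (\<pi> y)) * vec_norm H v" .
qed (use x y rep_norm_nonneg in simp)

lemma rep_norm_smult_le:
  assumes x: "x \<in> carrier P"
  shows "op_norm H (\<pi> (a \<odot>\<^bsub>P\<^esub> x)) \<le> cmod a * op_norm H (\<pi> x)"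
proof (rule H.op_norm_le)
  fix v assume v: "v \<in> carrier H"
  show "vec_norm H (\<pi> (a \<odot>\<^bsub>P\<^esub> x) v) \<le> cmod a * op_norm H (\<pi> x) * vec_norm H v"
    using x v rep_bound[OF x v] by (simp add: rep_smult H.vec_norm_smult mult.assoc mult_left_mono)
qed (use x rep_norm_nonneg in simp)

lemma rep_norm_mult:
  assumes x: "x \<in> carrier P" and y: "y \<in> carrier P"
  shows "op_norm H (\<pi> (x \<otimes> y)) \<le> op_norm H (\<pi> x) * op_norm H (\<pi> y)"
proof (rule H.op_norm_le)
  fix v assume v: "v \<in> carrier H"
  have "vec_norm H (\<pi> (x \<otimes> y) v) \<le> op_norm H (\<pi> x) * vec_norm H (\<pi> y v)"
    using x y v by (simp add: rep_mult rep_bound)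
  also have "\<dots> \<le> op_norm H (\<pi> x) * (op_norm H (\<pi> y) * vec_norm H v)"
    using x y v by (intro mult_left_mono rep_bound rep_norm_nonneg)
  finally show "vec_norm H (\<pi> (x \<otimes> y) v) \<le> op_norm H (\<pi> x) * op_norm H (\<pi> y) * vec_norm H v"
    by (simp add: mult.assoc)
qed (use x y rep_norm_nonneg in simp)

lemma rep_norm_star_le:
  assumes x: "x \<in> carrier P"
  shows "op_norm H (\<pi> (star P x)) \<le> op_norm H (\<pi> x)"
proof (rule H.op_norm_le)
  fix v assume v: "v \<in> carrier H"
  define w where "w = \<pi> (star P x) v"
  have w: "w \<in> carrier H" using x v by (simp add: w_def P.star_closed)
  have "(vec_norm H w)\<^sup>2 = Re (inner_prod H v (\<pi> x w))"
    using rep_adjoint[OF x v w] H.vec_norm_sq[OF w] by (simp add: w_def)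
  also have "\<dots> \<le> vec_norm H v * vec_norm H (\<pi> x w)"
    using H.Cauchy_Schwarz[OF v rep_closed[OF x w]] complex_Re_le_cmod order_trans by blast
  also have "\<dots> \<le> vec_norm H v * (op_norm H (\<pi> x) * vec_norm H w)"
    using x v w by (intro mult_left_mono rep_bound H.vec_norm_nonneg)
  finally have "vec_norm H w * vec_norm H w \<le> (op_norm H (\<pi> x) * vec_norm H v) * vec_norm H w"
    by (simp add: power2_eq_square mult_ac)
  moreover have "0 \<le> op_norm H (\<pi> x) * vec_norm H v" using x v rep_norm_nonneg by simp
  ultimately show "vec_norm H w \<le> op_norm H (\<pi> x) * vec_norm H v"
    using H.vec_norm_nonneg[OF w] by (cases "vec_norm H w = 0") auto
qed (rule rep_norm_nonneg[OF x])

lemma rep_norm_star: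
  assumes x: "x \<in> carrier P"
  shows "op_norm H (\<pi> (star P x)) = op_norm H (\<pi> x)"
  using rep_norm_star_le[OF x] rep_norm_star_le[OF P.star_closed[OF x]] by (simp add: P.star_star x)

end

lemma star_representationI:
  "\<lbrakk>star_algebra P; representation P H \<pi>\<rbrakk> \<Longrightarrow> star_representation P H \<pi>"
  by (simp add: star_representation_def star_representation_axioms_def representationD(1))

text \<open>A supremum of reals over an empty family is unspecified, so the universal norms need at
  least one representation. A one-point space exists in any type of vectors.\<close>

lemma representation_zero:
  fixes P :: "('p, 'm) star_algebra_scheme"
  shows "\<exists>(H :: 'h inner_product_space) \<pi>. representation P H \<pi> \<and> (\<forall>x. op_norm H (\<pi> x) = 0)"
proof -
  fix z :: 'h
  define H :: "'h inner_product_space" where "H = \<lparr>carrier = {z}, mult = undefined, one = undefined,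
    zero = z, add = (\<lambda>_ _. z), smult = (\<lambda>_ _. z), inner_prod = (\<lambda>_ _. 0)\<rparr>"
  have mod: "module class_ring H"
    by (rule complex_moduleI) (auto simp: H_def)
  have pre: "pre_hilbert_space H"
    by (rule pre_hilbert_space.intro[OF mod]) (auto simp: H_def)
  interpret pre_hilbert_space H by (rule pre)
  have hil: "hilbert_space H"
  proof (rule hilbert_spaceI[OF pre])
    fix s assume "vcauchy H s"
    then have "s = (\<lambda>n. z)" by (auto simp: vcauchy_def H_def)
    then show "\<exists>v. vlim H s v" using vlim_const[of z] by (auto simp: H_def)
  qed
  have "representation P H (\<lambda>_ _. z)"
    using hil by (auto simp: representation_def bounded_operator_def H_def vec_norm_def)
  moreover have "op_norm H (\<lambda>_. z) = 0"
    by (simp add: op_norm_def H_def vec_norm_def)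
  ultimately show ?thesis by blast
qed

text \<open>Each operator norm is a submultiplicative seminorm invariant under the star, and these
  properties survive a supremum. \<open>ex\<close> and \<open>bd\<close> make the real supremum
  meaningful.\<close>

lemma seminormed_universal_norm:
  assumes P: "star_algebra P"
    and R: "\<And>H \<pi>. R H \<pi> \<Longrightarrow> representation P H \<pi>"
    and ex: "R H0 \<pi>0"
    and bd: "\<And>x. x \<in> carrier P \<Longrightarrow> \<exists>M. \<forall>H \<pi>. R H \<pi> \<longrightarrow> op_norm H (\<pi> x) \<le> M"
  shows "seminormed_star_algebra (P\<lparr>nrm := universal_norm P R\<rparr>)"
    and "\<And>x H \<pi>. \<lbrakk>R H \<pi>; x \<in> carrier P\<rbrakk> \<Longrightarrow> op_norm H (\<pi> x) \<le> universal_norm P R x"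
    and "\<And>x M. \<lbrakk>x \<in> carrier P; \<And>H \<pi>. R H \<pi> \<Longrightarrow> op_norm H (\<pi> x) \<le> M\<rbrakk> \<Longrightarrow> universal_norm P R x \<le> M"
proof -
  interpret P: star_algebra P by (rule P)
  let ?u = "universal_norm P R"
  let ?P = "P\<lparr>nrm := ?u\<rparr>"
  have SR: "star_representation P H \<pi>" if "R H \<pi>" for H \<pi>
    using star_representationI[OF P R[OF that]] .
  show upper: "op_norm H (\<pi> x) \<le> ?u x" if "R H \<pi>" "x \<in> carrier P" for x H \<pi>
    unfolding universal_norm_def
  proof (rule cSup_upper)
    show "bdd_above {op_norm H (\<pi> x) |H \<pi>. R H \<pi>}"
      using bd[OF that(2)] by (auto simp: bdd_above_def)
  qed (use that in blast)
  show least: "?u x \<le> M" if "x \<in> carrier P" "\<And>H \<pi>. R H \<pi> \<Longrightarrow> op_norm H (\<pi> x) \<le> M" for x M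
    unfolding universal_norm_def
    by (rule cSup_least) (use that ex in auto)
  have nonneg: "0 \<le> ?u x" if x: "x \<in> carrier P" for x
    using upper[OF ex x] star_representation.rep_norm_nonneg[OF SR[OF ex] x] by linarith
  have smult_le: "?u (a \<odot>\<^bsub>P\<^esub> x) \<le> cmod a * ?u x" if x: "x \<in> carrier P" for a x
  proof (rule least)
    fix H \<pi> assume r: "R H \<pi>"
    show "op_norm H (\<pi> (a \<odot>\<^bsub>P\<^esub> x)) \<le> cmod a * ?u x"
      using star_representation.rep_norm_smult_le[OF SR[OF r] x, of a] upper[OF r x]
      by (meson mult_left_mono norm_ge_zero order_trans)
  qed (use x in simp)
  have star_le: "?u (star P x) \<le> ?u x" if x: "x \<in> carrier P" for x
    by (rule least) (use x upper star_representation.rep_norm_star[OF SR x] in \<open>auto simp: P.star_closed\<close>)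
  show "seminormed_star_algebra ?P"
  proof (rule seminormed_star_algebra.intro[OF _ seminormed_star_algebra_axioms.intro])
    show "star_algebra ?P"
      by (rule star_algebra_pullback[OF P, of id])
         (auto simp: P.mult_closed P.star_closed)
    fix x assume "x \<in> carrier ?P"
    then have x: "x \<in> carrier P" by simp
    show "0 \<le> nrm ?P x" using nonneg[OF x] by simp
    \<comment> \<open>The reverse of \<open>smult_le\<close> comes from applying it to the scalar
      \<open>1 / a\<close>, hence the separate case of a zero scalar.\<close>
    show "nrm ?P (a \<odot>\<^bsub>?P\<^esub> x) = cmod a * nrm ?P x" for a
    proof (cases "a = 0")
      case True
      have "?u (0 \<odot>\<^bsub>P\<^esub> x) = 0"
        using smult_le[OF x, of 0] nonneg[of "0 \<odot>\<^bsub>P\<^esub> x"] x by simp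
      then show ?thesis using True by simp
    next
      case False
      have "?u x = ?u ((1 / a) \<odot>\<^bsub>P\<^esub> (a \<odot>\<^bsub>P\<^esub> x))"
        using x False by (simp add: P.smult_smult)
      also have "\<dots> \<le> cmod (1 / a) * ?u (a \<odot>\<^bsub>P\<^esub> x)" using x by (intro smult_le) simp
      finally have "cmod a * ?u x \<le> ?u (a \<odot>\<^bsub>P\<^esub> x)"
        using False by (simp add: norm_divide field_simps)
      then show ?thesis using smult_le[OF x, of a] by simp
    qed
    show "nrm ?P (star ?P x) = nrm ?P x"
      using star_le[OF x] star_le[OF P.star_closed[OF x]] x by (simp add: P.star_star)
    fix y assume "y \<in> carrier ?P"
    then have y: "y \<in> carrier P" by simp
    have "?u (x \<oplus>\<^bsub>P\<^esub> y) \<le> ?u x + ?u y"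
    proof (rule least)
      fix H \<pi> assume r: "R H \<pi>"
      show "op_norm H (\<pi> (x \<oplus>\<^bsub>P\<^esub> y)) \<le> ?u x + ?u y"
        using star_representation.rep_norm_add[OF SR[OF r] x y] upper[OF r x] upper[OF r y] by linarith
    qed (use x y in simp)
    then show "nrm ?P (x \<oplus>\<^bsub>?P\<^esub> y) \<le> nrm ?P x + nrm ?P y" by simp
    have "?u (x \<otimes>\<^bsub>P\<^esub> y) \<le> ?u x * ?u y"
    proof (rule least)
      fix H \<pi> assume r: "R H \<pi>"
      have "op_norm H (\<pi> x) * op_norm H (\<pi> y) \<le> ?u x * ?u y"
        using upper[OF r x] upper[OF r y] nonneg x star_representation.rep_norm_nonneg[OF SR[OF r] y]
        by (intro mult_mono) auto
      then show "op_norm H (\<pi> (x \<otimes>\<^bsub>P\<^esub> y)) \<le> ?u x * ?u y"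
        using star_representation.rep_norm_mult[OF SR[OF r] x y] by linarith
    qed (use x y P.mult_closed in simp)
    then show "nrm ?P (x \<otimes>\<^bsub>?P\<^esub> y) \<le> nrm ?P x * nrm ?P y" by simp
  qed
qed

subsection \<open>Changing the type of the vectors\<close>

context star_representation
begin

definition invariant_subspace :: "'h set \<Rightarrow> bool" where
  "invariant_subspace K \<longleftrightarrow> K \<subseteq> carrier H \<and> \<zero>\<^bsub>H\<^esub> \<in> K \<and>
     (\<forall>v\<in>K. \<forall>w\<in>K. v \<oplus>\<^bsub>H\<^esub> w \<in> K) \<and> (\<forall>a. \<forall>v\<in>K. a \<odot>\<^bsub>H\<^esub> v \<in> K) \<and>
     (\<forall>s v. (\<forall>n. s n \<in> K) \<longrightarrow> vlim H s v \<longrightarrow> v \<in> K) \<and>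
     (\<forall>x\<in>carrier P. \<forall>v\<in>K. \<pi> x v \<in> K)"

text \<open>\<open>universal_norm\<close> ranges over spaces with vectors in one fixed type; this
  moves an invariant subspace into any type that can hold a copy of it. Closedness under limits,
  part of \<open>invariant_subspace\<close>, makes the copy complete.\<close>

lemma representation_transport:
  fixes e :: "'h \<Rightarrow> 'u"
  assumes K: "invariant_subspace K" and e: "inj_on e K"
  shows "\<exists>(H' :: 'u inner_product_space) \<pi>'. representation P H' \<pi>' \<and>
    (\<forall>x\<in>carrier P. \<forall>v\<in>K. vec_norm H (\<pi> x v) \<le> op_norm H' (\<pi>' x) * vec_norm H v)"
proof -
  define i where "i = inv_into K e"
  define H' :: "'u inner_product_space" where "H' = \<lparr>carrier = e ` K, mult = undefined, one = undefined,
    zero = e \<zero>\<^bsub>H\<^esub>, add = (\<lambda>a b. e (i a \<oplus>\<^bsub>H\<^esub> i b)), smult = (\<lambda>c a. e (c \<odot>\<^bsub>H\<^esub> i a)),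
    inner_prod = (\<lambda>a b. inner_prod H (i a) (i b))\<rparr>"
  define \<pi>' where "\<pi>' x a = e (\<pi> x (i a))" for x a
  have KH: "v \<in> K \<Longrightarrow> v \<in> carrier H" for v using K by (auto simp: invariant_subspace_def)
  have Kz: "\<zero>\<^bsub>H\<^esub> \<in> K" using K by (simp add: invariant_subspace_def)
  have Ka: "v \<in> K \<Longrightarrow> w \<in> K \<Longrightarrow> v \<oplus>\<^bsub>H\<^esub> w \<in> K" for v w using K by (simp add: invariant_subspace_def)
  have Ks: "v \<in> K \<Longrightarrow> a \<odot>\<^bsub>H\<^esub> v \<in> K" for a v using K by (simp add: invariant_subspace_def)
  have Kl: "(\<And>n. s n \<in> K) \<Longrightarrow> vlim H s v \<Longrightarrow> v \<in> K" for s v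
    using K unfolding invariant_subspace_def by blast
  have Kp: "x \<in> carrier P \<Longrightarrow> v \<in> K \<Longrightarrow> \<pi> x v \<in> K" for x v using K by (simp add: invariant_subspace_def)
  have ie [simp]: "v \<in> K \<Longrightarrow> i (e v) = v" for v using e by (simp add: i_def)
  have H'_add: "e v \<oplus>\<^bsub>H'\<^esub> e w = e (v \<oplus>\<^bsub>H\<^esub> w)" if "v \<in> K" "w \<in> K" for v w
    using that by (simp add: H'_def)
  have H'_smult: "a \<odot>\<^bsub>H'\<^esub> e v = e (a \<odot>\<^bsub>H\<^esub> v)" if "v \<in> K" for a v
    using that by (simp add: H'_def)
  have H'_inner: "inner_prod H' (e v) (e w) = inner_prod H v w" if "v \<in> K" "w \<in> K" for v w
    using that by (simp add: H'_def)
  have H'_carrier: "carrier H' = e ` K" by (simp add: H'_def)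
  have H'_zero: "\<zero>\<^bsub>H'\<^esub> = e \<zero>\<^bsub>H\<^esub>" by (simp add: H'_def)
  have mod: "module class_ring H'"
    by (rule complex_moduleI)
       (auto simp: H'_carrier H'_zero H'_add H'_smult Ka Ks Kz KH H.a_ac H.smult_add_left
          H.smult_add_right H.smult_smult)
  have e_eq: "e v = e w \<longleftrightarrow> v = w" if "v \<in> K" "w \<in> K" for v w
    using e that by (auto dest: inj_onD)
  have pre: "pre_hilbert_space H'"
  proof (rule pre_hilbert_space.intro[OF mod])
    fix v w assume "v \<in> carrier H'" "w \<in> carrier H'"
    then obtain v0 w0 where vw: "v0 \<in> K" "w0 \<in> K" "v = e v0" "w = e w0"
      unfolding H'_carrier by blast
    have "inner_prod H w0 v0 = cnj (inner_prod H v0 w0)"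
      using vw KH by (intro H.inner_commute)
    then show "inner_prod H' w v = cnj (inner_prod H' v w)"
      unfolding vw(3,4) H'_inner[OF vw(1,2)] H'_inner[OF vw(2,1)] .
  qed (auto simp: H'_carrier H'_zero H'_add H'_smult H'_inner Ka Ks Kz KH H.inner_add H.inner_smult
         H.inner_nonneg H.inner_eq_0 e_eq)
  interpret H': pre_hilbert_space H' by (rule pre)
  have H'_diff: "e v \<ominus>\<^bsub>H'\<^esub> e w = e (v \<ominus>\<^bsub>H\<^esub> w)" if "v \<in> K" "w \<in> K" for v w
    using that by (simp add: H'.diff_eq_smult H.diff_eq_smult H'_carrier H'_add H'_smult Ks KH)
  have Kd: "v \<ominus>\<^bsub>H\<^esub> w \<in> K" if "v \<in> K" "w \<in> K" for v w
    using that by (simp add: H.diff_eq_smult Ka Ks KH)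
  have H'_norm: "vec_norm H' (e v) = vec_norm H v" if "v \<in> K" for v
    using that by (simp add: vec_norm_def H'_inner)
  have hil: "hilbert_space H'"
  proof (rule hilbert_spaceI[OF pre])
    fix s assume s: "vcauchy H' s"
    have "\<forall>n. \<exists>v. v \<in> K \<and> s n = e v" using s by (auto simp: vcauchy_def H'_carrier)
    then obtain t where t: "\<And>n. t n \<in> K" "\<And>n. s n = e (t n)" by metis
    have "vcauchy H t"
      using s t by (simp add: vcauchy_def KH H'_diff H'_norm Kd)
    then obtain v where v: "vlim H t v" using H.vcauchy_vlim by blast
    then have vK: "v \<in> K" using Kl t by blast
    then have "vlim H' s (e v)"
      using v t by (simp add: vlim_def H'_carrier H'_diff H'_norm Kd)
    then show "\<exists>v. vlim H' s v" by blast
  qed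
  have \<pi>'e: "\<pi>' x (e v) = e (\<pi> x v)" if "v \<in> K" for x v using that by (simp add: \<pi>'_def)
  have "bounded_operator H' (\<pi>' x)" if x: "x \<in> carrier P" for x
  proof -
    have "\<forall>v\<in>carrier H'. vec_norm H' (\<pi>' x v) \<le> op_norm H (\<pi> x) * vec_norm H' v"
      using x by (auto simp: H'_carrier \<pi>'e H'_norm Kp KH intro: rep_bound)
    moreover have "\<pi>' x \<in> carrier H' \<rightarrow> carrier H'" using x by (auto simp: H'_carrier \<pi>'e Kp)
    moreover have "\<forall>v\<in>carrier H'. \<forall>w\<in>carrier H'. \<pi>' x (v \<oplus>\<^bsub>H'\<^esub> w) = \<pi>' x v \<oplus>\<^bsub>H'\<^esub> \<pi>' x w"
      using x by (auto simp: H'_carrier \<pi>'e H'_add Kp Ka KH H.bounded_operatorD[OF rep_bounded])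
    moreover have "\<forall>a. \<forall>v\<in>carrier H'. \<pi>' x (a \<odot>\<^bsub>H'\<^esub> v) = a \<odot>\<^bsub>H'\<^esub> \<pi>' x v"
      using x by (auto simp: H'_carrier \<pi>'e H'_smult Kp Ks KH H.bounded_operatorD[OF rep_bounded])
    ultimately show ?thesis unfolding bounded_operator_def by blast
  qed
  then have rep': "representation P H' \<pi>'"
    unfolding representation_def
    using hil
    by (auto simp: H'_carrier \<pi>'e H'_add H'_smult H'_inner Kp KH rep_add rep_smult rep_mult rep_adjoint
        P.star_closed P.mult_closed)
  interpret R: star_representation P H' \<pi>'
    by (rule star_representationI[OF P.star_algebra_axioms rep'])
  have "vec_norm H (\<pi> x v) \<le> op_norm H' (\<pi>' x) * vec_norm H v" if "x \<in> carrier P" "v \<in> K" for x v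
    using R.rep_bound[OF that(1), of "e v"] that by (simp add: H'_carrier \<pi>'e H'_norm Kp)
  then show ?thesis using rep' by blast
qed

text \<open>Each point of the closure \<open>K\<close> of the vectors \<open>\<pi> x v\<close> is
  the limit of \<open>\<pi> (b n) v\<close> for a sequence \<open>b\<close> in the dense set
  \<open>B\<close>, so \<open>K\<close> embeds into \<open>nat \<Rightarrow> 'q\<close>. Without a
  unit \<open>v\<close> may lie outside \<open>K\<close>. The transported operators are therefore
  tested at \<open>\<pi> x v\<close>, which does lie in \<open>K\<close>, and moving
  \<open>\<pi> x\<close> to the other side of the inner product brings in
  \<open>star P x\<close>.\<close>

lemma cyclic_transport:
  fixes \<iota> :: "'p \<Rightarrow> 'q"
  assumes v: "v \<in> carrier H" and B: "B \<subseteq> carrier P"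
    and dense: "\<And>x e. \<lbrakk>x \<in> carrier P; 0 < e\<rbrakk> \<Longrightarrow> \<exists>b\<in>B. vec_norm H (\<pi> b v \<ominus>\<^bsub>H\<^esub> \<pi> x v) < e"
    and \<iota>: "inj_on \<iota> B"
  shows "\<exists>(H' :: (nat \<Rightarrow> 'q) inner_product_space) \<pi>'. representation P H' \<pi>' \<and>
    (\<forall>x\<in>carrier P. vec_norm H (\<pi> x v) \<le> op_norm H' (\<pi>' (star P x)) * vec_norm H v)"
proof -
  define K where "K = {w \<in> carrier H. \<forall>e>0. \<exists>x\<in>carrier P. vec_norm H (\<pi> x v \<ominus>\<^bsub>H\<^esub> w) < e}"
  have KH: "w \<in> K \<Longrightarrow> w \<in> carrier H" for w by (simp add: K_def)
  have Kx: "\<exists>x\<in>carrier P. vec_norm H (\<pi> x v \<ominus>\<^bsub>H\<^esub> w) < e" if "w \<in> K" "e > 0" for w e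
    using that by (simp add: K_def)
  have pK: "\<pi> x v \<in> K" if x: "x \<in> carrier P" for x
  proof -
    have "\<pi> x v \<ominus>\<^bsub>H\<^esub> \<pi> x v = \<zero>\<^bsub>H\<^esub>" using x v by (simp add: H.diff_eq_zero_iff)
    then show ?thesis using x v by (auto simp: K_def intro!: bexI[of _ x])
  qed
  have Ka: "w \<oplus>\<^bsub>H\<^esub> w' \<in> K" if w: "w \<in> K" "w' \<in> K" for w w'
  proof -
    have "\<exists>x\<in>carrier P. vec_norm H (\<pi> x v \<ominus>\<^bsub>H\<^esub> (w \<oplus>\<^bsub>H\<^esub> w')) < e" if e: "e > 0" for e
    proof -
      obtain x where x: "x \<in> carrier P" "vec_norm H (\<pi> x v \<ominus>\<^bsub>H\<^esub> w) < e / 2"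
        using Kx[OF w(1), of "e / 2"] e by auto
      obtain x' where x': "x' \<in> carrier P" "vec_norm H (\<pi> x' v \<ominus>\<^bsub>H\<^esub> w') < e / 2"
        using Kx[OF w(2), of "e / 2"] e by auto
      have "\<pi> (x \<oplus> x') v \<ominus>\<^bsub>H\<^esub> (w \<oplus>\<^bsub>H\<^esub> w') = (\<pi> x v \<ominus>\<^bsub>H\<^esub> w) \<oplus>\<^bsub>H\<^esub> (\<pi> x' v \<ominus>\<^bsub>H\<^esub> w')"
        using x x' v w by (simp add: rep_add H.diff_add_diff KH)
      then have "vec_norm H (\<pi> (x \<oplus> x') v \<ominus>\<^bsub>H\<^esub> (w \<oplus>\<^bsub>H\<^esub> w')) < e"
        using H.vec_norm_triangle[of "\<pi> x v \<ominus>\<^bsub>H\<^esub> w" "\<pi> x' v \<ominus>\<^bsub>H\<^esub> w'"] x x' v w KH by simp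
      then show ?thesis using x x' by blast
    qed
    then show ?thesis using w by (simp add: K_def)
  qed
  have Ks: "a \<odot>\<^bsub>H\<^esub> w \<in> K" if w: "w \<in> K" for a w
  proof -
    have "\<exists>x\<in>carrier P. vec_norm H (\<pi> x v \<ominus>\<^bsub>H\<^esub> (a \<odot>\<^bsub>H\<^esub> w)) < e" if e: "e > 0" for e
    proof -
      \<comment> \<open>The added 1 keeps the divisor positive when \<open>a = 0\<close>; the same
        device is used for \<open>op_norm H (\<pi> y)\<close> below.\<close>
      have a: "cmod a + 1 > 0" by (simp add: add_nonneg_pos)
      have pos: "e / (cmod a + 1) > 0" using e a by simp
      obtain x where x: "x \<in> carrier P" "vec_norm H (\<pi> x v \<ominus>\<^bsub>H\<^esub> w) < e / (cmod a + 1)"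
        using Kx[OF w pos] by auto
      have "vec_norm H (\<pi> (a \<odot>\<^bsub>P\<^esub> x) v \<ominus>\<^bsub>H\<^esub> (a \<odot>\<^bsub>H\<^esub> w)) = cmod a * vec_norm H (\<pi> x v \<ominus>\<^bsub>H\<^esub> w)"
        using x v w by (simp add: rep_smult H.diff_smult KH H.vec_norm_smult)
      also have "\<dots> \<le> (cmod a + 1) * vec_norm H (\<pi> x v \<ominus>\<^bsub>H\<^esub> w)"
        using x v w KH by (intro mult_right_mono) auto
      also have "\<dots> < e" using x(2) a by (simp only: pos_less_divide_eq mult.commute)
      finally show ?thesis using x by blast
    qed
    then show ?thesis using w by (simp add: K_def)
  qed
  have Kl: "w \<in> K" if s: "\<And>n. s n \<in> K" and l: "vlim H s w" for s w
  proof -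
    have wH: "w \<in> carrier H" using l by (simp add: vlim_def)
    have "\<exists>x\<in>carrier P. vec_norm H (\<pi> x v \<ominus>\<^bsub>H\<^esub> w) < e" if e: "e > 0" for e
    proof -
      have "(\<lambda>n. vec_norm H (s n \<ominus>\<^bsub>H\<^esub> w)) \<longlonglongrightarrow> 0" using l by (simp add: vlim_def)
      from order_tendstoD(2)[OF this, of "e / 2"] e
      obtain n where n: "vec_norm H (s n \<ominus>\<^bsub>H\<^esub> w) < e / 2" by (auto simp: eventually_sequentially)
      obtain x where x: "x \<in> carrier P" "vec_norm H (\<pi> x v \<ominus>\<^bsub>H\<^esub> s n) < e / 2"
        using Kx[OF s[of n], of "e / 2"] e by auto
      have "vec_norm H (\<pi> x v \<ominus>\<^bsub>H\<^esub> w) < e"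
        using H.vec_norm_diff_triangle[of "\<pi> x v" "s n" w] n x v wH KH[OF s[of n]] by simp
      then show ?thesis using x by blast
    qed
    then show ?thesis using wH by (simp add: K_def)
  qed
  have Kp: "\<pi> y w \<in> K" if y: "y \<in> carrier P" and w: "w \<in> K" for y w
  proof -
    have "\<exists>x\<in>carrier P. vec_norm H (\<pi> x v \<ominus>\<^bsub>H\<^esub> \<pi> y w) < e" if e: "e > 0" for e
    proof -
      let ?M = "op_norm H (\<pi> y) + 1"
      have M: "?M > 0" using rep_norm_nonneg[OF y] by simp
      obtain x where x: "x \<in> carrier P" "vec_norm H (\<pi> x v \<ominus>\<^bsub>H\<^esub> w) < e / ?M"
        using Kx[OF w, of "e / ?M"] M e by auto
      have "\<pi> (y \<otimes> x) v \<ominus>\<^bsub>H\<^esub> \<pi> y w = \<pi> y (\<pi> x v \<ominus>\<^bsub>H\<^esub> w)"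
        using x y v w by (simp add: rep_mult H.bounded_operator_diff[OF rep_bounded] KH)
      then have "vec_norm H (\<pi> (y \<otimes> x) v \<ominus>\<^bsub>H\<^esub> \<pi> y w) \<le> op_norm H (\<pi> y) * vec_norm H (\<pi> x v \<ominus>\<^bsub>H\<^esub> w)"
        using rep_bound[OF y, of "\<pi> x v \<ominus>\<^bsub>H\<^esub> w"] x v w KH by simp
      also have "\<dots> \<le> ?M * vec_norm H (\<pi> x v \<ominus>\<^bsub>H\<^esub> w)"
        using x v w KH by (intro mult_right_mono) auto
      also have "\<dots> < e" using x(2) M by (simp add: field_simps)
      finally show ?thesis using x y P.mult_closed by blast
    qed
    then show ?thesis using rep_closed[OF y KH[OF w]] by (simp add: K_def)
  qed
  have Kz: "\<zero>\<^bsub>H\<^esub> \<in> K" using pK[of \<zero>] v by (simp add: rep_zero)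
  have inv: "invariant_subspace K"
    unfolding invariant_subspace_def using KH Kz Ka Ks Kl Kp by blast
  have approx: "\<exists>b\<in>B. vec_norm H (\<pi> b v \<ominus>\<^bsub>H\<^esub> w) < e" if w: "w \<in> K" and e: "e > 0" for w e
  proof -
    obtain x where x: "x \<in> carrier P" "vec_norm H (\<pi> x v \<ominus>\<^bsub>H\<^esub> w) < e / 2"
      using Kx[OF w, of "e / 2"] e by auto
    obtain b where b: "b \<in> B" "vec_norm H (\<pi> b v \<ominus>\<^bsub>H\<^esub> \<pi> x v) < e / 2"
      using dense[OF x(1), of "e / 2"] e by auto
    have "b \<in> carrier P" using b B by blast
    then have "vec_norm H (\<pi> b v \<ominus>\<^bsub>H\<^esub> w) < e"
      using H.vec_norm_diff_triangle[of "\<pi> b v" "\<pi> x v" w] x b v w KH by simp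
    then show ?thesis using b by blast
  qed
  have "\<exists>b. (\<forall>n. b n \<in> B) \<and> vlim H (\<lambda>n. \<pi> (b n) v) w" if w: "w \<in> K" for w
  proof -
    have "\<forall>n. \<exists>b\<in>B. vec_norm H (\<pi> b v \<ominus>\<^bsub>H\<^esub> w) < 1 / real (Suc n)" by (intro allI approx w) simp
    then obtain b where b: "\<And>n. b n \<in> B" "\<And>n. vec_norm H (\<pi> (b n) v \<ominus>\<^bsub>H\<^esub> w) < 1 / real (Suc n)" by metis
    have lim: "(\<lambda>n. 1 / real (Suc n)) \<longlonglongrightarrow> 0"
      using LIMSEQ_inverse_real_of_nat by (simp add: inverse_eq_divide)
    have "vlim H (\<lambda>n. \<pi> (b n) v) w"
      by (rule H.vlimI[OF _ _ less_imp_le[OF b(2)] lim]) (use b(1) B v w KH in auto)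
    then show ?thesis using b by blast
  qed
  then obtain b where b: "\<And>w n. w \<in> K \<Longrightarrow> b w n \<in> B" "\<And>w. w \<in> K \<Longrightarrow> vlim H (\<lambda>n. \<pi> (b w n) v) w"
    by metis
  \<comment> \<open>A point is coded by a chosen sequence approximating it. The sequence determines
    the point by uniqueness of limits, which gives injectivity.\<close>
  define e where "e w = (\<lambda>n. \<iota> (b w n))" for w
  have "inj_on e K"
  proof (rule inj_onI)
    fix w w' assume w: "w \<in> K" "w' \<in> K" and eq: "e w = e w'"
    have "b w n = b w' n" for n
    proof -
      have "\<iota> (b w n) = \<iota> (b w' n)" using fun_cong[OF eq, of n] by (simp add: e_def)
      then show ?thesis using \<iota> b(1) w by (meson inj_onD)
    qed
    then have "b w = b w'" by blast
    then show "w = w'" using b(2)[OF w(1)] b(2)[OF w(2)] H.vlim_unique by metis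
  qed
  from representation_transport[OF inv this]
  obtain H' :: "(nat \<Rightarrow> 'q) inner_product_space" and \<pi>' where rep': "representation P H' \<pi>'"
    and le: "\<And>x w. x \<in> carrier P \<Longrightarrow> w \<in> K \<Longrightarrow> vec_norm H (\<pi> x w) \<le> op_norm H' (\<pi>' x) * vec_norm H w"
    by blast
  interpret R: star_representation P H' \<pi>'
    by (rule star_representationI[OF P.star_algebra_axioms rep'])
  have "vec_norm H (\<pi> x v) \<le> op_norm H' (\<pi>' (star P x)) * vec_norm H v" if x: "x \<in> carrier P" for x
  proof -
    define w where "w = \<pi> x v"
    have w: "w \<in> K" "w \<in> carrier H" using pK[OF x] KH by (auto simp: w_def)
    have "(vec_norm H w)\<^sup>2 = Re (inner_prod H v (\<pi> (star P x) w))"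
      using rep_adjoint[OF P.star_closed[OF x] v w(2)] H.vec_norm_sq[OF w(2)] x
      by (simp add: w_def P.star_star)
    also have "\<dots> \<le> vec_norm H v * vec_norm H (\<pi> (star P x) w)"
      using H.Cauchy_Schwarz[OF v rep_closed[OF P.star_closed[OF x] w(2)]] complex_Re_le_cmod order_trans
      by blast
    also have "\<dots> \<le> vec_norm H v * (op_norm H' (\<pi>' (star P x)) * vec_norm H w)"
      using x v w by (intro mult_left_mono le H.vec_norm_nonneg P.star_closed)
    finally have "vec_norm H w * vec_norm H w \<le> (op_norm H' (\<pi>' (star P x)) * vec_norm H v) * vec_norm H w"
      by (simp add: power2_eq_square mult_ac)
    moreover have "0 \<le> op_norm H' (\<pi>' (star P x)) * vec_norm H v"
      using x v R.rep_norm_nonneg P.star_closed by simp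
    ultimately show ?thesis
      using H.vec_norm_nonneg[OF w(2)] by (cases "vec_norm H w = 0") (auto simp flip: w_def)
  qed
  then show ?thesis using rep' by blast
qed

end

section \<open>Functions vanishing at infinity\<close>

lemma C0_iff:
  "f \<in> carrier (C0 X) \<longleftrightarrow> continuous_map X euclidean f \<and> (\<forall>x. x \<notin> topspace X \<longrightarrow> f x = 0) \<and>
     (\<forall>e>0. compactin X {x \<in> topspace X. e \<le> cmod (f x)})"
  by (simp add: C0_def)

lemma C0_simps [simp]:
  "f \<otimes>\<^bsub>C0 X\<^esub> g = (\<lambda>x. f x * g x)" "f \<oplus>\<^bsub>C0 X\<^esub> g = (\<lambda>x. f x + g x)"
  "a \<odot>\<^bsub>C0 X\<^esub> f = (\<lambda>x. a * f x)" "star (C0 X) f = (\<lambda>x. cnj (f x))" "\<zero>\<^bsub>C0 X\<^esub> = (\<lambda>x. 0)"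
  by (simp_all add: C0_def)

lemma C0D:
  assumes "f \<in> carrier (C0 X)"
  shows "continuous_map X euclidean f" and "x \<notin> topspace X \<Longrightarrow> f x = 0"
    and "e > 0 \<Longrightarrow> compactin X {x \<in> topspace X. e \<le> cmod (f x)}"
  using assms by (auto simp: C0_iff)

lemma closedin_norm_ge:
  fixes f :: "'x \<Rightarrow> complex"
  assumes "continuous_map X euclidean f"
  shows "closedin X {x \<in> topspace X. e \<le> cmod (f x)}"
proof -
  have "closedin X {x \<in> topspace X. f x \<in> {z. e \<le> cmod z}}"
    by (rule closedin_continuous_map_preimage[OF assms])
       (simp, intro closed_Collect_le continuous_intros)
  then show ?thesis by simp
qed

text \<open>Level sets of a continuous function are closed, so a compact set containing one already
  makes it compact.\<close>

lemma C0_dominated: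
  assumes g: "continuous_map X euclidean g" and 0: "\<And>x. x \<notin> topspace X \<Longrightarrow> g x = 0"
    and cov: "\<And>e. e > 0 \<Longrightarrow> \<exists>K. compactin X K \<and> {x \<in> topspace X. e \<le> cmod (g x)} \<subseteq> K"
  shows "g \<in> carrier (C0 X)"
proof -
  have "compactin X {x \<in> topspace X. e \<le> cmod (g x)}" if "e > 0" for e
    using cov[OF that] closed_compactin[OF _ _ closedin_norm_ge[OF g]] by blast
  then show ?thesis using g 0 by (simp add: C0_iff)
qed

text \<open>A value of \<open>\<theta> (f x)\<close> away from 0 forces a value of
  \<open>f x\<close> away from 0. Besides scalar multiples and conjugates this provides the square
  roots and thresholds used later.\<close>

lemma C0_compose:
  fixes \<theta> :: "complex \<Rightarrow> complex"
  assumes f: "f \<in> carrier (C0 X)" and \<theta>: "continuous_on UNIV \<theta>" "\<theta> 0 = 0"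
  shows "(\<lambda>x. \<theta> (f x)) \<in> carrier (C0 X)"
proof (rule C0_dominated)
  have "continuous_map X euclidean (\<theta> \<circ> f)"
    by (rule continuous_map_compose[OF C0D(1)[OF f]]) (simp add: \<theta>)
  then show "continuous_map X euclidean (\<lambda>x. \<theta> (f x))" by (simp add: o_def)
  fix e :: real assume e: "e > 0"
  obtain d where d: "d > 0" "\<And>z. dist z 0 < d \<Longrightarrow> dist (\<theta> z) (\<theta> 0) < e"
    using \<theta>(1) e unfolding continuous_on_iff by blast
  have "{x \<in> topspace X. e \<le> cmod (\<theta> (f x))} \<subseteq> {x \<in> topspace X. d \<le> cmod (f x)}"
    using d(2) \<theta>(2) by (auto simp: not_less[symmetric])
  then show "\<exists>K. compactin X K \<and> {x \<in> topspace X. e \<le> cmod (\<theta> (f x))} \<subseteq> K"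
    using C0D(3)[OF f d(1)] by blast
qed (use C0D(2)[OF f] \<theta> in simp)

lemma C0_add:
  assumes f: "f \<in> carrier (C0 X)" and g: "g \<in> carrier (C0 X)"
  shows "(\<lambda>x. f x + g x) \<in> carrier (C0 X)"
proof (rule C0_dominated)
  show "continuous_map X euclidean (\<lambda>x. f x + g x)"
    by (intro continuous_map_add C0D(1) f g)
  fix e :: real assume e: "e > 0"
  have "{x \<in> topspace X. e \<le> cmod (f x + g x)} \<subseteq>
      {x \<in> topspace X. e / 2 \<le> cmod (f x)} \<union> {x \<in> topspace X. e / 2 \<le> cmod (g x)}"
  proof clarsimp
    fix x assume "e \<le> cmod (f x + g x)" "\<not> e \<le> cmod (g x) * 2"
    then show "e \<le> cmod (f x) * 2" using norm_triangle_ineq[of "f x" "g x"] by linarith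
  qed
  moreover have "compactin X ({x \<in> topspace X. e / 2 \<le> cmod (f x)} \<union> {x \<in> topspace X. e / 2 \<le> cmod (g x)})"
    using e by (intro compactin_Un C0D(3) f g) auto
  ultimately show "\<exists>K. compactin X K \<and> {x \<in> topspace X. e \<le> cmod (f x + g x)} \<subseteq> K" by blast
qed (use C0D(2)[OF f] C0D(2)[OF g] in simp)

lemma C0_bounded:
  assumes f: "f \<in> carrier (C0 X)"
  obtains M where "M > 0" "\<And>x. cmod (f x) \<le> M"
proof -
  have "compactin euclidean (f ` {x \<in> topspace X. 1 \<le> cmod (f x)})"
    by (rule image_compactin[OF C0D(3)[OF f] C0D(1)[OF f]]) simp
  then have "bounded (f ` {x \<in> topspace X. 1 \<le> cmod (f x)})"
    by (simp add: compact_imp_bounded)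
  then obtain B where B: "\<And>x. x \<in> topspace X \<Longrightarrow> 1 \<le> cmod (f x) \<Longrightarrow> cmod (f x) \<le> B"
    by (auto simp: bounded_iff)
  have "cmod (f x) \<le> max 1 B" for x
    using B[of x] C0D(2)[OF f, of x] by (cases "x \<in> topspace X"; cases "1 \<le> cmod (f x)") auto
  then show thesis by (intro that[of "max 1 B"]) auto
qed

lemma C0_mult:
  assumes f: "f \<in> carrier (C0 X)" and g: "g \<in> carrier (C0 X)"
  shows "(\<lambda>x. f x * g x) \<in> carrier (C0 X)"
proof (rule C0_dominated)
  show "continuous_map X euclidean (\<lambda>x. f x * g x)"
    using C0D(1)[OF f] C0D(1)[OF g] by (auto simp: continuous_map_atin intro!: tendsto_mult)
  fix e :: real assume e: "e > 0"
  obtain M where M: "M > 0" "\<And>x. cmod (g x) \<le> M" by (rule C0_bounded[OF g]) blast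
  have "{x \<in> topspace X. e \<le> cmod (f x * g x)} \<subseteq> {x \<in> topspace X. e / M \<le> cmod (f x)}"
  proof clarsimp
    fix x assume "e \<le> cmod (f x * g x)"
    also have "\<dots> \<le> cmod (f x) * M" by (simp add: norm_mult mult_left_mono M)
    finally show "e / M \<le> cmod (f x)" using M(1) by (simp add: field_simps)
  qed
  then show "\<exists>K. compactin X K \<and> {x \<in> topspace X. e \<le> cmod (f x * g x)} \<subseteq> K"
    using C0D(3)[OF f, of "e / M"] e M by auto
qed (use C0D(2)[OF f] C0D(2)[OF g] in simp)

lemma C0_smult: "f \<in> carrier (C0 X) \<Longrightarrow> (\<lambda>x. a * f x) \<in> carrier (C0 X)"
  by (rule C0_compose[of f X "\<lambda>z. a * z"]) (auto intro: continuous_intros)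

lemma C0_cnj: "f \<in> carrier (C0 X) \<Longrightarrow> (\<lambda>x. cnj (f x)) \<in> carrier (C0 X)"
  by (rule C0_compose[of f X cnj]) (auto intro: continuous_intros)

lemma C0_zero: "(\<lambda>x. 0) \<in> carrier (C0 X)"
  by (auto intro!: C0_dominated exI[of _ "{}"])

lemma star_algebra_C0: "star_algebra (C0 X)"
proof -
  let ?W = "(C0 X)\<lparr>carrier := UNIV\<rparr>"
  have "module class_ring ?W"
    by (rule complex_moduleI) (auto simp: fun_eq_iff algebra_simps)
  then have "star_algebra ?W"
    by (rule star_algebra.intro) (auto simp: fun_eq_iff algebra_simps)
  then show ?thesis
    by (rule star_algebra_pullback[of _ id]) (auto simp: C0_add C0_mult C0_smult C0_cnj C0_zero)
qed

lemma C0_nrm_upper: "f \<in> carrier (C0 X) \<Longrightarrow> cmod (f x) \<le> nrm (C0 X) f"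
proof -
  assume f: "f \<in> carrier (C0 X)"
  obtain M where M: "\<And>x. cmod (f x) \<le> M" by (rule C0_bounded[OF f]) blast
  have "cmod (f x) \<le> (SUP x. cmod (f x))"
    by (rule cSUP_upper) (auto intro!: bdd_aboveI2 M)
  then show ?thesis by (simp add: C0_def)
qed

text \<open>Only neighbourhoods \<open>V\<close> of 0 are at stake: there the preimage also contains
  the points with \<open>cmod (g x) < e\<close>, and these form an open set because the level sets
  are closed in all of \<open>X\<close>, not just in \<open>U\<close>.\<close>

lemma continuous_map_extend_zero:
  fixes g :: "'x \<Rightarrow> complex"
  assumes U: "openin X U" and g: "continuous_map (subtopology X U) euclidean g"
    and 0: "\<And>x. x \<notin> U \<Longrightarrow> g x = 0"
    and cl: "\<And>e. e > 0 \<Longrightarrow> closedin X {x \<in> topspace X. e \<le> cmod (g x)}"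
  shows "continuous_map X euclidean g"
  unfolding continuous_map_def
proof (intro conjI allI impI)
  fix V :: "complex set" assume "openin euclidean V"
  then have V: "open V" by simp
  define A where "A = {x \<in> topspace (subtopology X U). g x \<in> V}"
  have "openin (subtopology X U) A"
    unfolding A_def using g V by (simp add: continuous_map_def)
  then have A: "openin X A" using U openin_trans_full by blast
  have AU: "A = {x \<in> topspace X. x \<in> U \<and> g x \<in> V}" by (auto simp: A_def)
  show "openin X {x \<in> topspace X. g x \<in> V}"
  proof (cases "0 \<in> V")
    case True
    then obtain e where e: "e > 0" "ball 0 e \<subseteq> V" using V open_contains_ball by blast
    have "g x \<in> V \<or> e \<le> cmod (g x)" for x using e(2) by (auto simp: subset_iff)
    moreover have "e \<le> cmod (g x) \<Longrightarrow> x \<in> U" for x using 0[of x] e(1) by force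
    ultimately have "{x \<in> topspace X. g x \<in> V} = A \<union> (topspace X - {x \<in> topspace X. e \<le> cmod (g x)})"
      unfolding AU by blast
    then show ?thesis using A cl[OF e(1)] by auto
  next
    case False
    then have "{x \<in> topspace X. g x \<in> V} = A" using 0 by (auto simp: AU) metis
    then show ?thesis using A by simp
  qed
qed simp

text \<open>Transport along a homeomorphism \<open>h\<close> between open sets, extended by zero.
  Level sets correspond under the inverse \<open>k\<close>, so they stay compact, and in a Hausdorff
  space closed, which is what the extension by zero requires.\<close>

lemma C0_transfer:
  assumes X: "Hausdorff_space X" and U: "openin X U" and V: "openin Y V"
    and h: "continuous_map (subtopology X U) Y h" and k: "continuous_map (subtopology Y V) X k"
    and hV: "\<And>x. x \<in> U \<Longrightarrow> h x \<in> V \<and> k (h x) = x"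
    and kU: "\<And>y. y \<in> V \<Longrightarrow> k y \<in> U \<and> h (k y) = y"
    and f: "f \<in> carrier (C0 Y)" and f0: "\<And>y. y \<notin> V \<Longrightarrow> f y = 0"
  shows "(\<lambda>x. if x \<in> U then f (h x) else 0) \<in> carrier (C0 X)"
proof -
  define g where "g x = (if x \<in> U then f (h x) else 0)" for x
  have UX: "U \<subseteq> topspace X" and VY: "V \<subseteq> topspace Y" using U V openin_subset by auto
  have cpt: "compactin X {x \<in> topspace X. e \<le> cmod (g x)}" if e: "e > 0" for e
  proof -
    have sub: "{y \<in> topspace Y. e \<le> cmod (f y)} \<subseteq> V" using f0 e by fastforce
    have "{x \<in> topspace X. e \<le> cmod (g x)} = k ` {y \<in> topspace Y. e \<le> cmod (f y)}"
    proof (intro equalityI subsetI)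
      fix x assume "x \<in> {x \<in> topspace X. e \<le> cmod (g x)}"
      then have "x \<in> U" "e \<le> cmod (f (h x))" using e by (auto simp: g_def split: if_splits)
      then show "x \<in> k ` {y \<in> topspace Y. e \<le> cmod (f y)}"
        using hV[of x] VY by (intro image_eqI[of _ _ "h x"]) auto
    next
      fix x assume "x \<in> k ` {y \<in> topspace Y. e \<le> cmod (f y)}"
      then obtain y where "y \<in> V" "x = k y" "e \<le> cmod (f y)" using sub by auto
      then show "x \<in> {x \<in> topspace X. e \<le> cmod (g x)}" using kU[of y] UX by (auto simp: g_def)
    qed
    moreover have "compactin (subtopology Y V) {y \<in> topspace Y. e \<le> cmod (f y)}"
      using C0D(3)[OF f e] sub by (simp add: compactin_subtopology)
    ultimately show ?thesis using image_compactin[OF _ k] by simp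
  qed
  have "continuous_map (subtopology X U) euclidean (f \<circ> h)"
    by (rule continuous_map_compose[OF h C0D(1)[OF f]])
  then have "continuous_map (subtopology X U) euclidean g"
    by (rule continuous_map_eq) (simp add: g_def)
  then have "continuous_map X euclidean g"
    by (rule continuous_map_extend_zero[OF U _ _ compactin_imp_closedin[OF X cpt]]) (simp_all add: g_def)
  then have "g \<in> carrier (C0 X)" using cpt UX by (auto simp: C0_iff g_def)
  then show ?thesis unfolding g_def .
qed

section \<open>Convolution of functions with finite rows and columns\<close>

definition conv :: "('x \<times> 'x \<Rightarrow> complex) \<Rightarrow> ('x \<times> 'x \<Rightarrow> complex) \<Rightarrow> 'x \<times> 'x \<Rightarrow> complex" where
  "conv f g = (\<lambda>(x, z). \<Sum>\<^sub>\<infinity>y. f (x, y) * g (y, z))"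

text \<open>On these matrices convolution is a finite sum from either side. The condition involves
  no topology, so the laws of a star-algebra are proved here once and inherited by every function
  algebra below.\<close>

definition row_col_finite :: "('x \<times> 'x \<Rightarrow> complex) set" where
  "row_col_finite = {f. (\<forall>x. finite {y. f (x, y) \<noteq> 0}) \<and> (\<forall>y. finite {x. f (x, y) \<noteq> 0})}"

lemma Cc_algebra_simps [simp]:
  "f \<otimes>\<^bsub>Cc_algebra \<G>\<^esub> g = conv f g" "f \<oplus>\<^bsub>Cc_algebra \<G>\<^esub> g = (\<lambda>p. f p + g p)"
  "a \<odot>\<^bsub>Cc_algebra \<G>\<^esub> f = (\<lambda>p. a * f p)" "star (Cc_algebra \<G>) f = (\<lambda>(x, y). cnj (f (y, x)))"
  "\<zero>\<^bsub>Cc_algebra \<G>\<^esub> = (\<lambda>p. 0)"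
  by (simp_all add: Cc_algebra_def conv_def)

lemma infsum_finite_support:
  fixes f :: "'a \<Rightarrow> 'b::{topological_comm_monoid_add, t2_space}"
  assumes "finite A" "\<And>x. x \<notin> A \<Longrightarrow> f x = 0"
  shows "(\<Sum>\<^sub>\<infinity>x. f x) = sum f A"
proof -
  have "(\<Sum>\<^sub>\<infinity>x. f x) = (\<Sum>\<^sub>\<infinity>x\<in>A. f x)"
    by (rule infsum_cong_neutral) (use assms(2) in auto)
  then show ?thesis using assms(1) by simp
qed

lemma conv_row:
  assumes "finite A" "\<And>y. y \<notin> A \<Longrightarrow> f (x, y) = 0"
  shows "conv f g (x, z) = (\<Sum>y\<in>A. f (x, y) * g (y, z))"
  unfolding conv_def by (simp, rule infsum_finite_support) (use assms in auto)

lemma conv_col: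
  assumes "finite A" "\<And>y. y \<notin> A \<Longrightarrow> g (y, z) = 0"
  shows "conv f g (x, z) = (\<Sum>y\<in>A. f (x, y) * g (y, z))"
  unfolding conv_def by (simp, rule infsum_finite_support) (use assms in auto)

lemma row_col_finiteD:
  assumes "f \<in> row_col_finite"
  shows "finite {y. f (x, y) \<noteq> 0}" "finite {x. f (x, y) \<noteq> 0}"
  using assms by (auto simp: row_col_finite_def)

lemma row_col_finite_conv:
  assumes f: "f \<in> row_col_finite" and g: "g \<in> row_col_finite"
  shows "conv f g \<in> row_col_finite"
proof -
  note fin = row_col_finiteD[OF f] row_col_finiteD[OF g]
  have row: "conv f g (x, z) = (\<Sum>y | f (x, y) \<noteq> 0. f (x, y) * g (y, z))" for x z
    by (rule conv_row[OF fin(1)]) simp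
  have col: "conv f g (x, z) = (\<Sum>y | g (y, z) \<noteq> 0. f (x, y) * g (y, z))" for x z
    by (rule conv_col[OF fin(4)]) simp
  have "finite {z. conv f g (x, z) \<noteq> 0}" for x
  proof (rule finite_subset)
    show "{z. conv f g (x, z) \<noteq> 0} \<subseteq> (\<Union>y\<in>{y. f (x, y) \<noteq> 0}. {z. g (y, z) \<noteq> 0})"
    proof
      fix z assume "z \<in> {z. conv f g (x, z) \<noteq> 0}"
      then have "(\<Sum>y | f (x, y) \<noteq> 0. f (x, y) * g (y, z)) \<noteq> 0" unfolding mem_Collect_eq row .
      from sum.not_neutral_contains_not_neutral[OF this]
      show "z \<in> (\<Union>y\<in>{y. f (x, y) \<noteq> 0}. {z. g (y, z) \<noteq> 0})" by auto
    qed
  qed (simp add: fin)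
  moreover have "finite {x. conv f g (x, z) \<noteq> 0}" for z
  proof (rule finite_subset)
    show "{x. conv f g (x, z) \<noteq> 0} \<subseteq> (\<Union>y\<in>{y. g (y, z) \<noteq> 0}. {x. f (x, y) \<noteq> 0})"
    proof
      fix x assume "x \<in> {x. conv f g (x, z) \<noteq> 0}"
      then have "(\<Sum>y | g (y, z) \<noteq> 0. f (x, y) * g (y, z)) \<noteq> 0" unfolding mem_Collect_eq col .
      from sum.not_neutral_contains_not_neutral[OF this]
      show "x \<in> (\<Union>y\<in>{y. g (y, z) \<noteq> 0}. {x. f (x, y) \<noteq> 0})" by auto
    qed
  qed (simp add: fin)
  ultimately show ?thesis unfolding row_col_finite_def by blast
qed

lemma star_algebra_row_col_finite: "star_algebra ((Cc_algebra \<G>)\<lparr>carrier := row_col_finite\<rparr>)"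
  (is "star_algebra ?M")
proof -
  have add: "(\<lambda>p. f p + g p) \<in> row_col_finite" if fg: "f \<in> row_col_finite" "g \<in> row_col_finite"
    for f g :: "'a \<times> 'a \<Rightarrow> complex"
  proof -
    note fin = row_col_finiteD[OF fg(1)] row_col_finiteD[OF fg(2)]
    have "finite {y. f (x, y) + g (x, y) \<noteq> 0}" for x
      by (rule finite_subset[of _ "{y. f (x, y) \<noteq> 0} \<union> {y. g (x, y) \<noteq> 0}"]) (use fin in auto)
    moreover have "finite {x. f (x, y) + g (x, y) \<noteq> 0}" for y
      by (rule finite_subset[of _ "{x. f (x, y) \<noteq> 0} \<union> {x. g (x, y) \<noteq> 0}"]) (use fin in auto)
    ultimately show ?thesis by (simp add: row_col_finite_def)
  qed
  have smult: "(\<lambda>p. a * f p) \<in> row_col_finite" if "f \<in> row_col_finite"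
    for a and f :: "'a \<times> 'a \<Rightarrow> complex"
    using that by (cases "a = 0") (simp_all add: row_col_finite_def)
  have star: "(\<lambda>(x, y). cnj (f (y, x))) \<in> row_col_finite" if "f \<in> row_col_finite"
    for f :: "'a \<times> 'a \<Rightarrow> complex"
    using that by (simp add: row_col_finite_def)
  have zero: "(\<lambda>p. 0) \<in> row_col_finite" by (simp add: row_col_finite_def)
  have M: "module class_ring ?M"
    by (rule complex_moduleI) (auto simp: fun_eq_iff algebra_simps add smult zero)
  have row: "conv f g (x, z) = (\<Sum>y | f (x, y) \<noteq> 0. f (x, y) * g (y, z))" if "f \<in> row_col_finite"
    for f g :: "'a \<times> 'a \<Rightarrow> complex" and x z
    by (rule conv_row[OF row_col_finiteD(1)[OF that]]) simp
  have col: "conv f g (x, z) = (\<Sum>y | g (y, z) \<noteq> 0. f (x, y) * g (y, z))" if "g \<in> row_col_finite"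
    for f g :: "'a \<times> 'a \<Rightarrow> complex" and x z
    by (rule conv_col[OF row_col_finiteD(2)[OF that]]) simp
  show ?thesis
  proof (rule star_algebra.intro[OF M])
    fix f g h assume "f \<in> carrier ?M" "g \<in> carrier ?M" "h \<in> carrier ?M"
    then have f: "f \<in> row_col_finite" and g: "g \<in> row_col_finite" and h: "h \<in> row_col_finite"
      by simp_all
    \<comment> \<open>Expanding along a row of \<open>f\<close> and a column of \<open>h\<close>
      gives two independent finite index sets, so associativity becomes an exchange of sums.\<close>
    have "conv (conv f g) h (x, w) = conv f (conv g h) (x, w)" for x w
      by (simp add: row[OF f] col[OF h] sum_distrib_left sum_distrib_right mult.assoc) (rule sum.swap)
    then show "(f \<otimes>\<^bsub>?M\<^esub> g) \<otimes>\<^bsub>?M\<^esub> h = f \<otimes>\<^bsub>?M\<^esub> (g \<otimes>\<^bsub>?M\<^esub> h)" by (simp add: fun_eq_iff)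
    have "conv f (\<lambda>p. g p + h p) (x, w) = conv f g (x, w) + conv f h (x, w)" for x w
      by (simp add: row[OF f] distrib_left sum.distrib)
    then show "f \<otimes>\<^bsub>?M\<^esub> (g \<oplus>\<^bsub>?M\<^esub> h) = f \<otimes>\<^bsub>?M\<^esub> g \<oplus>\<^bsub>?M\<^esub> f \<otimes>\<^bsub>?M\<^esub> h" by (simp add: fun_eq_iff)
    have "conv (\<lambda>p. f p + g p) h (x, w) = conv f h (x, w) + conv g h (x, w)" for x w
      by (simp add: col[OF h] distrib_right sum.distrib)
    then show "(f \<oplus>\<^bsub>?M\<^esub> g) \<otimes>\<^bsub>?M\<^esub> h = f \<otimes>\<^bsub>?M\<^esub> h \<oplus>\<^bsub>?M\<^esub> g \<otimes>\<^bsub>?M\<^esub> h" by (simp add: fun_eq_iff)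
  next
    fix a f g assume "f \<in> carrier ?M" "g \<in> carrier ?M"
    then have f: "f \<in> row_col_finite" and g: "g \<in> row_col_finite" by simp_all
    show "f \<otimes>\<^bsub>?M\<^esub> g \<in> carrier ?M" using f g by (simp add: row_col_finite_conv)
    have "conv (\<lambda>p. a * f p) g (x, w) = a * conv f g (x, w)" for x w
      by (simp add: col[OF g] sum_distrib_left mult.assoc)
    then show "(a \<odot>\<^bsub>?M\<^esub> f) \<otimes>\<^bsub>?M\<^esub> g = a \<odot>\<^bsub>?M\<^esub> (f \<otimes>\<^bsub>?M\<^esub> g)" by (simp add: fun_eq_iff)
    have "conv f (\<lambda>p. a * g p) (x, w) = a * conv f g (x, w)" for x w
      by (simp add: row[OF f] sum_distrib_left mult_ac)
    then show "f \<otimes>\<^bsub>?M\<^esub> (a \<odot>\<^bsub>?M\<^esub> g) = a \<odot>\<^bsub>?M\<^esub> (f \<otimes>\<^bsub>?M\<^esub> g)" by (simp add: fun_eq_iff)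
    have "cnj (conv f g (w, x)) = conv (\<lambda>(x, y). cnj (g (y, x))) (\<lambda>(x, y). cnj (f (y, x))) (x, w)" for x w
      by (simp add: row[OF f] col[OF star[OF f]] mult.commute)
    then show "star ?M (f \<otimes>\<^bsub>?M\<^esub> g) = star ?M g \<otimes>\<^bsub>?M\<^esub> star ?M f" by (simp add: fun_eq_iff)
  qed (auto simp: star fun_eq_iff)
qed

section \<open>Principal groupoids graded by a cocycle\<close>

text \<open>
  As the cocycle vanishes on units only, each set \<open>c\<^sup>-\<^sup>1(n)\<close> is an open \<open>\<G>\<close>-set: it is the
  graph of a homeomorphism between open sets of units.
\<close>

locale graded_groupoid = lc_r_discrete_principal_groupoid \<G>
  for \<G> :: "('x \<times> 'x) topology" +
  fixes c :: "'x \<times> 'x \<Rightarrow> real"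
  assumes cocycle: "cocycle \<G> c"
    and locally_constant: "locally_constant \<G> c"
    and kernel: "\<lbrakk>(x, y) \<in> topspace \<G>; c (x, y) = 0\<rbrakk> \<Longrightarrow> x = y"
begin

lemma topspace_unit_space: "topspace (unit_space \<G>) = {x. (x, x) \<in> topspace \<G>}"
  by (auto simp: unit_space_def topspace_pullback_topology)

lemma units: "(x, y) \<in> topspace \<G> \<Longrightarrow> x \<in> topspace (unit_space \<G>) \<and> y \<in> topspace (unit_space \<G>)"
  using equivalence by (auto simp: equiv_def)

lemma groupoid_refl: "x \<in> topspace (unit_space \<G>) \<Longrightarrow> (x, x) \<in> topspace \<G>"
  by (simp add: topspace_unit_space)

lemma groupoid_sym: "(x, y) \<in> topspace \<G> \<Longrightarrow> (y, x) \<in> topspace \<G>"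
  using equivalence by (auto simp: equiv_def dest: symD)

lemma groupoid_trans: "\<lbrakk>(x, y) \<in> topspace \<G>; (y, z) \<in> topspace \<G>\<rbrakk> \<Longrightarrow> (x, z) \<in> topspace \<G>"
  using equivalence by (auto simp: equiv_def dest: transD)

lemma c_trans: "\<lbrakk>(x, y) \<in> topspace \<G>; (y, z) \<in> topspace \<G>\<rbrakk> \<Longrightarrow> c (x, z) = c (x, y) + c (y, z)"
  using cocycle unfolding cocycle_def by blast

lemma c_refl: "(x, x) \<in> topspace \<G> \<Longrightarrow> c (x, x) = 0"
  using c_trans[of x x x] by simp

lemma c_sym: "(x, y) \<in> topspace \<G> \<Longrightarrow> c (y, x) = - c (x, y)"
  using c_trans[of x y x] groupoid_sym[of x y] groupoid_trans[of x y x] c_refl[of x] by simp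

definition slice :: "real \<Rightarrow> ('x \<times> 'x) set" where
  "slice n = {p \<in> topspace \<G>. c p = n}"

definition dom :: "real \<Rightarrow> 'x set" where
  "dom n = fst ` slice n"

text \<open>The direction follows partial actions: \<open>act n\<close> takes
  \<open>dom (- n)\<close> to \<open>dom n\<close>, reading an arrow \<open>(x, y)\<close> from
  \<open>y\<close> to \<open>x\<close>. Elsewhere its value is arbitrary.\<close>

definition act :: "real \<Rightarrow> 'x \<Rightarrow> 'x" where
  "act n y = (THE x. (x, y) \<in> slice n)"

lemma slice_subset: "slice n \<subseteq> topspace \<G>"
  by (auto simp: slice_def)

lemma mem_slice_c: "(x, y) \<in> topspace \<G> \<Longrightarrow> (x, y) \<in> slice (c (x, y))"
  by (simp add: slice_def)

lemma slice_sym: "(x, y) \<in> slice n \<longleftrightarrow> (y, x) \<in> slice (- n)"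
  using c_sym[of x y] c_sym[of y x] groupoid_sym[of x y] groupoid_sym[of y x] by (auto simp: slice_def)

lemma slice_trans: "\<lbrakk>(x, y) \<in> slice n; (y, z) \<in> slice m\<rbrakk> \<Longrightarrow> (x, z) \<in> slice (n + m)"
  using c_trans[of x y z] groupoid_trans[of x y z] by (auto simp: slice_def)

lemma slice_0: "(x, y) \<in> slice 0 \<longleftrightarrow> x = y \<and> x \<in> topspace (unit_space \<G>)"
  using kernel[of x y] c_refl[of x] by (auto simp: slice_def topspace_unit_space)

text \<open>Two arrows of equal degree with a common source differ by an arrow of degree 0, which is
  a unit by \<open>kernel\<close>.\<close>

lemma slice_unique: "\<lbrakk>(x, y) \<in> slice n; (x', y) \<in> slice n\<rbrakk> \<Longrightarrow> x = x'"
  using slice_trans[of x y n x' "- n"] slice_sym[of x' y n] slice_0[of x x'] by simp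

lemma slice_unique': "\<lbrakk>(x, y) \<in> slice n; (x, y') \<in> slice n\<rbrakk> \<Longrightarrow> y = y'"
  using slice_unique[of y x "- n" y'] slice_sym[of x y n] slice_sym[of x y' n] by simp

lemma act_eq: "(x, y) \<in> slice n \<Longrightarrow> act n y = x"
  unfolding act_def by (rule the_equality) (auto intro: slice_unique)

lemma mem_dom: "x \<in> dom n \<longleftrightarrow> (\<exists>y. (x, y) \<in> slice n)"
  by (force simp: dom_def)

lemma act_slice: "x \<in> dom n \<Longrightarrow> (x, act (- n) x) \<in> slice n"
  using act_eq slice_sym unfolding mem_dom by metis

lemma act_slice': "y \<in> dom (- n) \<Longrightarrow> (act n y, y) \<in> slice n"
  using act_slice[of y "- n"] slice_sym by simp

lemma slice_dom: "(x, y) \<in> slice n \<Longrightarrow> x \<in> dom n \<and> y \<in> dom (- n) \<and> act (- n) x = y \<and> act n y = x"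
  using act_eq[of x y n] act_eq[of y x "- n"] slice_sym mem_dom by blast

lemma dom_subset: "dom n \<subseteq> topspace (unit_space \<G>)"
  using units slice_subset by (force simp: dom_def)

lemma dom_0: "dom 0 = topspace (unit_space \<G>)"
  using slice_0 by (auto simp: mem_dom)

lemma open_slice: "openin \<G> (slice n)"
proof (subst openin_subopen, intro ballI)
  fix p assume p: "p \<in> slice n"
  then have "p \<in> topspace \<G>" by (simp add: slice_def)
  then obtain U where U: "openin \<G> U" "p \<in> U" "\<forall>q\<in>U. c q = c p"
    using locally_constant unfolding locally_constant_def by blast
  have "U \<subseteq> slice n"
  proof
    fix q assume q: "q \<in> U"
    then have "c q = c p" using U(3) by blast
    then show "q \<in> slice n" using p q openin_subset[OF U(1)] by (auto simp: slice_def)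
  qed
  then show "\<exists>T. openin \<G> T \<and> p \<in> T \<and> T \<subseteq> slice n" using U by blast
qed

lemma closed_slice: "closedin \<G> (slice n)"
proof -
  have "closedin \<G> {p \<in> topspace \<G>. c p \<in> {n}}"
    by (rule closedin_continuous_map_preimage[of _ euclideanreal]) (use cocycle in \<open>auto simp: cocycle_def\<close>)
  then show ?thesis by (simp add: slice_def)
qed

text \<open>The range of \<open>p\<close> is the unit obtained by multiplying \<open>p\<close> by
  its inverse, so continuity follows from that of the groupoid operations.\<close>

lemma continuous_fst: "continuous_map \<G> (unit_space \<G>) fst"
proof -
  let ?Z = "subtopology (prod_topology \<G> \<G>) {(p, q). snd p = fst q}"
  have "continuous_map \<G> ?Z (\<lambda>p. (p, (\<lambda>(x, y). (y, x)) p))"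
    unfolding continuous_map_in_subtopology
    using continuous_inverse by (auto intro!: continuous_map_pairedI continuous_map_id[unfolded id_def])
  from continuous_map_compose[OF this continuous_mult]
  have "continuous_map \<G> \<G> ((\<lambda>x. (x, x)) \<circ> fst)"
    by (rule continuous_map_eq) auto
  then show ?thesis
    unfolding unit_space_def by (rule continuous_map_pullback') simp
qed

lemma continuous_snd: "continuous_map \<G> (unit_space \<G>) snd"
  by (rule continuous_map_eq[OF continuous_map_compose[OF continuous_inverse continuous_fst]]) auto

lemma open_fst: "openin \<G> U \<Longrightarrow> openin (unit_space \<G>) (fst ` U)"
  using open_range by (simp add: open_map_def)

lemma open_dom: "openin (unit_space \<G>) (dom n)"
  unfolding dom_def by (rule open_fst[OF open_slice])

text \<open>The preimage of \<open>W\<close> consists of the ranges of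
  \<open>W \<inter> slice n\<close>, and it is open because the range map is. This is how
  \<open>open_range\<close> makes slices homeomorphic to open sets of units.\<close>

lemma continuous_section: "continuous_map (subtopology (unit_space \<G>) (dom n)) \<G> (\<lambda>x. (x, act (- n) x))"
  unfolding continuous_map_def
proof (intro conjI allI impI)
  show "(\<lambda>x. (x, act (- n) x)) \<in> topspace (subtopology (unit_space \<G>) (dom n)) \<rightarrow> topspace \<G>"
    using act_slice slice_subset by auto
  fix W assume W: "openin \<G> W"
  have "{x \<in> topspace (subtopology (unit_space \<G>) (dom n)). (x, act (- n) x) \<in> W} = fst ` (W \<inter> slice n)"
  proof (intro equalityI subsetI)
    fix x assume "x \<in> {x \<in> topspace (subtopology (unit_space \<G>) (dom n)). (x, act (- n) x) \<in> W}"
    then show "x \<in> fst ` (W \<inter> slice n)"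
      using act_slice by (intro image_eqI[of _ _ "(x, act (- n) x)"]) auto
  next
    fix x assume "x \<in> fst ` (W \<inter> slice n)"
    then obtain y where "(x, y) \<in> W" "(x, y) \<in> slice n" by auto
    then show "x \<in> {x \<in> topspace (subtopology (unit_space \<G>) (dom n)). (x, act (- n) x) \<in> W}"
      using slice_dom[of x y n] dom_subset by auto
  qed
  moreover have "openin (unit_space \<G>) (fst ` (W \<inter> slice n))"
    by (intro open_fst openin_Int W open_slice)
  moreover have "fst ` (W \<inter> slice n) \<subseteq> dom n" by (auto simp: dom_def)
  ultimately show "openin (subtopology (unit_space \<G>) (dom n))
      {x \<in> topspace (subtopology (unit_space \<G>) (dom n)). (x, act (- n) x) \<in> W}"
    by (simp add: openin_open_subtopology open_dom)
qed

lemma continuous_act: "continuous_map (subtopology (unit_space \<G>) (dom (- n))) (unit_space \<G>) (act n)"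
  by (rule continuous_map_eq[OF continuous_map_compose[OF continuous_section continuous_snd]]) auto

lemma Hausdorff_unit_space: "Hausdorff_space (unit_space \<G>)"
proof (rule Hausdorff_space_injective_preimage[OF hausdorff])
  show "continuous_map (unit_space \<G>) \<G> (\<lambda>x. (x, x))"
    using continuous_map_pullback[OF continuous_map_id, where A=UNIV and f="\<lambda>x. (x, x)"]
    by (simp add: unit_space_def)
qed (auto simp: inj_on_def)

lemma lch_unit_space: "lch_space (unit_space \<G>)"
proof -
  have "\<exists>U K. openin (unit_space \<G>) U \<and> compactin (unit_space \<G>) K \<and> x \<in> U \<and> U \<subseteq> K"
    if x: "x \<in> topspace (unit_space \<G>)" for x
  proof -
    obtain U K where "openin \<G> U" "compactin \<G> K" "(x, x) \<in> U" "U \<subseteq> K"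
      using locally_compact groupoid_refl[OF x] unfolding locally_compact_space_def by blast
    then have "openin (unit_space \<G>) (fst ` U) \<and> compactin (unit_space \<G>) (fst ` K) \<and>
        x \<in> fst ` U \<and> fst ` U \<subseteq> fst ` K"
      using image_compactin[OF _ continuous_fst] open_fst by force
    then show ?thesis by blast
  qed
  then show ?thesis
    using Hausdorff_unit_space by (simp add: lch_space_def locally_compact_space_def)
qed

section \<open>Functions on a slice and functions on the units\<close>

lemma C0_slice_to_units:
  assumes F: "F \<in> carrier (C0 \<G>)" and 0: "\<And>p. p \<notin> slice n \<Longrightarrow> F p = 0"
  shows "(\<lambda>x. if x \<in> dom n then F (x, act (- n) x) else 0) \<in> carrier (C0 (unit_space \<G>))"
proof (rule C0_transfer[OF Hausdorff_unit_space open_dom open_slice continuous_section])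
  show "continuous_map (subtopology \<G> (slice n)) (unit_space \<G>) fst"
    using continuous_fst by (rule continuous_map_from_subtopology)
  show "\<And>x. x \<in> dom n \<Longrightarrow> (x, act (- n) x) \<in> slice n \<and> fst (x, act (- n) x) = x"
    by (simp add: act_slice)
  show "\<And>p. p \<in> slice n \<Longrightarrow> fst p \<in> dom n \<and> (fst p, act (- n) (fst p)) = p"
    using slice_dom by (metis prod.collapse)
qed (use F 0 in auto)

lemma C0_units_to_slice:
  assumes f: "f \<in> carrier (C0 (unit_space \<G>))" and 0: "\<And>x. x \<notin> dom n \<Longrightarrow> f x = 0"
  shows "(\<lambda>p. if p \<in> slice n then f (fst p) else 0) \<in> carrier (C0 \<G>)"
proof (rule C0_transfer[OF hausdorff open_slice open_dom _ continuous_section])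
  show "continuous_map (subtopology \<G> (slice n)) (unit_space \<G>) fst"
    using continuous_fst by (rule continuous_map_from_subtopology)
  show "\<And>x. x \<in> dom n \<Longrightarrow> (x, act (- n) x) \<in> slice n \<and> fst (x, act (- n) x) = x"
    by (simp add: act_slice)
  show "\<And>p. p \<in> slice n \<Longrightarrow> fst p \<in> dom n \<and> (fst p, act (- n) (fst p)) = p"
    using slice_dom by (metis prod.collapse)
qed (use f 0 in auto)

definition on_slice :: "real \<Rightarrow> ('x \<times> 'x \<Rightarrow> complex) \<Rightarrow> 'x \<times> 'x \<Rightarrow> complex" where
  "on_slice n F = (\<lambda>p. if p \<in> slice n then F p else 0)"

text \<open>Slices are closed as well as open, so setting a function to 0 outside one leaves it
  continuous.\<close>

lemma continuous_on_slice:
  assumes F: "continuous_map \<G> euclidean F"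
  shows "continuous_map \<G> euclidean (on_slice n F)"
proof (rule continuous_map_extend_zero[OF open_slice])
  show "continuous_map (subtopology \<G> (slice n)) euclidean (on_slice n F)"
    by (rule continuous_map_eq[OF continuous_map_from_subtopology[OF F]]) (auto simp: on_slice_def)
  fix e :: real assume "e > 0"
  then have "{p \<in> topspace \<G>. e \<le> cmod (on_slice n F p)} = {p \<in> topspace \<G>. e \<le> cmod (F p)} \<inter> slice n"
    by (auto simp: on_slice_def split: if_splits)
  then show "closedin \<G> {p \<in> topspace \<G>. e \<le> cmod (on_slice n F p)}"
    by (simp only:) (intro closedin_Int closedin_norm_ge F closed_slice)
qed (auto simp: on_slice_def)

lemma C0_on_slice:
  assumes F: "F \<in> carrier (C0 \<G>)"
  shows "on_slice n F \<in> carrier (C0 \<G>)"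
proof (rule C0_dominated)
  show "continuous_map \<G> euclidean (on_slice n F)" by (intro continuous_on_slice C0D(1) F)
  fix e :: real assume e: "e > 0"
  then have "{p \<in> topspace \<G>. e \<le> cmod (on_slice n F p)} \<subseteq> {p \<in> topspace \<G>. e \<le> cmod (F p)}"
    by (auto simp: on_slice_def split: if_splits)
  then show "\<exists>K. compactin \<G> K \<and> {p \<in> topspace \<G>. e \<le> cmod (on_slice n F p)} \<subseteq> K"
    using C0D(3)[OF F e] by blast
qed (use slice_subset in \<open>auto simp: on_slice_def\<close>)

end

lemma C0_sum: "finite N \<Longrightarrow> (\<And>n. n \<in> N \<Longrightarrow> f n \<in> carrier (C0 X)) \<Longrightarrow> (\<lambda>x. \<Sum>n\<in>N. f n x) \<in> carrier (C0 X)"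
  by (induction N rule: finite_induct) (auto simp: C0_zero C0_add)

lemma conv_sum_left:
  assumes "K \<in> row_col_finite"
  shows "conv (\<lambda>p. \<Sum>n\<in>N. f n p) K p = (\<Sum>n\<in>N. conv (f n) K p)"
proof -
  obtain x z where p: "p = (x, z)" by fastforce
  have "conv g K (x, z) = (\<Sum>y | K (y, z) \<noteq> 0. g (x, y) * K (y, z))" for g
    by (rule conv_col[OF row_col_finiteD(2)[OF assms]]) simp
  then show ?thesis unfolding p by (simp add: sum_distrib_right) (rule sum.swap)
qed

lemma conv_sum_right:
  assumes "F \<in> row_col_finite"
  shows "conv F (\<lambda>p. \<Sum>n\<in>N. f n p) p = (\<Sum>n\<in>N. conv F (f n) p)"
proof -
  obtain x z where p: "p = (x, z)" by fastforce
  have "conv F g (x, z) = (\<Sum>y | F (x, y) \<noteq> 0. F (x, y) * g (y, z))" for g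
    by (rule conv_row[OF row_col_finiteD(1)[OF assms]]) simp
  then show ?thesis unfolding p by (simp add: sum_distrib_left) (rule sum.swap)
qed

context graded_groupoid
begin

subsection \<open>Functions supported on finitely many slices\<close>

text \<open>These functions will turn out to be the images of the polynomials under
  \<open>\<Psi>\<close>: finitely many degrees, with a coefficient vanishing at infinity on each
  slice.\<close>

definition C0_fin :: "('x \<times> 'x \<Rightarrow> complex) set" where
  "C0_fin = {F \<in> carrier (C0 \<G>). finite (c ` {p. F p \<noteq> 0})}"

lemma C0_finD:
  assumes "F \<in> C0_fin"
  shows "F \<in> carrier (C0 \<G>)" "finite (c ` {p. F p \<noteq> 0})" "p \<notin> topspace \<G> \<Longrightarrow> F p = 0"
  using assms C0D(2) by (auto simp: C0_fin_def)

lemma C0_finI: "\<lbrakk>F \<in> carrier (C0 \<G>); finite N; \<And>p. F p \<noteq> 0 \<Longrightarrow> c p \<in> N\<rbrakk> \<Longrightarrow> F \<in> C0_fin"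
  unfolding C0_fin_def by (auto elim: finite_subset[rotated])

text \<open>The slices are an open cover indexed by the degree, and a compact set meets only
  finitely many of them.\<close>

lemma finite_c_compact:
  assumes A: "compactin \<G> A"
  shows "finite (c ` A)"
proof -
  have "\<exists>\<F>. finite \<F> \<and> \<F> \<subseteq> range slice \<and> A \<subseteq> \<Union>\<F>"
  proof -
    have "\<forall>U\<in>range slice. openin \<G> U" by (auto simp: open_slice)
    moreover have "A \<subseteq> \<Union>(range slice)"
      using compactin_subset_topspace[OF A] by (auto simp: slice_def)
    ultimately show ?thesis using A unfolding compactin_def by blast
  qed
  then obtain N where N: "finite N" "A \<subseteq> \<Union>(slice ` N)"
    by (metis finite_subset_image)
  have "c ` A \<subseteq> N" using N(2) by (fastforce simp: slice_def)
  then show ?thesis using N(1) finite_subset by blast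
qed

lemma Cc_iff: "F \<in> carrier (Cc_algebra \<G>) \<longleftrightarrow>
    F \<in> C0_fin \<and> (\<exists>A. compactin \<G> A \<and> (\<forall>p. p \<notin> A \<longrightarrow> F p = 0))"
proof
  let ?S = "{p \<in> topspace \<G>. F p \<noteq> 0}"
  assume "F \<in> carrier (Cc_algebra \<G>)"
  then have F: "continuous_map \<G> euclidean F" "\<And>p. p \<notin> topspace \<G> \<Longrightarrow> F p = 0"
    and A: "compactin \<G> (\<G> closure_of ?S)"
    by (auto simp: Cc_algebra_def)
  have sub: "?S \<subseteq> \<G> closure_of ?S" by (rule closure_of_subset) auto
  have 0: "F p = 0" if "p \<notin> \<G> closure_of ?S" for p using that sub F(2)[of p] by auto
  have "F \<in> carrier (C0 \<G>)"
  proof (rule C0_dominated[OF F])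
    fix e :: real assume "e > 0"
    then have "{p \<in> topspace \<G>. e \<le> cmod (F p)} \<subseteq> ?S" by auto
    then show "\<exists>K. compactin \<G> K \<and> {p \<in> topspace \<G>. e \<le> cmod (F p)} \<subseteq> K" using A sub by blast
  qed
  then have "F \<in> C0_fin" by (rule C0_finI[OF _ finite_c_compact[OF A]]) (use 0 in blast)
  then show "F \<in> C0_fin \<and> (\<exists>A. compactin \<G> A \<and> (\<forall>p. p \<notin> A \<longrightarrow> F p = 0))" using A 0 by blast
next
  assume "F \<in> C0_fin \<and> (\<exists>A. compactin \<G> A \<and> (\<forall>p. p \<notin> A \<longrightarrow> F p = 0))"
  then obtain A where F: "F \<in> carrier (C0 \<G>)" and A: "compactin \<G> A" "\<And>p. p \<notin> A \<Longrightarrow> F p = 0"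
    using C0_finD by blast
  have "\<G> closure_of {p \<in> topspace \<G>. F p \<noteq> 0} \<subseteq> A"
    by (rule closure_of_minimal[OF _ compactin_imp_closedin[OF hausdorff A(1)]]) (use A(2) in blast)
  then have "compactin \<G> (\<G> closure_of {p \<in> topspace \<G>. F p \<noteq> 0})"
    using closed_compactin[OF A(1)] closedin_closure_of by blast
  then show "F \<in> carrier (Cc_algebra \<G>)"
    using C0D(1,2)[OF F] by (simp add: Cc_algebra_def)
qed

text \<open>A slice is a graph, so it meets each row and each column at most once.\<close>

lemma C0_fin_row_col: "F \<in> C0_fin \<Longrightarrow> F \<in> row_col_finite"
proof -
  assume F: "F \<in> C0_fin"
  define N where "N = c ` {p. F p \<noteq> 0}"
  have N: "finite N" using C0_finD(2)[OF F] by (simp add: N_def)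
  have s: "(x, y) \<in> slice (c (x, y)) \<and> c (x, y) \<in> N" if "F (x, y) \<noteq> 0" for x y
    using that mem_slice_c[of x y] C0_finD(3)[OF F, of "(x, y)"] unfolding N_def by blast
  have "{y. F (x, y) \<noteq> 0} \<subseteq> (\<lambda>n. act (- n) x) ` N" for x
  proof
    fix y assume "y \<in> {y. F (x, y) \<noteq> 0}"
    then show "y \<in> (\<lambda>n. act (- n) x) ` N"
      using s[of x y] slice_dom[of x y "c (x, y)"] by (intro image_eqI[of _ _ "c (x, y)"]) auto
  qed
  moreover have "{x. F (x, y) \<noteq> 0} \<subseteq> (\<lambda>n. act n y) ` N" for y
  proof
    fix x assume "x \<in> {x. F (x, y) \<noteq> 0}"
    then show "x \<in> (\<lambda>n. act n y) ` N"
      using s[of x y] slice_dom[of x y "c (x, y)"] by (intro image_eqI[of _ _ "c (x, y)"]) auto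
  qed
  ultimately show ?thesis
    unfolding row_col_finite_def mem_Collect_eq by (intro conjI allI finite_surj[OF N])
qed

lemma on_slice_support: "on_slice n F p \<noteq> 0 \<Longrightarrow> p \<in> slice n"
  by (auto simp: on_slice_def split: if_splits)

lemma on_slice_outside: "p \<notin> slice n \<Longrightarrow> on_slice n F p = 0"
  by (simp add: on_slice_def)

text \<open>At most one summand survives at a point, so the decomposition into slices commutes with
  any \<open>\<psi>\<close> that fixes 0. It is used for the identity and for
  \<open>cmod\<close>.\<close>

lemma sum_on_slice:
  assumes "finite N" "\<And>p. F p \<noteq> 0 \<Longrightarrow> c p \<in> N" "\<And>p. p \<notin> topspace \<G> \<Longrightarrow> F p = 0" "\<psi> 0 = 0"
  shows "(\<Sum>n\<in>N. \<psi> (on_slice n F p)) = \<psi> (F p)"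
proof (cases "F p = 0")
  case True
  then have "on_slice n F p = 0" for n by (simp add: on_slice_def)
  then show ?thesis using True assms(4) by simp
next
  case False
  then have p: "p \<in> topspace \<G>" "c p \<in> N" using assms(2,3)[of p] by blast+
  have "(\<Sum>n\<in>N. \<psi> (on_slice n F p)) = (\<Sum>n\<in>N. if n = c p then \<psi> (F p) else 0)"
    by (rule sum.cong) (use p assms(4) in \<open>auto simp: on_slice_def slice_def\<close>)
  then show ?thesis using p assms(1) by simp
qed

lemma row_sum:
  fixes \<psi> :: "complex \<Rightarrow> 'b::{topological_comm_monoid_add, t2_space}"
  assumes N: "finite N" "\<And>p. F p \<noteq> 0 \<Longrightarrow> c p \<in> N" and 0: "\<And>p. p \<notin> topspace \<G> \<Longrightarrow> F p = 0" "\<psi> 0 = 0"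
  shows "(\<Sum>\<^sub>\<infinity>y. \<psi> (F (x, y))) = (\<Sum>n\<in>N. \<psi> (on_slice n F (x, act (- n) x)))"
proof -
  \<comment> \<open>If \<open>x \<notin> dom n\<close>, the point \<open>act (- n) x\<close> is
    arbitrary, but then \<open>on_slice n F\<close> vanishes on the whole row of
    \<open>x\<close>.\<close>
  let ?A = "(\<lambda>n. act (- n) x) ` N"
  have z: "\<psi> (on_slice n F (x, y)) = 0" if "y \<noteq> act (- n) x" for n y
    using that slice_dom[of x y n] 0(2) by (auto simp: on_slice_def)
  have "(\<Sum>\<^sub>\<infinity>y. \<psi> (F (x, y))) = (\<Sum>\<^sub>\<infinity>y. \<Sum>n\<in>N. \<psi> (on_slice n F (x, y)))"
    by (simp add: sum_on_slice assms)
  also have "\<dots> = (\<Sum>y\<in>?A. \<Sum>n\<in>N. \<psi> (on_slice n F (x, y)))"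
    by (rule infsum_finite_support) (use N in \<open>auto intro!: sum.neutral z\<close>)
  also have "\<dots> = (\<Sum>n\<in>N. \<Sum>y\<in>?A. \<psi> (on_slice n F (x, y)))" by (rule sum.swap)
  also have "\<dots> = (\<Sum>n\<in>N. \<psi> (on_slice n F (x, act (- n) x)))"
  proof (rule sum.cong[OF refl])
    fix n assume n: "n \<in> N"
    have "(\<Sum>y\<in>?A. \<psi> (on_slice n F (x, y))) = (\<Sum>y\<in>{act (- n) x}. \<psi> (on_slice n F (x, y)))"
      by (rule sum.mono_neutral_right) (use N n z in auto)
    then show "(\<Sum>y\<in>?A. \<psi> (on_slice n F (x, y))) = \<psi> (on_slice n F (x, act (- n) x))" by simp
  qed
  finally show ?thesis .
qed

lemma col_sum:
  fixes \<psi> :: "complex \<Rightarrow> 'b::{topological_comm_monoid_add, t2_space}"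
  assumes N: "finite N" "\<And>p. F p \<noteq> 0 \<Longrightarrow> c p \<in> N" and 0: "\<And>p. p \<notin> topspace \<G> \<Longrightarrow> F p = 0" "\<psi> 0 = 0"
  shows "(\<Sum>\<^sub>\<infinity>x. \<psi> (F (x, y))) = (\<Sum>n\<in>N. \<psi> (on_slice n F (act n y, y)))"
proof -
  let ?A = "(\<lambda>n. act n y) ` N"
  have z: "\<psi> (on_slice n F (x, y)) = 0" if "x \<noteq> act n y" for n x
    using that slice_dom[of x y n] 0(2) by (auto simp: on_slice_def)
  have "(\<Sum>\<^sub>\<infinity>x. \<psi> (F (x, y))) = (\<Sum>\<^sub>\<infinity>x. \<Sum>n\<in>N. \<psi> (on_slice n F (x, y)))"
    by (simp add: sum_on_slice assms)
  also have "\<dots> = (\<Sum>x\<in>?A. \<Sum>n\<in>N. \<psi> (on_slice n F (x, y)))"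
    by (rule infsum_finite_support) (use N in \<open>auto intro!: sum.neutral z\<close>)
  also have "\<dots> = (\<Sum>n\<in>N. \<Sum>x\<in>?A. \<psi> (on_slice n F (x, y)))" by (rule sum.swap)
  also have "\<dots> = (\<Sum>n\<in>N. \<psi> (on_slice n F (act n y, y)))"
  proof (rule sum.cong[OF refl])
    fix n assume n: "n \<in> N"
    have "(\<Sum>x\<in>?A. \<psi> (on_slice n F (x, y))) = (\<Sum>x\<in>{act n y}. \<psi> (on_slice n F (x, y)))"
      by (rule sum.mono_neutral_right) (use N n z in auto)
    then show "(\<Sum>x\<in>?A. \<psi> (on_slice n F (x, y))) = \<psi> (on_slice n F (act n y, y))" by simp
  qed
  finally show ?thesis .
qed

text \<open>Only one middle point can contribute. For \<open>x \<notin> dom n\<close> both sides are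
  0, whatever \<open>act (- n) x\<close> may be.\<close>

lemma conv_on_slice:
  assumes "\<And>p. p \<notin> slice n \<Longrightarrow> F p = 0"
  shows "conv F K (x, z) = F (x, act (- n) x) * K (act (- n) x, z)"
proof -
  have "F (x, y) = 0" if "y \<notin> {act (- n) x}" for y
    using that slice_dom[of x y n] assms[of "(x, y)"] by auto
  then show ?thesis using conv_row[of "{act (- n) x}" F x K z] by simp
qed

lemma conv_on_slice':
  assumes "\<And>p. p \<notin> slice n \<Longrightarrow> K p = 0"
  shows "conv F K (x, z) = F (x, act n z) * K (act n z, z)"
proof -
  have "K (y, z) = 0" if "y \<notin> {act n z}" for y
    using that slice_dom[of y z n] assms[of "(y, z)"] by auto
  then show ?thesis using conv_col[of "{act n z}" K z F x] by simp
qed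

lemma conv_support:
  assumes "F \<in> row_col_finite" "conv F K (x, z) \<noteq> 0"
  obtains y where "F (x, y) \<noteq> 0" "K (y, z) \<noteq> 0"
proof -
  have "conv F K (x, z) = (\<Sum>y | F (x, y) \<noteq> 0. F (x, y) * K (y, z))"
    by (rule conv_row[OF row_col_finiteD(1)[OF assms(1)]]) simp
  then have "(\<Sum>y | F (x, y) \<noteq> 0. F (x, y) * K (y, z)) \<noteq> 0" using assms(2) by simp
  from sum.not_neutral_contains_not_neutral[OF this] show thesis using that by auto
qed

lemma C0_flip:
  assumes F: "F \<in> carrier (C0 \<G>)"
  shows "(\<lambda>(x, y). F (y, x)) \<in> carrier (C0 \<G>)"
proof -
  let ?i = "\<lambda>(x, y). (y, x)"
  have "(\<lambda>p. if p \<in> topspace \<G> then F (?i p) else 0) \<in> carrier (C0 \<G>)"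
    by (rule C0_transfer[where h="?i" and k="?i" and U="topspace \<G>" and V="topspace \<G>"])
       (use hausdorff continuous_inverse F C0D(2)[OF F] groupoid_sym in auto)
  moreover have "(\<lambda>p. if p \<in> topspace \<G> then F (?i p) else 0) = (\<lambda>(x, y). F (y, x))"
    using C0D(2)[OF F] groupoid_sym by (auto simp: fun_eq_iff)
  ultimately show ?thesis by simp
qed

definition set_comp :: "('x \<times> 'x) set \<Rightarrow> ('x \<times> 'x) set \<Rightarrow> ('x \<times> 'x) set" where
  "set_comp A B = {(x, z). \<exists>y. (x, y) \<in> A \<and> (y, z) \<in> B}"

text \<open>The product of \<open>A\<close> and \<open>B\<close> is a continuous image of the set
  \<open>L\<close> of possible middle points. This set is compact, being the intersection of the
  sources of \<open>A\<close> with the ranges of \<open>B\<close> in a Hausdorff space.\<close>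

lemma compactin_set_comp:
  assumes A: "compactin \<G> A" "A \<subseteq> slice n" and B: "compactin \<G> B" "B \<subseteq> slice m"
  shows "compactin \<G> (set_comp A B)"
proof -
  let ?X = "unit_space \<G>"
  define L where "L = snd ` A \<inter> fst ` B"
  define W where "W = dom (- n) \<inter> dom m"
  have "compactin ?X (snd ` A)" "compactin ?X (fst ` B)"
    using image_compactin A B continuous_fst continuous_snd by blast+
  then have L: "compactin ?X L"
    unfolding L_def using compact_Int_closedin compactin_imp_closedin[OF Hausdorff_unit_space] by blast
  have Adom: "\<And>x y. (x, y) \<in> A \<Longrightarrow> y \<in> dom (- n) \<and> act n y = x"
    and Bdom: "\<And>y z. (y, z) \<in> B \<Longrightarrow> y \<in> dom m \<and> act (- m) y = z"
    using A(2) B(2) slice_dom by blast+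
  have LW: "L \<subseteq> W" using Adom Bdom by (auto simp: L_def W_def)
  have sl: "(act n y, act (- m) y) \<in> slice (n + m)" if "y \<in> W" for y
    using that slice_trans[OF act_slice' act_slice] by (auto simp: W_def)
  \<comment> \<open>The map taking a middle point to the product arrow is \<open>act n\<close>
    followed by the section of \<open>slice (n + m)\<close>.\<close>
  have "continuous_map (subtopology ?X W) (subtopology ?X (dom (n + m))) (act n)"
    unfolding continuous_map_in_subtopology
  proof
    have "subtopology ?X W = subtopology (subtopology ?X (dom (- n))) (dom m)"
      by (simp add: subtopology_subtopology W_def)
    then show "continuous_map (subtopology ?X W) ?X (act n)"
      using continuous_map_from_subtopology[OF continuous_act] by simp
    show "act n \<in> topspace (subtopology ?X W) \<rightarrow> dom (n + m)"
      using sl slice_dom by auto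
  qed
  moreover have "act (- n - m) (act n y) = act (- m) y" if "y \<in> W" for y
    using slice_dom[OF sl[OF that]] by simp
  ultimately have "continuous_map (subtopology ?X W) \<G> (\<lambda>y. (act n y, act (- m) y))"
    by (intro continuous_map_eq[OF continuous_map_compose[OF _ continuous_section]]) auto
  moreover have "compactin (subtopology ?X W) L" using L LW by (simp add: compactin_subtopology)
  ultimately have "compactin \<G> ((\<lambda>y. (act n y, act (- m) y)) ` L)" by (rule image_compactin[rotated])
  moreover have "(\<lambda>y. (act n y, act (- m) y)) ` L = set_comp A B"
  proof (intro equalityI subsetI)
    fix p assume "p \<in> (\<lambda>y. (act n y, act (- m) y)) ` L"
    then obtain x y z where "(x, y) \<in> A" "(y, z) \<in> B" "p = (act n y, act (- m) y)"
      by (auto simp: L_def)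
    then show "p \<in> set_comp A B" using Adom[of x y] Bdom[of y z] by (auto simp: set_comp_def)
  next
    fix p assume "p \<in> set_comp A B"
    then obtain x y z where xyz: "(x, y) \<in> A" "(y, z) \<in> B" "p = (x, z)" by (auto simp: set_comp_def)
    then have "y \<in> L" by (force simp: L_def)
    then show "p \<in> (\<lambda>y. (act n y, act (- m) y)) ` L"
      using xyz Adom[of x y] Bdom[of y z] by (intro image_eqI[of _ _ y]) auto
  qed
  ultimately show ?thesis by simp
qed

text \<open>On \<open>slice (n + m)\<close> the convolution is a function \<open>a\<close> of the
  range times a function \<open>b\<close> of the source, which gives continuity. Decay at infinity
  is a separate matter: a large value needs large values of both factors, so it occurs in a product
  of two compact sets.\<close>

lemma C0_conv_slices:
  assumes F: "F \<in> carrier (C0 \<G>)" "\<And>p. p \<notin> slice n \<Longrightarrow> F p = 0"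
    and K: "K \<in> carrier (C0 \<G>)" "\<And>p. p \<notin> slice m \<Longrightarrow> K p = 0"
  shows "conv F K \<in> carrier (C0 \<G>)"
proof (rule C0_dominated)
  let ?X = "unit_space \<G>"
  define a where "a x = (if x \<in> dom n then F (x, act (- n) x) else 0)" for x
  define b where "b z = (if z \<in> dom (- m) then K (act m z, z) else 0)" for z
  have a: "a \<in> carrier (C0 ?X)" using C0_slice_to_units[OF F] by (simp add: a_def[abs_def])
  have K': "(\<lambda>(x, y). K (y, x)) \<in> carrier (C0 \<G>)" by (rule C0_flip[OF K(1)])
  have "(\<lambda>(x, y). K (y, x)) (x, y) = 0" if "(x, y) \<notin> slice (- m)" for x y
    using K(2)[of "(y, x)"] that slice_sym[of y x m] by simp
  then have b: "b \<in> carrier (C0 ?X)"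
    using C0_slice_to_units[OF K', of "- m"] by (auto simp: b_def[abs_def] cong: if_cong)
  have supp: "p \<in> slice (n + m)" if "conv F K p \<noteq> 0" for p
  proof -
    obtain x z :: 'x where p: "p = (x, z)" by fastforce
    then have "F (x, act (- n) x) \<noteq> 0" "K (act (- n) x, z) \<noteq> 0"
      using that conv_on_slice[OF F(2), where K=K and x=x and z=z] by auto
    then show ?thesis using F(2) K(2) slice_trans unfolding p by blast
  qed
  have eq: "conv F K = on_slice (n + m) (\<lambda>p. a (fst p) * b (snd p))"
  proof
    fix p :: "'x \<times> 'x"
    obtain x z :: 'x where p: "p = (x, z)" by fastforce
    show "conv F K p = on_slice (n + m) (\<lambda>p. a (fst p) * b (snd p)) p"
    proof (cases "p \<in> slice (n + m)")
      case True
      show ?thesis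
      proof (cases "x \<in> dom n")
        case x: True
        have "(act (- n) x, x) \<in> slice (- n)" using act_slice[OF x] slice_sym by blast
        then have "(act (- n) x, z) \<in> slice m" using slice_trans[of _ x "- n" z "n + m"] True p by simp
        then have "b z = K (act (- n) x, z)" using slice_dom by (auto simp: b_def)
        moreover have "a x = F (x, act (- n) x)" using x by (simp add: a_def)
        ultimately show ?thesis
          using True p conv_on_slice[OF F(2), where K=K and x=x and z=z] by (simp add: on_slice_def)
      next
        case x: False
        then have "F (x, act (- n) x) = 0" using F(2) mem_dom by blast
        then show ?thesis
          using x p conv_on_slice[OF F(2), where K=K and x=x and z=z] by (simp add: on_slice_def a_def)
      qed
    next
      case False
      then show ?thesis using supp[of p] by (auto simp: on_slice_outside)
    qed
  qed
  have "continuous_map \<G> euclidean (\<lambda>p. a (fst p) * b (snd p))"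
    using continuous_map_compose[OF continuous_fst C0D(1)[OF a]]
      continuous_map_compose[OF continuous_snd C0D(1)[OF b]]
    by (auto simp: continuous_map_atin o_def intro!: tendsto_mult)
  then show "continuous_map \<G> euclidean (conv F K)"
    unfolding eq by (rule continuous_on_slice)
  show "p \<notin> topspace \<G> \<Longrightarrow> conv F K p = 0" for p
    using supp slice_subset by blast
  fix e :: real assume e: "e > 0"
  obtain M where M: "M > 0" "\<And>p. cmod (F p) \<le> M" by (rule C0_bounded[OF F(1)]) blast
  obtain M' where M': "M' > 0" "\<And>p. cmod (K p) \<le> M'" by (rule C0_bounded[OF K(1)]) blast
  \<comment> \<open>If a product has modulus at least \<open>e\<close>, each factor has modulus at
    least \<open>e\<close> divided by the bound on the other.\<close>
  define A where "A = {p \<in> topspace \<G>. e / M' \<le> cmod (F p)}"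
  define B where "B = {p \<in> topspace \<G>. e / M \<le> cmod (K p)}"
  have pos: "e / M' > 0" "e / M > 0" using e M M' by auto
  have AB: "compactin \<G> A" "compactin \<G> B"
    unfolding A_def B_def by (intro C0D(3) F K pos)+
  have AB': "A \<subseteq> slice n" "B \<subseteq> slice m"
    unfolding A_def B_def using F(2) K(2) pos by force+
  have "{p \<in> topspace \<G>. e \<le> cmod (conv F K p)} \<subseteq> set_comp A B"
  proof clarify
    fix x z assume "e \<le> cmod (conv F K (x, z))"
    moreover define y where "y = act (- n) x"
    ultimately have le: "e \<le> cmod (F (x, y)) * cmod (K (y, z))"
      using conv_on_slice[OF F(2), where K=K and x=x and z=z] by (simp add: norm_mult)
    have "cmod (F (x, y)) * cmod (K (y, z)) \<le> cmod (F (x, y)) * M'"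
      "cmod (F (x, y)) * cmod (K (y, z)) \<le> M * cmod (K (y, z))"
      by (intro mult_left_mono mult_right_mono M M' norm_ge_zero)+
    then have "e / M' \<le> cmod (F (x, y))" "e / M \<le> cmod (K (y, z))"
      using le M(1) M'(1) by (auto simp: field_simps)
    moreover from this have "(x, y) \<in> topspace \<G>" "(y, z) \<in> topspace \<G>"
      using pos C0D(2)[OF F(1), of "(x, y)"] C0D(2)[OF K(1), of "(y, z)"] by force+
    ultimately have "(x, y) \<in> A" "(y, z) \<in> B" unfolding A_def B_def by blast+
    then show "(x, z) \<in> set_comp A B" unfolding set_comp_def by blast
  qed
  then show "\<exists>K'. compactin \<G> K' \<and> {p \<in> topspace \<G>. e \<le> cmod (conv F K p)} \<subseteq> K'"
    using compactin_set_comp[OF AB(1) AB'(1) AB(2) AB'(2)] by blast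
qed

lemma C0_fin_on_slice: "F \<in> C0_fin \<Longrightarrow> on_slice n F \<in> C0_fin"
  by (rule C0_finI[OF C0_on_slice[OF C0_finD(1)], of _ "{n}"])
     (auto dest: on_slice_support simp: slice_def)

lemma C0_fin_conv:
  assumes F: "F \<in> C0_fin" and K: "K \<in> C0_fin"
  shows "conv F K \<in> C0_fin"
proof (rule C0_finI)
  define N M where "N = c ` {p. F p \<noteq> 0}" and "M = c ` {p. K p \<noteq> 0}"
  have fin: "finite N" "finite M" using C0_finD(2) F K by (auto simp: N_def M_def)
  have dF: "F = (\<lambda>p. \<Sum>n\<in>N. on_slice n F p)"
    using sum_on_slice[of N F "\<lambda>z. z"] fin C0_finD(3)[OF F] by (auto simp: fun_eq_iff N_def)
  have dK: "K = (\<lambda>p. \<Sum>m\<in>M. on_slice m K p)"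
    using sum_on_slice[of M K "\<lambda>z. z"] fin C0_finD(3)[OF K] by (auto simp: fun_eq_iff M_def)
  have rc: "on_slice n F \<in> row_col_finite" for n by (intro C0_fin_row_col C0_fin_on_slice F)
  have "conv F K p = (\<Sum>n\<in>N. \<Sum>m\<in>M. conv (on_slice n F) (on_slice m K) p)" for p
    by (subst dF, subst conv_sum_left[OF C0_fin_row_col[OF K]], subst dK) (simp add: conv_sum_right[OF rc])
  then have "conv F K = (\<lambda>p. \<Sum>n\<in>N. \<Sum>m\<in>M. conv (on_slice n F) (on_slice m K) p)" by blast
  moreover have "conv (on_slice n F) (on_slice m K) \<in> carrier (C0 \<G>)" for n m
    by (rule C0_conv_slices[of _ n _ m]) (use F K in \<open>auto simp: C0_on_slice C0_finD on_slice_outside\<close>)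
  ultimately show "conv F K \<in> carrier (C0 \<G>)" using fin by (simp add: C0_sum)
  show "finite ((\<lambda>(n, m). n + m) ` (N \<times> M))" using fin by simp
  fix p assume p: "conv F K p \<noteq> 0"
  obtain x z :: 'x where xz: "p = (x, z)" by fastforce
  obtain y where y: "F (x, y) \<noteq> 0" "K (y, z) \<noteq> 0"
    using conv_support[OF C0_fin_row_col[OF F]] p xz by blast
  then have "c (x, z) = c (x, y) + c (y, z)"
    using C0_finD(3)[OF F] C0_finD(3)[OF K] by (intro c_trans) blast+
  moreover have "c (x, y) \<in> N" "c (y, z) \<in> M" using y by (auto simp: N_def M_def)
  ultimately show "c p \<in> (\<lambda>(n, m). n + m) ` (N \<times> M)" using xz by auto
qed

lemma Cc_conv:
  assumes F: "F \<in> carrier (Cc_algebra \<G>)" and K: "K \<in> carrier (Cc_algebra \<G>)"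
  shows "conv F K \<in> carrier (Cc_algebra \<G>)"
proof -
  obtain A where A: "compactin \<G> A" "\<And>p. p \<notin> A \<Longrightarrow> F p = 0" using F Cc_iff by blast
  obtain B where B: "compactin \<G> B" "\<And>p. p \<notin> B \<Longrightarrow> K p = 0" using K Cc_iff by blast
  have F': "F \<in> C0_fin" and K': "K \<in> C0_fin" using F K Cc_iff by auto
  define N M where "N = c ` A" and "M = c ` B"
  have fin: "finite N" "finite M" unfolding N_def M_def by (intro finite_c_compact A B)+
  define E where "E = (\<Union>n\<in>N. \<Union>m\<in>M. set_comp (A \<inter> slice n) (B \<inter> slice m))"
  have "compactin \<G> (set_comp (A \<inter> slice n) (B \<inter> slice m))" for n m
    by (rule compactin_set_comp) (auto intro: compact_Int_closedin A B closed_slice)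
  then have "compactin \<G> (\<Union>m\<in>M. set_comp (A \<inter> slice n) (B \<inter> slice m))" for n
    using fin by (intro compactin_Union) auto
  then have "compactin \<G> E"
    unfolding E_def using fin by (intro compactin_Union) auto
  moreover have "conv F K p = 0" if "p \<notin> E" for p
  proof (rule ccontr)
    assume "conv F K p \<noteq> 0"
    moreover obtain x z :: 'x where xz: "p = (x, z)" by fastforce
    ultimately obtain y where "F (x, y) \<noteq> 0" "K (y, z) \<noteq> 0"
      using conv_support[OF C0_fin_row_col[OF F']] by blast
    then have y: "(x, y) \<in> A" "(y, z) \<in> B" using A(2) B(2) by blast+
    then have "(x, y) \<in> slice (c (x, y))" "(y, z) \<in> slice (c (y, z))"
      using compactin_subset_topspace[OF A(1)] compactin_subset_topspace[OF B(1)] mem_slice_c by blast+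
    then have "p \<in> E" using y unfolding E_def xz set_comp_def N_def M_def by blast
    then show False using that by blast
  qed
  ultimately show ?thesis using C0_fin_conv[OF F' K'] Cc_iff by blast
qed

end

subsection \<open>Automatic boundedness of representations\<close>

abbreviation fstar :: "('x \<times> 'x \<Rightarrow> complex) \<Rightarrow> 'x \<times> 'x \<Rightarrow> complex" where
  "fstar f \<equiv> (\<lambda>(x, y). cnj (f (y, x)))"

abbreviation fun_algebra :: "('x \<times> 'x \<Rightarrow> complex) set \<Rightarrow> ('x \<times> 'x) topology \<Rightarrow> ('x \<times> 'x \<Rightarrow> complex) star_algebra" where
  "fun_algebra B \<G> \<equiv> (Cc_algebra \<G>)\<lparr>carrier := B\<rparr>"

text \<open>What the boundedness proof requires of an algebra of functions. Both
  \<open>C0_fin\<close> and the compactly supported functions qualify, so the Schur test is proved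
  once. \<open>B_compose\<close> acts entrywise and takes the place of a functional calculus;
  \<open>\<theta> 0 = 0\<close> keeps it inside an algebra without unit.\<close>

locale slice_algebra = graded_groupoid \<G> c
  for \<G> :: "('x \<times> 'x) topology" and c +
  fixes B :: "('x \<times> 'x \<Rightarrow> complex) set"
  assumes B_subset: "B \<subseteq> C0_fin"
    and B_zero: "(\<lambda>p. 0) \<in> B"
    and B_add: "\<lbrakk>f \<in> B; g \<in> B\<rbrakk> \<Longrightarrow> (\<lambda>p. f p + g p) \<in> B"
    and B_smult: "f \<in> B \<Longrightarrow> (\<lambda>p. a * f p) \<in> B"
    and B_star: "f \<in> B \<Longrightarrow> fstar f \<in> B"
    and B_conv: "\<lbrakk>f \<in> B; g \<in> B\<rbrakk> \<Longrightarrow> conv f g \<in> B"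
    and B_on_slice: "f \<in> B \<Longrightarrow> on_slice n f \<in> B"
    and B_compose: "\<lbrakk>f \<in> B; continuous_on UNIV \<theta>; \<theta> 0 = 0\<rbrakk> \<Longrightarrow> (\<lambda>p. \<theta> (f p)) \<in> B"
begin

lemma star_algebra_B: "star_algebra (fun_algebra B \<G>)"
proof (rule star_algebra_pullback[OF star_algebra_row_col_finite, of id])
  show "\<And>f. f \<in> carrier (fun_algebra B \<G>) \<Longrightarrow> id f \<in> carrier (fun_algebra row_col_finite \<G>)"
    using B_subset C0_fin_row_col by auto
qed (auto simp: B_zero B_add B_smult B_star B_conv)

lemma B_sum: "finite N \<Longrightarrow> (\<And>n. n \<in> N \<Longrightarrow> f n \<in> B) \<Longrightarrow> (\<lambda>p. \<Sum>n\<in>N. f n p) \<in> B"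
  by (induction N rule: finite_induct) (auto simp: B_zero B_add)

end

context graded_groupoid
begin

lemma slice_algebra_C0_fin: "slice_algebra \<G> c C0_fin"
proof (unfold_locales)
  fix f g assume f: "f \<in> C0_fin" and g: "g \<in> C0_fin"
  have "(\<lambda>p. f p + g p) \<in> carrier (C0 \<G>)" by (intro C0_add C0_finD(1) f g)
  then show "(\<lambda>p. f p + g p) \<in> C0_fin"
    by (rule C0_finI[of _ "c ` {p. f p \<noteq> 0} \<union> c ` {p. g p \<noteq> 0}"]) (use C0_finD(2) f g in auto)
  show "conv f g \<in> C0_fin" by (rule C0_fin_conv[OF f g])
next
  fix f n assume f: "f \<in> C0_fin"
  have fin: "finite (c ` {p. f p \<noteq> 0})" by (rule C0_finD(2)[OF f])
  show "(\<lambda>p. a * f p) \<in> C0_fin" for a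
    by (rule C0_finI[OF C0_smult[OF C0_finD(1)[OF f]] fin]) auto
  show "on_slice n f \<in> C0_fin" by (rule C0_fin_on_slice[OF f])
  have "c (x, y) \<in> uminus ` c ` {p. f p \<noteq> 0}" if "f (y, x) \<noteq> 0" for x y
  proof -
    have "c (x, y) = - c (y, x)" using C0_finD(3)[OF f, of "(y, x)"] that c_sym by blast
    then show ?thesis using that by blast
  qed
  then show "fstar f \<in> C0_fin"
    by (intro C0_finI[of _ "uminus ` c ` {p. f p \<noteq> 0}"])
       (use C0_cnj[OF C0_flip[OF C0_finD(1)[OF f]]] fin in \<open>auto simp: case_prod_beta'\<close>)
  fix \<theta> :: "complex \<Rightarrow> complex" assume \<theta>: "continuous_on UNIV \<theta>" "\<theta> 0 = 0"
  show "(\<lambda>p. \<theta> (f p)) \<in> C0_fin"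
    by (rule C0_finI[OF C0_compose[OF C0_finD(1)[OF f] \<theta>] fin]) (use \<theta>(2) in auto)
next
  show "(\<lambda>p. 0) \<in> C0_fin" by (rule C0_finI[OF C0_zero, of "{}"]) auto
qed simp

lemma slice_algebra_Cc: "slice_algebra \<G> c (carrier (Cc_algebra \<G>))"
proof -
  interpret C: slice_algebra \<G> c C0_fin by (rule slice_algebra_C0_fin)
  let ?B = "carrier (Cc_algebra \<G>)"
  have I: "f \<in> ?B" if "f \<in> C0_fin" "compactin \<G> A" "\<And>p. f p \<noteq> 0 \<Longrightarrow> p \<in> A" for f A
    using that Cc_iff by blast
  show ?thesis
  proof (unfold_locales)
    fix f g assume f: "f \<in> ?B" and g: "g \<in> ?B"
    show "conv f g \<in> ?B" by (rule Cc_conv[OF f g])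
    obtain A where A: "compactin \<G> A" "\<And>p. p \<notin> A \<Longrightarrow> f p = 0" using f Cc_iff by blast
    obtain A' where A': "compactin \<G> A'" "\<And>p. p \<notin> A' \<Longrightarrow> g p = 0" using g Cc_iff by blast
    show "(\<lambda>p. f p + g p) \<in> ?B"
    proof (rule I[OF C.B_add compactin_Un[OF A(1) A'(1)]])
      fix p assume "f p + g p \<noteq> 0"
      then have "f p \<noteq> 0 \<or> g p \<noteq> 0" by auto
      then show "p \<in> A \<union> A'" using A(2) A'(2) by blast
    qed (use f g Cc_iff in auto)
  next
    fix f n assume f: "f \<in> ?B"
    obtain A where A: "compactin \<G> A" "\<And>p. p \<notin> A \<Longrightarrow> f p = 0" using f Cc_iff by blast
    have f': "f \<in> C0_fin" using f Cc_iff by blast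
    have A0: "f p \<noteq> 0 \<Longrightarrow> p \<in> A" for p using A(2) by blast
    show "(\<lambda>p. a * f p) \<in> ?B" for a
      by (rule I[OF C.B_smult[OF f'] A(1)]) (use A0 in auto)
    show "on_slice n f \<in> ?B"
      by (rule I[OF C.B_on_slice[OF f'] A(1)]) (use A0 in \<open>auto simp: on_slice_def split: if_splits\<close>)
    have "compactin \<G> ((\<lambda>(x, y). (y, x)) ` A)" by (rule image_compactin[OF A(1) continuous_inverse])
    then show "fstar f \<in> ?B"
      by (rule I[OF C.B_star[OF f']]) (use A0 in force)
    fix \<theta> :: "complex \<Rightarrow> complex" assume \<theta>: "continuous_on UNIV \<theta>" "\<theta> 0 = 0"
    show "(\<lambda>p. \<theta> (f p)) \<in> ?B"
      by (rule I[OF C.B_compose[OF f' \<theta>] A(1)]) (use A0 \<theta>(2) in metis)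
  next
    show "(\<lambda>p. 0) \<in> ?B" by (rule I[OF C.B_zero, of "{}"]) auto
    show "?B \<subseteq> C0_fin" using Cc_iff by blast
  qed
qed

lemma slice_0_diag: "p \<in> slice 0 \<Longrightarrow> snd p = fst p"
  using slice_0[of "fst p" "snd p"] by simp

lemma conv_unit_right:
  assumes k: "\<And>p. p \<notin> slice 0 \<Longrightarrow> k p = 0"
  shows "conv f k (x, z) = f (x, z) * k (z, z)"
proof (cases "(z, z) \<in> slice 0")
  case True
  then show ?thesis using conv_on_slice'[of 0 k f x z] k act_eq[of z z 0] by simp
next
  case False
  then have "(act 0 z, z) \<notin> slice 0" using slice_0 by metis
  then show ?thesis using conv_on_slice'[of 0 k f x z] k False by simp
qed

text \<open>On functions supported by the units, convolution is pointwise multiplication.\<close>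

lemma conv_star_unit:
  assumes k: "\<And>p. p \<notin> slice 0 \<Longrightarrow> k p = 0"
  shows "conv (fstar k) k p = of_real ((cmod (k p))\<^sup>2)"
proof -
  obtain x z where p: "p = (x, z)" by fastforce
  have "conv (fstar k) k (x, z) = fstar k (x, z) * k (z, z)" by (rule conv_unit_right[OF k])
  also have "\<dots> = of_real ((cmod (k (x, z)))\<^sup>2)"
  proof (cases "x = z")
    case True
    then show ?thesis using complex_norm_square[of "k (x, z)"] by (simp add: mult.commute)
  next
    case False
    then have "k (x, z) = 0" "k (z, x) = 0" using k slice_0_diag by force+
    then show ?thesis by simp
  qed
  finally show ?thesis using p by simp
qed

end

text \<open>This function keeps the phase of \<open>z\<close> and takes the square root of its
  modulus. At the origin the modulus tends to 0, which is also the value that division by zero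
  yields there.\<close>

lemma continuous_half_power: "continuous_on UNIV (\<lambda>z::complex. z / of_real (sqrt (cmod z)))"
proof (rule continuous_at_imp_continuous_on, rule ballI)
  fix z :: complex
  show "isCont (\<lambda>z. z / of_real (sqrt (cmod z))) z"
  proof (cases "z = 0")
    case True
    have "((\<lambda>z::complex. z / of_real (sqrt (cmod z))) \<longlongrightarrow> 0) (at 0)"
    proof (rule Lim_null_comparison)
      have "((\<lambda>z::complex. sqrt (cmod z)) \<longlongrightarrow> sqrt (cmod 0)) (at 0)" by (intro tendsto_intros)
      then show "((\<lambda>z::complex. sqrt (cmod z)) \<longlongrightarrow> 0) (at 0)" by simp
      show "\<forall>\<^sub>F z in at 0. norm (z / complex_of_real (sqrt (cmod z))) \<le> sqrt (cmod z)"
        by (rule always_eventually) (simp add: norm_divide real_div_sqrt)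
    qed
    then show ?thesis using True by (simp add: isCont_def)
  qed (auto intro!: continuous_intros)
qed

locale slice_representation = slice_algebra \<G> c B + star_representation "fun_algebra B \<G>" H \<pi>
  for \<G> :: "('x \<times> 'x) topology" and c B and H :: "('h, 'n) inner_product_space_scheme" and \<pi>
begin

lemma inner_lin:
  assumes "f \<in> B" "g \<in> B" "v \<in> carrier H" "w \<in> carrier H"
  shows "inner_prod H (\<pi> (\<lambda>p. a * f p + b * g p) v) w = a * inner_prod H (\<pi> f v) w + b * inner_prod H (\<pi> g v) w"
proof -
  have "\<pi> (\<lambda>p. a * f p + b * g p) v = \<pi> (\<lambda>p. a * f p) v \<oplus>\<^bsub>H\<^esub> \<pi> (\<lambda>p. b * g p) v"
    using rep_add[of "\<lambda>p. a * f p" "\<lambda>p. b * g p" v] assms by (simp add: B_smult)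
  moreover have "\<pi> (\<lambda>p. a * f p) v = a \<odot>\<^bsub>H\<^esub> \<pi> f v" "\<pi> (\<lambda>p. b * g p) v = b \<odot>\<^bsub>H\<^esub> \<pi> g v"
    using rep_smult[of f v a] rep_smult[of g v b] assms by simp_all
  moreover have "\<pi> f v \<in> carrier H" "\<pi> g v \<in> carrier H" using assms by simp_all
  ultimately show ?thesis using assms by (simp add: H.inner_add H.inner_smult)
qed

lemma inner_sum:
  assumes "finite N" "\<And>n. n \<in> N \<Longrightarrow> f n \<in> B" "v \<in> carrier H" "w \<in> carrier H"
  shows "inner_prod H (\<pi> (\<lambda>p. \<Sum>n\<in>N. f n p) v) w = (\<Sum>n\<in>N. inner_prod H (\<pi> (f n) v) w)"
  using assms(1,2)
proof (induction N rule: finite_induct)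
  case empty
  then show ?case using rep_zero[of v] assms by simp
next
  case (insert n N)
  have "(\<lambda>p. \<Sum>n\<in>insert n N. f n p) = (\<lambda>p. 1 * f n p + 1 * (\<Sum>n\<in>N. f n p))"
    using insert by simp
  moreover have "(\<lambda>p. \<Sum>n\<in>N. f n p) \<in> B" using insert by (intro B_sum) auto
  ultimately show ?case
    using inner_lin[of "f n" "\<lambda>p. \<Sum>n\<in>N. f n p" v w 1 1] insert assms by simp
qed

lemma norm_sq_conv:
  "\<lbrakk>f \<in> B; v \<in> carrier H\<rbrakk> \<Longrightarrow> (vec_norm H (\<pi> f v))\<^sup>2 = Re (inner_prod H (\<pi> (conv (fstar f) f) v) v)"
  using rep_norm_sq[of f v] by simp

text \<open>
  If \<open>\<bar>k\<bar>\<^sup>2 \<le> M\<close> then \<open>M - k\<^sup>* k\<close> is \<open>M (1 - g)\<^sup>2\<close> for the self-adjoint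
  \<open>g = 1 - (1 - \<bar>k\<bar>\<^sup>2 / M)\<^sup>1\<^sup>/\<^sup>2\<close>, which lies in the (possibly non-unital) algebra.
\<close>

lemma unit_function_bound:
  assumes k: "k \<in> B" "\<And>p. p \<notin> slice 0 \<Longrightarrow> k p = 0"
    and M: "M > 0" "\<And>p. (cmod (k p))\<^sup>2 \<le> M" and v: "v \<in> carrier H"
  shows "(vec_norm H (\<pi> k v))\<^sup>2 \<le> M * (vec_norm H v)\<^sup>2"
proof -
  define t where "t z = sqrt (max 0 (1 - (cmod z)\<^sup>2 / M))" for z
  define \<theta> where "\<theta> z = 1 - complex_of_real (t z)" for z
  define g where "g = (\<lambda>p. \<theta> (k p))"
  have t_sq: "(t (k p))\<^sup>2 = 1 - (cmod (k p))\<^sup>2 / M" for p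
  proof -
    have "(cmod (k p))\<^sup>2 / M \<le> 1" using M by simp
    then show ?thesis by (simp add: t_def)
  qed
  have \<theta>0: "\<theta> 0 = 0" by (simp add: \<theta>_def t_def)
  have "continuous_on UNIV \<theta>" unfolding \<theta>_def t_def using M by (intro continuous_intros) auto
  then have gB: "g \<in> B" unfolding g_def using k(1) \<theta>0 by (intro B_compose[of k \<theta>])
  have g0: "g p = 0" if "p \<notin> slice 0" for p using k(2)[OF that] \<theta>0 by (simp add: g_def)
  have star_g: "fstar g = g"
  proof
    fix p :: "'x \<times> 'x"
    obtain x y where p: "p = (x, y)" by fastforce
    show "fstar g p = g p"
    proof (cases "x = y")
      case True
      then show ?thesis by (simp add: p g_def \<theta>_def)
    next
      case False
      then have "g (x, y) = 0" "g (y, x) = 0" using g0 slice_0_diag by force+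
      then show ?thesis by (simp add: p)
    qed
  qed
  have gg: "conv (fstar g) g p = g p * g p" for p
  proof -
    have "g p = complex_of_real (1 - t (k p))" by (simp add: g_def \<theta>_def)
    then have "complex_of_real ((cmod (g p))\<^sup>2) = g p * g p"
      by (simp only: norm_of_real power2_eq_square abs_mult_self_eq of_real_mult)
    then show ?thesis using conv_star_unit[of g p] g0 by simp
  qed
  have gg_B: "conv (fstar g) g \<in> B" and kk_B: "conv (fstar k) k \<in> B"
    by (intro B_conv B_star gB k)+
  \<comment> \<open>This is \<open>1 - (1 - g)\<^sup>2 = \<bar>k\<bar>\<^sup>2 / M\<close> with the
    unit multiplied out, so that every term belongs to the algebra. The term \<open>0 * k p\<close>
    fills the second slot of \<open>inner_lin\<close>.\<close>
  have "(\<lambda>p. 2 * g p + (- 1) * conv (fstar g) g p) = (\<lambda>p. of_real (1 / M) * conv (fstar k) k p + 0 * k p)"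
  proof
    fix p
    have "2 * g p + (- 1) * conv (fstar g) g p = 1 - (complex_of_real (t (k p)))\<^sup>2"
      unfolding gg by (simp add: g_def \<theta>_def power2_eq_square algebra_simps)
    also have "\<dots> = of_real ((cmod (k p))\<^sup>2 / M)"
      by (simp add: t_sq flip: of_real_power)
    finally show "2 * g p + (- 1) * conv (fstar g) g p = of_real (1 / M) * conv (fstar k) k p + 0 * k p"
      using conv_star_unit[of k p] k(2) by simp
  qed
  then have "2 * inner_prod H (\<pi> g v) v + (- 1) * inner_prod H (\<pi> (conv (fstar g) g) v) v =
      of_real (1 / M) * inner_prod H (\<pi> (conv (fstar k) k) v) v + 0 * inner_prod H (\<pi> k v) v"
    unfolding inner_lin[OF gB gg_B v v, symmetric] inner_lin[OF kk_B k(1) v v, symmetric] by simp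
  from arg_cong[OF this, of Re]
  have "2 * Re (inner_prod H (\<pi> g v) v) - (vec_norm H (\<pi> g v))\<^sup>2 = (vec_norm H (\<pi> k v))\<^sup>2 / M"
    by (simp add: norm_sq_conv gB k(1) v)
  \<comment> \<open>The operator \<open>1 - \<pi> g\<close> exists on the Hilbert space although
    \<open>1 - g\<close> may be missing from the algebra; its positivity is used through this
    norm.\<close>
  moreover have "(vec_norm H (v \<oplus>\<^bsub>H\<^esub> (- 1) \<odot>\<^bsub>H\<^esub> \<pi> g v))\<^sup>2 =
      (vec_norm H v)\<^sup>2 - 2 * Re (inner_prod H (\<pi> g v) v) + (vec_norm H (\<pi> g v))\<^sup>2"
  proof -
    have c: "\<pi> g v \<in> carrier H" using gB v by simp
    have "Re (inner_prod H v (\<pi> g v)) = Re (inner_prod H (\<pi> g v) v)"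
      using H.inner_commute[OF c v] by simp
    then show ?thesis
      using c v by (simp add: H.vec_norm_add_sq H.inner_smult_right H.vec_norm_smult)
  qed
  ultimately have "(vec_norm H (\<pi> k v))\<^sup>2 / M \<le> (vec_norm H v)\<^sup>2"
    using zero_le_power2[of "vec_norm H (v \<oplus>\<^bsub>H\<^esub> (- 1) \<odot>\<^bsub>H\<^esub> \<pi> g v)"] by linarith
  then show ?thesis using M(1) by (simp add: field_simps)
qed

text \<open>A nonnegative function on the units is the product of its square root with itself, so
  the form is the square of a norm, to which \<open>unit_function_bound\<close> applies.\<close>

lemma unit_function_form_bound:
  assumes h: "h \<in> B" "\<And>p. p \<notin> slice 0 \<Longrightarrow> h p = 0" "\<And>p. h p = of_real (cmod (h p))"
    and M: "M > 0" "\<And>p. cmod (h p) \<le> M" and v: "v \<in> carrier H"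
  shows "Re (inner_prod H (\<pi> h v) v) \<le> M * (vec_norm H v)\<^sup>2"
proof -
  define k where "k p = complex_of_real (sqrt (cmod (h p)))" for p
  have k: "k \<in> B" unfolding k_def
    by (rule B_compose[OF h(1), of "\<lambda>z. complex_of_real (sqrt (cmod z))"]) (auto intro!: continuous_intros)
  have k0: "k p = 0" if "p \<notin> slice 0" for p using h(2)[OF that] by (simp add: k_def)
  have k_sq: "(cmod (k p))\<^sup>2 = cmod (h p)" for p by (simp add: k_def)
  have "conv (fstar k) k = h"
  proof
    fix p show "conv (fstar k) k p = h p"
      using conv_star_unit[of k p] k0 k_sq[of p] h(3)[of p] by simp
  qed
  then show ?thesis
    using unit_function_bound[OF k k0 M(1) _ v] norm_sq_conv[OF k v] M(2) by (simp add: k_sq)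
qed

text \<open>
  A Schur test: on each slice \<open>F = g b\<close> with \<open>\<bar>g\<bar>\<^sup>2 = \<bar>F\<bar>\<close> and \<open>b\<close> a function on the units,
  so that \<open>\<Sum> b\<^sup>* b\<close> and \<open>\<Sum> g g\<^sup>*\<close> are the column and row sums of \<open>\<bar>F\<bar>\<close>.
\<close>

theorem rep_Schur_bound:
  assumes F: "F \<in> B" and M: "M > 0"
    and row: "\<And>x. (\<Sum>\<^sub>\<infinity>y. cmod (F (x, y))) \<le> M" and col: "\<And>y. (\<Sum>\<^sub>\<infinity>x. cmod (F (x, y))) \<le> M"
    and v: "v \<in> carrier H"
  shows "vec_norm H (\<pi> F v) \<le> M * vec_norm H v"
proof -
  define N where "N = c ` {p. F p \<noteq> 0}"
  have FC: "F \<in> C0_fin" using F B_subset by blast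
  have N: "finite N" "\<And>p. F p \<noteq> 0 \<Longrightarrow> c p \<in> N" and F0: "\<And>p. p \<notin> topspace \<G> \<Longrightarrow> F p = 0"
    using C0_finD(2,3)[OF FC] by (auto simp: N_def)
  define s where "s = (\<lambda>z. complex_of_real (sqrt (cmod z)))"
  \<comment> \<open>The factorization \<open>z = \<theta> z * s z\<close> splits the modulus evenly,
    so that squaring the factors yields sums of \<open>cmod (F p)\<close> itself.\<close>
  define \<theta> where "\<theta> z = z / s z" for z
  define g where "g n p = \<theta> (on_slice n F p)" for n p
  define d where "d n = conv (fstar (g n)) (g n)" for n
  define e where "e n = conv (g n) (fstar (g n))" for n
  define b where "b n p = s (d n p)" for n p
  have s: "continuous_on UNIV s" "s 0 = 0" by (auto simp: s_def intro!: continuous_intros)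
  have \<theta>: "continuous_on UNIV \<theta>" "\<theta> 0 = 0"
    using continuous_half_power by (auto simp: \<theta>_def s_def)
  have \<theta>_sq: "(cmod (\<theta> z))\<^sup>2 = cmod z" "\<theta> z * s z = z" for z
    by (cases "z = 0"; simp add: \<theta>_def s_def norm_divide power_divide power2_eq_square)+
  have g: "g n \<in> B" for n unfolding g_def by (rule B_compose[OF B_on_slice[OF F] \<theta>])
  have gs: "fstar (g n) \<in> B" for n by (rule B_star[OF g])
  have d: "d n \<in> B" and e: "e n \<in> B" for n unfolding d_def e_def by (intro B_conv g gs)+
  have b: "b n \<in> B" for n unfolding b_def by (rule B_compose[OF d s])
  have g0: "g n p = 0" if "p \<notin> slice n" for n p using that by (simp add: g_def on_slice_outside \<theta>)
  have gs0: "fstar (g n) p = 0" if "p \<notin> slice (- n)" for n p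
    using g0[of "(snd p, fst p)" n] that slice_sym[of "snd p" "fst p" n] by (simp add: case_prod_beta)
  \<comment> \<open>Both \<open>d n\<close> and \<open>e n\<close> are supported by the units
    because a slice meets each row and column once: off the diagonal one of the two factors is
    0.\<close>
  have d_val: "d n (x, z) = (if x = z then of_real (cmod (on_slice n F (act n x, x))) else 0)" for n x z
  proof -
    have "d n (x, z) = cnj (g n (act n x, x)) * g n (act n x, z)"
      unfolding d_def using conv_on_slice[of "- n" "fstar (g n)" "g n" x z] gs0 by simp
    also have "\<dots> = (if x = z then of_real ((cmod (g n (act n x, x)))\<^sup>2) else 0)"
    proof (cases "x = z")
      case True
      then show ?thesis using complex_norm_square[of "g n (act n x, x)"] by (simp add: mult.commute)
    next
      case False
      then have "g n (act n x, x) = 0 \<or> g n (act n x, z) = 0"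
        using slice_unique' g0 by blast
      then show ?thesis using False by auto
    qed
    finally show ?thesis by (simp add: g_def \<theta>_sq)
  qed
  have e_val: "e n (x, z) = (if x = z then of_real (cmod (on_slice n F (x, act (- n) x))) else 0)" for n x z
  proof -
    have "e n (x, z) = g n (x, act (- n) x) * cnj (g n (z, act (- n) x))"
      unfolding e_def using conv_on_slice[of n "g n" "fstar (g n)" x z] g0 by simp
    also have "\<dots> = (if x = z then of_real ((cmod (g n (x, act (- n) x)))\<^sup>2) else 0)"
    proof (cases "x = z")
      case True
      then show ?thesis using complex_norm_square[of "g n (x, act (- n) x)"] by simp
    next
      case False
      then have "g n (x, act (- n) x) = 0 \<or> g n (z, act (- n) x) = 0"
        using slice_unique g0 by blast
      then show ?thesis using False by auto
    qed
    finally show ?thesis by (simp add: g_def \<theta>_sq)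
  qed
  have d0: "d n p = 0" and e0: "e n p = 0" if p: "p \<notin> slice 0" for n p
  proof -
    obtain x z where xz: "p = (x, z)" by fastforce
    have out: "(x, y) \<notin> slice m" "(y, x) \<notin> slice m" if "x = z" for y m
      using p slice_0[of x z] slice_subset units that unfolding xz by blast+
    show "d n p = 0" using d_val[of n x z] out by (auto simp: xz on_slice_outside)
    show "e n p = 0" using e_val[of n x z] out by (auto simp: xz on_slice_outside)
  qed
  have b0: "b n p = 0" if "p \<notin> slice 0" for n p using d0[OF that] s by (simp add: b_def)
  have gb: "conv (g n) (b n) = on_slice n F" for n
  proof
    fix p :: "'x \<times> 'x"
    obtain x z where xz: "p = (x, z)" by fastforce
    have eq: "conv (g n) (b n) (x, z) = g n (x, z) * s (on_slice n F (act n z, z))"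
      using conv_unit_right[of "b n" "g n" x z] b0 by (simp add: b_def d_val s_def)
    show "conv (g n) (b n) p = on_slice n F p"
    proof (cases "(x, z) \<in> slice n")
      case True
      then have "act n z = x" by (rule act_eq)
      then show ?thesis using eq xz \<theta>_sq(2) by (simp add: g_def)
    next
      case False
      then show ?thesis using eq xz g0 by (simp add: on_slice_outside)
    qed
  qed
  have bb: "conv (fstar (b n)) (b n) = d n" for n
  proof
    fix p :: "'x \<times> 'x"
    obtain x z where "p = (x, z)" by fastforce
    then show "conv (fstar (b n)) (b n) p = d n p"
      using conv_star_unit[of "b n" p] b0 d_val[of n x z] by (auto simp: b_def s_def)
  qed
  define w where "w = \<pi> F v"
  have w: "w \<in> carrier H" using F v by (simp add: w_def)
  have split: "F = (\<lambda>p. \<Sum>n\<in>N. on_slice n F p)"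
    using sum_on_slice[of N F "\<lambda>z. z"] N F0 by (simp add: fun_eq_iff)
  \<comment> \<open>Since \<open>on_slice n F\<close> is the convolution of \<open>g n\<close> with
    \<open>b n\<close>, the first factor can be moved to \<open>w\<close> as an adjoint. The
    absolute values match the form of \<open>L2_set_mult_ineq\<close>.\<close>
  have slice_le: "cmod (inner_prod H (\<pi> (on_slice n F) v) w) \<le>
      \<bar>vec_norm H (\<pi> (b n) v)\<bar> * \<bar>vec_norm H (\<pi> (fstar (g n)) w)\<bar>" for n
  proof -
    have bv: "\<pi> (b n) v \<in> carrier H" and gw: "\<pi> (fstar (g n)) w \<in> carrier H"
      using b gs v w by auto
    have "\<pi> (on_slice n F) v = \<pi> (g n) (\<pi> (b n) v)"
      using rep_mult[of "g n" "b n" v] g b v by (simp add: gb)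
    moreover have "fstar (fstar (g n)) = g n" by (auto simp: fun_eq_iff)
    ultimately have "inner_prod H (\<pi> (on_slice n F) v) w = inner_prod H (\<pi> (b n) v) (\<pi> (fstar (g n)) w)"
      using rep_adjoint[of "fstar (g n)" "\<pi> (b n) v" w] gs bv w by simp
    then show ?thesis using H.Cauchy_Schwarz[OF bv gw] bv gw by simp
  qed
  \<comment> \<open>The squared norms add up to a single quadratic form, that of the function on the
    units whose values are the column sums; in \<open>E\<close> they are the row sums.\<close>
  have D: "(\<Sum>n\<in>N. (vec_norm H (\<pi> (b n) v))\<^sup>2) \<le> M * (vec_norm H v)\<^sup>2"
  proof -
    define h where "h p = (\<Sum>n\<in>N. d n p)" for p
    have hB: "h \<in> B" unfolding h_def by (intro B_sum N d)
    have "(\<Sum>\<^sub>\<infinity>y. cmod (F (y, x))) = (\<Sum>n\<in>N. cmod (on_slice n F (act n x, x)))" for x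
      using N F0 by (intro col_sum) auto
    then have h_val: "h (x, z) = (if x = z then of_real (\<Sum>\<^sub>\<infinity>y. cmod (F (y, x))) else 0)" for x z
      by (simp add: h_def d_val)
    have nn: "0 \<le> (\<Sum>\<^sub>\<infinity>y. cmod (F (y, x)))" for x by (rule infsum_nonneg) simp
    have "(\<Sum>n\<in>N. (vec_norm H (\<pi> (b n) v))\<^sup>2) = Re (inner_prod H (\<pi> h v) v)"
      unfolding h_def inner_sum[OF N(1) d v v] by (simp add: norm_sq_conv[OF b v] bb)
    also have "\<dots> \<le> M * (vec_norm H v)\<^sup>2"
    proof (rule unit_function_form_bound[OF hB _ _ M _ v])
      fix p :: "'x \<times> 'x"
      obtain x z where xz: "p = (x, z)" by fastforce
      show "p \<notin> slice 0 \<Longrightarrow> h p = 0" by (simp add: h_def d0)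
      show "h p = of_real (cmod (h p))" "cmod (h p) \<le> M"
        using nn[of x] col[of x] M by (auto simp: xz h_val)
    qed
    finally show ?thesis .
  qed
  have E: "(\<Sum>n\<in>N. (vec_norm H (\<pi> (fstar (g n)) w))\<^sup>2) \<le> M * (vec_norm H w)\<^sup>2"
  proof -
    define h where "h p = (\<Sum>n\<in>N. e n p)" for p
    have hB: "h \<in> B" unfolding h_def by (intro B_sum N e)
    have "(\<Sum>\<^sub>\<infinity>y. cmod (F (x, y))) = (\<Sum>n\<in>N. cmod (on_slice n F (x, act (- n) x)))" for x
      using N F0 by (intro row_sum) auto
    then have h_val: "h (x, z) = (if x = z then of_real (\<Sum>\<^sub>\<infinity>y. cmod (F (x, y))) else 0)" for x z
      by (simp add: h_def e_val)
    have nn: "0 \<le> (\<Sum>\<^sub>\<infinity>y. cmod (F (x, y)))" for x by (rule infsum_nonneg) simp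
    have "fstar (fstar (g n)) = g n" for n by (auto simp: fun_eq_iff)
    then have "(\<Sum>n\<in>N. (vec_norm H (\<pi> (fstar (g n)) w))\<^sup>2) = Re (inner_prod H (\<pi> h w) w)"
      unfolding h_def inner_sum[OF N(1) e w w] by (simp add: norm_sq_conv[OF gs w] e_def)
    also have "\<dots> \<le> M * (vec_norm H w)\<^sup>2"
    proof (rule unit_function_form_bound[OF hB _ _ M _ w])
      fix p :: "'x \<times> 'x"
      obtain x z where xz: "p = (x, z)" by fastforce
      show "p \<notin> slice 0 \<Longrightarrow> h p = 0" by (simp add: h_def e0)
      show "h p = of_real (cmod (h p))" "cmod (h p) \<le> M"
        using nn[of x] row[of x] M by (auto simp: xz h_val)
    qed
    finally show ?thesis .
  qed
  \<comment> \<open>Testing against \<open>w = \<pi> F v\<close> itself bounds the square of its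
    norm by \<open>M\<close> times both norms, after which one factor \<open>vec_norm H w\<close>
    cancels.\<close>
  have "(vec_norm H w)\<^sup>2 = Re (inner_prod H (\<pi> F v) w)"
    using w by (simp add: H.vec_norm_sq w_def)
  also have "\<dots> \<le> cmod (inner_prod H (\<pi> F v) w)" by (rule complex_Re_le_cmod)
  also have "inner_prod H (\<pi> F v) w = (\<Sum>n\<in>N. inner_prod H (\<pi> (on_slice n F) v) w)"
    by (subst split) (rule inner_sum[OF N(1) B_on_slice[OF F] v w])
  also have "cmod \<dots> \<le> (\<Sum>n\<in>N. cmod (inner_prod H (\<pi> (on_slice n F) v) w))" by (rule norm_sum)
  also have "\<dots> \<le> (\<Sum>n\<in>N. \<bar>vec_norm H (\<pi> (b n) v)\<bar> * \<bar>vec_norm H (\<pi> (fstar (g n)) w)\<bar>)"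
    by (intro sum_mono slice_le)
  also have "\<dots> \<le> L2_set (\<lambda>n. vec_norm H (\<pi> (b n) v)) N * L2_set (\<lambda>n. vec_norm H (\<pi> (fstar (g n)) w)) N"
    by (rule L2_set_mult_ineq)
  also have "\<dots> \<le> sqrt (M * (vec_norm H v)\<^sup>2) * sqrt (M * (vec_norm H w)\<^sup>2)"
    unfolding L2_set_def using D E M
    by (intro mult_mono real_sqrt_le_mono) (auto intro!: real_sqrt_ge_zero sum_nonneg)
  also have "\<dots> = (M * vec_norm H v) * vec_norm H w"
    using M v w by (simp add: real_sqrt_mult)
  finally have "vec_norm H w * vec_norm H w \<le> (M * vec_norm H v) * vec_norm H w"
    by (simp add: power2_eq_square)
  then show ?thesis
    using M v H.vec_norm_nonneg[OF w] by (cases "vec_norm H w = 0") (auto simp flip: w_def)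
qed

end

context slice_representation
begin

text \<open>Each row and column has at most \<open>card N\<close> nonzero entries, one per slice.
  The bound involves the number of slices but not their size, and this makes uniform approximation
  effective.\<close>

lemma rep_uniform_bound:
  assumes F: "F \<in> B" and N: "finite N" "\<And>p. F p \<noteq> 0 \<Longrightarrow> c p \<in> N"
    and e: "\<And>p. cmod (F p) \<le> e" and v: "v \<in> carrier H"
  shows "vec_norm H (\<pi> F v) \<le> real (card N) * e * vec_norm H v"
proof (cases "\<exists>p. F p \<noteq> 0")
  \<comment> \<open>The Schur test asks for a strictly positive bound, so the zero function is
    treated apart.\<close>
  case True
  then obtain p where p: "F p \<noteq> 0" by blast
  then have "e > 0" using e[of p] by (meson norm_le_zero_iff not_le order_trans zero_less_norm_iff)
  moreover have "card N > 0" using N(1) N(2)[OF p] by (auto simp: card_gt_0_iff)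
  ultimately have M: "real (card N) * e > 0" by simp
  have F0: "\<And>p. p \<notin> topspace \<G> \<Longrightarrow> F p = 0" using C0_finD(3) F B_subset by blast
  have le: "cmod (on_slice n F p) \<le> e" for n p using e[of p] \<open>e > 0\<close> by (simp add: on_slice_def)
  have "(\<Sum>\<^sub>\<infinity>y. cmod (F (x, y))) \<le> real (card N) * e" for x
  proof -
    have "(\<Sum>\<^sub>\<infinity>y. cmod (F (x, y))) = (\<Sum>n\<in>N. cmod (on_slice n F (x, act (- n) x)))"
      using N F0 by (intro row_sum) auto
    also have "\<dots> \<le> real (card N) * e" by (rule sum_bounded_above[OF le])
    finally show ?thesis .
  qed
  moreover have "(\<Sum>\<^sub>\<infinity>x. cmod (F (x, y))) \<le> real (card N) * e" for y
  proof -
    have "(\<Sum>\<^sub>\<infinity>x. cmod (F (x, y))) = (\<Sum>n\<in>N. cmod (on_slice n F (act n y, y)))"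
      using N F0 by (intro col_sum) auto
    also have "\<dots> \<le> real (card N) * e" by (rule sum_bounded_above[OF le])
    finally show ?thesis .
  qed
  ultimately show ?thesis by (rule rep_Schur_bound[OF F M _ _ v])
next
  case False
  then have "F = (\<lambda>p. 0)" by auto
  moreover have "0 \<le> e" using e[of undefined] norm_ge_zero order_trans by blast
  ultimately show ?thesis using rep_zero[OF v] v by simp
qed

text \<open>The Schur test applies to any positive bound above the \<open>I\<close>-norm, hence the
  slack \<open>e\<close>. The crude bounds by \<open>card N * K\<close> ensure that the suprema in
  the \<open>I\<close>-norm are taken over bounded sets.\<close>

lemma rep_I_norm_bound:
  assumes F: "F \<in> B"
  shows "op_norm H (\<pi> F) \<le> nrm (Cc_algebra \<G>) F"
proof (rule field_le_epsilon)
  fix e :: real assume e: "e > 0"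
  have FC: "F \<in> C0_fin" using F B_subset by blast
  define N where "N = c ` {p. F p \<noteq> 0}"
  have N: "finite N" "\<And>p. F p \<noteq> 0 \<Longrightarrow> c p \<in> N" and F0: "\<And>p. p \<notin> topspace \<G> \<Longrightarrow> F p = 0"
    using C0_finD(2,3)[OF FC] by (auto simp: N_def)
  obtain K where K: "K > 0" "\<And>p. cmod (F p) \<le> K" by (rule C0_bounded[OF C0_finD(1)[OF FC]]) blast
  have le: "cmod (on_slice n F p) \<le> K" for n p using K by (simp add: on_slice_def less_imp_le)
  have row: "(\<Sum>\<^sub>\<infinity>y. cmod (F (x, y))) \<le> real (card N) * K" for x
  proof -
    have "(\<Sum>\<^sub>\<infinity>y. cmod (F (x, y))) = (\<Sum>n\<in>N. cmod (on_slice n F (x, act (- n) x)))"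
      using N F0 by (intro row_sum) auto
    also have "\<dots> \<le> real (card N) * K" by (rule sum_bounded_above[OF le])
    finally show ?thesis .
  qed
  have col: "(\<Sum>\<^sub>\<infinity>x. cmod (F (x, y))) \<le> real (card N) * K" for y
  proof -
    have "(\<Sum>\<^sub>\<infinity>x. cmod (F (x, y))) = (\<Sum>n\<in>N. cmod (on_slice n F (act n y, y)))"
      using N F0 by (intro col_sum) auto
    also have "\<dots> \<le> real (card N) * K" by (rule sum_bounded_above[OF le])
    finally show ?thesis .
  qed
  define I where "I = nrm (Cc_algebra \<G>) F"
  have I: "I = max (SUP x. \<Sum>\<^sub>\<infinity>y. cmod (F (x, y))) (SUP y. \<Sum>\<^sub>\<infinity>x. cmod (F (x, y)))"
    by (simp add: I_def Cc_algebra_def)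
  have rowI: "(\<Sum>\<^sub>\<infinity>y. cmod (F (x, y))) \<le> I" for x
    unfolding I by (rule max.coboundedI1, rule cSUP_upper) (auto intro: bdd_aboveI2 row)
  have colI: "(\<Sum>\<^sub>\<infinity>x. cmod (F (x, y))) \<le> I" for y
    unfolding I by (rule max.coboundedI2, rule cSUP_upper) (auto intro: bdd_aboveI2 col)
  have "0 \<le> (\<Sum>\<^sub>\<infinity>y. cmod (F (undefined, y)))" by (rule infsum_nonneg) simp
  then have I0: "0 \<le> I" using rowI[of undefined] by linarith
  have "op_norm H (\<pi> F) \<le> I + e"
  proof (rule H.op_norm_le)
    fix v assume v: "v \<in> carrier H"
    have "(\<Sum>\<^sub>\<infinity>y. cmod (F (x, y))) \<le> I + e" for x using rowI[of x] e by simp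
    moreover have "(\<Sum>\<^sub>\<infinity>x. cmod (F (x, y))) \<le> I + e" for y using colI[of y] e by simp
    ultimately show "vec_norm H (\<pi> F v) \<le> (I + e) * vec_norm H v"
      using I0 e by (intro rep_Schur_bound[OF F _ _ _ v]) auto
  qed (use I0 e in simp)
  then show "op_norm H (\<pi> F) \<le> nrm (Cc_algebra \<G>) F + e" by (simp add: I_def)
qed

end

subsection \<open>Extending representations from compact supports to vanishing at infinity\<close>

text \<open>This shortens \<open>z\<close> by \<open>e\<close> along its ray, down to 0; a sharp
  cutoff would destroy continuity. The denominator \<open>max e (cmod z)\<close> equals
  \<open>cmod z\<close> wherever the numerator is nonzero and, for \<open>e > 0\<close>, avoids
  division by 0.\<close>

definition soft_threshold :: "real \<Rightarrow> complex \<Rightarrow> complex" where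
  "soft_threshold e z = z * of_real (max 0 (cmod z - e) / max e (cmod z))"

lemma soft_threshold:
  assumes e: "e > 0"
  shows "continuous_on UNIV (soft_threshold e)" "soft_threshold e 0 = 0"
    "cmod (soft_threshold e z - z) \<le> e" "cmod z < e \<Longrightarrow> soft_threshold e z = 0"
proof -
  show "continuous_on UNIV (soft_threshold e)"
    unfolding soft_threshold_def[abs_def] using e by (intro continuous_intros) (auto simp: max_def)
  show "soft_threshold e 0 = 0" by (simp add: soft_threshold_def)
  show 0: "cmod z < e \<Longrightarrow> soft_threshold e z = 0" by (simp add: soft_threshold_def max_def)
  show "cmod (soft_threshold e z - z) \<le> e"
  proof (cases "cmod z < e")
    case True
    then show ?thesis using 0 by simp
  next
    case False
    then have z: "cmod z > 0" using e by linarith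
    have "soft_threshold e z - z = z * of_real (- (e / cmod z))"
      using False z by (simp add: soft_threshold_def max_def diff_divide_distrib algebra_simps)
    then have "cmod (soft_threshold e z - z) = cmod z * (e / cmod z)"
      using e z by (simp add: norm_mult norm_divide)
    then show ?thesis using z by simp
  qed
qed

context graded_groupoid
begin

abbreviation Cc :: "('x \<times> 'x \<Rightarrow> complex) set" where
  "Cc \<equiv> carrier (Cc_algebra \<G>)"

definition truncate :: "real \<Rightarrow> ('x \<times> 'x \<Rightarrow> complex) \<Rightarrow> 'x \<times> 'x \<Rightarrow> complex" where
  "truncate e F = (\<lambda>p. soft_threshold e (F p))"

text \<open>The truncated function lives on a level set of \<open>F\<close>, which is compact
  because \<open>F\<close> vanishes at infinity.\<close>

lemma truncate_Cc:
  assumes F: "F \<in> C0_fin" and e: "e > 0"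
  shows "truncate e F \<in> Cc"
proof -
  interpret C: slice_algebra \<G> c C0_fin by (rule slice_algebra_C0_fin)
  have "truncate e F \<in> C0_fin"
    unfolding truncate_def by (rule C.B_compose[OF F soft_threshold(1,2)[OF e]])
  moreover have "truncate e F p = 0" if "p \<notin> {p \<in> topspace \<G>. e \<le> cmod (F p)}" for p
    using that soft_threshold(2,4)[OF e] C0_finD(3)[OF F, of p] by (auto simp: truncate_def not_le)
  ultimately show ?thesis
    using C0D(3)[OF C0_finD(1)[OF F] e] Cc_iff by blast
qed

text \<open>Uniform convergence with all degrees in one finite set \<open>N\<close>. By
  \<open>rep_uniform_bound\<close> this forces the operators to converge.\<close>

definition approximates :: "(nat \<Rightarrow> 'x \<times> 'x \<Rightarrow> complex) \<Rightarrow> ('x \<times> 'x \<Rightarrow> complex) \<Rightarrow> bool" where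
  "approximates q F \<longleftrightarrow> (\<forall>k. q k \<in> Cc) \<and> F \<in> C0_fin \<and>
     (\<exists>N e. finite N \<and> e \<longlonglongrightarrow> (0::real) \<and> (\<forall>k p. q k p \<noteq> 0 \<longrightarrow> c p \<in> N) \<and>
        (\<forall>k p. cmod (q k p - F p) \<le> e k))"

lemma approximatesE:
  assumes "approximates q F"
  obtains N e where "\<And>k. q k \<in> Cc" "F \<in> C0_fin" "finite N" "e \<longlonglongrightarrow> (0::real)"
    "\<And>k p. q k p \<noteq> 0 \<Longrightarrow> c p \<in> N" "\<And>k p. cmod (q k p - F p) \<le> e k" "\<And>k. 0 \<le> e k"
proof -
  obtain N e where *: "\<And>k. q k \<in> Cc" "F \<in> C0_fin" "finite N" "e \<longlonglongrightarrow> (0::real)"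
    "\<And>k p. q k p \<noteq> 0 \<Longrightarrow> c p \<in> N" "\<And>k p. cmod (q k p - F p) \<le> e k"
    using assms unfolding approximates_def by blast
  have "0 \<le> e k" for k using *(6)[of k undefined] norm_ge_zero order_trans by blast
  then show thesis using that * by blast
qed

lemma approximatesI:
  assumes "\<And>k. q k \<in> Cc" "F \<in> C0_fin" "finite N" "e \<longlonglongrightarrow> (0::real)"
    "\<And>k p. q k p \<noteq> 0 \<Longrightarrow> c p \<in> N" "\<And>k p. cmod (q k p - F p) \<le> e k"
  shows "approximates q F"
  unfolding approximates_def using assms by blast

lemma approximates_truncate:
  assumes F: "F \<in> C0_fin"
  shows "approximates (\<lambda>k. truncate (1 / Suc k) F) F"
proof (rule approximatesI[OF truncate_Cc[OF F] F C0_finD(2)[OF F], of "\<lambda>k. 1 / Suc k"])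
  show "(\<lambda>k. 1 / real (Suc k)) \<longlonglongrightarrow> 0"
    using LIMSEQ_inverse_real_of_nat by (simp add: inverse_eq_divide)
  fix k p
  have pos: "1 / real (Suc k) > 0" by simp
  show "cmod (truncate (1 / real (Suc k)) F p - F p) \<le> 1 / real (Suc k)"
    unfolding truncate_def by (rule soft_threshold(3)[OF pos])
  show "c p \<in> c ` {p. F p \<noteq> 0}" if "truncate (1 / real (Suc k)) F p \<noteq> 0"
  proof -
    have "truncate (1 / real (Suc k)) F p = 0" if "F p = 0"
      unfolding truncate_def that by (rule soft_threshold(2)[OF pos])
    then show ?thesis using that by blast
  qed
qed simp

lemma approximates_const:
  assumes "F \<in> Cc"
  shows "approximates (\<lambda>k. F) F"
proof -
  have F: "F \<in> C0_fin" using assms Cc_iff by blast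
  show ?thesis
    by (rule approximatesI[OF assms F C0_finD(2)[OF F], of "\<lambda>k. 0"]) auto
qed

lemma approximates_add:
  assumes "approximates q F" "approximates r K"
  shows "approximates (\<lambda>k p. q k p + r k p) (\<lambda>p. F p + K p)"
proof -
  interpret C: slice_algebra \<G> c C0_fin by (rule slice_algebra_C0_fin)
  interpret D: slice_algebra \<G> c Cc by (rule slice_algebra_Cc)
  obtain N e where q: "\<And>k. q k \<in> Cc" "F \<in> C0_fin" "finite N" "e \<longlonglongrightarrow> (0::real)"
    "\<And>k p. q k p \<noteq> 0 \<Longrightarrow> c p \<in> N" "\<And>k p. cmod (q k p - F p) \<le> e k"
    using approximatesE[OF assms(1)] by metis
  obtain M d where r: "\<And>k. r k \<in> Cc" "K \<in> C0_fin" "finite M" "d \<longlonglongrightarrow> (0::real)"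
    "\<And>k p. r k p \<noteq> 0 \<Longrightarrow> c p \<in> M" "\<And>k p. cmod (r k p - K p) \<le> d k"
    using approximatesE[OF assms(2)] by metis
  show ?thesis
  proof (rule approximatesI)
    show "(\<lambda>k. e k + d k) \<longlonglongrightarrow> 0" using tendsto_add[OF q(4) r(4)] by simp
    show "finite (N \<union> M)" using q(3) r(3) by simp
    fix k p
    show "c p \<in> N \<union> M" if "q k p + r k p \<noteq> 0"
    proof -
      have "q k p \<noteq> 0 \<or> r k p \<noteq> 0" using that by auto
      then show ?thesis using q(5) r(5) by blast
    qed
    show "cmod (q k p + r k p - (F p + K p)) \<le> e k + d k"
      unfolding add_diff_add by (rule norm_triangle_le[OF add_mono[OF q(6) r(6)]])
  qed (use C.B_add D.B_add q r in auto)
qed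

lemma approximates_smult:
  assumes "approximates q F"
  shows "approximates (\<lambda>k p. a * q k p) (\<lambda>p. a * F p)"
proof -
  interpret C: slice_algebra \<G> c C0_fin by (rule slice_algebra_C0_fin)
  interpret D: slice_algebra \<G> c Cc by (rule slice_algebra_Cc)
  obtain N e where q: "\<And>k. q k \<in> Cc" "F \<in> C0_fin" "finite N" "e \<longlonglongrightarrow> (0::real)"
    "\<And>k p. q k p \<noteq> 0 \<Longrightarrow> c p \<in> N" "\<And>k p. cmod (q k p - F p) \<le> e k"
    using approximatesE[OF assms(1)] by metis
  show ?thesis
  proof (rule approximatesI[OF _ _ q(3)])
    show "(\<lambda>k. cmod a * e k) \<longlonglongrightarrow> 0" using tendsto_mult_right_zero[OF q(4)] by simp
    show "cmod (a * q k p - a * F p) \<le> cmod a * e k" for k p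
      using q(6)[of k p] by (simp add: norm_mult mult_left_mono flip: right_diff_distrib)
    show "c p \<in> N" if "a * q k p \<noteq> 0" for k p using that q(5)[of k p] by simp
  qed (use C.B_smult D.B_smult q in auto)
qed

lemma approximates_star:
  assumes "approximates q F"
  shows "approximates (\<lambda>k. fstar (q k)) (fstar F)"
proof -
  interpret C: slice_algebra \<G> c C0_fin by (rule slice_algebra_C0_fin)
  interpret D: slice_algebra \<G> c Cc by (rule slice_algebra_Cc)
  obtain N e where q: "\<And>k. q k \<in> Cc" "F \<in> C0_fin" "finite N" "e \<longlonglongrightarrow> (0::real)"
    "\<And>k p. q k p \<noteq> 0 \<Longrightarrow> c p \<in> N" "\<And>k p. cmod (q k p - F p) \<le> e k"
    using approximatesE[OF assms(1)] by metis
  show ?thesis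
  proof (rule approximatesI[OF _ _ _ q(4)])
    show "finite (uminus ` N)" using q(3) by simp
    fix k and p :: "'x \<times> 'x"
    obtain x y where p: "p = (x, y)" by fastforce
    show "cmod (fstar (q k) p - fstar F p) \<le> e k"
      using q(6)[of k "(y, x)"] unfolding p by (simp flip: complex_cnj_diff)
    assume "fstar (q k) p \<noteq> 0"
    then have nz: "q k (y, x) \<noteq> 0" by (simp add: p)
    moreover have "q k \<in> C0_fin" using q(1) Cc_iff by blast
    ultimately have "(y, x) \<in> topspace \<G>" using C0_finD(3) by blast
    then have "c p = - c (y, x)" using c_sym by (simp add: p)
    then show "c p \<in> uminus ` N" using q(5)[OF nz] by blast
  qed (use C.B_star D.B_star q in auto)
qed

text \<open>The usual estimate for products, from \<open>q r - F K = q (r - K) + (q - F) K\<close>,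
  in which each entry of a convolution is a sum of at most \<open>card N\<close> terms.\<close>

lemma approximates_conv:
  assumes "approximates q F" "approximates r K"
  shows "approximates (\<lambda>k. conv (q k) (r k)) (conv F K)"
proof -
  obtain N0 e where q: "\<And>k. q k \<in> Cc" "F \<in> C0_fin" "finite N0" "e \<longlonglongrightarrow> (0::real)"
    "\<And>k p. q k p \<noteq> 0 \<Longrightarrow> c p \<in> N0" "\<And>k p. cmod (q k p - F p) \<le> e k" "\<And>k. 0 \<le> e k"
    using approximatesE[OF assms(1)] by metis
  obtain M d where r: "\<And>k. r k \<in> Cc" "K \<in> C0_fin" "finite M" "d \<longlonglongrightarrow> (0::real)"
    "\<And>k p. r k p \<noteq> 0 \<Longrightarrow> c p \<in> M" "\<And>k p. cmod (r k p - K p) \<le> d k" "\<And>k. 0 \<le> d k"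
    using approximatesE[OF assms(2)] by metis
  define N where "N = N0 \<union> c ` {p. F p \<noteq> 0}"
  have N: "finite N" using q(3) C0_finD(2)[OF q(2)] by (simp add: N_def)
  have qC: "q k \<in> C0_fin" and rC: "r k \<in> C0_fin" for k using q(1) r(1) Cc_iff by blast+
  have qN: "c p \<in> N" if "q k p \<noteq> 0" for k p using q(5)[OF that] by (simp add: N_def)
  have FN: "c p \<in> N" if "F p \<noteq> 0" for p using that by (simp add: N_def)
  obtain L where L: "L > 0" "\<And>p. cmod (F p) \<le> L" by (rule C0_bounded[OF C0_finD(1)[OF q(2)]]) blast
  obtain L' where L': "L' > 0" "\<And>p. cmod (K p) \<le> L'" by (rule C0_bounded[OF C0_finD(1)[OF r(2)]]) blast
  show ?thesis
  proof (rule approximatesI)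
    show "conv (q k) (r k) \<in> Cc" for k by (rule Cc_conv[OF q(1) r(1)])
    show "conv F K \<in> C0_fin" by (rule C0_fin_conv[OF q(2) r(2)])
    show "finite ((\<lambda>(n, m). n + m) ` (N0 \<times> M))" using q(3) r(3) by simp
    have "(\<lambda>k. real (card N) * ((L + e k) * d k + e k * L')) \<longlonglongrightarrow> real (card N) * ((L + 0) * 0 + 0 * L')"
      by (intro tendsto_intros q r)
    then show "(\<lambda>k. real (card N) * ((L + e k) * d k + e k * L')) \<longlonglongrightarrow> 0" by simp
    fix k and p :: "'x \<times> 'x"
    obtain x z where xz: "p = (x, z)" by fastforce
    show "c p \<in> (\<lambda>(n, m). n + m) ` (N0 \<times> M)" if "conv (q k) (r k) p \<noteq> 0"
    proof -
      have nz: "conv (q k) (r k) (x, z) \<noteq> 0" using that xz by simp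
      obtain y where y: "q k (x, y) \<noteq> 0" "r k (y, z) \<noteq> 0"
        by (rule conv_support[OF C0_fin_row_col[OF qC] nz]) blast
      then have "c (x, z) = c (x, y) + c (y, z)"
        using C0_finD(3)[OF qC] C0_finD(3)[OF rC] by (intro c_trans) blast+
      then show ?thesis using q(5)[OF y(1)] r(5)[OF y(2)] xz by force
    qed
    \<comment> \<open>One index set serves both convolutions: \<open>N\<close> contains the degrees
      of \<open>F\<close> as well as of all \<open>q k\<close>, so \<open>A\<close> covers row
      \<open>x\<close> of either left factor.\<close>
    define A where "A = (\<lambda>n. act (- n) x) ` N"
    have A: "finite A" "card A \<le> card N" using N by (auto simp: A_def card_image_le)
    have mem: "y \<in> A" if "G \<in> C0_fin" "G (x, y) \<noteq> 0" "c (x, y) \<in> N" for G y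
    proof -
      have "(x, y) \<in> slice (c (x, y))" using C0_finD(3)[OF that(1)] that(2) mem_slice_c by blast
      then have "y = act (- c (x, y)) x" using slice_dom by metis
      then show ?thesis using that(3) unfolding A_def by blast
    qed
    have "conv (q k) (r k) (x, z) = (\<Sum>y\<in>A. q k (x, y) * r k (y, z))"
      by (rule conv_row[OF A(1)]) (use mem[OF qC] qN in blast)
    moreover have "conv F K (x, z) = (\<Sum>y\<in>A. F (x, y) * K (y, z))"
      by (rule conv_row[OF A(1)]) (use mem[OF q(2)] FN in blast)
    ultimately have "conv (q k) (r k) p - conv F K p =
        (\<Sum>y\<in>A. q k (x, y) * r k (y, z) - F (x, y) * K (y, z))"
      by (simp add: xz sum_subtractf)
    also have "cmod \<dots> \<le> real (card A) * ((L + e k) * d k + e k * L')"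
    proof (rule order_trans[OF norm_sum sum_bounded_above])
      fix y
      have "cmod (q k (x, y)) \<le> L + e k"
        using norm_triangle_ineq[of "F (x, y)" "q k (x, y) - F (x, y)"] L(2)[of "(x, y)"] q(6)[of k "(x, y)"] by simp
      then have "cmod (q k (x, y) * (r k (y, z) - K (y, z))) \<le> (L + e k) * d k"
        unfolding norm_mult using r(6) L(1) q(7)[of k] by (intro mult_mono) auto
      moreover have "cmod ((q k (x, y) - F (x, y)) * K (y, z)) \<le> e k * L'"
        unfolding norm_mult using q(6,7) L'(2) by (intro mult_mono) auto
      moreover have "q k (x, y) * r k (y, z) - F (x, y) * K (y, z) =
          q k (x, y) * (r k (y, z) - K (y, z)) + (q k (x, y) - F (x, y)) * K (y, z)"
        by (simp add: algebra_simps)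
      ultimately show "cmod (q k (x, y) * r k (y, z) - F (x, y) * K (y, z)) \<le> (L + e k) * d k + e k * L'"
        using norm_triangle_ineq[of "q k (x, y) * (r k (y, z) - K (y, z))" "(q k (x, y) - F (x, y)) * K (y, z)"]
        by simp
    qed
    also have "\<dots> \<le> real (card N) * ((L + e k) * d k + e k * L')"
      using A(2) L(1) L'(1) q(7)[of k] r(7)[of k] by (intro mult_right_mono) auto
    finally show "cmod (conv (q k) (r k) p - conv F K p) \<le> real (card N) * ((L + e k) * d k + e k * L')" .
  qed
qed

end

locale Cc_representation = slice_representation \<G> c "carrier (Cc_algebra \<G>)" H \<pi>
  for \<G> :: "('x \<times> 'x) topology" and c and H :: "('h, 'n) inner_product_space_scheme" and \<pi>
begin

lemma approximates_bounded:
  assumes "approximates q F"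
  obtains C where "0 \<le> C" "\<And>k v. v \<in> carrier H \<Longrightarrow> vec_norm H (\<pi> (q k) v) \<le> C * vec_norm H v"
proof -
  obtain N e where q: "\<And>k. q k \<in> Cc" "F \<in> C0_fin" "finite N" "e \<longlonglongrightarrow> (0::real)"
    "\<And>k p. q k p \<noteq> 0 \<Longrightarrow> c p \<in> N" "\<And>k p. cmod (q k p - F p) \<le> e k" "\<And>k. 0 \<le> e k"
    using approximatesE[OF assms(1)] by metis
  obtain L where L: "L > 0" "\<And>p. cmod (F p) \<le> L" by (rule C0_bounded[OF C0_finD(1)[OF q(2)]]) blast
  have "Bseq e" using q(4) by (intro convergent_imp_Bseq convergentI)
  then obtain E where E: "E > 0" "\<And>k. e k \<le> E" by (auto elim!: BseqE) (metis abs_le_D1)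
  show thesis
  proof (rule that)
    show "0 \<le> real (card N) * (L + E)" using L(1) E(1) by simp
    fix k v assume v: "v \<in> carrier H"
    have "cmod (q k p) \<le> L + E" for p
      using norm_triangle_ineq[of "F p" "q k p - F p"] L(2)[of p] q(6)[of k p] E(2)[of k] by simp
    then show "vec_norm H (\<pi> (q k) v) \<le> real (card N) * (L + E) * vec_norm H v"
      using q(5) by (intro rep_uniform_bound[OF q(1) q(3) _ _ v]) auto
  qed
qed

text \<open>With \<open>r = q\<close> this says that the vectors form a Cauchy sequence; with
  different sequences it says that the limit depends on \<open>F\<close> alone.\<close>

lemma approximates_close:
  assumes "approximates q F" "approximates r F" and v: "v \<in> carrier H"
  obtains e where "e \<longlonglongrightarrow> (0::real)"
    "\<And>k l. vec_norm H (\<pi> (q k) v \<ominus>\<^bsub>H\<^esub> \<pi> (r l) v) \<le> e k + e l"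
proof -
  obtain N e where q: "\<And>k. q k \<in> Cc" "F \<in> C0_fin" "finite N" "e \<longlonglongrightarrow> (0::real)"
    "\<And>k p. q k p \<noteq> 0 \<Longrightarrow> c p \<in> N" "\<And>k p. cmod (q k p - F p) \<le> e k" "\<And>k. 0 \<le> e k"
    using approximatesE[OF assms(1)] by metis
  obtain M d where r: "\<And>k. r k \<in> Cc" "F \<in> C0_fin" "finite M" "d \<longlonglongrightarrow> (0::real)"
    "\<And>k p. r k p \<noteq> 0 \<Longrightarrow> c p \<in> M" "\<And>k p. cmod (r k p - F p) \<le> d k" "\<And>k. 0 \<le> d k"
    using approximatesE[OF assms(2)] by metis
  \<comment> \<open>Adding the two errors lets a single sequence bound both indices.\<close>
  define f where "f k = real (card (N \<union> M)) * (e k + d k) * vec_norm H v" for k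
  show thesis
  proof (rule that)
    have "f \<longlonglongrightarrow> real (card (N \<union> M)) * (0 + 0) * vec_norm H v"
      unfolding f_def by (intro tendsto_intros q r)
    then show "f \<longlonglongrightarrow> 0" by simp
    fix k l
    define g where "g = (\<lambda>p. q k p + (- 1) * r l p)"
    have g: "g \<in> Cc" unfolding g_def by (intro B_add B_smult q r)
    have "\<pi> g v = \<pi> (q k) v \<ominus>\<^bsub>H\<^esub> \<pi> (r l) v"
      unfolding g_def
      using rep_add[of "q k" "\<lambda>p. (- 1) * r l p" v] rep_smult[of "r l" v "- 1"] B_smult[OF r(1), of "- 1" l] q(1) r(1) v
      by (simp add: H.diff_eq_smult)
    moreover have "vec_norm H (\<pi> g v) \<le> real (card (N \<union> M)) * (e k + d l) * vec_norm H v"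
    proof (rule rep_uniform_bound[OF g _ _ _ v])
      show "finite (N \<union> M)" using q r by simp
      show "c p \<in> N \<union> M" if "g p \<noteq> 0" for p
      proof -
        have "q k p \<noteq> 0 \<or> r l p \<noteq> 0" using that by (auto simp: g_def)
        then show ?thesis using q(5) r(5) by blast
      qed
      have "g p = (q k p - F p) - (r l p - F p)" for p by (simp add: g_def)
      then show "cmod (g p) \<le> e k + d l" for p
        using norm_triangle_ineq4[of "q k p - F p" "r l p - F p"] q(6)[of k p] r(6)[of l p] by simp
    qed
    moreover have "real (card (N \<union> M)) * (e k + d l) * vec_norm H v \<le> f k + f l"
    proof -
      have "e k + d l \<le> (e k + d k) + (e l + d l)" using q(7)[of l] r(7)[of k] by simp
      then have "real (card (N \<union> M)) * (e k + d l) * vec_norm H v \<le>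
          real (card (N \<union> M)) * ((e k + d k) + (e l + d l)) * vec_norm H v"
        using v by (intro mult_right_mono mult_left_mono) auto
      then show ?thesis by (simp add: f_def algebra_simps)
    qed
    ultimately show "vec_norm H (\<pi> (q k) v \<ominus>\<^bsub>H\<^esub> \<pi> (r l) v) \<le> f k + f l" by simp
  qed
qed

definition extension :: "('x \<times> 'x \<Rightarrow> complex) \<Rightarrow> 'h \<Rightarrow> 'h" where
  "extension F v = (THE w. vlim H (\<lambda>k. \<pi> (truncate (1 / Suc k) F) v) w)"

text \<open>Truncations fix the definition, but any approximating sequence computes the extension. A
  product of truncations need not be a truncation of the product, so the homomorphism laws rest on
  this freedom.\<close>

lemma extension_vlim:
  assumes q: "approximates q F" and v: "v \<in> carrier H"
  shows "vlim H (\<lambda>k. \<pi> (q k) v) (extension F v)"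
proof -
  define r where "r = (\<lambda>k. truncate (1 / real (Suc k)) F)"
  have F: "F \<in> C0_fin" and qC: "\<And>k. q k \<in> Cc" using q by (auto simp: approximates_def)
  have r: "approximates r F" unfolding r_def by (rule approximates_truncate[OF F])
  then have rC: "\<And>k. r k \<in> Cc" by (simp add: approximates_def)
  obtain e where e: "e \<longlonglongrightarrow> (0::real)" "\<And>k l. vec_norm H (\<pi> (r k) v \<ominus>\<^bsub>H\<^esub> \<pi> (r l) v) \<le> e k + e l"
    by (rule approximates_close[OF r r v]) blast
  have "vcauchy H (\<lambda>k. \<pi> (r k) v)"
    unfolding vcauchy_def
  proof (intro conjI allI impI)
    fix d :: real assume "d > 0"
    then obtain K where K: "\<And>k. k \<ge> K \<Longrightarrow> e k < d / 2"
      using order_tendstoD(2)[OF e(1), of "d / 2"] unfolding eventually_sequentially by auto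
    have "vec_norm H (\<pi> (r k) v \<ominus>\<^bsub>H\<^esub> \<pi> (r l) v) < d" if "k \<ge> K" "l \<ge> K" for k l
      using e(2)[of k l] K[OF that(1)] K[OF that(2)] by simp
    then show "\<exists>K. \<forall>k\<ge>K. \<forall>l\<ge>K. vec_norm H (\<pi> (r k) v \<ominus>\<^bsub>H\<^esub> \<pi> (r l) v) < d" by blast
  qed (use rC v in auto)
  then obtain w where w: "vlim H (\<lambda>k. \<pi> (r k) v) w" using H.vcauchy_vlim by blast
  then have ext: "extension F v = w"
    unfolding extension_def r_def by (rule the_equality) (use w H.vlim_unique r_def in blast)
  obtain d where d: "d \<longlonglongrightarrow> (0::real)" "\<And>k l. vec_norm H (\<pi> (q k) v \<ominus>\<^bsub>H\<^esub> \<pi> (r l) v) \<le> d k + d l"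
    by (rule approximates_close[OF q r v]) blast
  have wc: "w \<in> carrier H" using w by (simp add: vlim_def)
  have lim0: "(\<lambda>k. vec_norm H (\<pi> (r k) v \<ominus>\<^bsub>H\<^esub> w)) \<longlonglongrightarrow> 0" using w by (simp add: vlim_def)
  have "vlim H (\<lambda>k. \<pi> (q k) v) w"
  proof (rule H.vlimI)
    show "vec_norm H (\<pi> (q k) v \<ominus>\<^bsub>H\<^esub> w) \<le> (d k + d k) + vec_norm H (\<pi> (r k) v \<ominus>\<^bsub>H\<^esub> w)" for k
      using H.vec_norm_diff_triangle[of "\<pi> (q k) v" "\<pi> (r k) v" w] d(2)[of k k] qC rC v wc by simp
    show "(\<lambda>k. (d k + d k) + vec_norm H (\<pi> (r k) v \<ominus>\<^bsub>H\<^esub> w)) \<longlonglongrightarrow> 0"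
      using tendsto_add[OF tendsto_add[OF d(1) d(1)] lim0] by simp
  qed (use qC v wc in auto)
  then show ?thesis unfolding ext .
qed

lemma extension_closed: "\<lbrakk>F \<in> C0_fin; v \<in> carrier H\<rbrakk> \<Longrightarrow> extension F v \<in> carrier H"
  using extension_vlim[OF approximates_truncate] H.vlim_closed by blast

lemma extension_eq:
  assumes F: "F \<in> Cc" and v: "v \<in> carrier H"
  shows "extension F v = \<pi> F v"
  by (rule H.vlim_unique[OF extension_vlim[OF approximates_const[OF F] v] H.vlim_const[OF rep_closed]])
     (use F v in simp_all)

lemma representation_extension: "representation (fun_algebra C0_fin \<G>) H extension"
proof -
  interpret C: slice_algebra \<G> c C0_fin by (rule slice_algebra_C0_fin)
  define q where "q F k = truncate (1 / real (Suc k)) F" for F k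
  have q: "approximates (q F) F" if "F \<in> C0_fin" for F
    unfolding q_def[abs_def] by (rule approximates_truncate[OF that])
  have qC: "q F k \<in> Cc" if "F \<in> C0_fin" for F k using q[OF that] by (simp add: approximates_def)
  have lim: "vlim H (\<lambda>k. \<pi> (q F k) v) (extension F v)" if "F \<in> C0_fin" "v \<in> carrier H" for F v
    by (rule extension_vlim[OF q[OF that(1)] that(2)])
  have bounded: "\<exists>C. \<forall>v\<in>carrier H. vec_norm H (extension F v) \<le> C * vec_norm H v" if F: "F \<in> C0_fin" for F
  proof -
    obtain C where C: "0 \<le> C" "\<And>k v. v \<in> carrier H \<Longrightarrow> vec_norm H (\<pi> (q F k) v) \<le> C * vec_norm H v"
      by (rule approximates_bounded[OF q[OF F]]) blast
    have "vec_norm H (extension F v) \<le> C * vec_norm H v" if v: "v \<in> carrier H" for v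
      by (rule LIMSEQ_le_const2[OF H.vlim_norm[OF lim[OF F v]]]) (use C(2)[OF v] in blast)
    then show ?thesis by blast
  qed
  have bop: "bounded_operator H (extension F)" if F: "F \<in> C0_fin" for F
    unfolding bounded_operator_def
  proof (intro conjI ballI allI)
    show "extension F \<in> carrier H \<rightarrow> carrier H" using extension_closed[OF F] by blast
    show "\<exists>C. \<forall>v\<in>carrier H. vec_norm H (extension F v) \<le> C * vec_norm H v" by (rule bounded[OF F])
    fix v assume v: "v \<in> carrier H"
    show "extension F (a \<odot>\<^bsub>H\<^esub> v) = a \<odot>\<^bsub>H\<^esub> extension F v" for a
    proof (rule H.vlim_unique[OF lim[OF F]])
      show "vlim H (\<lambda>k. \<pi> (q F k) (a \<odot>\<^bsub>H\<^esub> v)) (a \<odot>\<^bsub>H\<^esub> extension F v)"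
        using H.vlim_smult[OF lim[OF F v], of a] H.bounded_operatorD(3)[OF rep_bounded] qC[OF F] v by simp
    qed (use v in simp)
    fix w assume w: "w \<in> carrier H"
    show "extension F (v \<oplus>\<^bsub>H\<^esub> w) = extension F v \<oplus>\<^bsub>H\<^esub> extension F w"
    proof (rule H.vlim_unique[OF lim[OF F]])
      show "vlim H (\<lambda>k. \<pi> (q F k) (v \<oplus>\<^bsub>H\<^esub> w)) (extension F v \<oplus>\<^bsub>H\<^esub> extension F w)"
        using H.vlim_add[OF lim[OF F v] lim[OF F w]] H.bounded_operatorD(2)[OF rep_bounded] qC[OF F] v w by simp
    qed (use v w in simp)
  qed
  \<comment> \<open>Operators and vectors vary together; the uniform bound \<open>C\<close> on the
    operators \<open>\<pi> (q F k)\<close> lets the limit of the vectors be taken first.\<close>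
  have mult: "extension (conv F K) v = extension F (extension K v)"
    if F: "F \<in> C0_fin" and K: "K \<in> C0_fin" and v: "v \<in> carrier H" for F K v
  proof (rule H.vlim_unique[OF extension_vlim[OF approximates_conv[OF q[OF F] q[OF K]] v]])
    let ?w = "extension K v"
    have w: "?w \<in> carrier H" by (rule extension_closed[OF K v])
    obtain C where C: "0 \<le> C" "\<And>k v. v \<in> carrier H \<Longrightarrow> vec_norm H (\<pi> (q F k) v) \<le> C * vec_norm H v"
      by (rule approximates_bounded[OF q[OF F]]) blast
    have Kv: "\<pi> (q K k) v \<in> carrier H" for k using qC[OF K] v by simp
    have e1: "(\<lambda>k. vec_norm H (\<pi> (q K k) v \<ominus>\<^bsub>H\<^esub> ?w)) \<longlonglongrightarrow> 0"
      using lim[OF K v] by (simp add: vlim_def)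
    have e2: "(\<lambda>k. vec_norm H (\<pi> (q F k) ?w \<ominus>\<^bsub>H\<^esub> extension F ?w)) \<longlonglongrightarrow> 0"
      using lim[OF F w] by (simp add: vlim_def)
    have conv_eq: "\<pi> (conv (q F k) (q K k)) v = \<pi> (q F k) (\<pi> (q K k) v)" for k
      using rep_mult[of "q F k" "q K k" v] qC F K v by simp
    show "vlim H (\<lambda>k. \<pi> (conv (q F k) (q K k)) v) (extension F ?w)"
      unfolding conv_eq
    proof (rule H.vlimI)
      show "\<pi> (q F k) (\<pi> (q K k) v) \<in> carrier H" for k using qC[OF F] Kv by simp
      show "extension F ?w \<in> carrier H" by (rule extension_closed[OF F w])
      show "vec_norm H (\<pi> (q F k) (\<pi> (q K k) v) \<ominus>\<^bsub>H\<^esub> extension F ?w) \<le>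
          C * vec_norm H (\<pi> (q K k) v \<ominus>\<^bsub>H\<^esub> ?w) + vec_norm H (\<pi> (q F k) ?w \<ominus>\<^bsub>H\<^esub> extension F ?w)" for k
      proof -
        have "\<pi> (q F k) (\<pi> (q K k) v) \<ominus>\<^bsub>H\<^esub> \<pi> (q F k) ?w = \<pi> (q F k) (\<pi> (q K k) v \<ominus>\<^bsub>H\<^esub> ?w)"
          using H.bounded_operator_diff[OF rep_bounded] qC[OF F] Kv w by simp
        then have "vec_norm H (\<pi> (q F k) (\<pi> (q K k) v) \<ominus>\<^bsub>H\<^esub> \<pi> (q F k) ?w) \<le> C * vec_norm H (\<pi> (q K k) v \<ominus>\<^bsub>H\<^esub> ?w)"
          using C(2)[of "\<pi> (q K k) v \<ominus>\<^bsub>H\<^esub> ?w" k] Kv w by simp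
        then show ?thesis
          using H.vec_norm_diff_triangle[of "\<pi> (q F k) (\<pi> (q K k) v)" "\<pi> (q F k) ?w" "extension F ?w"]
            qC[OF F] Kv w extension_closed[OF F w] by simp
      qed
      show "(\<lambda>k. C * vec_norm H (\<pi> (q K k) v \<ominus>\<^bsub>H\<^esub> ?w) + vec_norm H (\<pi> (q F k) ?w \<ominus>\<^bsub>H\<^esub> extension F ?w)) \<longlonglongrightarrow> 0"
        using tendsto_add[OF tendsto_mult_right_zero[OF e1] e2] by simp
    qed
  qed
  have add: "extension (\<lambda>p. F p + K p) v = extension F v \<oplus>\<^bsub>H\<^esub> extension K v"
    if F: "F \<in> C0_fin" and K: "K \<in> C0_fin" and v: "v \<in> carrier H" for F K v
  proof (rule H.vlim_unique[OF extension_vlim[OF approximates_add[OF q[OF F] q[OF K]] v]])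
    have "\<pi> (\<lambda>p. q F k p + q K k p) v = \<pi> (q F k) v \<oplus>\<^bsub>H\<^esub> \<pi> (q K k) v" for k
      using rep_add[of "q F k" "q K k" v] qC F K v by simp
    then show "vlim H (\<lambda>k. \<pi> (\<lambda>p. q F k p + q K k p) v) (extension F v \<oplus>\<^bsub>H\<^esub> extension K v)"
      using H.vlim_add[OF lim[OF F v] lim[OF K v]] by simp
  qed
  have smult: "extension (\<lambda>p. a * F p) v = a \<odot>\<^bsub>H\<^esub> extension F v"
    if F: "F \<in> C0_fin" and v: "v \<in> carrier H" for a F v
  proof (rule H.vlim_unique[OF extension_vlim[OF approximates_smult[OF q[OF F]] v]])
    have "\<pi> (\<lambda>p. a * q F k p) v = a \<odot>\<^bsub>H\<^esub> \<pi> (q F k) v" for k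
      using rep_smult[of "q F k" v a] qC F v by simp
    then show "vlim H (\<lambda>k. \<pi> (\<lambda>p. a * q F k p) v) (a \<odot>\<^bsub>H\<^esub> extension F v)"
      using H.vlim_smult[OF lim[OF F v], of a] by simp
  qed
  have adj: "inner_prod H (extension (fstar F) v) w = inner_prod H v (extension F w)"
    if F: "F \<in> C0_fin" and v: "v \<in> carrier H" and w: "w \<in> carrier H" for F v w
  proof (rule LIMSEQ_unique)
    show "(\<lambda>k. inner_prod H (\<pi> (fstar (q F k)) v) w) \<longlonglongrightarrow> inner_prod H (extension (fstar F) v) w"
      by (rule H.vlim_inner[OF extension_vlim[OF approximates_star[OF q[OF F]] v] w])
    have "inner_prod H (\<pi> (fstar (q F k)) v) w = inner_prod H v (\<pi> (q F k) w)" for k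
      using rep_adjoint[of "q F k" v w] qC F v w by simp
    then show "(\<lambda>k. inner_prod H (\<pi> (fstar (q F k)) v) w) \<longlonglongrightarrow> inner_prod H v (extension F w)"
      using H.vlim_inner_right[OF lim[OF F w] v] by simp
  qed
  show ?thesis
    unfolding representation_def
    using bop mult add smult adj H.hilbert_space_axioms by simp
qed

end

section \<open>The crossed product and the groupoid algebra\<close>

lemma representation_comp:
  assumes rep: "representation Q H \<pi>"
    and j: "\<And>x. x \<in> carrier P \<Longrightarrow> j x \<in> carrier Q"
      "\<And>x y. \<lbrakk>x \<in> carrier P; y \<in> carrier P\<rbrakk> \<Longrightarrow> j (x \<oplus>\<^bsub>P\<^esub> y) = j x \<oplus>\<^bsub>Q\<^esub> j y"
      "\<And>a x. x \<in> carrier P \<Longrightarrow> j (a \<odot>\<^bsub>P\<^esub> x) = a \<odot>\<^bsub>Q\<^esub> j x"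
      "\<And>x y. \<lbrakk>x \<in> carrier P; y \<in> carrier P\<rbrakk> \<Longrightarrow> j (x \<otimes>\<^bsub>P\<^esub> y) = j x \<otimes>\<^bsub>Q\<^esub> j y"
      "\<And>x. x \<in> carrier P \<Longrightarrow> j (star P x) = star Q (j x)"
  shows "representation P H (\<lambda>x. \<pi> (j x))"
  using representationD[OF rep] j unfolding representation_def by simp

lemma (in seminormed_star_algebra) completion_closed:
  "\<lbrakk>x \<in> carrier (completion P); y \<in> carrier (completion P)\<rbrakk> \<Longrightarrow> x \<oplus>\<^bsub>completion P\<^esub> y \<in> carrier (completion P)"
  "\<lbrakk>x \<in> carrier (completion P); y \<in> carrier (completion P)\<rbrakk> \<Longrightarrow> x \<otimes>\<^bsub>completion P\<^esub> y \<in> carrier (completion P)"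
  "x \<in> carrier (completion P) \<Longrightarrow> a \<odot>\<^bsub>completion P\<^esub> x \<in> carrier (completion P)"
  "x \<in> carrier (completion P) \<Longrightarrow> star (completion P) x \<in> carrier (completion P)"
  by (auto simp: carrier_completion add_cls mult_cls smult_cls star_cls
      intro!: imageI add_cauchy mult_cauchy smult_cauchy star_cauchy)

text \<open>Common ground of both directions. For a free action the groupoid is the orbit relation
  and \<open>\<phi>\<close> identifies \<open>A\<close> with functions on its units; for the
  converse \<open>A\<close> is \<open>C0 (unit_space \<G>)\<close> and \<open>\<phi>\<close> is the
  identity. \<open>\<alpha>_slice\<close> says that \<open>\<alpha> n\<close> transports functions
  along \<open>slice n\<close>. The group \<open>G\<close> may exceed the range of \<open>c\<close>,
  in which case some slices are empty.\<close>

locale groupoid_model = graded_groupoid \<G> c + A: star_algebra A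
  for \<G> :: "('x \<times> 'x) topology" and c
    and A :: "('a, 'm) star_algebra_scheme" +
  fixes G :: "real set" and D :: "real \<Rightarrow> 'a set" and \<alpha> :: "real \<Rightarrow> 'a \<Rightarrow> 'a"
    and \<phi> :: "'a \<Rightarrow> 'x \<Rightarrow> complex"
  assumes G_add: "\<lbrakk>m \<in> G; n \<in> G\<rbrakk> \<Longrightarrow> m + n \<in> G"
    and G_uminus: "n \<in> G \<Longrightarrow> - n \<in> G"
    and c_G: "p \<in> topspace \<G> \<Longrightarrow> c p \<in> G"
    and \<phi>: "star_iso A (C0 (unit_space \<G>)) \<phi>"
    and D_subset: "n \<in> G \<Longrightarrow> D n \<subseteq> carrier A"
    and D_image: "n \<in> G \<Longrightarrow> \<phi> ` D n = C0_domain (unit_space \<G>) dom n"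
    and \<alpha>_closed: "\<lbrakk>n \<in> G; a \<in> D (- n)\<rbrakk> \<Longrightarrow> \<alpha> n a \<in> D n"
    and \<alpha>_slice: "\<lbrakk>n \<in> G; a \<in> D (- n); (x, y) \<in> slice n\<rbrakk> \<Longrightarrow> \<phi> (\<alpha> n a) x = \<phi> a y"
    and \<phi>_contractive: "a \<in> carrier A \<Longrightarrow> cmod (\<phi> a x) \<le> nrm A a"
begin

lemma \<phi>_bij: "bij_betw \<phi> (carrier A) (carrier (C0 (unit_space \<G>)))"
  using \<phi> by (simp add: star_iso_def)

lemma \<phi>_closed: "a \<in> carrier A \<Longrightarrow> \<phi> a \<in> carrier (C0 (unit_space \<G>))"
  using \<phi>_bij by (auto simp: bij_betw_def)

lemma \<phi>_inj: "\<lbrakk>a \<in> carrier A; b \<in> carrier A; \<And>x. \<phi> a x = \<phi> b x\<rbrakk> \<Longrightarrow> a = b"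
  by (rule inj_onD[OF bij_betw_imp_inj_on[OF \<phi>_bij]]) auto

lemma \<phi>_hom:
  "\<lbrakk>a \<in> carrier A; b \<in> carrier A\<rbrakk> \<Longrightarrow> \<phi> (a \<oplus>\<^bsub>A\<^esub> b) x = \<phi> a x + \<phi> b x"
  "a \<in> carrier A \<Longrightarrow> \<phi> (z \<odot>\<^bsub>A\<^esub> a) x = z * \<phi> a x"
  "\<lbrakk>a \<in> carrier A; b \<in> carrier A\<rbrakk> \<Longrightarrow> \<phi> (a \<otimes>\<^bsub>A\<^esub> b) x = \<phi> a x * \<phi> b x"
  "a \<in> carrier A \<Longrightarrow> \<phi> (star A a) x = cnj (\<phi> a x)"
  using \<phi> by (auto simp: star_iso_def)

lemma \<phi>_zero: "\<phi> \<zero>\<^bsub>A\<^esub> x = 0"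
  using \<phi>_hom(2)[of "\<zero>\<^bsub>A\<^esub>" 0 x] by simp

lemma \<phi>_eq_zero: "\<lbrakk>a \<in> carrier A; \<And>x. \<phi> a x = 0\<rbrakk> \<Longrightarrow> a = \<zero>\<^bsub>A\<^esub>"
  by (rule \<phi>_inj) (simp_all add: \<phi>_zero)

lemma D_iff: "n \<in> G \<Longrightarrow> a \<in> D n \<longleftrightarrow> a \<in> carrier A \<and> (\<forall>x. x \<notin> dom n \<longrightarrow> \<phi> a x = 0)"
proof
  assume n: "n \<in> G" and a: "a \<in> D n"
  then have "\<phi> a \<in> C0_domain (unit_space \<G>) dom n" using D_image by blast
  then show "a \<in> carrier A \<and> (\<forall>x. x \<notin> dom n \<longrightarrow> \<phi> a x = 0)"
    using D_subset[OF n] a by (auto simp: C0_domain_def)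
next
  assume n: "n \<in> G" and a: "a \<in> carrier A \<and> (\<forall>x. x \<notin> dom n \<longrightarrow> \<phi> a x = 0)"
  then have "\<phi> a \<in> \<phi> ` D n" using D_image[OF n] \<phi>_closed by (auto simp: C0_domain_def)
  then obtain b where "b \<in> D n" "\<phi> a = \<phi> b" by blast
  then show "a \<in> D n" using \<phi>_inj[of a b] a D_subset[OF n] by auto
qed

lemma D_closed: "\<lbrakk>n \<in> G; a \<in> D n\<rbrakk> \<Longrightarrow> a \<in> carrier A"
  using D_iff by blast

lemma D_vanish: "\<lbrakk>n \<in> G; a \<in> D n; x \<notin> dom n\<rbrakk> \<Longrightarrow> \<phi> a x = 0"
  using D_iff by blast

lemma zero_D: "n \<in> G \<Longrightarrow> \<zero>\<^bsub>A\<^esub> \<in> D n"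
  using D_iff \<phi>_zero by simp

lemma \<alpha>_zero: "n \<in> G \<Longrightarrow> \<alpha> n \<zero>\<^bsub>A\<^esub> = \<zero>\<^bsub>A\<^esub>"
proof (rule \<phi>_eq_zero)
  assume n: "n \<in> G"
  have 0: "\<zero>\<^bsub>A\<^esub> \<in> D (- n)" by (rule zero_D[OF G_uminus[OF n]])
  show "\<alpha> n \<zero>\<^bsub>A\<^esub> \<in> carrier A" by (rule D_closed[OF n \<alpha>_closed[OF n 0]])
  fix x
  show "\<phi> (\<alpha> n \<zero>\<^bsub>A\<^esub>) x = 0"
    using \<alpha>_slice[OF n 0 act_slice] D_vanish[OF n \<alpha>_closed[OF n 0]] \<phi>_zero by (cases "x \<in> dom n") auto
qed

section \<open>Polynomials as functions on the groupoid\<close>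

abbreviation "PA \<equiv> polynomial_algebra G A D \<alpha>"

lemma PA_simps:
  "p \<oplus>\<^bsub>PA\<^esub> q = (\<lambda>n. p n \<oplus>\<^bsub>A\<^esub> q n)" "a \<odot>\<^bsub>PA\<^esub> p = (\<lambda>n. a \<odot>\<^bsub>A\<^esub> p n)" "\<zero>\<^bsub>PA\<^esub> = (\<lambda>n. \<zero>\<^bsub>A\<^esub>)"
  "star PA p = (\<lambda>n. if n \<in> G then \<alpha> n (star A (p (- n))) else \<zero>\<^bsub>A\<^esub>)"
  "(p \<otimes>\<^bsub>PA\<^esub> q) k = (\<Oplus>\<^bsub>A\<^esub>n\<in>{n. p n \<noteq> \<zero>\<^bsub>A\<^esub>}. \<alpha> n (\<alpha> (- n) (p n) \<otimes>\<^bsub>A\<^esub> q (k - n)))"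
  "nrm PA p = (\<Sum>n | p n \<noteq> \<zero>\<^bsub>A\<^esub>. nrm A (p n))"
  by (simp_all add: polynomial_algebra_def)

lemma PA_iff: "p \<in> carrier PA \<longleftrightarrow> (\<forall>n\<in>G. p n \<in> D n) \<and> (\<forall>n. n \<notin> G \<longrightarrow> p n = \<zero>\<^bsub>A\<^esub>) \<and> finite {n. p n \<noteq> \<zero>\<^bsub>A\<^esub>}"
  by (simp add: polynomial_algebra_def)

lemma PAD:
  assumes "p \<in> carrier PA"
  shows "n \<in> G \<Longrightarrow> p n \<in> D n" "n \<notin> G \<Longrightarrow> p n = \<zero>\<^bsub>A\<^esub>" "finite {n. p n \<noteq> \<zero>\<^bsub>A\<^esub>}" "p n \<in> carrier A"
  using assms D_closed[of n "p n"] by (cases "n \<in> G"; auto simp: PA_iff)+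

lemma PA_support: "p \<in> carrier PA \<Longrightarrow> p n \<noteq> \<zero>\<^bsub>A\<^esub> \<Longrightarrow> n \<in> G"
  using PAD(2) by blast

lemma PA_vanish: "\<lbrakk>p \<in> carrier PA; x \<notin> dom n\<rbrakk> \<Longrightarrow> \<phi> (p n) x = 0"
  using PAD(1,2) D_vanish \<phi>_zero by (cases "n \<in> G") auto

text \<open>The monomial \<open>f U\<^sup>n\<close> becomes the function on \<open>slice n\<close>
  that applies \<open>f\<close> to the range. A point \<open>q\<close> of the groupoid has exactly
  one degree, so the entry there involves the single coefficient \<open>p (c q)\<close>.\<close>

definition \<Psi> :: "(real \<Rightarrow> 'a) \<Rightarrow> 'x \<times> 'x \<Rightarrow> complex" where
  "\<Psi> p = (\<lambda>q. if q \<in> topspace \<G> then \<phi> (p (c q)) (fst q) else 0)"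

lemma \<Psi>_slice: "(x, y) \<in> slice n \<Longrightarrow> \<Psi> p (x, y) = \<phi> (p n) x"
  by (auto simp: \<Psi>_def slice_def)

lemma \<Psi>_outside: "q \<notin> topspace \<G> \<Longrightarrow> \<Psi> p q = 0"
  by (simp add: \<Psi>_def)

lemma \<Psi>_support: "\<Psi> p q \<noteq> 0 \<Longrightarrow> p (c q) \<noteq> \<zero>\<^bsub>A\<^esub>"
  using \<phi>_zero by (auto simp: \<Psi>_def split: if_splits)

lemma \<Psi>_closed:
  assumes p: "p \<in> carrier PA"
  shows "\<Psi> p \<in> C0_fin"
proof (rule C0_finI[OF _ PAD(3)[OF p]])
  define N where "N = {n. p n \<noteq> \<zero>\<^bsub>A\<^esub>}"
  have N: "finite N" using PAD(3)[OF p] by (simp add: N_def)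
  have sl: "(\<lambda>q. if q \<in> slice n then \<phi> (p n) (fst q) else 0) = on_slice n (\<Psi> p)" for n
    using \<Psi>_slice by (fastforce simp: on_slice_def fun_eq_iff)
  have "\<Psi> p = (\<lambda>q. \<Sum>n\<in>N. on_slice n (\<Psi> p) q)"
  proof
    fix q show "\<Psi> p q = (\<Sum>n\<in>N. on_slice n (\<Psi> p) q)"
      using N \<Psi>_support[of p] \<Psi>_outside[of _ p]
      by (intro sum_on_slice[of N "\<Psi> p" "\<lambda>z. z" q, symmetric]) (auto simp: N_def)
  qed
  moreover have "on_slice n (\<Psi> p) \<in> carrier (C0 \<G>)" for n
    unfolding sl[symmetric]
    by (rule C0_units_to_slice[OF \<phi>_closed[OF PAD(4)[OF p]] PA_vanish[OF p]])
  ultimately show "\<Psi> p \<in> carrier (C0 \<G>)" using C0_sum[OF N] by metis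
  show "c q \<in> {n. p n \<noteq> \<zero>\<^bsub>A\<^esub>}" if "\<Psi> p q \<noteq> 0" for q using \<Psi>_support[OF that] by simp
qed

lemma \<Psi>_inj: "inj_on \<Psi> (carrier PA)"
proof (rule inj_onI)
  fix p q assume p: "p \<in> carrier PA" and q: "q \<in> carrier PA" and eq: "\<Psi> p = \<Psi> q"
  show "p = q"
  proof
    fix n
    show "p n = q n"
    proof (rule \<phi>_inj[OF PAD(4)[OF p] PAD(4)[OF q]])
      fix x
      show "\<phi> (p n) x = \<phi> (q n) x"
        using \<Psi>_slice[OF act_slice, of x n p] \<Psi>_slice[OF act_slice, of x n q] eq
          PA_vanish[OF p] PA_vanish[OF q] by (cases "x \<in> dom n") auto
    qed
  qed
qed

text \<open>The coefficient of degree \<open>n\<close> is the restriction of \<open>F\<close> to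
  \<open>slice n\<close>, read as a function of the range and pulled back through
  \<open>\<phi>\<close>. Degrees outside \<open>G\<close> cannot occur because of
  \<open>c_G\<close>.\<close>

lemma \<Psi>_surj:
  assumes F: "F \<in> C0_fin"
  shows "\<exists>p\<in>carrier PA. \<Psi> p = F"
proof -
  define f where "f n x = (if x \<in> dom n then on_slice n F (x, act (- n) x) else 0)" for n x
  have f: "f n \<in> carrier (C0 (unit_space \<G>))" for n
    unfolding f_def by (rule C0_slice_to_units[OF C0_on_slice[OF C0_finD(1)[OF F]]]) (simp add: on_slice_outside)
  define p where "p n = (if n \<in> G then inv_into (carrier A) \<phi> (f n) else \<zero>\<^bsub>A\<^esub>)" for n
  have pA: "p n \<in> carrier A" for n
    using f \<phi>_bij by (auto simp: p_def bij_betw_def intro!: inv_into_into)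
  have \<phi>p: "\<phi> (p n) = f n" if "n \<in> G" for n
    using f \<phi>_bij that by (auto simp: p_def bij_betw_def intro!: f_inv_into_f)
  have F0: "F q = 0" if "q \<notin> topspace \<G>" for q using C0_finD(3)[OF F that] .
  have "p n = \<zero>\<^bsub>A\<^esub>" if n: "n \<notin> c ` {q. F q \<noteq> 0}" for n
  proof (cases "n \<in> G")
    case True
    have "on_slice n F q = 0" for q using n by (auto simp: on_slice_def slice_def)
    then show ?thesis using \<phi>p[OF True] by (intro \<phi>_eq_zero pA) (simp add: f_def)
  qed (simp add: p_def)
  then have "{n. p n \<noteq> \<zero>\<^bsub>A\<^esub>} \<subseteq> c ` {q. F q \<noteq> 0}" by blast
  then have "finite {n. p n \<noteq> \<zero>\<^bsub>A\<^esub>}" using C0_finD(2)[OF F] finite_subset by blast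
  moreover have "p n \<in> D n" if "n \<in> G" for n
    using D_iff[OF that] pA \<phi>p[OF that] by (simp add: f_def)
  ultimately have p: "p \<in> carrier PA" unfolding PA_iff by (simp add: p_def)
  have "\<Psi> p q = F q" for q
  proof (cases "q \<in> topspace \<G>")
    case True
    obtain x y where q: "q = (x, y)" by fastforce
    then have sl: "(x, y) \<in> slice (c q)" using True mem_slice_c by blast
    have "\<Psi> p q = f (c q) x" using \<Psi>_slice[OF sl] \<phi>p[OF c_G[OF True]] q by simp
    also have "\<dots> = F q" using slice_dom[OF sl] sl by (simp add: f_def on_slice_def q)
    finally show ?thesis .
  qed (simp add: \<Psi>_outside F0)
  then show ?thesis using p by blast
qed

lemma \<Psi>_add:
  assumes p: "p \<in> carrier PA" and q: "q \<in> carrier PA"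
  shows "p \<oplus>\<^bsub>PA\<^esub> q \<in> carrier PA" "\<Psi> (p \<oplus>\<^bsub>PA\<^esub> q) = (\<lambda>z. \<Psi> p z + \<Psi> q z)"
proof -
  note c = PAD(4)[OF p] PAD(4)[OF q]
  have "{n. p n \<oplus>\<^bsub>A\<^esub> q n \<noteq> \<zero>\<^bsub>A\<^esub>} \<subseteq> {n. p n \<noteq> \<zero>\<^bsub>A\<^esub>} \<union> {n. q n \<noteq> \<zero>\<^bsub>A\<^esub>}" by auto
  then have "finite {n. p n \<oplus>\<^bsub>A\<^esub> q n \<noteq> \<zero>\<^bsub>A\<^esub>}"
    using PAD(3)[OF p] PAD(3)[OF q] finite_subset by blast
  then show "p \<oplus>\<^bsub>PA\<^esub> q \<in> carrier PA"
    unfolding PA_iff PA_simps using c PA_vanish[OF p] PA_vanish[OF q] PAD(2)[OF p] PAD(2)[OF q]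
    by (simp add: D_iff \<phi>_hom)
  show "\<Psi> (p \<oplus>\<^bsub>PA\<^esub> q) = (\<lambda>z. \<Psi> p z + \<Psi> q z)"
    by (simp add: \<Psi>_def PA_simps fun_eq_iff \<phi>_hom c)
qed

lemma \<Psi>_smult:
  assumes p: "p \<in> carrier PA"
  shows "a \<odot>\<^bsub>PA\<^esub> p \<in> carrier PA" "\<Psi> (a \<odot>\<^bsub>PA\<^esub> p) = (\<lambda>z. a * \<Psi> p z)"
proof -
  note c = PAD(4)[OF p]
  have "{n. a \<odot>\<^bsub>A\<^esub> p n \<noteq> \<zero>\<^bsub>A\<^esub>} \<subseteq> {n. p n \<noteq> \<zero>\<^bsub>A\<^esub>}" by auto
  then have "finite {n. a \<odot>\<^bsub>A\<^esub> p n \<noteq> \<zero>\<^bsub>A\<^esub>}"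
    using PAD(3)[OF p] finite_subset by blast
  then show "a \<odot>\<^bsub>PA\<^esub> p \<in> carrier PA"
    unfolding PA_iff PA_simps using c PA_vanish[OF p] PAD(2)[OF p]
    by (simp add: D_iff \<phi>_hom)
  show "\<Psi> (a \<odot>\<^bsub>PA\<^esub> p) = (\<lambda>z. a * \<Psi> p z)"
    by (simp add: \<Psi>_def PA_simps fun_eq_iff \<phi>_hom c)
qed

lemma \<Psi>_star:
  assumes p: "p \<in> carrier PA"
  shows "star PA p \<in> carrier PA" "\<Psi> (star PA p) = fstar (\<Psi> p)"
proof -
  have D: "star A (p (- n)) \<in> D (- n)" if "n \<in> G" for n
    using PAD(4)[OF p] PA_vanish[OF p] by (simp add: D_iff[OF G_uminus[OF that]] A.star_closed \<phi>_hom)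
  have "star PA p n = \<zero>\<^bsub>A\<^esub>" if "- n \<notin> {n. p n \<noteq> \<zero>\<^bsub>A\<^esub>}" for n
  proof -
    have "star A \<zero>\<^bsub>A\<^esub> = \<zero>\<^bsub>A\<^esub>" by (rule \<phi>_eq_zero) (simp_all add: A.star_closed \<phi>_hom \<phi>_zero)
    then show ?thesis using that \<alpha>_zero by (simp add: PA_simps)
  qed
  then have "{n. star PA p n \<noteq> \<zero>\<^bsub>A\<^esub>} \<subseteq> uminus ` {n. p n \<noteq> \<zero>\<^bsub>A\<^esub>}"
    by (force simp: image_iff)
  then have "finite {n. star PA p n \<noteq> \<zero>\<^bsub>A\<^esub>}" using PAD(3)[OF p] finite_surj by blast
  then show "star PA p \<in> carrier PA"
    unfolding PA_iff using \<alpha>_closed[OF _ D] by (auto simp: PA_simps)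
  show "\<Psi> (star PA p) = fstar (\<Psi> p)"
  proof
    fix q :: "'x \<times> 'x"
    obtain x y where q: "q = (x, y)" by fastforce
    show "\<Psi> (star PA p) q = fstar (\<Psi> p) q"
    proof (cases "(x, y) \<in> topspace \<G>")
      case True
      define n where "n = c (x, y)"
      have sl: "(x, y) \<in> slice n" and n: "n \<in> G"
        using True mem_slice_c c_G by (auto simp: n_def)
      then have sl': "(y, x) \<in> slice (- n)" using slice_sym by blast
      have "\<Psi> (star PA p) (x, y) = \<phi> (\<alpha> n (star A (p (- n)))) x"
        using \<Psi>_slice[OF sl] n by (simp add: PA_simps)
      also have "\<dots> = cnj (\<phi> (p (- n)) y)"
        using \<alpha>_slice[OF n D[OF n] sl] PAD(4)[OF p] by (simp add: \<phi>_hom)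
      finally show ?thesis using \<Psi>_slice[OF sl'] by (simp add: q)
    next
      case False
      then have "(y, x) \<notin> topspace \<G>" using groupoid_sym by blast
      then show ?thesis using False by (simp add: q \<Psi>_outside)
    qed
  qed
qed

lemma \<phi>_finsum:
  "finite N \<Longrightarrow> (\<And>n. n \<in> N \<Longrightarrow> f n \<in> carrier A) \<Longrightarrow>
    (\<Oplus>\<^bsub>A\<^esub>n\<in>N. f n) \<in> carrier A \<and> \<phi> (\<Oplus>\<^bsub>A\<^esub>n\<in>N. f n) x = (\<Sum>n\<in>N. \<phi> (f n) x)"
proof (induction N rule: finite_induct)
  case empty
  then show ?case by (simp add: \<phi>_zero)
next
  case (insert n N)
  then have "f \<in> N \<rightarrow> carrier A" "f n \<in> carrier A" by auto
  then show ?case using insert by (simp add: A.finsum_insert \<phi>_hom)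
qed

text \<open>At \<open>x \<in> dom n\<close> the coefficient
  \<open>\<alpha> n (\<alpha> (- n) f \<otimes> g)\<close> is the value of \<open>f\<close> at
  \<open>x\<close> times that of \<open>g\<close> at \<open>act (- n) x\<close>. This is the summand
  of the convolution at the middle point reached by the arrow of degree \<open>n\<close>.\<close>

lemma \<Psi>_mult:
  assumes p: "p \<in> carrier PA" and q: "q \<in> carrier PA"
  shows "p \<otimes>\<^bsub>PA\<^esub> q \<in> carrier PA" "\<Psi> (p \<otimes>\<^bsub>PA\<^esub> q) = conv (\<Psi> p) (\<Psi> q)"
proof -
  define N where "N = {n. p n \<noteq> \<zero>\<^bsub>A\<^esub>}"
  have N: "finite N" "N \<subseteq> G" using PAD(3)[OF p] PA_support[OF p] by (auto simp: N_def)
  define b where "b k n = \<alpha> (- n) (p n) \<otimes>\<^bsub>A\<^esub> q (k - n)" for k n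
  define t where "t k n = \<alpha> n (b k n)" for k n
  have t: "t k n \<in> carrier A \<and> \<phi> (t k n) x =
      (if x \<in> dom n then \<phi> (p n) x * \<phi> (q (k - n)) (act (- n) x) else 0)"
    if "n \<in> N" for k n x
  proof -
    have n: "n \<in> G" "- n \<in> G" using that N G_uminus by auto
    have pn: "p n \<in> D (- (- n))" using PAD(1)[OF p n(1)] by simp
    have \<alpha>p: "\<alpha> (- n) (p n) \<in> D (- n)" by (rule \<alpha>_closed[OF n(2) pn])
    note c = D_closed[OF n(2) \<alpha>p] PAD(4)[OF q]
    have b: "b k n \<in> D (- n)"
      unfolding D_iff[OF n(2)] b_def
      using c D_vanish[OF n(2) \<alpha>p] by (simp add: A.mult_closed \<phi>_hom)
    have tD: "t k n \<in> D n" unfolding t_def by (rule \<alpha>_closed[OF n(1) b])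
    have "\<phi> (t k n) x = \<phi> (p n) x * \<phi> (q (k - n)) (act (- n) x)" if x: "x \<in> dom n"
    proof -
      have sl: "(x, act (- n) x) \<in> slice n" by (rule act_slice[OF x])
      then have sl': "(act (- n) x, x) \<in> slice (- n)" using slice_sym by blast
      have "\<phi> (t k n) x = \<phi> (b k n) (act (- n) x)" unfolding t_def by (rule \<alpha>_slice[OF n(1) b sl])
      also have "\<dots> = \<phi> (\<alpha> (- n) (p n)) (act (- n) x) * \<phi> (q (k - n)) (act (- n) x)"
        unfolding b_def by (rule \<phi>_hom(3)[OF c])
      also have "\<phi> (\<alpha> (- n) (p n)) (act (- n) x) = \<phi> (p n) x" by (rule \<alpha>_slice[OF n(2) pn sl'])
      finally show ?thesis .
    qed
    then show ?thesis using D_closed[OF n(1) tD] D_vanish[OF n(1) tD] by auto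
  qed
  have pq: "(p \<otimes>\<^bsub>PA\<^esub> q) k = (\<Oplus>\<^bsub>A\<^esub>n\<in>N. t k n)" for k by (simp add: PA_simps N_def t_def b_def)
  have tA: "\<And>n. n \<in> N \<Longrightarrow> t k n \<in> carrier A" for k using t by blast
  have fs: "(\<Oplus>\<^bsub>A\<^esub>n\<in>N. t k n) \<in> carrier A \<and> \<phi> (\<Oplus>\<^bsub>A\<^esub>n\<in>N. t k n) x = (\<Sum>n\<in>N. \<phi> (t k n) x)" for k x
    by (rule \<phi>_finsum[of N "t k", OF N(1)]) (rule tA)
  then have pqA: "(p \<otimes>\<^bsub>PA\<^esub> q) k \<in> carrier A" for k unfolding pq by blast
  have \<phi>pq: "\<phi> ((p \<otimes>\<^bsub>PA\<^esub> q) k) x =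
      (\<Sum>n\<in>N. if x \<in> dom n then \<phi> (p n) x * \<phi> (q (k - n)) (act (- n) x) else 0)" for k x
    unfolding pq using fs[of k x] t by simp
  have zero: "(p \<otimes>\<^bsub>PA\<^esub> q) k = \<zero>\<^bsub>A\<^esub>" if k: "\<And>n. n \<in> N \<Longrightarrow> q (k - n) = \<zero>\<^bsub>A\<^esub>" for k
  proof (rule \<phi>_eq_zero[OF pqA])
    show "\<phi> ((p \<otimes>\<^bsub>PA\<^esub> q) k) x = 0" for x unfolding \<phi>pq by (intro sum.neutral ballI) (simp add: k \<phi>_zero)
  qed
  \<comment> \<open>An arrow of degree \<open>n\<close> with range \<open>x\<close> followed by one
    of degree \<open>k - n\<close> would be an arrow of degree \<open>k\<close>, putting
    \<open>x\<close> in \<open>dom k\<close>. Hence the product coefficient of degree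
    \<open>k\<close> lies in \<open>D k\<close>.\<close>
  have out: "\<phi> (q (k - n)) (act (- n) x) = 0" if "x \<in> dom n" "x \<notin> dom k" for n k x
  proof (rule PA_vanish[OF q], rule notI)
    assume "act (- n) x \<in> dom (k - n)"
    then obtain z where "(act (- n) x, z) \<in> slice (k - n)" unfolding mem_dom by blast
    then have "(x, z) \<in> slice k" using slice_trans[OF act_slice[OF that(1)], of z "k - n"] by simp
    then show False using that(2) mem_dom by blast
  qed
  show pq_closed: "p \<otimes>\<^bsub>PA\<^esub> q \<in> carrier PA"
    unfolding PA_iff
  proof (intro conjI ballI allI impI)
    show "(p \<otimes>\<^bsub>PA\<^esub> q) k \<in> D k" if "k \<in> G" for k
      unfolding D_iff[OF that] using pqA out unfolding \<phi>pq by (auto intro!: sum.neutral)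
    show "(p \<otimes>\<^bsub>PA\<^esub> q) k = \<zero>\<^bsub>A\<^esub>" if k: "k \<notin> G" for k
    proof (rule zero)
      fix n assume "n \<in> N"
      then have "k - n \<notin> G" using G_add[of "k - n" n] N k by auto
      then show "q (k - n) = \<zero>\<^bsub>A\<^esub>" by (rule PAD(2)[OF q])
    qed
    have "{k. (p \<otimes>\<^bsub>PA\<^esub> q) k \<noteq> \<zero>\<^bsub>A\<^esub>} \<subseteq> (\<lambda>(n, m). n + m) ` (N \<times> {m. q m \<noteq> \<zero>\<^bsub>A\<^esub>})"
    proof
      fix k assume "k \<in> {k. (p \<otimes>\<^bsub>PA\<^esub> q) k \<noteq> \<zero>\<^bsub>A\<^esub>}"
      then obtain n where "n \<in> N" "q (k - n) \<noteq> \<zero>\<^bsub>A\<^esub>" using zero by blast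
      then show "k \<in> (\<lambda>(n, m). n + m) ` (N \<times> {m. q m \<noteq> \<zero>\<^bsub>A\<^esub>})"
        by (intro image_eqI[of _ _ "(n, k - n)"]) auto
    qed
    then show "finite {k. (p \<otimes>\<^bsub>PA\<^esub> q) k \<noteq> \<zero>\<^bsub>A\<^esub>}"
      using N PAD(3)[OF q] by (elim finite_subset) simp
  qed
  have conv_C: "conv (\<Psi> p) (\<Psi> q) \<in> C0_fin" by (intro C0_fin_conv \<Psi>_closed p q)
  have split: "\<Psi> p = (\<lambda>z. \<Sum>n\<in>N. on_slice n (\<Psi> p) z)"
  proof
    fix z show "\<Psi> p z = (\<Sum>n\<in>N. on_slice n (\<Psi> p) z)"
      using N \<Psi>_support[of p] \<Psi>_outside[of _ p]
      by (intro sum_on_slice[of N "\<Psi> p" "\<lambda>z. z" z, symmetric]) (auto simp: N_def)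
  qed
  show "\<Psi> (p \<otimes>\<^bsub>PA\<^esub> q) = conv (\<Psi> p) (\<Psi> q)"
  proof
    fix w :: "'x \<times> 'x"
    obtain x z where w: "w = (x, z)" by fastforce
    show "\<Psi> (p \<otimes>\<^bsub>PA\<^esub> q) w = conv (\<Psi> p) (\<Psi> q) w"
    proof (cases "w \<in> topspace \<G>")
      case True
      define k where "k = c w"
      have sl: "(x, z) \<in> slice k" using True w mem_slice_c by (simp add: k_def)
      have "conv (\<Psi> p) (\<Psi> q) (x, z) = (\<Sum>n\<in>N. conv (on_slice n (\<Psi> p)) (\<Psi> q) (x, z))"
        by (subst split) (rule conv_sum_left[OF C0_fin_row_col[OF \<Psi>_closed[OF q]]])
      also have "\<dots> = (\<Sum>n\<in>N. if x \<in> dom n then \<phi> (p n) x * \<phi> (q (k - n)) (act (- n) x) else 0)"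
      proof (rule sum.cong[OF refl])
        fix n assume "n \<in> N"
        have cv: "conv (on_slice n (\<Psi> p)) (\<Psi> q) (x, z) =
            on_slice n (\<Psi> p) (x, act (- n) x) * \<Psi> q (act (- n) x, z)"
          by (rule conv_on_slice) (rule on_slice_outside)
        show "conv (on_slice n (\<Psi> p)) (\<Psi> q) (x, z) =
            (if x \<in> dom n then \<phi> (p n) x * \<phi> (q (k - n)) (act (- n) x) else 0)"
        proof (cases "x \<in> dom n")
          case x: True
          have s1: "(x, act (- n) x) \<in> slice n" by (rule act_slice[OF x])
          then have "(act (- n) x, x) \<in> slice (- n)" using slice_sym by blast
          then have s2: "(act (- n) x, z) \<in> slice (k - n)" using slice_trans[OF _ sl] by fastforce
          show ?thesis using cv x s1 \<Psi>_slice[OF s1] \<Psi>_slice[OF s2] by (simp add: on_slice_def)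
        next
          case False
          then have "(x, act (- n) x) \<notin> slice n" using mem_dom by blast
          then show ?thesis using cv False by (simp add: on_slice_outside)
        qed
      qed
      also have "\<dots> = \<Psi> (p \<otimes>\<^bsub>PA\<^esub> q) (x, z)" unfolding \<Psi>_slice[OF sl] \<phi>pq ..
      finally show ?thesis by (simp add: w)
    next
      case False
      then show ?thesis using C0_finD(3)[OF conv_C] \<Psi>_outside by simp
    qed
  qed
qed

lemma \<Psi>_zero: "\<zero>\<^bsub>PA\<^esub> \<in> carrier PA" "\<Psi> \<zero>\<^bsub>PA\<^esub> = (\<lambda>z. 0)"
  by (simp_all add: PA_iff PA_simps zero_D \<Psi>_def \<phi>_zero fun_eq_iff)

sublocale C: slice_algebra \<G> c C0_fin
  by (rule slice_algebra_C0_fin)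

sublocale K: slice_algebra \<G> c Cc
  by (rule slice_algebra_Cc)

text \<open>Even associativity, awkward to check directly for partial actions, is inherited from
  matrices through the injection \<open>\<Psi>\<close>.\<close>

lemma star_algebra_PA: "star_algebra PA"
  by (rule star_algebra_pullback[OF C.star_algebra_B \<Psi>_inj])
     (auto simp: \<Psi>_closed \<Psi>_add \<Psi>_smult \<Psi>_mult \<Psi>_star \<Psi>_zero)

definition \<Psi>' :: "('x \<times> 'x \<Rightarrow> complex) \<Rightarrow> real \<Rightarrow> 'a" where
  "\<Psi>' = inv_into (carrier PA) \<Psi>"

lemma \<Psi>': "F \<in> C0_fin \<Longrightarrow> \<Psi>' F \<in> carrier PA" "F \<in> C0_fin \<Longrightarrow> \<Psi> (\<Psi>' F) = F"
  "p \<in> carrier PA \<Longrightarrow> \<Psi>' (\<Psi> p) = p"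
proof -
  show "F \<in> C0_fin \<Longrightarrow> \<Psi>' F \<in> carrier PA" "F \<in> C0_fin \<Longrightarrow> \<Psi> (\<Psi>' F) = F"
  proof -
    assume "F \<in> C0_fin"
    then have "F \<in> \<Psi> ` carrier PA" using \<Psi>_surj by blast
    then show "\<Psi>' F \<in> carrier PA" "\<Psi> (\<Psi>' F) = F"
      unfolding \<Psi>'_def by (rule inv_into_into, rule f_inv_into_f)
  qed
  show "p \<in> carrier PA \<Longrightarrow> \<Psi>' (\<Psi> p) = p"
    unfolding \<Psi>'_def by (rule inv_into_f_f[OF \<Psi>_inj])
qed

lemma \<Psi>'_eqI: "\<lbrakk>p \<in> carrier PA; \<Psi> p = F\<rbrakk> \<Longrightarrow> \<Psi>' F = p"
  using \<Psi>'(3) by blast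

lemma \<Psi>'_hom:
  "\<lbrakk>F \<in> C0_fin; K \<in> C0_fin\<rbrakk> \<Longrightarrow> \<Psi>' (\<lambda>z. F z + K z) = \<Psi>' F \<oplus>\<^bsub>PA\<^esub> \<Psi>' K"
  "F \<in> C0_fin \<Longrightarrow> \<Psi>' (\<lambda>z. a * F z) = a \<odot>\<^bsub>PA\<^esub> \<Psi>' F"
  "\<lbrakk>F \<in> C0_fin; K \<in> C0_fin\<rbrakk> \<Longrightarrow> \<Psi>' (conv F K) = \<Psi>' F \<otimes>\<^bsub>PA\<^esub> \<Psi>' K"
  "F \<in> C0_fin \<Longrightarrow> \<Psi>' (fstar F) = star PA (\<Psi>' F)"
  by (rule \<Psi>'_eqI; simp add: \<Psi>' \<Psi>_add \<Psi>_smult \<Psi>_mult \<Psi>_star)+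

lemma slice_representation_PA:
  assumes "representation PA H \<pi>"
  shows "slice_representation \<G> c C0_fin H (\<lambda>F. \<pi> (\<Psi>' F))"
proof -
  have "representation (fun_algebra C0_fin \<G>) H (\<lambda>F. \<pi> (\<Psi>' F))"
    by (rule representation_comp[OF assms]) (simp_all add: \<Psi>' \<Psi>'_hom)
  then show ?thesis
    by (intro slice_representation.intro C.slice_algebra_axioms star_representationI C.star_algebra_B)
qed

lemma representation_PA:
  assumes "representation (fun_algebra C0_fin \<G>) H \<pi>"
  shows "representation PA H (\<lambda>p. \<pi> (\<Psi> p))"
  by (rule representation_comp[OF assms]) (simp_all add: \<Psi>_closed \<Psi>_add \<Psi>_smult \<Psi>_mult \<Psi>_star)

text \<open>Each slice contributes at most the norm of its coefficient to any row or column, so the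
  \<open>L\<close>-norm dominates the sums in the Schur test; \<open>d\<close> supplies strict
  positivity.\<close>

lemma rep_PA_L_bound:
  assumes rep: "representation PA H \<pi>" and p: "p \<in> carrier PA" and v: "v \<in> carrier H" and d: "d > 0"
  shows "vec_norm H (\<pi> p v) \<le> (nrm PA p + d) * vec_norm H v"
proof -
  interpret R: slice_representation \<G> c C0_fin H "\<lambda>F. \<pi> (\<Psi>' F)" by (rule slice_representation_PA[OF rep])
  define N where "N = {n. p n \<noteq> \<zero>\<^bsub>A\<^esub>}"
  have N: "finite N" using PAD(3)[OF p] by (simp add: N_def)
  have le: "cmod (on_slice n (\<Psi> p) (x, y)) \<le> nrm A (p n)" for n x y
    using \<Psi>_slice[of x y n p] \<phi>_contractive[OF PAD(4)[OF p], of n x]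
      order_trans[OF norm_ge_zero \<phi>_contractive[OF PAD(4)[OF p], of n x]]
    by (simp add: on_slice_def)
  have nrm: "nrm PA p = (\<Sum>n\<in>N. nrm A (p n))" by (simp add: PA_simps N_def)
  have row: "(\<Sum>\<^sub>\<infinity>y. cmod (\<Psi> p (x, y))) \<le> nrm PA p" for x
  proof -
    have "(\<Sum>\<^sub>\<infinity>y. cmod (\<Psi> p (x, y))) = (\<Sum>n\<in>N. cmod (on_slice n (\<Psi> p) (x, act (- n) x)))"
      using N \<Psi>_support[of p] \<Psi>_outside[of _ p] by (intro row_sum) (auto simp: N_def)
    also have "\<dots> \<le> nrm PA p" unfolding nrm by (intro sum_mono le)
    finally show ?thesis .
  qed
  have col: "(\<Sum>\<^sub>\<infinity>x. cmod (\<Psi> p (x, y))) \<le> nrm PA p" for y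
  proof -
    have "(\<Sum>\<^sub>\<infinity>x. cmod (\<Psi> p (x, y))) = (\<Sum>n\<in>N. cmod (on_slice n (\<Psi> p) (act n y, y)))"
      using N \<Psi>_support[of p] \<Psi>_outside[of _ p] by (intro col_sum) (auto simp: N_def)
    also have "\<dots> \<le> nrm PA p" unfolding nrm by (intro sum_mono le)
    finally show ?thesis .
  qed
  have "0 \<le> (\<Sum>\<^sub>\<infinity>y. cmod (\<Psi> p (undefined, y)))" by (rule infsum_nonneg) simp
  then have pos: "nrm PA p + d > 0" using row[of undefined] d by linarith
  have "vec_norm H (\<pi> (\<Psi>' (\<Psi> p)) v) \<le> (nrm PA p + d) * vec_norm H v"
  proof (rule R.rep_Schur_bound[OF \<Psi>_closed[OF p] pos _ _ v])
    show "(\<Sum>\<^sub>\<infinity>y. cmod (\<Psi> p (x, y))) \<le> nrm PA p + d" for x using row[of x] d by simp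
    show "(\<Sum>\<^sub>\<infinity>x. cmod (\<Psi> p (x, y))) \<le> nrm PA p + d" for y using col[of y] d by simp
  qed
  then show ?thesis by (simp add: \<Psi>'(3)[OF p])
qed

lemma nrm_PA_nonneg: "p \<in> carrier PA \<Longrightarrow> 0 \<le> nrm PA p"
  unfolding PA_simps
  by (intro sum_nonneg order_trans[OF norm_ge_zero \<phi>_contractive] PAD(4))

text \<open>Continuity in the \<open>L\<close>-norm is automatic by the preceding bound, so any
  star-representation carried over to \<open>PA\<close> counts in the supremum
  \<open>uP\<close>.\<close>

lemma continuous_representation_PA: "continuous_representation PA H \<pi> \<longleftrightarrow> representation PA H \<pi>"
proof
  assume rep: "representation PA H \<pi>"
  interpret R: star_representation PA H \<pi> by (rule star_representationI[OF star_algebra_PA rep])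
  show "continuous_representation PA H \<pi>"
    unfolding continuous_representation_def
  proof (intro conjI rep ballI allI impI)
    fix x and e :: real assume x: "x \<in> carrier PA" and e: "e > 0"
    have "op_norm H (\<lambda>v. \<pi> y v \<ominus>\<^bsub>H\<^esub> \<pi> x v) < e"
      if y: "y \<in> carrier PA" "nrm PA (y \<ominus>\<^bsub>PA\<^esub> x) < e / 2" for y
    proof -
      have yx: "y \<ominus>\<^bsub>PA\<^esub> x \<in> carrier PA" using x y by simp
      have "op_norm H (\<lambda>v. \<pi> y v \<ominus>\<^bsub>H\<^esub> \<pi> x v) \<le> nrm PA (y \<ominus>\<^bsub>PA\<^esub> x) + e / 2"
      proof (rule R.H.op_norm_le)
        fix v assume v: "v \<in> carrier H"
        show "vec_norm H (\<pi> y v \<ominus>\<^bsub>H\<^esub> \<pi> x v) \<le> (nrm PA (y \<ominus>\<^bsub>PA\<^esub> x) + e / 2) * vec_norm H v"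
          using rep_PA_L_bound[OF rep yx v, of "e / 2"] e R.rep_diff[OF y(1) x v] by simp
      qed (use nrm_PA_nonneg[OF yx] e in simp)
      then show ?thesis using y(2) by simp
    qed
    then show "\<exists>d>0. \<forall>y\<in>carrier PA. nrm PA (y \<ominus>\<^bsub>PA\<^esub> x) < d \<longrightarrow> op_norm H (\<lambda>v. \<pi> y v \<ominus>\<^bsub>H\<^esub> \<pi> x v) < e"
      using e by (intro exI[of _ "e / 2"]) auto
  qed
qed (simp add: continuous_representation_def)

lemma fun_algebra_Cc: "fun_algebra Cc \<G> = Cc_algebra \<G>"
  by (simp add: Cc_algebra_def)

lemma slice_representation_Cc:
  assumes "representation (Cc_algebra \<G>) H \<pi>"
  shows "slice_representation \<G> c Cc H \<pi>"
  using assms K.star_algebra_B fun_algebra_Cc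
  by (intro slice_representation.intro K.slice_algebra_axioms star_representationI) auto

lemma norm_decreasing_representation_Cc:
  "norm_decreasing_representation (Cc_algebra \<G>) H \<pi> \<longleftrightarrow> representation (Cc_algebra \<G>) H \<pi>"
  using slice_representation.rep_I_norm_bound[OF slice_representation_Cc]
  by (auto simp: norm_decreasing_representation_def)

section \<open>Comparison of the two universal norms\<close>

abbreviation "uP \<equiv> universal_norm PA (continuous_representation PA)"
abbreviation "uQ \<equiv> universal_norm (Cc_algebra \<G>) (norm_decreasing_representation (Cc_algebra \<G>))"

lemma star_algebra_Cc: "star_algebra (Cc_algebra \<G>)"
  using K.star_algebra_B fun_algebra_Cc by simp

lemma uP_bounded:
  assumes p: "p \<in> carrier PA"
  shows "\<exists>M. \<forall>H \<pi>. continuous_representation PA H \<pi> \<longrightarrow> op_norm H (\<pi> p) \<le> M"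
proof (intro exI allI impI)
  fix H \<pi> assume "continuous_representation PA H \<pi>"
  then have rep: "representation PA H \<pi>" by (simp add: continuous_representation_PA)
  interpret R: star_representation PA H \<pi> by (rule star_representationI[OF star_algebra_PA rep])
  show "op_norm H (\<pi> p) \<le> nrm PA p + 1"
    using rep_PA_L_bound[OF rep p, of _ 1] nrm_PA_nonneg[OF p] by (intro R.H.op_norm_le) auto
qed

lemma uQ_bounded:
  "\<exists>M. \<forall>H \<pi>. norm_decreasing_representation (Cc_algebra \<G>) H \<pi> \<longrightarrow> op_norm H (\<pi> f) \<le> M" if "f \<in> Cc"
  using that by (auto simp: norm_decreasing_representation_def)

text \<open>The type constraints are those built into \<open>uP\<close>; representations on other
  types enter through \<open>cyclic_transport\<close>.\<close>

lemma seminormed_PA: "seminormed_star_algebra (normed_polynomial_algebra G A D \<alpha>)"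
  and uP_upper: "\<lbrakk>continuous_representation PA (H :: (nat \<Rightarrow> real \<Rightarrow> 'a) inner_product_space) \<pi>; p \<in> carrier PA\<rbrakk> \<Longrightarrow> op_norm H (\<pi> p) \<le> uP p"
  and uP_least: "\<lbrakk>p \<in> carrier PA; \<And>(H :: (nat \<Rightarrow> real \<Rightarrow> 'a) inner_product_space) \<pi>. continuous_representation PA H \<pi> \<Longrightarrow> op_norm H (\<pi> p) \<le> M\<rbrakk> \<Longrightarrow> uP p \<le> M"
proof -
  obtain H0 :: "(nat \<Rightarrow> real \<Rightarrow> 'a) inner_product_space" and \<pi>0 where "representation PA H0 \<pi>0"
    using representation_zero[of PA] by blast
  then have ex: "continuous_representation PA H0 \<pi>0" by (simp add: continuous_representation_PA)
  have R: "\<And>H \<pi>. continuous_representation PA H \<pi> \<Longrightarrow> representation PA H \<pi>"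
    by (simp add: continuous_representation_def)
  note * = seminormed_universal_norm[OF star_algebra_PA, where R="continuous_representation PA", OF R ex uP_bounded]
  show "seminormed_star_algebra (normed_polynomial_algebra G A D \<alpha>)"
    unfolding normed_polynomial_algebra_def Let_def by (rule *(1))
  show "\<lbrakk>continuous_representation PA H \<pi>; p \<in> carrier PA\<rbrakk> \<Longrightarrow> op_norm H (\<pi> p) \<le> uP p"
    by (rule *(2))
  show "\<lbrakk>p \<in> carrier PA; \<And>(H :: (nat \<Rightarrow> real \<Rightarrow> 'a) inner_product_space) \<pi>. continuous_representation PA H \<pi> \<Longrightarrow> op_norm H (\<pi> p) \<le> M\<rbrakk> \<Longrightarrow> uP p \<le> M"
    by (rule *(3))
qed

lemma seminormed_Cc: "seminormed_star_algebra (normed_Cc_algebra \<G>)"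
  and uQ_upper: "\<lbrakk>norm_decreasing_representation (Cc_algebra \<G>) (H :: (nat \<Rightarrow> 'x \<times> 'x \<Rightarrow> complex) inner_product_space) \<pi>; f \<in> Cc\<rbrakk> \<Longrightarrow> op_norm H (\<pi> f) \<le> uQ f"
  and uQ_least: "\<lbrakk>f \<in> Cc; \<And>(H :: (nat \<Rightarrow> 'x \<times> 'x \<Rightarrow> complex) inner_product_space) \<pi>. norm_decreasing_representation (Cc_algebra \<G>) H \<pi> \<Longrightarrow> op_norm H (\<pi> f) \<le> M\<rbrakk> \<Longrightarrow> uQ f \<le> M"
proof -
  obtain H0 :: "(nat \<Rightarrow> 'x \<times> 'x \<Rightarrow> complex) inner_product_space" and \<pi>0
    where "representation (Cc_algebra \<G>) H0 \<pi>0"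
    using representation_zero[of "Cc_algebra \<G>"] by blast
  then have ex: "norm_decreasing_representation (Cc_algebra \<G>) H0 \<pi>0"
    by (simp add: norm_decreasing_representation_Cc)
  have R: "\<And>H \<pi>. norm_decreasing_representation (Cc_algebra \<G>) H \<pi> \<Longrightarrow> representation (Cc_algebra \<G>) H \<pi>"
    by (simp add: norm_decreasing_representation_def)
  note * = seminormed_universal_norm[OF star_algebra_Cc, where R="norm_decreasing_representation (Cc_algebra \<G>)",
      OF R ex uQ_bounded]
  show "seminormed_star_algebra (normed_Cc_algebra \<G>)"
    unfolding normed_Cc_algebra_def by (rule *(1))
  show "\<lbrakk>norm_decreasing_representation (Cc_algebra \<G>) H \<pi>; f \<in> Cc\<rbrakk> \<Longrightarrow> op_norm H (\<pi> f) \<le> uQ f"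
    by (rule *(2))
  show "\<lbrakk>f \<in> Cc; \<And>(H :: (nat \<Rightarrow> 'x \<times> 'x \<Rightarrow> complex) inner_product_space) \<pi>. norm_decreasing_representation (Cc_algebra \<G>) H \<pi> \<Longrightarrow> op_norm H (\<pi> f) \<le> M\<rbrakk> \<Longrightarrow> uQ f \<le> M"
    by (rule *(3))
qed

lemma Cc_subset: "f \<in> Cc \<Longrightarrow> f \<in> C0_fin"
  using Cc_iff by blast

text \<open>A representation of polynomials is recoded on the cyclic subspace of \<open>v\<close>,
  with vectors given by sequences in \<open>Cc\<close>, and then restricted to \<open>Cc\<close>.
  The coding relies on truncations being dense among the vectors \<open>\<pi> (\<Psi>' F) v\<close>;
  the adjoint brought in by \<open>cyclic_transport\<close> leaves \<open>uQ\<close>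
  unchanged.\<close>

lemma uP_le_uQ:
  assumes f: "f \<in> Cc"
  shows "uP (\<Psi>' f) \<le> uQ f"
proof (rule uP_least[OF \<Psi>'(1)[OF Cc_subset[OF f]]])
  interpret Q: seminormed_star_algebra "normed_Cc_algebra \<G>" by (rule seminormed_Cc)
  have star_f: "fstar f \<in> Cc" "uQ (fstar f) = uQ f"
    using Q.nrm_star[of f] K.B_star[OF f] f by (simp_all add: normed_Cc_algebra_def)
  have uQ0: "0 \<le> uQ f" using Q.nrm_nonneg[of f] f by (simp add: normed_Cc_algebra_def)
  fix H :: "(nat \<Rightarrow> real \<Rightarrow> 'a) inner_product_space" and \<pi>
  assume "continuous_representation PA H \<pi>"
  then have rep: "representation PA H \<pi>" by (simp add: continuous_representation_PA)
  interpret R: slice_representation \<G> c C0_fin H "\<lambda>F. \<pi> (\<Psi>' F)" by (rule slice_representation_PA[OF rep])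
  show "op_norm H (\<pi> (\<Psi>' f)) \<le> uQ f"
  proof (rule R.H.op_norm_le[OF _ uQ0])
    fix v assume v: "v \<in> carrier H"
    have dense: "\<exists>b\<in>Cc. vec_norm H (\<pi> (\<Psi>' b) v \<ominus>\<^bsub>H\<^esub> \<pi> (\<Psi>' F) v) < e"
      if F: "F \<in> carrier (fun_algebra C0_fin \<G>)" and e: "e > 0" for F and e :: real
    proof -
      have F': "F \<in> C0_fin" using F by simp
      define N where "N = c ` {p. F p \<noteq> 0}"
      have N: "finite N" using C0_finD(2)[OF F'] by (simp add: N_def)
      \<comment> \<open>The threshold is chosen against the bound
        \<open>card N * d * vec_norm H v\<close> of \<open>rep_uniform_bound\<close>; the added 1
        covers zero \<open>v\<close> and zero \<open>F\<close>.\<close>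
      define d where "d = e / (real (card N) * vec_norm H v + 1)"
      have den: "real (card N) * vec_norm H v + 1 > 0" using v by (simp add: add_nonneg_pos)
      then have d: "d > 0" using e by (simp add: d_def)
      define b where "b = truncate d F"
      have b: "b \<in> Cc" unfolding b_def by (rule truncate_Cc[OF F' d])
      define g where "g = (\<lambda>p. b p + (- 1) * F p)"
      have g: "g \<in> C0_fin" unfolding g_def by (intro C.B_add C.B_smult Cc_subset b F')
      have "\<pi> (\<Psi>' g) v = \<pi> (\<Psi>' b) v \<ominus>\<^bsub>H\<^esub> \<pi> (\<Psi>' F) v"
        unfolding g_def
        using R.rep_add[of b "\<lambda>p. (- 1) * F p" v] R.rep_smult[of F v "- 1"] C.B_smult[OF F', of "- 1"]
          Cc_subset[OF b] F' v by (simp add: R.H.diff_eq_smult)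
      then have "vec_norm H (\<pi> (\<Psi>' b) v \<ominus>\<^bsub>H\<^esub> \<pi> (\<Psi>' F) v) = vec_norm H (\<pi> (\<Psi>' g) v)" by simp
      also have "\<dots> \<le> real (card N) * d * vec_norm H v"
      proof (rule R.rep_uniform_bound[OF g N _ _ v])
        fix p
        show "cmod (g p) \<le> d" using soft_threshold(3)[OF d, of "F p"] by (simp add: g_def b_def truncate_def)
        have "g p = 0" if "F p = 0" using that soft_threshold(2)[OF d] by (simp add: g_def b_def truncate_def)
        then show "g p \<noteq> 0 \<Longrightarrow> c p \<in> N" by (auto simp: N_def)
      qed
      also have "\<dots> < e" using den e by (simp add: d_def field_simps)
      finally show ?thesis using b by blast
    qed
    from R.cyclic_transport[of v Cc "\<lambda>x. x", OF v _ dense]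
    obtain H' :: "(nat \<Rightarrow> 'x \<times> 'x \<Rightarrow> complex) inner_product_space" and \<pi>'
      where rep': "representation (fun_algebra C0_fin \<G>) H' \<pi>'"
        and le: "\<And>F. F \<in> C0_fin \<Longrightarrow> vec_norm H (\<pi> (\<Psi>' F) v) \<le> op_norm H' (\<pi>' (fstar F)) * vec_norm H v"
      using Cc_subset by (auto simp: subset_iff inj_on_def)
    have "representation (Cc_algebra \<G>) H' \<pi>'"
      by (rule representation_comp[OF rep', of _ "\<lambda>x. x"]) (use Cc_subset in auto)
    then have "norm_decreasing_representation (Cc_algebra \<G>) H' \<pi>'"
      by (simp add: norm_decreasing_representation_Cc)
    from uQ_upper[OF this star_f(1)] have "op_norm H' (\<pi>' (fstar f)) \<le> uQ f" unfolding star_f(2) .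
    then show "vec_norm H (\<pi> (\<Psi>' f) v) \<le> uQ f * vec_norm H v"
      using le[OF Cc_subset[OF f]] mult_right_mono[OF _ R.H.vec_norm_nonneg[OF v]] order_trans by blast
  qed
qed

text \<open>Here the representation is first extended from \<open>Cc\<close> to
  \<open>C0_fin\<close>. Density is then trivial, and \<open>\<Psi>'\<close> encodes functions as
  polynomials to reach the required type of vectors.\<close>

lemma uQ_le_uP:
  assumes f: "f \<in> Cc"
  shows "uQ f \<le> uP (\<Psi>' f)"
proof (rule uQ_least[OF f])
  interpret P: seminormed_star_algebra "normed_polynomial_algebra G A D \<alpha>" by (rule seminormed_PA)
  have f': "f \<in> C0_fin" by (rule Cc_subset[OF f])
  have star_f: "uP (\<Psi>' (fstar f)) = uP (\<Psi>' f)"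
    using P.nrm_star[of "\<Psi>' f"] \<Psi>'(1)[OF f']
    by (simp add: normed_polynomial_algebra_def Let_def \<Psi>'_hom f')
  have uP0: "0 \<le> uP (\<Psi>' f)"
    using P.nrm_nonneg[of "\<Psi>' f"] \<Psi>'(1)[OF f'] by (simp add: normed_polynomial_algebra_def Let_def)
  fix H :: "(nat \<Rightarrow> 'x \<times> 'x \<Rightarrow> complex) inner_product_space" and \<pi>
  assume "norm_decreasing_representation (Cc_algebra \<G>) H \<pi>"
  then have rep: "representation (Cc_algebra \<G>) H \<pi>" by (simp add: norm_decreasing_representation_Cc)
  interpret S: Cc_representation \<G> c H \<pi>
    by (rule Cc_representation.intro[OF slice_representation_Cc[OF rep]])
  interpret R: star_representation "fun_algebra C0_fin \<G>" H S.extension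
    by (rule star_representationI[OF C.star_algebra_B S.representation_extension])
  show "op_norm H (\<pi> f) \<le> uP (\<Psi>' f)"
  proof (rule S.H.op_norm_le[OF _ uP0])
    fix v assume v: "v \<in> carrier H"
    have dense: "\<exists>b\<in>C0_fin. vec_norm H (S.extension b v \<ominus>\<^bsub>H\<^esub> S.extension F v) < e"
      if F: "F \<in> carrier (fun_algebra C0_fin \<G>)" and e: "e > 0" for F and e :: real
    proof -
      have "S.extension F v \<ominus>\<^bsub>H\<^esub> S.extension F v = \<zero>\<^bsub>H\<^esub>"
        using S.extension_closed[of F v] F v by (simp add: S.H.diff_eq_zero_iff)
      then show ?thesis using F e by (intro bexI[of _ F]) auto
    qed
    have inj: "inj_on \<Psi>' C0_fin" using \<Psi>'(2) by (metis inj_onI)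
    from R.cyclic_transport[of v C0_fin \<Psi>', OF v _ dense inj]
    obtain H' :: "(nat \<Rightarrow> real \<Rightarrow> 'a) inner_product_space" and \<pi>'
      where rep': "representation (fun_algebra C0_fin \<G>) H' \<pi>'"
        and le: "\<And>F. F \<in> C0_fin \<Longrightarrow> vec_norm H (S.extension F v) \<le> op_norm H' (\<pi>' (fstar F)) * vec_norm H v"
      by auto
    have "continuous_representation PA H' (\<lambda>p. \<pi>' (\<Psi> p))"
      unfolding continuous_representation_PA by (rule representation_PA[OF rep'])
    from uP_upper[OF this \<Psi>'(1)[OF C.B_star[OF f']]]
    have "op_norm H' (\<pi>' (fstar f)) \<le> uP (\<Psi>' f)"
      unfolding star_f \<Psi>'(2)[OF C.B_star[OF f']] .
    then have "op_norm H' (\<pi>' (fstar f)) * vec_norm H v \<le> uP (\<Psi>' f) * vec_norm H v"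
      using v by (intro mult_right_mono) auto
    then show "vec_norm H (\<pi> f v) \<le> uP (\<Psi>' f) * vec_norm H v"
      using le[OF f'] S.extension_eq[OF f v] by simp
  qed
qed

lemma uP_uniform_bound:
  assumes p: "p \<in> carrier PA" and N: "finite N" "\<And>q. \<Psi> p q \<noteq> 0 \<Longrightarrow> c q \<in> N"
    and e: "\<And>q. cmod (\<Psi> p q) \<le> e"
  shows "uP p \<le> real (card N) * e"
proof (rule uP_least[OF p])
  fix H :: "(nat \<Rightarrow> real \<Rightarrow> 'a) inner_product_space" and \<pi>
  assume "continuous_representation PA H \<pi>"
  then have rep: "representation PA H \<pi>" by (simp add: continuous_representation_PA)
  interpret R: slice_representation \<G> c C0_fin H "\<lambda>F. \<pi> (\<Psi>' F)" by (rule slice_representation_PA[OF rep])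
  have e0: "0 \<le> e" using e[of undefined] norm_ge_zero order_trans by blast
  show "op_norm H (\<pi> p) \<le> real (card N) * e"
  proof (rule R.H.op_norm_le)
    fix v assume v: "v \<in> carrier H"
    show "vec_norm H (\<pi> p v) \<le> real (card N) * e * vec_norm H v"
      using R.rep_uniform_bound[OF \<Psi>_closed[OF p] N e v] by (simp add: \<Psi>'(3)[OF p])
  qed (use e0 in simp)
qed

text \<open>Truncation never enlarges the support, so the same approximation works among the
  polynomials of nonnegative degree. The difference is written with the scalar -1 because
  \<open>PA\<close> and the normed algebra are distinct records sharing addition and
  scalars.\<close>

lemma truncation_dense:
  assumes p: "p \<in> carrier PA" and e: "e > 0"
  shows "\<exists>f\<in>Cc. (\<forall>q. f q \<noteq> 0 \<longrightarrow> \<Psi> p q \<noteq> 0) \<and> uP (p \<oplus>\<^bsub>PA\<^esub> (- 1) \<odot>\<^bsub>PA\<^esub> \<Psi>' f) < e"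
proof -
  define N where "N = c ` {q. \<Psi> p q \<noteq> 0}"
  have F: "\<Psi> p \<in> C0_fin" by (rule \<Psi>_closed[OF p])
  have N: "finite N" using C0_finD(2)[OF F] by (simp add: N_def)
  define d where "d = e / (real (card N) + 1)"
  have d: "d > 0" using e by (simp add: d_def add_nonneg_pos)
  define f where "f = truncate d (\<Psi> p)"
  have f: "f \<in> Cc" unfolding f_def by (rule truncate_Cc[OF F d])
  have f0: "f q = 0" if "\<Psi> p q = 0" for q
    using that soft_threshold(2)[OF d] by (simp add: f_def truncate_def)
  let ?r = "p \<oplus>\<^bsub>PA\<^esub> (- 1) \<odot>\<^bsub>PA\<^esub> \<Psi>' f"
  have f': "\<Psi>' f \<in> carrier PA" "\<Psi> (\<Psi>' f) = f" using \<Psi>' Cc_subset[OF f] by auto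
  have r: "?r \<in> carrier PA" by (intro \<Psi>_add \<Psi>_smult p f')
  have \<Psi>r: "\<Psi> ?r = (\<lambda>q. \<Psi> p q - f q)"
    by (simp add: \<Psi>_add \<Psi>_smult p f')
  have "uP ?r \<le> real (card N) * d"
  proof (rule uP_uniform_bound[OF r N])
    fix q
    show "cmod (\<Psi> ?r q) \<le> d"
      unfolding \<Psi>r using soft_threshold(3)[OF d, of "\<Psi> p q"] by (simp add: f_def truncate_def norm_minus_commute)
    show "c q \<in> N" if "\<Psi> ?r q \<noteq> 0"
      using that f0[of q] unfolding \<Psi>r N_def by auto
  qed
  also have "real (card N) * d < (real (card N) + 1) * d" using d by simp
  also have "\<dots> = e" by (simp add: d_def add_nonneg_pos)
  finally have "uP ?r < e" .
  moreover have "\<forall>q. f q \<noteq> 0 \<longrightarrow> \<Psi> p q \<noteq> 0" using f0 by blast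
  ultimately show ?thesis using f by blast
qed

theorem groupoid_algebra_iso_crossed_product:
  obtains \<Phi> where "star_iso (groupoid_algebra \<G>) (crossed_product G A D \<alpha>) \<Phi>"
    and "\<Phi> ` analytic_groupoid_algebra \<G> c = analytic_crossed_product G A D \<alpha> (G \<inter> {0..})"
proof -
  let ?P = "normed_polynomial_algebra G A D \<alpha>" and ?Q = "normed_Cc_algebra \<G>"
  interpret P: seminormed_star_algebra ?P by (rule seminormed_PA)
  have P_ops: "carrier ?P = carrier PA" "add ?P = add PA" "smult ?P = smult PA" "mult ?P = mult PA"
    "star ?P = star PA" "nrm ?P = uP"
    by (simp_all add: normed_polynomial_algebra_def Let_def)
  have Q_ops: "carrier ?Q = Cc" "nrm ?Q = uQ" by (simp_all add: normed_Cc_algebra_def)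
  have nrm_diff: "nrm ?P (p \<ominus>\<^bsub>?P\<^esub> \<Psi>' f) = uP (p \<oplus>\<^bsub>PA\<^esub> (- 1) \<odot>\<^bsub>PA\<^esub> \<Psi>' f)" if "f \<in> Cc" for p f
    using \<Psi>'(1)[OF Cc_subset[OF that]] by (simp add: P.diff_eq_smult P_ops)
  obtain \<Phi> where iso: "star_iso (completion ?Q) (completion ?P) \<Phi>"
    and cl: "\<And>S T. \<lbrakk>S \<subseteq> carrier ?Q; T \<subseteq> carrier ?P; \<Psi>' ` S \<subseteq> T;
            \<And>p e. \<lbrakk>p \<in> T; 0 < e\<rbrakk> \<Longrightarrow> \<exists>q\<in>S. nrm ?P (p \<ominus>\<^bsub>?P\<^esub> \<Psi>' q) < e\<rbrakk>
          \<Longrightarrow> \<Phi> ` closure_in_completion ?Q S = closure_in_completion ?P T"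
  proof (rule star_iso_completion[OF seminormed_PA seminormed_Cc, of \<Psi>'])
    fix p and e :: real assume "p \<in> carrier ?P" "0 < e"
    then show "\<exists>q\<in>carrier ?Q. nrm ?P (p \<ominus>\<^bsub>?P\<^esub> \<Psi>' q) < e"
      using truncation_dense[of p e] nrm_diff unfolding P_ops Q_ops by fastforce
  next
    fix f assume "f \<in> carrier ?Q"
    then show "nrm ?P (\<Psi>' f) = nrm ?Q f"
      using uP_le_uQ[of f] uQ_le_uP[of f] unfolding P_ops Q_ops by simp
  qed (simp_all add: normed_Cc_algebra_def P_ops \<Psi>' \<Psi>'_hom Cc_subset)
  let ?S = "{f \<in> carrier (Cc_algebra \<G>). \<forall>p\<in>topspace \<G>. f p \<noteq> 0 \<longrightarrow> 0 \<le> c p}"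
  let ?T = "{p \<in> carrier PA. \<forall>n. p n \<noteq> \<zero>\<^bsub>A\<^esub> \<longrightarrow> n \<in> G \<inter> {0..}}"
  have "\<Phi> ` closure_in_completion ?Q ?S = closure_in_completion ?P ?T"
  proof (rule cl)
    show "?S \<subseteq> carrier ?Q" "?T \<subseteq> carrier ?P" by (auto simp: P_ops Q_ops)
    show "\<Psi>' ` ?S \<subseteq> ?T"
    proof
      fix p assume "p \<in> \<Psi>' ` ?S"
      then obtain f where f: "f \<in> Cc" "\<And>q. q \<in> topspace \<G> \<Longrightarrow> f q \<noteq> 0 \<Longrightarrow> 0 \<le> c q" "p = \<Psi>' f"
        by blast
      have p: "p \<in> carrier PA" "\<Psi> p = f" using \<Psi>' Cc_subset[OF f(1)] f(3) by auto
      \<comment> \<open>A nonzero coefficient is nonzero at some point of \<open>dom n\<close> and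
        so produces a point of \<open>slice n\<close> in the support of \<open>f\<close>, where
        \<open>c\<close> takes the value \<open>n\<close>.\<close>
      have "n \<in> G \<inter> {0..}" if n: "p n \<noteq> \<zero>\<^bsub>A\<^esub>" for n
      proof -
        obtain x where x: "\<phi> (p n) x \<noteq> 0" using \<phi>_eq_zero[OF PAD(4)[OF p(1)]] n by blast
        then have "x \<in> dom n" using PA_vanish[OF p(1)] by blast
        then have sl: "(x, act (- n) x) \<in> slice n" by (rule act_slice)
        then have "f (x, act (- n) x) \<noteq> 0" using \<Psi>_slice[OF sl, of p] x p(2) by simp
        then have "0 \<le> n" using f(2)[of "(x, act (- n) x)"] sl by (simp add: slice_def)
        then show ?thesis using PA_support[OF p(1) n] by simp
      qed
      then show "p \<in> ?T" using p by blast
    qed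
    fix p and e :: real assume p: "p \<in> ?T" and e: "0 < e"
    then obtain f where f: "f \<in> Cc" "\<And>q. f q \<noteq> 0 \<Longrightarrow> \<Psi> p q \<noteq> 0"
      "uP (p \<oplus>\<^bsub>PA\<^esub> (- 1) \<odot>\<^bsub>PA\<^esub> \<Psi>' f) < e" using truncation_dense[of p e] by blast
    \<comment> \<open>The support of \<open>f\<close> lies in that of \<open>\<Psi> p\<close>, where
      only the degrees of nonzero coefficients of \<open>p\<close> occur.\<close>
    have "f \<in> ?S" using f(1,2) \<Psi>_support[of p] p by fastforce
    then show "\<exists>q\<in>?S. nrm ?P (p \<ominus>\<^bsub>?P\<^esub> \<Psi>' q) < e"
      using f(3) nrm_diff[OF f(1)] by auto
  qed
  then show thesis
    using that[of \<Phi>] iso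
    unfolding groupoid_algebra_def crossed_product_def analytic_groupoid_algebra_def
      analytic_crossed_product_def by blast
qed

theorem crossed_product_iso_groupoid_algebra:
  obtains \<Phi> where "star_iso (crossed_product G A D \<alpha>) (groupoid_algebra \<G>) \<Phi>"
    and "\<Phi> ` analytic_crossed_product G A D \<alpha> (G \<inter> {0..}) = analytic_groupoid_algebra \<G> c"
proof -
  obtain \<Phi> where iso: "star_iso (groupoid_algebra \<G>) (crossed_product G A D \<alpha>) \<Phi>"
    and im: "\<Phi> ` analytic_groupoid_algebra \<G> c = analytic_crossed_product G A D \<alpha> (G \<inter> {0..})"
    by (rule groupoid_algebra_iso_crossed_product)
  interpret Q: seminormed_star_algebra "normed_Cc_algebra \<G>" by (rule seminormed_Cc)
  let ?\<Phi>' = "inv_into (carrier (groupoid_algebra \<G>)) \<Phi>"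
  have "star_iso (crossed_product G A D \<alpha>) (groupoid_algebra \<G>) ?\<Phi>'"
    by (rule star_iso_inv[OF iso]) (simp_all add: groupoid_algebra_def Q.completion_closed)
  moreover have "analytic_groupoid_algebra \<G> c \<subseteq> carrier (groupoid_algebra \<G>)"
    unfolding analytic_groupoid_algebra_def groupoid_algebra_def
    by (subst Q.closure_in_completion_eq) (auto simp: normed_Cc_algebra_def)
  moreover have "inj_on \<Phi> (carrier (groupoid_algebra \<G>))"
    using iso by (simp add: star_iso_def bij_betw_def)
  ultimately show thesis
    using that[of ?\<Phi>'] im[symmetric] by (simp add: inv_into_image_cancel)
qed

end

section \<open>The groupoid of a free partial action\<close>

locale free_space_action = space_partial_action G X Xs \<beta>
  for G :: "real set" and X :: "'x topology" and Xs \<beta> +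
  assumes G_zero: "0 \<in> G"
    and G_uminus: "n \<in> G \<Longrightarrow> - n \<in> G"
    and free: "free_on_space G Xs \<beta>"
begin

lemma Xs_subset: "n \<in> G \<Longrightarrow> Xs n \<subseteq> topspace X"
  using open_domain openin_subset by blast

lemma \<beta>_image: "n \<in> G \<Longrightarrow> \<beta> n ` Xs (- n) = Xs n"
  using homeomorphic_imp_surjective_map[OF homeo[of n]] Xs_subset[of n] Xs_subset[OF G_uminus, of n]
  by (simp add: Int_absorb1)

lemma \<beta>_inj: "n \<in> G \<Longrightarrow> inj_on (\<beta> n) (Xs (- n))"
  using homeomorphic_imp_injective_map[OF homeo[of n]] Xs_subset[OF G_uminus, of n]
  by (simp add: Int_absorb1)

lemma \<beta>_closed: "\<lbrakk>n \<in> G; y \<in> Xs (- n)\<rbrakk> \<Longrightarrow> \<beta> n y \<in> Xs n"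
  using \<beta>_image by blast

lemma \<beta>_inverse: "\<lbrakk>n \<in> G; y \<in> Xs (- n)\<rbrakk> \<Longrightarrow> \<beta> (- n) (\<beta> n y) = y"
  using comp[of "- n" n y] G_uminus[of n] domain_0 action_0[of y] Xs_subset[OF G_uminus, of n] by auto

lemma \<beta>_inverse': "\<lbrakk>n \<in> G; x \<in> Xs n\<rbrakk> \<Longrightarrow> \<beta> (- n) x \<in> Xs (- n) \<and> \<beta> n (\<beta> (- n) x) = x"
  using \<beta>_inverse[of "- n" x] \<beta>_closed[of "- n" x] G_uminus[of n] by simp

lemma \<beta>_continuous: "n \<in> G \<Longrightarrow> continuous_map (subtopology X (Xs (- n))) X (\<beta> n)"
  using homeomorphic_imp_continuous_map[OF homeo[of n]] continuous_map_into_fulltopology by blast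

text \<open>The issue is whether \<open>y\<close> lies in the domain of
  \<open>\<beta> (m + n)\<close>: condition (1a) for \<open>- n\<close> and \<open>- m\<close>,
  applied to \<open>\<beta> n y\<close>, puts \<open>y\<close> into
  \<open>Xs (- n + - m)\<close>.\<close>

lemma \<beta>_comp:
  assumes n: "n \<in> G" and m: "m \<in> G" and y: "y \<in> Xs (- n)" and x: "\<beta> n y \<in> Xs (- m)"
  shows "y \<in> Xs (- (m + n)) \<and> \<beta> (m + n) y = \<beta> m (\<beta> n y)"
proof -
  have "\<beta> (- n) (\<beta> n y) \<in> \<beta> (- n) ` (Xs (- (- n)) \<inter> Xs (- m))"
    using x \<beta>_closed[OF n y] by simp
  then have "y \<in> Xs (- n + - m)"
    unfolding \<beta>_inverse[OF n y] using image_1a[of "- n" "- m"] G_uminus n m by blast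
  then have y': "y \<in> Xs (- m - n)" by (simp add: algebra_simps)
  then show ?thesis using comp[OF m n, of y] y by simp
qed

text \<open>Otherwise \<open>\<beta> (- n + m)\<close> would fix \<open>y\<close> with a nonzero
  index. Freeness thus gives each pair in an orbit a well defined degree.\<close>

lemma \<beta>_unique:
  assumes n: "n \<in> G" and m: "m \<in> G" and y: "y \<in> Xs (- n)" "y \<in> Xs (- m)" and eq: "\<beta> n y = \<beta> m y"
  shows "n = m"
proof -
  have "\<beta> m y \<in> Xs (- (- n))" using \<beta>_closed[OF n y(1)] eq by simp
  from \<beta>_comp[OF m G_uminus[OF n] y(2) this]
  have "y \<in> Xs (- (- n + m))" "\<beta> (- n + m) y = y"
    using \<beta>_inverse[OF n y(1)] eq by auto
  moreover have "- n + m \<in> G" using add_closed G_uminus n m by blast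
  ultimately have "- n + m = 0" using free unfolding free_on_space_def by blast
  then show ?thesis by simp
qed

definition graph :: "real \<Rightarrow> ('x \<times> 'x) set" where
  "graph n = {(x, y). n \<in> G \<and> y \<in> Xs (- n) \<and> x = \<beta> n y}"

definition orbit_rel :: "('x \<times> 'x) set" where
  "orbit_rel = (\<Union>n\<in>G. graph n)"

text \<open>The disjoint union topology: each graph is open and carries the topology of
  \<open>Xs n\<close> through the section \<open>x \<mapsto> (x, \<beta> (- n) x)\<close>. The
  relative topology of the square of \<open>X\<close> would not do, as graphs of different degrees
  may accumulate on one another.\<close>

definition orbit_groupoid :: "('x \<times> 'x) topology" where
  "orbit_groupoid = topology (\<lambda>W. W \<subseteq> orbit_rel \<and> (\<forall>n\<in>G. openin X {x \<in> Xs n. (x, \<beta> (- n) x) \<in> W}))"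

definition orbit_cocycle :: "'x \<times> 'x \<Rightarrow> real" where
  "orbit_cocycle p = (THE n. p \<in> graph n)"

lemma graph_iff: "(x, y) \<in> graph n \<longleftrightarrow> n \<in> G \<and> x \<in> Xs n \<and> y = \<beta> (- n) x"
  unfolding graph_def using \<beta>_inverse[of n y] \<beta>_inverse'[of n x] \<beta>_closed[of n y] by auto

lemma graphD: "(x, y) \<in> graph n \<Longrightarrow> n \<in> G \<and> y \<in> Xs (- n) \<and> x = \<beta> n y"
  by (simp add: graph_def)

lemma graph_unique: "\<lbrakk>p \<in> graph n; p \<in> graph m\<rbrakk> \<Longrightarrow> n = m"
  unfolding graph_def using \<beta>_unique by auto

lemma graph_sym: "(x, y) \<in> graph n \<Longrightarrow> (y, x) \<in> graph (- n)"
  using graph_iff[of x y n] G_uminus[of n] \<beta>_inverse'[of n x] by (auto simp: graph_def)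

lemma graph_trans: "\<lbrakk>(x, y) \<in> graph n; (y, z) \<in> graph m\<rbrakk> \<Longrightarrow> (x, z) \<in> graph (n + m)"
proof -
  assume "(x, y) \<in> graph n" "(y, z) \<in> graph m"
  then have *: "n \<in> G" "y \<in> Xs (- n)" "x = \<beta> n y" "m \<in> G" "z \<in> Xs (- m)" "y = \<beta> m z"
    using graphD by blast+
  then have "z \<in> Xs (- (n + m)) \<and> \<beta> (n + m) z = x" using \<beta>_comp[of m n z] by simp
  then show ?thesis using add_closed[OF *(1,4)] unfolding graph_def by blast
qed

lemma orbit_rel_trans: "\<lbrakk>(x, y) \<in> orbit_rel; (y, z) \<in> orbit_rel\<rbrakk> \<Longrightarrow> (x, z) \<in> orbit_rel"
proof -
  assume "(x, y) \<in> orbit_rel" "(y, z) \<in> orbit_rel"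
  then obtain n m where "(x, y) \<in> graph n" "(y, z) \<in> graph m" unfolding orbit_rel_def by blast
  then have "(x, z) \<in> graph (n + m)" by (rule graph_trans)
  then show ?thesis unfolding orbit_rel_def using graphD by blast
qed

lemma graph_0: "(x, y) \<in> graph 0 \<longleftrightarrow> x = y \<and> x \<in> topspace X"
  using G_zero domain_0 action_0 by (auto simp: graph_def)

lemma graph_fst: "(x, y) \<in> graph n \<Longrightarrow> x \<in> topspace X" and graph_snd: "(x, y) \<in> graph n \<Longrightarrow> y \<in> topspace X"
  using graph_iff[of x y n] graphD[of x y n] Xs_subset[of n] Xs_subset[of "- n"] G_uminus[of n] by blast+

lemma istopology_orbit:
  "istopology (\<lambda>W. W \<subseteq> orbit_rel \<and> (\<forall>n\<in>G. openin X {x \<in> Xs n. (x, \<beta> (- n) x) \<in> W}))"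
  unfolding istopology_def
proof (intro conjI allI impI ballI)
  fix S T n
  assume S: "S \<subseteq> orbit_rel \<and> (\<forall>n\<in>G. openin X {x \<in> Xs n. (x, \<beta> (- n) x) \<in> S})"
    and T: "T \<subseteq> orbit_rel \<and> (\<forall>n\<in>G. openin X {x \<in> Xs n. (x, \<beta> (- n) x) \<in> T})"
  show "S \<inter> T \<subseteq> orbit_rel" using S by blast
  assume "n \<in> G"
  then have "openin X ({x \<in> Xs n. (x, \<beta> (- n) x) \<in> S} \<inter> {x \<in> Xs n. (x, \<beta> (- n) x) \<in> T})"
    using S T by blast
  moreover have "{x \<in> Xs n. (x, \<beta> (- n) x) \<in> S} \<inter> {x \<in> Xs n. (x, \<beta> (- n) x) \<in> T} =
      {x \<in> Xs n. (x, \<beta> (- n) x) \<in> S \<inter> T}" by blast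
  ultimately show "openin X {x \<in> Xs n. (x, \<beta> (- n) x) \<in> S \<inter> T}" by simp
next
  fix \<W> n
  assume W: "\<forall>W\<in>\<W>. W \<subseteq> orbit_rel \<and> (\<forall>n\<in>G. openin X {x \<in> Xs n. (x, \<beta> (- n) x) \<in> W})"
  show "\<Union>\<W> \<subseteq> orbit_rel" using W by blast
  assume "n \<in> G"
  then have "openin X (\<Union>W\<in>\<W>. {x \<in> Xs n. (x, \<beta> (- n) x) \<in> W})" using W by blast
  moreover have "(\<Union>W\<in>\<W>. {x \<in> Xs n. (x, \<beta> (- n) x) \<in> W}) = {x \<in> Xs n. (x, \<beta> (- n) x) \<in> \<Union>\<W>}" by blast
  ultimately show "openin X {x \<in> Xs n. (x, \<beta> (- n) x) \<in> \<Union>\<W>}" by simp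
qed

lemma openin_orbit: "openin orbit_groupoid W \<longleftrightarrow>
    W \<subseteq> orbit_rel \<and> (\<forall>n\<in>G. openin X {x \<in> Xs n. (x, \<beta> (- n) x) \<in> W})"
  unfolding orbit_groupoid_def topology_inverse'[OF istopology_orbit] by (rule refl)

lemma open_Xs: "n \<in> G \<Longrightarrow> openin X (Xs n)"
  using open_domain by blast

lemma topspace_orbit: "topspace orbit_groupoid = orbit_rel"
proof
  have "{x \<in> Xs n. (x, \<beta> (- n) x) \<in> orbit_rel} = Xs n" if "n \<in> G" for n
    using that graph_iff by (auto simp: orbit_rel_def)
  then have "openin orbit_groupoid orbit_rel" using openin_orbit open_Xs by simp
  then show "orbit_rel \<subseteq> topspace orbit_groupoid" by (rule openin_subset)
  show "topspace orbit_groupoid \<subseteq> orbit_rel" using openin_orbit openin_topspace by blast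
qed

lemma open_graph: "openin orbit_groupoid (graph n)"
proof (cases "n \<in> G")
  case True
  have "{x \<in> Xs m. (x, \<beta> (- m) x) \<in> graph n} = (if m = n then Xs n else {})" if "m \<in> G" for m
    using that graph_iff[of _ _ m] graph_unique[of _ m n] by auto
  then show ?thesis using True open_Xs by (auto simp: openin_orbit orbit_rel_def)
next
  case False
  then have "graph n = {}" by (auto simp: graph_def)
  then show ?thesis by simp
qed

lemma continuous_orbit_fst: "continuous_map orbit_groupoid X fst"
  unfolding continuous_map_def
proof (intro conjI allI impI)
  show "fst \<in> topspace orbit_groupoid \<rightarrow> topspace X"
    using graph_fst by (auto simp: topspace_orbit orbit_rel_def)
  fix V assume V: "openin X V"
  have "{x \<in> Xs n. (x, \<beta> (- n) x) \<in> {p \<in> orbit_rel. fst p \<in> V}} = Xs n \<inter> V" if "n \<in> G" for n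
    using that graph_iff by (auto simp: orbit_rel_def)
  then show "openin orbit_groupoid {p \<in> topspace orbit_groupoid. fst p \<in> V}"
    unfolding openin_orbit topspace_orbit using V open_Xs by auto
qed

lemma continuous_orbit_section:
  assumes n: "n \<in> G"
  shows "continuous_map (subtopology X (Xs n)) orbit_groupoid (\<lambda>x. (x, \<beta> (- n) x))"
  unfolding continuous_map_def
proof (intro conjI allI impI)
  show "(\<lambda>x. (x, \<beta> (- n) x)) \<in> topspace (subtopology X (Xs n)) \<rightarrow> topspace orbit_groupoid"
    using n graph_iff by (auto simp: topspace_orbit orbit_rel_def)
  fix W assume "openin orbit_groupoid W"
  then have "openin X {x \<in> Xs n. (x, \<beta> (- n) x) \<in> W}" using n openin_orbit by blast
  moreover have "{x \<in> topspace (subtopology X (Xs n)). (x, \<beta> (- n) x) \<in> W} = {x \<in> Xs n. (x, \<beta> (- n) x) \<in> W}"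
    using Xs_subset[OF n] by auto
  ultimately show "openin (subtopology X (Xs n)) {x \<in> topspace (subtopology X (Xs n)). (x, \<beta> (- n) x) \<in> W}"
    by (simp add: openin_open_subtopology open_Xs n)
qed

lemma open_orbit_fst: "openin orbit_groupoid W \<Longrightarrow> openin X (fst ` W)"
proof -
  assume W: "openin orbit_groupoid W"
  have "fst ` W = (\<Union>n\<in>G. {x \<in> Xs n. (x, \<beta> (- n) x) \<in> W})"
  proof (intro equalityI subsetI)
    fix x assume "x \<in> fst ` W"
    then obtain y n where "(x, y) \<in> W" "(x, y) \<in> graph n"
      using W by (auto simp: openin_orbit orbit_rel_def)
    then show "x \<in> (\<Union>n\<in>G. {x \<in> Xs n. (x, \<beta> (- n) x) \<in> W})" using graph_iff[of x y n] by auto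
  next
    fix x assume "x \<in> (\<Union>n\<in>G. {x \<in> Xs n. (x, \<beta> (- n) x) \<in> W})"
    then show "x \<in> fst ` W" by force
  qed
  moreover have "openin X (\<Union>n\<in>G. {x \<in> Xs n. (x, \<beta> (- n) x) \<in> W})"
    using W by (auto simp: openin_orbit)
  ultimately show ?thesis by simp
qed

lemma unit_space_orbit: "unit_space orbit_groupoid = X"
  unfolding topology_eq
proof
  fix V
  show "openin (unit_space orbit_groupoid) V \<longleftrightarrow> openin X V"
  proof
    assume "openin (unit_space orbit_groupoid) V"
    then obtain W where W: "openin orbit_groupoid W" "V = (\<lambda>x. (x, x)) -` W"
      by (auto simp: unit_space_def openin_pullback_topology)
    have "V = {x \<in> Xs 0. (x, \<beta> (- 0) x) \<in> W}"
    proof -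
      have "(x, x) \<in> W \<Longrightarrow> x \<in> topspace X" for x
        using openin_subset[OF W(1)] graph_fst by (auto simp: topspace_orbit orbit_rel_def)
      then show ?thesis unfolding W(2) domain_0 using action_0 by auto
    qed
    then show "openin X V" using W(1) G_zero openin_orbit by blast
  next
    assume V: "openin X V"
    define W where "W = graph 0 \<inter> {p \<in> topspace orbit_groupoid. fst p \<in> V}"
    have "openin orbit_groupoid W"
      unfolding W_def using V continuous_orbit_fst open_graph
      by (intro openin_Int) (auto simp: continuous_map_def)
    moreover have "V = (\<lambda>x. (x, x)) -` W \<inter> UNIV"
      using openin_subset[OF V] graph_0 G_zero by (auto simp: W_def topspace_orbit orbit_rel_def)
    ultimately show "openin (unit_space orbit_groupoid) V"
      unfolding unit_space_def openin_pullback_topology by blast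
  qed
qed

text \<open>With points of each graph located by their range, inversion from \<open>graph n\<close>
  to \<open>graph (- n)\<close> is just \<open>\<beta> (- n)\<close>.\<close>

lemma continuous_orbit_inverse: "continuous_map orbit_groupoid orbit_groupoid (\<lambda>(x, y). (y, x))"
  unfolding continuous_map_def
proof (intro conjI allI impI)
  show "(\<lambda>(x, y). (y, x)) \<in> topspace orbit_groupoid \<rightarrow> topspace orbit_groupoid"
  proof clarify
    fix x y assume "(x, y) \<in> topspace orbit_groupoid"
    then obtain n where "(x, y) \<in> graph n" unfolding topspace_orbit orbit_rel_def by blast
    then have "(y, x) \<in> graph (- n)" by (rule graph_sym)
    then show "(y, x) \<in> topspace orbit_groupoid"
      unfolding topspace_orbit orbit_rel_def using graphD by blast
  qed
  fix W assume W: "openin orbit_groupoid W"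
  let ?V = "{p \<in> topspace orbit_groupoid. (\<lambda>(x, y). (y, x)) p \<in> W}"
  have "openin X {x \<in> Xs n. (x, \<beta> (- n) x) \<in> ?V}" if n: "n \<in> G" for n
  proof -
    define Y where "Y = {y \<in> Xs (- n). (y, \<beta> (- (- n)) y) \<in> W}"
    have Y: "openin X Y" unfolding Y_def using W G_uminus[OF n] openin_orbit by blast
    have "{x \<in> Xs n. (x, \<beta> (- n) x) \<in> ?V} = {x \<in> topspace (subtopology X (Xs n)). \<beta> (- n) x \<in> Y}"
    proof -
      have "(x, \<beta> (- n) x) \<in> topspace orbit_groupoid" if "x \<in> Xs n" for x
        using that n graph_iff by (auto simp: topspace_orbit orbit_rel_def)
      then show ?thesis
        using Xs_subset[OF n] \<beta>_inverse'[OF n] by (auto simp: Y_def)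
    qed
    moreover have "openin (subtopology X (Xs n)) {x \<in> topspace (subtopology X (Xs n)). \<beta> (- n) x \<in> Y}"
      using \<beta>_continuous[OF G_uminus[OF n]] Y by (simp add: continuous_map_def)
    ultimately show ?thesis using openin_trans_full open_Xs[OF n] by metis
  qed
  then show "openin orbit_groupoid ?V"
    unfolding openin_orbit by (auto simp: topspace_orbit)
qed

text \<open>A product of arrows of degrees \<open>n\<close> and \<open>m\<close> is determined by
  its range and the degree \<open>n + m\<close>. So the preimage of \<open>W\<close> is cut out by
  an open condition on the range of the first factor; \<open>P n m\<close> collects the first
  factors that satisfy it.\<close>

lemma continuous_orbit_mult:
  "continuous_map (subtopology (prod_topology orbit_groupoid orbit_groupoid) {(p, q). snd p = fst q})
     orbit_groupoid (\<lambda>(p, q). (fst p, snd q))"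
  (is "continuous_map (subtopology ?Z ?C) _ ?m")
  unfolding continuous_map_def
proof (intro conjI allI impI)
  show "?m \<in> topspace (subtopology ?Z ?C) \<rightarrow> topspace orbit_groupoid"
    using orbit_rel_trans by (auto simp: topspace_orbit)
  fix W assume W: "openin orbit_groupoid W"
  define P where "P n m = graph n \<inter> {p \<in> topspace orbit_groupoid. fst p \<in> {x \<in> Xs (n + m). (x, \<beta> (- (n + m)) x) \<in> W}}" for n m
  define T where "T = (\<Union>n\<in>G. \<Union>m\<in>G. P n m \<times> graph m)"
  have P: "openin orbit_groupoid (P n m)" if "n \<in> G" "m \<in> G" for n m
  proof -
    have "openin X {x \<in> Xs (n + m). (x, \<beta> (- (n + m)) x) \<in> W}"
      using W add_closed[OF that] openin_orbit by blast
    then show ?thesis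
      unfolding P_def using open_graph continuous_orbit_fst
      by (intro openin_Int) (auto simp: continuous_map_def)
  qed
  have "openin ?Z (P n m \<times> graph m)" if "n \<in> G" "m \<in> G" for n m
    using P[OF that] open_graph by (simp add: openin_prod_Times_iff)
  then have "openin ?Z T" unfolding T_def by auto
  moreover have "{z \<in> topspace (subtopology ?Z ?C). ?m z \<in> W} = T \<inter> ?C"
  proof (intro equalityI subsetI)
    fix w assume w: "w \<in> {z \<in> topspace (subtopology ?Z ?C). ?m z \<in> W}"
    then obtain x y z where xyz: "w = ((x, y), (y, z))" "(x, y) \<in> orbit_rel" "(y, z) \<in> orbit_rel" "(x, z) \<in> W"
      by (auto simp: topspace_orbit)
    then obtain n m where nm: "(x, y) \<in> graph n" "(y, z) \<in> graph m" unfolding orbit_rel_def by blast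
    then have "(x, z) \<in> graph (n + m)" by (rule graph_trans)
    then have "(x, y) \<in> P n m" using xyz nm graph_iff[of x z "n + m"] by (simp add: P_def topspace_orbit)
    moreover have "n \<in> G" "m \<in> G" using nm graphD by blast+
    ultimately show "w \<in> T \<inter> ?C" using nm xyz by (auto simp: T_def)
  next
    fix w assume w: "w \<in> T \<inter> ?C"
    then obtain x y z n m where xyz: "w = ((x, y), (y, z))" "(x, y) \<in> P n m" "(y, z) \<in> graph m"
      by (auto simp: T_def)
    then have xy: "(x, y) \<in> graph n" "(x, \<beta> (- (n + m)) x) \<in> W" by (auto simp: P_def)
    have "(x, z) \<in> graph (n + m)" by (rule graph_trans[OF xy(1) xyz(3)])
    then have "(x, z) \<in> W" using xy(2) graph_iff by auto
    moreover have "(x, y) \<in> orbit_rel" "(y, z) \<in> orbit_rel"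
      unfolding orbit_rel_def using xy(1) xyz(3) graphD by blast+
    ultimately show "w \<in> {z \<in> topspace (subtopology ?Z ?C). ?m z \<in> W}"
      using xyz(1) by (simp add: topspace_orbit)
  qed
  ultimately show "openin (subtopology ?Z ?C) {z \<in> topspace (subtopology ?Z ?C). ?m z \<in> W}"
    by (auto simp: openin_subtopology)
qed

lemma Hausdorff_X: "Hausdorff_space X" and locally_compact_X: "locally_compact_space X"
  using space by (auto simp: lch_space_def)

lemma groupoid_orbit: "lc_r_discrete_principal_groupoid orbit_groupoid"
proof (rule lc_r_discrete_principal_groupoid.intro)
  show "equiv (topspace (unit_space orbit_groupoid)) (topspace orbit_groupoid)"
    unfolding unit_space_orbit topspace_orbit
  proof (rule equivI)
    show "orbit_rel \<subseteq> topspace X \<times> topspace X"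
      using graph_fst graph_snd by (auto simp: orbit_rel_def)
    show "refl_on (topspace X) orbit_rel"
      using graph_0 G_zero by (auto simp: refl_on_def orbit_rel_def)
    show "sym orbit_rel"
    proof (rule symI)
      fix x y assume "(x, y) \<in> orbit_rel"
      then obtain n where "(x, y) \<in> graph n" unfolding orbit_rel_def by blast
      then have "(y, x) \<in> graph (- n)" by (rule graph_sym)
      then show "(y, x) \<in> orbit_rel" unfolding orbit_rel_def using graphD by blast
    qed
    show "trans orbit_rel"
      using orbit_rel_trans by (rule transI)
  qed
  show "locally_compact_space orbit_groupoid"
    unfolding locally_compact_space_def
  proof
    fix p assume "p \<in> topspace orbit_groupoid"
    then obtain n where "p \<in> graph n" by (auto simp: topspace_orbit orbit_rel_def)
    then obtain x y where p: "p = (x, y)" "(x, y) \<in> graph n" by (cases p) auto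
    then have n: "n \<in> G" and x: "x \<in> Xs n" "y = \<beta> (- n) x" using graph_iff by blast+
    have "locally_compact_space (subtopology X (Xs n))"
      using locally_compact_space_open_subset[OF _ locally_compact_X open_Xs[OF n]] Hausdorff_X by blast
    then obtain U K where UK: "openin (subtopology X (Xs n)) U" "compactin (subtopology X (Xs n)) K"
      "x \<in> U" "U \<subseteq> K"
    proof -
      have "x \<in> topspace (subtopology X (Xs n))" using x Xs_subset[OF n] by auto
      with \<open>locally_compact_space (subtopology X (Xs n))\<close> show ?thesis
        using that unfolding locally_compact_space_def by blast
    qed
    let ?s = "\<lambda>x. (x, \<beta> (- n) x)"
    have U: "openin X U" "U \<subseteq> Xs n" using UK(1) open_Xs[OF n] by (auto simp: openin_open_subtopology)
    \<comment> \<open>The section over \<open>U\<close> is open, being the part of the open set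
      \<open>graph n\<close> whose range lies in \<open>U\<close>.\<close>
    have "graph n \<inter> {p \<in> topspace orbit_groupoid. fst p \<in> U} = ?s ` U"
    proof (intro equalityI subsetI)
      fix q assume "q \<in> graph n \<inter> {p \<in> topspace orbit_groupoid. fst p \<in> U}"
      then show "q \<in> ?s ` U" using graph_iff[of "fst q" "snd q" n] by (intro image_eqI[of _ _ "fst q"]) (auto simp: prod_eq_iff)
    next
      fix q assume "q \<in> ?s ` U"
      then have "fst q \<in> U" "q \<in> graph n" using U(2) n graph_iff by auto
      then show "q \<in> graph n \<inter> {p \<in> topspace orbit_groupoid. fst p \<in> U}"
        using n unfolding topspace_orbit orbit_rel_def by blast
    qed
    moreover have "openin orbit_groupoid (graph n \<inter> {p \<in> topspace orbit_groupoid. fst p \<in> U})"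
      using U(1) continuous_orbit_fst open_graph by (intro openin_Int) (auto simp: continuous_map_def)
    ultimately have "openin orbit_groupoid (?s ` U)" by simp
    moreover have "compactin orbit_groupoid (?s ` K)"
      by (rule image_compactin[OF UK(2) continuous_orbit_section[OF n]])
    moreover have "p \<in> ?s ` U" "?s ` U \<subseteq> ?s ` K" using p x UK by auto
    ultimately show "\<exists>U K. openin orbit_groupoid U \<and> compactin orbit_groupoid K \<and> p \<in> U \<and> U \<subseteq> K" by blast
  qed
  show "Hausdorff_space orbit_groupoid"
    unfolding Hausdorff_space_def
  proof (intro allI impI)
    fix p q assume pq: "p \<in> topspace orbit_groupoid \<and> q \<in> topspace orbit_groupoid \<and> p \<noteq> q"
    then obtain n m where nm: "p \<in> graph n" "q \<in> graph m" by (auto simp: topspace_orbit orbit_rel_def)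
    \<comment> \<open>Distinct points with the same range lie on different graphs, which are
      disjoint open sets; otherwise their ranges are separated in \<open>X\<close>.\<close>
    show "\<exists>U V. openin orbit_groupoid U \<and> openin orbit_groupoid V \<and> p \<in> U \<and> q \<in> V \<and> disjnt U V"
    proof (cases "fst p = fst q")
      case True
      have "n \<noteq> m"
      proof
        assume "n = m"
        then have "(fst p, snd p) \<in> graph n" "(fst q, snd q) \<in> graph n" using nm by simp_all
        then have "snd p = snd q" using True unfolding graph_iff by simp
        then show False using True pq by (simp add: prod_eq_iff)
      qed
      then have "disjnt (graph n) (graph m)" using graph_unique by (auto simp: disjnt_iff)
      then show ?thesis using nm open_graph by blast
    next
      case False
      have "fst p \<in> topspace X" "fst q \<in> topspace X"
        using nm graph_fst[of "fst p" "snd p"] graph_fst[of "fst q" "snd q"] by auto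
      then obtain U V where UV: "openin X U" "openin X V" "fst p \<in> U" "fst q \<in> V" "disjnt U V"
        using Hausdorff_X False unfolding Hausdorff_space_def by blast
      have "openin orbit_groupoid {p \<in> topspace orbit_groupoid. fst p \<in> U}"
        "openin orbit_groupoid {p \<in> topspace orbit_groupoid. fst p \<in> V}"
        using UV continuous_orbit_fst by (auto simp: continuous_map_def)
      moreover have "disjnt {p \<in> topspace orbit_groupoid. fst p \<in> U} {p \<in> topspace orbit_groupoid. fst p \<in> V}"
        using UV(5) by (auto simp: disjnt_iff)
      ultimately show ?thesis using pq UV(3,4) by blast
    qed
  qed
  have "{p \<in> topspace orbit_groupoid. fst p = snd p} = graph 0"
    using graph_0 G_zero graph_fst by (auto simp: topspace_orbit orbit_rel_def)
  then show "openin orbit_groupoid {p \<in> topspace orbit_groupoid. fst p = snd p}"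
    using open_graph by simp
  show "\<exists>S. openin orbit_groupoid S \<and> groupoid_set orbit_groupoid S \<and> p \<in> S \<and> S \<subseteq> U"
    if U: "openin orbit_groupoid U" "p \<in> U" for U p
  proof -
    obtain n where n: "p \<in> graph n" using U by (auto simp: openin_orbit orbit_rel_def)
    have "inj_on fst (graph n)" using graph_iff by (auto simp: inj_on_def)
    moreover have "inj_on snd (graph n)" by (auto simp: inj_on_def graph_def)
    ultimately have "groupoid_set orbit_groupoid (U \<inter> graph n)"
      unfolding groupoid_set_def using openin_subset[OF U(1)] by (auto intro: inj_on_subset)
    moreover have "openin orbit_groupoid (U \<inter> graph n)" using U open_graph by blast
    ultimately show ?thesis using U n by blast
  qed
  show "open_map orbit_groupoid (unit_space orbit_groupoid) fst"
    unfolding unit_space_orbit open_map_def using open_orbit_fst by blast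
qed (rule continuous_orbit_mult continuous_orbit_inverse)+

lemma orbit_cocycle_eq: "p \<in> graph n \<Longrightarrow> orbit_cocycle p = n"
  unfolding orbit_cocycle_def by (rule the_equality) (auto intro: graph_unique)

lemma locally_constant_orbit: "locally_constant orbit_groupoid orbit_cocycle"
  unfolding locally_constant_def
proof
  fix p assume "p \<in> topspace orbit_groupoid"
  then obtain n where n: "p \<in> graph n" by (auto simp: topspace_orbit orbit_rel_def)
  then have "\<forall>q\<in>graph n. orbit_cocycle q = orbit_cocycle p" using orbit_cocycle_eq by metis
  then show "\<exists>U. openin orbit_groupoid U \<and> p \<in> U \<and> (\<forall>q\<in>U. orbit_cocycle q = orbit_cocycle p)"
    using n open_graph by blast
qed

lemma cocycle_orbit: "cocycle orbit_groupoid orbit_cocycle"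
  unfolding cocycle_def
proof (intro conjI allI impI)
  show "continuous_map orbit_groupoid euclideanreal orbit_cocycle"
    unfolding continuous_map_def
  proof (intro conjI allI impI)
    fix V :: "real set"
    have "{p \<in> topspace orbit_groupoid. orbit_cocycle p \<in> V} = (\<Union>n\<in>V. graph n)"
      using orbit_cocycle_eq graphD by (auto simp: topspace_orbit orbit_rel_def)
    then show "openin orbit_groupoid {p \<in> topspace orbit_groupoid. orbit_cocycle p \<in> V}"
      using open_graph by auto
  qed simp
  fix x y z assume "(x, y) \<in> topspace orbit_groupoid \<and> (y, z) \<in> topspace orbit_groupoid"
  then obtain n m where "(x, y) \<in> graph n" "(y, z) \<in> graph m" unfolding topspace_orbit orbit_rel_def by blast
  then show "orbit_cocycle (x, z) = orbit_cocycle (x, y) + orbit_cocycle (y, z)"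
    using orbit_cocycle_eq graph_trans by metis
qed

lemma graded_groupoid_orbit: "graded_groupoid orbit_groupoid orbit_cocycle"
proof (intro graded_groupoid.intro groupoid_orbit graded_groupoid_axioms.intro cocycle_orbit locally_constant_orbit)
  fix x y assume "(x, y) \<in> topspace orbit_groupoid" "orbit_cocycle (x, y) = 0"
  then have "(x, y) \<in> graph 0" using orbit_cocycle_eq by (auto simp: topspace_orbit orbit_rel_def)
  then show "x = y" using graph_0 by blast
qed

lemma slice_orbit: "graded_groupoid.slice orbit_groupoid orbit_cocycle n = graph n"
proof -
  interpret graded_groupoid orbit_groupoid orbit_cocycle by (rule graded_groupoid_orbit)
  show ?thesis
  proof (intro equalityI subsetI)
    fix p assume "p \<in> slice n"
    then obtain m where "p \<in> graph m" "orbit_cocycle p = n"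
      by (auto simp: slice_def topspace_orbit orbit_rel_def)
    then show "p \<in> graph n" using orbit_cocycle_eq by blast
  next
    fix p assume p: "p \<in> graph n"
    then have "n \<in> G" by (auto simp: graph_def)
    then show "p \<in> slice n"
      using p orbit_cocycle_eq[OF p] by (auto simp: slice_def topspace_orbit orbit_rel_def)
  qed
qed

lemma dom_orbit: "n \<in> G \<Longrightarrow> graded_groupoid.dom orbit_groupoid orbit_cocycle n = Xs n"
proof -
  assume n: "n \<in> G"
  interpret graded_groupoid orbit_groupoid orbit_cocycle by (rule graded_groupoid_orbit)
  show ?thesis using n graph_iff by (auto simp: mem_dom slice_orbit)
qed

end

section \<open>Separability\<close>

context cstar_algebra
begin

lemma Metric_space_nrm_dist: "Metric_space (carrier A) (nrm_dist A)"
proof (rule Metric_space.intro)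
  fix x y
  show "0 \<le> nrm_dist A x y" by (simp add: nrm_dist_def nrm_nonneg)
  show "nrm_dist A x y = nrm_dist A y x"
    using nrm_smult[of "y \<ominus> x" "- 1"] diff_swap[of x y] by (simp add: nrm_dist_def)
  assume x: "x \<in> carrier A" and y: "y \<in> carrier A"
  then show "nrm_dist A x y = 0 \<longleftrightarrow> x = y"
    by (simp add: nrm_dist_def nrm_eq_0 diff_eq_zero_iff)
  fix z assume z: "z \<in> carrier A"
  show "nrm_dist A x z \<le> nrm_dist A x y + nrm_dist A y z"
    using x y z nrm_triangle[of "x \<ominus> y" "y \<ominus> z"] diff_split[of x y z] by (simp add: nrm_dist_def)
qed

text \<open>
  If \<open>\<omega> b = 1\<close> with \<open>\<parallel>b\<parallel> < 1\<close>, then applying \<open>\<omega>\<close> to the fixed point \<open>s\<close> of the contraction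
  \<open>s \<mapsto> b + b s\<close> gives \<open>\<omega> s = 1 + \<omega> s\<close>.
\<close>

lemma character_contractive:
  assumes add: "\<And>a b. \<lbrakk>a \<in> carrier A; b \<in> carrier A\<rbrakk> \<Longrightarrow> \<omega> (a \<oplus> b) = \<omega> a + \<omega> b"
    and smult: "\<And>z a. a \<in> carrier A \<Longrightarrow> \<omega> (z \<odot>\<^bsub>A\<^esub> a) = z * \<omega> a"
    and mult: "\<And>a b. \<lbrakk>a \<in> carrier A; b \<in> carrier A\<rbrakk> \<Longrightarrow> \<omega> (a \<otimes> b) = \<omega> a * \<omega> b"
    and a: "a \<in> carrier A"
  shows "cmod (\<omega> a) \<le> nrm A a"
proof (rule ccontr)
  assume "\<not> ?thesis"
  then have lt: "nrm A a < cmod (\<omega> a)" by simp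
  then have nz: "\<omega> a \<noteq> 0" using nrm_nonneg[OF a] by auto
  define b where "b = (1 / \<omega> a) \<odot>\<^bsub>A\<^esub> a"
  have b: "b \<in> carrier A" using a by (simp add: b_def)
  have \<omega>b: "\<omega> b = 1" using a nz by (simp add: b_def smult)
  have nb: "nrm A b < 1" using a nz lt by (simp add: b_def nrm_smult norm_divide)
  interpret M: Metric_space "carrier A" "nrm_dist A" by (rule Metric_space_nrm_dist)
  obtain s where s: "s \<in> carrier A" "b \<oplus> b \<otimes> s = s"
  proof (rule M.Banach_fixedpoint_thm[OF complete _ _ nb, of "\<lambda>s. b \<oplus> b \<otimes> s"])
    show "carrier A \<noteq> {}" using b by blast
    show "(\<lambda>s. b \<oplus> b \<otimes> s) \<in> carrier A \<rightarrow> carrier A" using b by (auto simp: mult_closed)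
    fix x y assume x: "x \<in> carrier A" and y: "y \<in> carrier A"
    have "(b \<oplus> b \<otimes> x) \<ominus> (b \<oplus> b \<otimes> y) = (b \<ominus> b) \<oplus> (b \<otimes> x \<ominus> b \<otimes> y)"
      using b x y by (simp add: diff_add_diff mult_closed)
    also have "b \<ominus> b = \<zero>" using b by (simp add: diff_eq_zero_iff)
    also have "b \<otimes> x \<ominus> b \<otimes> y = b \<otimes> (x \<ominus> y)"
      using b x y by (simp add: diff_eq_smult distrib_left smult_mult_right mult_closed)
    finally have "(b \<oplus> b \<otimes> x) \<ominus> (b \<oplus> b \<otimes> y) = b \<otimes> (x \<ominus> y)"
      using b x y by (simp add: mult_closed)
    then show "nrm_dist A (b \<oplus> b \<otimes> x) (b \<oplus> b \<otimes> y) \<le> nrm A b * nrm_dist A x y"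
      using b x y nrm_mult[of b "x \<ominus> y"] by (simp add: nrm_dist_def mult_closed)
  qed auto
  have "\<omega> s = \<omega> b + \<omega> b * \<omega> s"
    using arg_cong[OF s(2), of \<omega>] b s(1) by (simp add: add mult mult_closed)
  then show False using \<omega>b by simp
qed

text \<open>Evaluation at a point turns \<open>\<phi>\<close> into a multiplicative
  functional.\<close>

lemma star_iso_C0_contractive:
  assumes \<phi>: "star_iso A (C0 X) \<phi>" and a: "a \<in> carrier A"
  shows "cmod (\<phi> a x) \<le> nrm A a"
  by (rule character_contractive[of "\<lambda>a. \<phi> a x", OF _ _ _ a]) (use \<phi> in \<open>auto simp: star_iso_def\<close>)

end

lemma C0_bump:
  assumes X: "lch_space X" and U: "openin X U" "x \<in> U"
  obtains f where "f \<in> carrier (C0 X)" "f x = 1" "\<And>y. y \<notin> U \<Longrightarrow> f y = 0"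
proof -
  have lc: "locally_compact_space X" and haus: "Hausdorff_space X" using X by (auto simp: lch_space_def)
  have xX: "x \<in> topspace X" using U openin_subset by blast
  obtain V K where V: "openin X V" "compactin X K" "x \<in> V" "V \<subseteq> K"
    using lc xX unfolding locally_compact_space_def by blast
  \<comment> \<open>Cutting down to \<open>V\<close> as well as \<open>U\<close> confines the
    support to the compact set \<open>K\<close>, so that \<open>f\<close> vanishes at
    infinity.\<close>
  let ?S = "topspace X - (V \<inter> U)"
  have "closedin X ?S" using U V by blast
  moreover have "x \<in> topspace X - ?S" using xX U V by blast
  moreover have "completely_regular_space X"
    using locally_compact_regular_imp_completely_regular_space lc haus by blast
  ultimately obtain g :: "'a \<Rightarrow> real" where g: "continuous_map X (top_of_set {0..1}) g" "g x = 0" "g ` ?S \<subseteq> {1}"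
    unfolding completely_regular_space_def by blast
  have gc: "continuous_map X euclideanreal g" using g(1) continuous_map_into_fulltopology by blast
  define f where "f y = (if y \<in> topspace X then complex_of_real (1 - g y) else 0)" for y
  have f0: "f y = 0" if "y \<notin> V \<inter> U" for y
    using that g(3) by (auto simp: f_def)
  have "continuous_map X euclidean (\<lambda>y. complex_of_real (1 - g y))"
    using gc by (auto simp: continuous_map_atin intro!: tendsto_intros)
  then have fc: "continuous_map X euclidean f"
    by (rule continuous_map_eq) (simp add: f_def)
  have "f \<in> carrier (C0 X)"
  proof (rule C0_dominated[OF fc])
    show "y \<notin> topspace X \<Longrightarrow> f y = 0" for y by (simp add: f_def)
    fix e :: real assume "e > 0"
    then have "{y \<in> topspace X. e \<le> cmod (f y)} \<subseteq> K" using f0 V(4) by force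
    then show "\<exists>K. compactin X K \<and> {y \<in> topspace X. e \<le> cmod (f y)} \<subseteq> K" using V(2) by blast
  qed
  moreover have "f x = 1" using xX g(2) by (simp add: f_def)
  ultimately show thesis using that f0 by blast
qed

text \<open>A base is given by the sets where \<open>cmod (\<phi> a x) > 1 / 2\<close>, for
  \<open>a\<close> in a countable dense set. A bump equal to 1 at \<open>x\<close> and 0 off
  \<open>U\<close> is approximated within \<open>1 / 2\<close>, which keeps the modulus above
  \<open>1 / 2\<close> at \<open>x\<close> and below it off \<open>U\<close>.\<close>

lemma (in cstar_algebra) second_countable_spectrum:
  assumes X: "lch_space X" and \<phi>: "star_iso A (C0 X) \<phi>" and sep: "separable_space (nrm_topology A)"
  shows "second_countable X"
proof -
  interpret M: Metric_space "carrier A" "nrm_dist A" by (rule Metric_space_nrm_dist)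
  obtain S where S: "countable S" "S \<subseteq> carrier A" "M.mtopology closure_of S = carrier A"
    using sep unfolding separable_space_def nrm_topology_def by auto
  define V where "V a = {x \<in> topspace X. \<phi> a x \<in> - cball 0 (1 / 2)}" for a
  have bij: "bij_betw \<phi> (carrier A) (carrier (C0 X))" using \<phi> by (simp add: star_iso_def)
  have cont: "continuous_map X euclidean (\<phi> a)" if "a \<in> carrier A" for a
    using bij that C0D(1) by (auto simp: bij_betw_def)
  have openV: "openin X (V a)" if "a \<in> S" for a
    unfolding V_def by (rule openin_continuous_map_preimage[OF cont]) (use that S in \<open>auto intro: open_Compl\<close>)
  have "\<exists>W\<in>V ` S. x \<in> W \<and> W \<subseteq> U" if U: "openin X U" "x \<in> U" for U x
  proof -
    obtain f where f: "f \<in> carrier (C0 X)" "f x = 1" "\<And>y. y \<notin> U \<Longrightarrow> f y = 0"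
      by (rule C0_bump[OF X U]) blast
    have "f \<in> \<phi> ` carrier A" using bij f(1) by (simp add: bij_betw_def)
    then obtain a where a: "a \<in> carrier A" "\<phi> a = f" by blast
    have "a \<in> M.mtopology closure_of S" using S a by simp
    then obtain b where b: "b \<in> S" "nrm_dist A a b < 1 / 2"
      unfolding M.metric_closure_of by (auto dest: spec[of _ "1 / 2"])
    have bA: "b \<in> carrier A" using b S by blast
    have diff: "cmod (f y - \<phi> b y) < 1 / 2" for y
    proof -
      have "\<phi> (a \<ominus> b) y = f y - \<phi> b y"
        using \<phi> a bA by (simp add: diff_eq_smult star_iso_def)
      then show ?thesis
        using star_iso_C0_contractive[OF \<phi>, of "a \<ominus> b" y] a bA b(2) by (simp add: nrm_dist_def)
    qed
    have "x \<in> V b"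
    proof -
      have "1 / 2 < cmod (\<phi> b x)"
        using diff[of x] norm_triangle_ineq2[of "f x" "f x - \<phi> b x"] f(2) by simp
      then show ?thesis using U openin_subset by (auto simp: V_def)
    qed
    moreover have "V b \<subseteq> U"
    proof
      fix y assume "y \<in> V b"
      then have "1 / 2 < cmod (\<phi> b y)" by (simp add: V_def)
      then show "y \<in> U" using diff[of y] f(3)[of y] by (cases "y \<in> U") auto
    qed
    ultimately show ?thesis using b(1) by blast
  qed
  then show ?thesis
    unfolding second_countable_def using S(1) openV by (intro exI[of _ "V ` S"]) auto
qed

section \<open>Subgroups of the real line\<close>

lemma additive_subgroup_class_ring:
  "additive_subgroup G (class_ring :: real ring) \<longleftrightarrow>
     0 \<in> G \<and> (\<forall>x\<in>G. \<forall>y\<in>G. x + y \<in> G) \<and> (\<forall>x\<in>G. - x \<in> G)"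
proof -
  interpret R: cring "class_ring :: real ring" by (rule cring_class_ring)
  have inv: "\<ominus>\<^bsub>class_ring\<^esub> x = - x" for x :: real
    by (rule R.minus_equality) (simp_all add: class_ring_def)
  show ?thesis
    unfolding additive_subgroup_def
    using inv by (auto simp: subgroup_def a_inv_def class_ring_def)
qed

text \<open>For a symmetric \<open>S\<close> this is the subgroup generated by it; lists make its
  countability immediate.\<close>

definition sums_of :: "real set \<Rightarrow> real set" where
  "sums_of S = sum_list ` lists S"

lemma sums_of_subgroup:
  assumes "\<And>x. x \<in> S \<Longrightarrow> - x \<in> S"
  shows "additive_subgroup (sums_of S) (class_ring :: real ring)"
proof -
  have "x + y \<in> sums_of S" if xy: "x \<in> sums_of S" "y \<in> sums_of S" for x y
  proof -
    obtain us vs where "us \<in> lists S" "vs \<in> lists S" "x = sum_list us" "y = sum_list vs"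
      using xy unfolding sums_of_def by blast
    then show ?thesis unfolding sums_of_def by (intro image_eqI[of _ _ "us @ vs"]) auto
  qed
  moreover have "- x \<in> sums_of S" if x: "x \<in> sums_of S" for x
  proof -
    obtain us where us: "us \<in> lists S" "x = sum_list us"
      using x unfolding sums_of_def by blast
    have "sum_list (map uminus us) = - sum_list us" by (induction us) auto
    moreover have "map uminus us \<in> lists S" using us assms by auto
    ultimately show ?thesis unfolding sums_of_def us(2) by (metis imageI)
  qed
  moreover have "0 \<in> sums_of S" unfolding sums_of_def by (intro image_eqI[of _ _ "[]"]) auto
  ultimately show ?thesis by (simp add: additive_subgroup_class_ring)
qed

lemma sums_of_superset: "x \<in> S \<Longrightarrow> x \<in> sums_of S"
  unfolding sums_of_def by (intro image_eqI[of _ _ "[x]"]) auto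

lemma countable_sums_of: "countable S \<Longrightarrow> countable (sums_of S)"
  unfolding sums_of_def by (intro countable_image countable_lists)

section \<open>The partial action of a graded groupoid\<close>

context graded_groupoid
begin

text \<open>Distinct values give disjoint nonempty open slices, each containing a nonempty basic
  set; a point picked from that set recovers the value.\<close>

lemma countable_c:
  assumes "second_countable \<G>"
  shows "countable (c ` topspace \<G>)"
proof -
  obtain \<B> where \<B>: "countable \<B>"
    "\<forall>U p. openin \<G> U \<and> p \<in> U \<longrightarrow> (\<exists>V\<in>\<B>. p \<in> V \<and> V \<subseteq> U)"
    using assms unfolding second_countable_def by (elim exE conjE) (rule that)
  have "c ` topspace \<G> \<subseteq> (\<lambda>V. c (SOME q. q \<in> V)) ` \<B>"
  proof
    fix r assume "r \<in> c ` topspace \<G>"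
    then obtain p where p: "p \<in> topspace \<G>" "r = c p" by blast
    then have "p \<in> slice r" by (simp add: slice_def)
    then obtain V where V: "V \<in> \<B>" "p \<in> V" "V \<subseteq> slice r" using \<B>(2) open_slice by blast
    have "(SOME q. q \<in> V) \<in> V" using V(2) by (rule someI[of "\<lambda>q. q \<in> V"])
    then have "(SOME q. q \<in> V) \<in> slice r" using V(3) by blast
    then have "c (SOME q. q \<in> V) = r" by (simp add: slice_def)
    then show "r \<in> (\<lambda>V. c (SOME q. q \<in> V)) ` \<B>" using V(1) by blast
  qed
  then show ?thesis using \<B>(1) countable_image countable_subset by blast
qed

text \<open>Arrows of degrees \<open>n\<close> and \<open>n + m\<close> with the same range differ
  by an arrow of degree \<open>m\<close>. Taking \<open>(n, m)\<close> to be \<open>(s, t)\<close>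
  or \<open>(t, - s - t)\<close> gives both image axioms of a partial action.\<close>

lemma act_image_Int: "act n ` (dom (- n) \<inter> dom m) = dom n \<inter> dom (n + m)"
proof (intro equalityI subsetI)
  fix x assume "x \<in> act n ` (dom (- n) \<inter> dom m)"
  then obtain y where y: "y \<in> dom (- n)" "y \<in> dom m" "x = act n y" by blast
  then obtain z where z: "(y, z) \<in> slice m" unfolding mem_dom by blast
  have xy: "(x, y) \<in> slice n" unfolding y(3) by (rule act_slice'[OF y(1)])
  show "x \<in> dom n \<inter> dom (n + m)" using slice_dom[OF xy] slice_dom[OF slice_trans[OF xy z]] by simp
next
  fix x assume x: "x \<in> dom n \<inter> dom (n + m)"
  then obtain y z where yz: "(x, y) \<in> slice n" "(x, z) \<in> slice (n + m)"
    unfolding Int_iff mem_dom by blast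
  then have "(y, x) \<in> slice (- n)" using slice_sym by blast
  from slice_trans[OF this yz(2)] have "y \<in> dom m" unfolding mem_dom by auto
  then show "x \<in> act n ` (dom (- n) \<inter> dom m)"
    using slice_dom[OF yz(1)] by (intro image_eqI[of _ _ y]) auto
qed

lemma act_inverse: "y \<in> dom (- n) \<Longrightarrow> act n y \<in> dom n \<and> act (- n) (act n y) = y"
  using slice_dom[OF act_slice'] by blast

lemma homeomorphic_act:
  "homeomorphic_map (subtopology (unit_space \<G>) (dom (- n))) (subtopology (unit_space \<G>) (dom n)) (act n)"
  unfolding homeomorphic_map_maps homeomorphic_maps_def
proof (intro exI[of _ "act (- n)"] conjI ballI)
  show "continuous_map (subtopology (unit_space \<G>) (dom (- n))) (subtopology (unit_space \<G>) (dom n)) (act n)"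
    unfolding continuous_map_in_subtopology using continuous_act[of n] act_inverse by auto
  show "continuous_map (subtopology (unit_space \<G>) (dom n)) (subtopology (unit_space \<G>) (dom (- n))) (act (- n))"
    unfolding continuous_map_in_subtopology using continuous_act[of "- n"] act_inverse[of _ "- n"] by auto
qed (use act_inverse[of _ n] act_inverse[of _ "- n"] in auto)

lemma space_partial_action_act:
  assumes "\<And>m n. \<lbrakk>m \<in> G; n \<in> G\<rbrakk> \<Longrightarrow> m + n \<in> G"
  shows "space_partial_action G (unit_space \<G>) dom act"
proof
  fix s t assume "s \<in> G" "t \<in> G"
  show "act s ` (dom (- s) \<inter> dom t) = dom s \<inter> dom (s + t)" by (rule act_image_Int)
  show "act t ` (dom (- t) \<inter> dom (- s - t)) = dom t \<inter> dom (- s)"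
    using act_image_Int[of t "- s - t"] by simp
  fix x assume x: "x \<in> dom (- t) \<inter> dom (- s - t)"
  then have tx: "(act t x, x) \<in> slice t" and stx: "(act (s + t) x, x) \<in> slice (s + t)"
    using act_slice'[of x t] act_slice'[of x "s + t"] by auto
  have "(x, act t x) \<in> slice (- t)" using tx slice_sym by blast
  from slice_trans[OF stx this] have "(act (s + t) x, act t x) \<in> slice s" by simp
  then show "act (s + t) x = act s (act t x)" using act_eq by metis
next
  fix x assume "x \<in> topspace (unit_space \<G>)"
  then show "act 0 x = x" using act_eq slice_0 by blast
qed (simp_all add: assms lch_unit_space open_dom homeomorphic_act dom_0)

lemma inv_into_act: "x \<in> dom n \<Longrightarrow> inv_into (dom (- n)) (act n) x = act (- n) x"
proof (rule inv_into_f_eq)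
  show "inj_on (act n) (dom (- n))" using act_inverse by (metis inj_onI)
qed (use act_inverse[of x "- n"] in auto)

lemma groupoid_model_act:
  assumes add: "\<And>m n. \<lbrakk>m \<in> G; n \<in> G\<rbrakk> \<Longrightarrow> m + n \<in> G" and uminus: "\<And>n. n \<in> G \<Longrightarrow> - n \<in> G"
    and c: "\<And>p. p \<in> topspace \<G> \<Longrightarrow> c p \<in> G"
  shows "groupoid_model \<G> c (C0 (unit_space \<G>)) G (C0_domain (unit_space \<G>) dom) (C0_action dom act) (\<lambda>f. f)"
proof (intro groupoid_model.intro graded_groupoid_axioms star_algebra_C0 groupoid_model_axioms.intro add uminus c)
  let ?X = "unit_space \<G>"
  show "star_iso (C0 ?X) (C0 ?X) (\<lambda>f. f)" by (simp add: star_iso_def bij_betw_def inj_on_def)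
  show "C0_domain ?X dom n \<subseteq> carrier (C0 ?X)" for n by (auto simp: C0_domain_def)
  show "(\<lambda>f. f) ` C0_domain ?X dom n = C0_domain ?X dom n" for n by simp
  fix n f assume f: "f \<in> C0_domain ?X dom (- n)"
  then have f': "f \<in> carrier (C0 ?X)" "\<And>x. x \<notin> dom (- n) \<Longrightarrow> f x = 0" by (auto simp: C0_domain_def)
  have act: "C0_action dom act n f = (\<lambda>x. if x \<in> dom n then f (act (- n) x) else 0)"
    by (auto simp: C0_action_def inv_into_act)
  have "continuous_map (subtopology ?X (dom n)) ?X (act (- n))" using continuous_act[of "- n"] by simp
  then have "(\<lambda>x. if x \<in> dom n then f (act (- n) x) else 0) \<in> carrier (C0 ?X)"
    by (rule C0_transfer[OF Hausdorff_unit_space open_dom open_dom _ continuous_act _ _ f'])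
       (use act_inverse[of _ n] act_inverse[of _ "- n"] in auto)
  then show "C0_action dom act n f \<in> C0_domain ?X dom n"
    unfolding act by (simp add: C0_domain_def)
  fix x y assume "(x, y) \<in> slice n"
  then show "C0_action dom act n f x = f y" unfolding act using slice_dom by simp
qed (assumption | erule C0_nrm_upper)+

end

lemma (in free_space_action) groupoid_model_orbit:
  assumes A: "star_algebra A" and action: "partial_action G A D \<alpha>"
    and \<phi>: "star_iso A (C0 X) \<phi>"
    and D: "\<And>t. t \<in> G \<Longrightarrow> \<phi> ` D t = C0_domain X Xs t"
    and \<alpha>: "\<And>t f. \<lbrakk>t \<in> G; f \<in> D (- t)\<rbrakk> \<Longrightarrow> \<phi> (\<alpha> t f) = C0_action Xs \<beta> t (\<phi> f)"
    and contractive: "\<And>a x. a \<in> carrier A \<Longrightarrow> cmod (\<phi> a x) \<le> nrm A a"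
  shows "groupoid_model orbit_groupoid orbit_cocycle A G D \<alpha> \<phi>"
proof (intro groupoid_model.intro graded_groupoid_orbit A groupoid_model_axioms.intro add_closed G_uminus contractive)
  interpret partial_action G A D \<alpha> by (rule action)
  show "star_iso A (C0 (unit_space orbit_groupoid)) \<phi>" using \<phi> by (simp add: unit_space_orbit)
  show "orbit_cocycle p \<in> G" if p: "p \<in> topspace orbit_groupoid" for p
  proof -
    obtain n where "n \<in> G" "p \<in> graph n" using p unfolding topspace_orbit orbit_rel_def by blast
    then show ?thesis using orbit_cocycle_eq by simp
  qed
  fix n assume n: "n \<in> G"
  show "D n \<subseteq> carrier A"
    using ideal[OF n] additive_subgroup.a_subset[of "D n" A] by (simp add: closed_ideal_def)
  show "\<phi> ` D n = C0_domain (unit_space orbit_groupoid) (graded_groupoid.dom orbit_groupoid orbit_cocycle) n"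
    using D[OF n] dom_orbit[OF n] by (simp add: C0_domain_def unit_space_orbit)
  fix a assume a: "a \<in> D (- n)"
  show "\<alpha> n a \<in> D n" using iso[OF n] a by (auto simp: star_iso_def bij_betw_def)
  fix x y assume "(x, y) \<in> graded_groupoid.slice orbit_groupoid orbit_cocycle n"
  then have "(x, y) \<in> graph n" by (simp add: slice_orbit)
  then have xy: "x \<in> Xs n" "y \<in> Xs (- n)" "\<beta> n y = x" using graph_iff graphD by blast+
  \<comment> \<open>On the graph of degree \<open>n\<close> the inverse in \<open>C0_action\<close>
    picks out the source \<open>y\<close>, which is the transport required of
    \<open>\<alpha> n\<close>.\<close>
  have "inv_into (Xs (- n)) (\<beta> n) x = y" by (rule inv_into_f_eq[OF \<beta>_inj[OF n] xy(2,3)])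
  then show "\<phi> (\<alpha> n a) x = \<phi> a y" using \<alpha>[OF n a] xy(1) by (simp add: C0_action_def)
qed assumption+

text \<open>In the converse, the condition on the zeros of \<open>c\<close> makes every slice a
  graph, and second countability of the groupoid itself limits \<open>c\<close> to countably many
  values. The zero cocycle on the full relation on two points shows what the first prevents: its
  analytic subalgebra is all of the 2 by 2 matrices, whereas a crossed product of a commutative
  algebra that equals its analytic subalgebra is commutative.\<close>

theorem theorem5p1:
  shows "(\<forall>(G :: real set) (A :: 'a star_algebra) D \<alpha>.
            additive_subgroup G (class_ring :: real ring) \<and> countable G \<and>
            cstar_algebra A \<and> abelian_star_algebra A \<and> separable_space (nrm_topology A) \<and>
            partial_action G A D \<alpha> \<and> free_partial_action G A D \<alpha> \<longrightarrow>
            (\<exists>(\<G> :: (('a \<Rightarrow> complex) \<times> ('a \<Rightarrow> complex)) topology) c.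
               lc_r_discrete_principal_groupoid \<G> \<and> second_countable (unit_space \<G>) \<and>
               cocycle \<G> c \<and> locally_constant \<G> c \<and>
               (\<exists>\<Phi>. star_iso (crossed_product G A D \<alpha>) (groupoid_algebra \<G>) \<Phi> \<and>
                    \<Phi> ` analytic_crossed_product G A D \<alpha> (G \<inter> {0..}) =
                      analytic_groupoid_algebra \<G> c)))
       \<and>
         (\<forall>(\<G> :: ('x \<times> 'x) topology) c.
            lc_r_discrete_principal_groupoid \<G> \<and> second_countable (unit_space \<G>) \<and>
            second_countable \<G> \<and>
            cocycle \<G> c \<and> locally_constant \<G> c \<and>
            (\<forall>(x, y)\<in>topspace \<G>. c (x, y) = 0 \<longrightarrow> x = y) \<longrightarrow>
            (\<exists>(G :: real set) (X :: 'x topology) Xs \<beta>.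
               additive_subgroup G (class_ring :: real ring) \<and> countable G \<and>
               space_partial_action G X Xs \<beta> \<and> second_countable X \<and>
               (\<exists>\<Phi>. star_iso (groupoid_algebra \<G>)
                        (crossed_product G (C0 X) (C0_domain X Xs) (C0_action Xs \<beta>)) \<Phi> \<and>
                    \<Phi> ` analytic_groupoid_algebra \<G> c =
                      analytic_crossed_product G (C0 X) (C0_domain X Xs) (C0_action Xs \<beta>)
                        (G \<inter> {0..}))))"
proof (intro conjI allI impI; elim conjE)
  fix G :: "real set" and A :: "'a star_algebra" and D \<alpha>
  assume G: "additive_subgroup G (class_ring :: real ring)" and A: "cstar_algebra A"
    and sep: "separable_space (nrm_topology A)"
    and action: "partial_action G A D \<alpha>" and free: "free_partial_action G A D \<alpha>"
  \<comment> \<open>The units of the groupoid are the space witnessing freeness, a copy of the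
    Gelfand spectrum; this is why its points have type
    \<open>'a \<Rightarrow> complex\<close>.\<close>
  from free obtain X :: "('a \<Rightarrow> complex) topology" and Xs \<beta> \<phi> where X: "space_partial_action G X Xs \<beta> \<and>
        star_iso A (C0 X) \<phi> \<and>
        (\<forall>t\<in>G. \<phi> ` D t = C0_domain X Xs t \<and> \<phi> ` D (- t) = C0_domain X Xs (- t)) \<and>
        (\<forall>t\<in>G. \<forall>f\<in>D (- t). \<phi> (\<alpha> t f) = C0_action Xs \<beta> t (\<phi> f)) \<and>
        free_on_space G Xs \<beta>"
    unfolding free_partial_action_def by (elim conjE exE) (rule that, intro conjI; assumption)
  have \<phi>: "star_iso A (C0 X) \<phi>"
    and D: "\<And>t. t \<in> G \<Longrightarrow> \<phi> ` D t = C0_domain X Xs t"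
    and \<alpha>: "\<And>t f. t \<in> G \<Longrightarrow> f \<in> D (- t) \<Longrightarrow> \<phi> (\<alpha> t f) = C0_action Xs \<beta> t (\<phi> f)"
    using X by simp_all
  interpret A: cstar_algebra A by (rule A)
  interpret free_space_action G X Xs \<beta>
    using X G
    by (simp add: free_space_action_def free_space_action_axioms_def additive_subgroup_class_ring)
  interpret M: groupoid_model orbit_groupoid orbit_cocycle A G D \<alpha> \<phi>
    by (rule groupoid_model_orbit[OF A.star_algebra_axioms action \<phi> D \<alpha> A.star_iso_C0_contractive[OF \<phi>]])
  obtain \<Phi> where "star_iso (crossed_product G A D \<alpha>) (groupoid_algebra orbit_groupoid) \<Phi>"
    "\<Phi> ` analytic_crossed_product G A D \<alpha> (G \<inter> {0..}) = analytic_groupoid_algebra orbit_groupoid orbit_cocycle"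
    by (rule M.crossed_product_iso_groupoid_algebra)
  moreover have "second_countable (unit_space orbit_groupoid)"
    using A.second_countable_spectrum[OF space \<phi> sep] by (simp add: unit_space_orbit)
  ultimately show "\<exists>(\<G> :: (('a \<Rightarrow> complex) \<times> ('a \<Rightarrow> complex)) topology) c.
      lc_r_discrete_principal_groupoid \<G> \<and> second_countable (unit_space \<G>) \<and>
      cocycle \<G> c \<and> locally_constant \<G> c \<and>
      (\<exists>\<Phi>. star_iso (crossed_product G A D \<alpha>) (groupoid_algebra \<G>) \<Phi> \<and>
           \<Phi> ` analytic_crossed_product G A D \<alpha> (G \<inter> {0..}) = analytic_groupoid_algebra \<G> c)"
    using groupoid_orbit cocycle_orbit locally_constant_orbit by blast
next
  fix \<G> :: "('x \<times> 'x) topology" and c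
  assume \<G>: "lc_r_discrete_principal_groupoid \<G>" and sc: "second_countable (unit_space \<G>)" "second_countable \<G>"
    and c: "cocycle \<G> c" "locally_constant \<G> c" and ker: "\<forall>(x, y)\<in>topspace \<G>. c (x, y) = 0 \<longrightarrow> x = y"
  interpret graded_groupoid \<G> c
    by (intro graded_groupoid.intro \<G> graded_groupoid_axioms.intro c) (use ker in blast)
  \<comment> \<open>The values of \<open>c\<close> are closed under negation but perhaps not under
    addition, since arrows need not be composable. The group they generate may contain degrees whose
    slice is empty.\<close>
  define G where "G = sums_of (c ` topspace \<G>)"
  have sym: "- r \<in> c ` topspace \<G>" if r: "r \<in> c ` topspace \<G>" for r
  proof -
    from r obtain x y where "(x, y) \<in> topspace \<G>" "r = c (x, y)" by (metis imageE surj_pair)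
    then show ?thesis using c_sym[of x y] groupoid_sym[of x y] by (metis imageI)
  qed
  have sub: "additive_subgroup G (class_ring :: real ring)"
    unfolding G_def by (rule sums_of_subgroup) (rule sym)
  then have G: "\<And>m n. m \<in> G \<Longrightarrow> n \<in> G \<Longrightarrow> m + n \<in> G" "\<And>n. n \<in> G \<Longrightarrow> - n \<in> G"
    by (simp_all add: additive_subgroup_class_ring)
  have cG: "c p \<in> G" if "p \<in> topspace \<G>" for p
    unfolding G_def by (rule sums_of_superset) (use that in blast)
  interpret M: groupoid_model \<G> c "C0 (unit_space \<G>)" G "C0_domain (unit_space \<G>) dom" "C0_action dom act" "\<lambda>f. f"
    by (rule groupoid_model_act[OF G cG])
  obtain \<Phi> where "star_iso (groupoid_algebra \<G>)
      (crossed_product G (C0 (unit_space \<G>)) (C0_domain (unit_space \<G>) dom) (C0_action dom act)) \<Phi>"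
    "\<Phi> ` analytic_groupoid_algebra \<G> c = analytic_crossed_product G (C0 (unit_space \<G>))
      (C0_domain (unit_space \<G>) dom) (C0_action dom act) (G \<inter> {0..})"
    by (rule M.groupoid_algebra_iso_crossed_product)
  moreover have "countable G" unfolding G_def by (intro countable_sums_of countable_c sc)
  moreover have "space_partial_action G (unit_space \<G>) dom act"
    by (rule space_partial_action_act) (use G in auto)
  ultimately show "\<exists>(G :: real set) (X :: 'x topology) Xs \<beta>.
      additive_subgroup G (class_ring :: real ring) \<and> countable G \<and>
      space_partial_action G X Xs \<beta> \<and> second_countable X \<and>
      (\<exists>\<Phi>. star_iso (groupoid_algebra \<G>)
               (crossed_product G (C0 X) (C0_domain X Xs) (C0_action Xs \<beta>)) \<Phi> \<and>
           \<Phi> ` analytic_groupoid_algebra \<G> c =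
             analytic_crossed_product G (C0 X) (C0_domain X Xs) (C0_action Xs \<beta>) (G \<inter> {0..}))"
    using sub sc(1) by blast
qed

end
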